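(* Let $u$ be a solution of the thin eigenvalue problem in $\Omega$ (with parameters $s\in(0,1)$, $a=1-2s$, $\lambda>0$). Then for any $K\Subset\Omega$: - if $s\le 1/2$, then $u(\cdot,0)\in C^{1,\alpha}(K)$ for every $0<\alpha<2s$; - if $s>1/2$, then $u(\cdot,0)\in C^{2,\alpha}(K)$ for every $0<\alpha<2s-1$.
   Context: $\Omega\subset\mathbb{R}^n$ is a smooth bounded domain, $\mathbb{R}^+=(0,\infty)$, points of $\mathbb{R}^{n+1}$ are $(x,y)$ with $x\in\mathbb{R}^n$, $y\in\mathbb{R}$. For $U\subset\{y>0\}$ open, $L^2(a,U)=\{f: f\,y^{a/2}\in L^2(U)\}$ and $H^1(a,U)=\{f: f,\nabla f\in L^2(a,U)\}$. A solution of the thin eigenvalue problem in $\Omega$ is a function $u$ with $u\in H^1(a,\Omega\times(0,T))$ for every $T>0$ satisfying $$\operatorname{div}(y^a\nabla u)=0\ \text{ in }\Omega\times\mathbb{R}^+,\qquad \lim_{y\to0^+}y^a u_y(x,y)=-\lambda\,u_+(x,0)\ \text{ for } x\in\Omega,$$ in the weak sense: $\int_{\Omega\times\mathbb{R}^+}y^a\nabla u\cdot\nabla\psi\,dx\,dy=\lambda\int_\Omega u_+(x,0)\psi(x,0)\,dx$ for all $\psi\in C_c^\infty(\Omega\times\mathbb{R})$. Here $u(\cdot,0)$ is the trace of $u$ on $\Omega\times\{0\}$, and $u_+=\max(u,0)$. *)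

theory Defs
  imports "HOL-Analysis.Analysis"
begin

section \<open>Classical derivatives, \<open>C\<^sup>k\<close> and Hoelder classes\<close>

definition partial :: "'a::euclidean_space \<Rightarrow> ('a \<Rightarrow> real) \<Rightarrow> 'a \<Rightarrow> real" where
  "partial i f = (\<lambda>x. frechet_derivative f (at x) i)"

definition grad :: "('a::euclidean_space \<Rightarrow> real) \<Rightarrow> 'a \<Rightarrow> 'a" where
  "grad f x = (\<Sum>i\<in>Basis. partial i f x *\<^sub>R i)"

text \<open>A multi-index of order \<open>k\<close> is represented by a list of \<open>k\<close> basis vectors.\<close>

primrec partials :: "'a::euclidean_space list \<Rightarrow> ('a \<Rightarrow> real) \<Rightarrow> 'a \<Rightarrow> real" where
  "partials [] f = f"
| "partials (i # is) f = partial i (partials is f)"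

text \<open>Only meant for open \<open>S\<close>: differentiability is at \<open>x\<close> in the full space.\<close>

definition Ck_on :: "nat \<Rightarrow> 'a set \<Rightarrow> ('a::euclidean_space \<Rightarrow> real) \<Rightarrow> bool" where
  "Ck_on k S f \<longleftrightarrow>
     (\<forall>is. set is \<subseteq> Basis \<longrightarrow>
        (length is < k \<longrightarrow> (\<forall>x\<in>S. partials is f differentiable (at x))) \<and>
        (length is \<le> k \<longrightarrow> continuous_on S (partials is f)))"

definition smooth_on :: "'a set \<Rightarrow> ('a::euclidean_space \<Rightarrow> real) \<Rightarrow> bool" where
  "smooth_on S f \<longleftrightarrow> (\<forall>k. Ck_on k S f)"

definition test_functions :: "'a set \<Rightarrow> ('a::euclidean_space \<Rightarrow> real) set" where
  "test_functions U =
     {\<phi>. smooth_on UNIV \<phi> \<and> compact (closure {x. \<phi> x \<noteq> 0}) \<and> closure {x. \<phi> x \<noteq> 0} \<subseteq> U}"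

text \<open>
  The class \<open>C\<^sup>k\<^sup>,\<^sup>\<alpha>(K)\<close> (finite \<open>C\<^sup>k\<^sup>,\<^sup>\<alpha>\<close> norm on \<open>K\<close>). So that derivatives
  make sense for sets \<open>K\<close> which are not open, \<open>f\<close> is required to be \<open>C\<^sup>k\<close> in some
  open neighbourhood of \<open>K\<close>; for open \<open>K\<close> this is no additional requirement.
\<close>

definition holder_on :: "nat \<Rightarrow> real \<Rightarrow> 'a set \<Rightarrow> ('a::euclidean_space \<Rightarrow> real) \<Rightarrow> bool" where
  "holder_on k \<alpha> K f \<longleftrightarrow>
     (\<exists>V. open V \<and> K \<subseteq> V \<and> Ck_on k V f) \<and>
     (\<exists>C. \<forall>is. set is \<subseteq> Basis \<longrightarrow>
        (length is \<le> k \<longrightarrow> (\<forall>x\<in>K. \<bar>partials is f x\<bar> \<le> C)) \<and>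
        (length is = k \<longrightarrow>
           (\<forall>x\<in>K. \<forall>y\<in>K. \<bar>partials is f x - partials is f y\<bar> \<le> C * dist x y powr \<alpha>)))"

section \<open>Domains\<close>

definition compactly_contained :: "'a::euclidean_space set \<Rightarrow> 'a set \<Rightarrow> bool" where
  "compactly_contained K U \<longleftrightarrow> compact (closure K) \<and> closure K \<subseteq> U"

text \<open>
  Near every boundary point, after a rotation taking some unit vector \<open>\<nu>\<close> to the last
  coordinate direction, the set lies above the graph of a smooth function \<open>\<gamma>\<close> of the
  remaining coordinates, i.e. of the projection of \<open>x\<close> to the hyperplane orthogonal to \<open>\<nu>\<close>
  (the values of \<open>\<gamma>\<close> off that hyperplane are irrelevant).
\<close>

definition smooth_bounded_domain :: "'a::euclidean_space set \<Rightarrow> bool" where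
  "smooth_bounded_domain \<Omega> \<longleftrightarrow>
     open \<Omega> \<and> connected \<Omega> \<and> \<Omega> \<noteq> {} \<and> bounded \<Omega> \<and>
     (\<forall>p\<in>frontier \<Omega>. \<exists>r>0. \<exists>\<nu> \<gamma>. norm \<nu> = 1 \<and> smooth_on UNIV \<gamma> \<and>
        \<Omega> \<inter> ball p r = {x \<in> ball p r. x \<bullet> \<nu> > \<gamma> (x - (x \<bullet> \<nu>) *\<^sub>R \<nu>)})"

section \<open>Weighted Sobolev spaces\<close>

definition L2_sqnorm :: "'a::euclidean_space set \<Rightarrow> ('a \<Rightarrow> 'b::euclidean_space) \<Rightarrow> ennreal" where
  "L2_sqnorm U f = (\<integral>\<^sup>+x\<in>U. ennreal ((norm (f x))\<^sup>2) \<partial>lebesgue)"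

definition L2_on :: "'a::euclidean_space set \<Rightarrow> ('a \<Rightarrow> 'b::euclidean_space) \<Rightarrow> bool" where
  "L2_on U f \<longleftrightarrow> set_borel_measurable lebesgue U f \<and> L2_sqnorm U f < \<infinity>"

text \<open>Points of the extended space are pairs \<open>z = (x, y)\<close>, so \<open>y\<close> is \<open>snd z\<close>.\<close>

definition weighted :: "real \<Rightarrow> ('a::euclidean_space \<times> real \<Rightarrow> 'b::euclidean_space) \<Rightarrow> 'a \<times> real \<Rightarrow> 'b"
  where "weighted a f z = (snd z powr (a/2)) *\<^sub>R f z"

definition wL2_on ::
    "real \<Rightarrow> ('a::euclidean_space \<times> real) set \<Rightarrow> ('a \<times> real \<Rightarrow> 'b::euclidean_space) \<Rightarrow> bool" where
  "wL2_on a U f \<longleftrightarrow> L2_on U (weighted a f)"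

definition weak_gradient ::
    "'a::euclidean_space set \<Rightarrow> ('a \<Rightarrow> real) \<Rightarrow> ('a \<Rightarrow> 'a) \<Rightarrow> bool" where
  "weak_gradient U f g \<longleftrightarrow>
     (\<forall>K. compact K \<and> K \<subseteq> U \<longrightarrow> set_integrable lebesgue K f \<and> set_integrable lebesgue K g) \<and>
     (\<forall>\<phi>\<in>test_functions U. \<forall>i\<in>Basis.
        (LINT x:U|lebesgue. f x * partial i \<phi> x) = - (LINT x:U|lebesgue. (g x \<bullet> i) * \<phi> x))"

definition wH1_on :: "real \<Rightarrow> ('a::euclidean_space \<times> real) set \<Rightarrow> ('a \<times> real \<Rightarrow> real) \<Rightarrow> bool" where
  "wH1_on a U f \<longleftrightarrow> wL2_on a U f \<and> (\<exists>g. weak_gradient U f g \<and> wL2_on a U g)"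

text \<open>
  \<open>w\<close> is (a version of) the trace \<open>u(\<cdot>,0)\<close>. The trace operator is the continuous extension
  to the weighted space \<open>H\<^sup>1\<close> on \<open>\<Omega> \<times> (0,T)\<close>, with values in \<open>L\<^sup>2(\<Omega>)\<close>, of the restriction
  \<open>\<phi> \<mapsto> \<phi>(\<cdot>,0)\<close> of functions smooth up to the boundary. The trace depends only on \<open>u\<close> near
  \<open>y = 0\<close>, hence not on \<open>T\<close>, and \<open>w\<close> is determined almost everywhere on \<open>\<Omega>\<close>.
\<close>

definition has_trace ::
    "real \<Rightarrow> 'a::euclidean_space set \<Rightarrow> ('a \<times> real \<Rightarrow> real) \<Rightarrow> ('a \<Rightarrow> real) \<Rightarrow> bool" where
  "has_trace a \<Omega> u w \<longleftrightarrow> L2_on \<Omega> w \<and>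
     (\<exists>T>0. \<exists>g \<Phi>. let U = \<Omega> \<times> {0<..<T} in
        wL2_on a U u \<and> weak_gradient U u g \<and> wL2_on a U g \<and>
        (\<forall>k::nat. smooth_on UNIV (\<Phi> k)) \<and>
        (\<lambda>k. L2_sqnorm U (weighted a (\<lambda>z. u z - \<Phi> k z))) \<longlonglongrightarrow> 0 \<and>
        (\<lambda>k. L2_sqnorm U (weighted a (\<lambda>z. g z - grad (\<Phi> k) z))) \<longlonglongrightarrow> 0 \<and>
        (\<lambda>k. L2_sqnorm \<Omega> (\<lambda>x. w x - \<Phi> k (x, 0))) \<longlonglongrightarrow> 0)"

section \<open>The thin eigenvalue problem\<close>

text \<open>
  The weak gradient \<open>g\<close> and the trace \<open>w\<close> are determined almost everywhere by \<open>u\<close>, so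
  quantifying them existentially here involves no choice.
\<close>

definition thin_eigen_solution ::
    "real \<Rightarrow> real \<Rightarrow> 'a::euclidean_space set \<Rightarrow> ('a \<times> real \<Rightarrow> real) \<Rightarrow> bool" where
  "thin_eigen_solution a lam \<Omega> u \<longleftrightarrow>
     (\<forall>T>0. wH1_on a (\<Omega> \<times> {0<..<T}) u) \<and>
     (\<exists>g w. weak_gradient (\<Omega> \<times> {0<..}) u g \<and> has_trace a \<Omega> u w \<and>
        (\<forall>\<psi>\<in>test_functions (\<Omega> \<times> UNIV).
           (LINT z:\<Omega> \<times> {0<..}|lebesgue. snd z powr a * (g z \<bullet> grad \<psi> z)) =
           lam * (LINT x:\<Omega>|lebesgue. max (w x) 0 * \<psi> (x, 0))))"

end

theory Submission
  imports Defs
begin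

text \<open>
  Testing the weak equation with \<open>F (|z - (x, 0)|\<^sup>2)\<close>, where \<open>F\<close> is a smooth cut-off of a multiple of the
  fundamental solution \<open>|z - (x, 0)|\<close> to the power \<open>2 s - n\<close> of \<open>div (y\<^sup>a grad)\<close>, regularised by an \<open>e > 0\<close>
  that is sent to 0, represents the trace \<open>w\<close> in the interior of \<open>\<Omega>\<close>, up to a smooth function, as a
  constant multiple of the truncated Riesz potential of order \<open>2 s\<close> of \<open>w\<^sub>+\<close>. Only the homogeneity of the weight
  is used (Green's identity for \<open>F\<close> reduces to the invariance of an integral under dilations), and the
  boundary term converges to \<open>w\<close> by the definition of the trace. Regularity is then a bootstrap:
  iterating the potential estimate gives \<open>w\<close> locally bounded; each further application improves
  the Hoelder exponent by a fixed amount, until \<open>w\<close> is Lipschitz. Taking the positive part preserves no more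
  than that, so one last application, with one derivative falling on the Lipschitz density \<open>w\<^sub>+\<close>, gives \<open>C\<^sup>1\<^sup>,\<^sup>\<alpha>\<close> or \<open>C\<^sup>2\<^sup>,\<^sup>\<alpha>\<close>.
\<close>

section \<open>Smooth functions\<close>

text \<open>The trace is only given as an L2 limit, so \<open>u\<close> cannot be evaluated at
  \<open>y = 0\<close>; its boundary value is recovered from averages against an approximate
  identity. Both conditions on the weight enter there: \<open>a > -1\<close> makes
  \<open>y powr a\<close> integrable near 0, and \<open>a < 1\<close> does the same for
  \<open>y powr (- a)\<close>, so that a gradient in weighted L2 is locally in L1 without weight,
  which controls the averages uniformly in the regularisation. The kernel is cut off at the level of
  its derivative in the squared radius. One formula then serves all \<open>n\<close> and
  \<open>s\<close>, including \<open>n = 1\<close> with \<open>s \<ge> 1/2\<close>, where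
  \<open>2 s - n\<close> is nonnegative and the kernel is logarithmic or bounded. The thresholds
  come from homogeneity: first and second derivatives of the kernel have size \<open>|x|\<close> to
  the power \<open>- (n + 1 - 2 s)\<close> and \<open>- (n + 2 - 2 s)\<close>. A Lipschitz density
  compensates one power, so the integrals converge for \<open>2 s > 0\<close>, respectively
  \<open>2 s > 1\<close>, and the exponents left over, \<open>2 s\<close> and
  \<open>2 s - 1\<close>, bound the range of \<open>\<alpha>\<close>.\<close>

primrec kdiff :: "real set \<Rightarrow> nat \<Rightarrow> (real \<Rightarrow> real) \<Rightarrow> bool" where
  "kdiff S 0 f = True"
| "kdiff S (Suc k) f = (\<exists>f'. (\<forall>t\<in>S. (f has_real_derivative f' t) (at t)) \<and> kdiff S k f')"

lemma kdiff_Suc_imp: "kdiff S (Suc k) f \<Longrightarrow> kdiff S k f"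
proof (induction k arbitrary: f)
  case (Suc k)
  then show ?case by (metis kdiff.simps(2))
qed simp

lemma kdiff_const: "kdiff S k (\<lambda>_. c)"
  by (induction k arbitrary: c) (auto intro!: exI[of _ "\<lambda>_. 0"])

lemma kdiff_id: "kdiff S k (\<lambda>t. t)"
  by (cases k) (auto intro!: exI[of _ "\<lambda>_. 1"] kdiff_const derivative_eq_intros)

lemma kdiff_add: "kdiff S k f \<Longrightarrow> kdiff S k g \<Longrightarrow> kdiff S k (\<lambda>t. f t + g t)"
proof (induction k arbitrary: f g)
  case (Suc k)
  then obtain f' g' where "\<forall>t\<in>S. (f has_real_derivative f' t) (at t)" "kdiff S k f'"
    "\<forall>t\<in>S. (g has_real_derivative g' t) (at t)" "kdiff S k g'"
    by auto
  then show ?case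
    using Suc.IH[of f' g'] by (auto intro!: exI[of _ "\<lambda>t. f' t + g' t"] DERIV_add)
qed simp

lemma kdiff_mult: "kdiff S k f \<Longrightarrow> kdiff S k g \<Longrightarrow> kdiff S k (\<lambda>t. f t * g t)"
proof (induction k arbitrary: f g)
  case (Suc k)
  then obtain f' g' where *: "\<forall>t\<in>S. (f has_real_derivative f' t) (at t)" "kdiff S k f'"
    "\<forall>t\<in>S. (g has_real_derivative g' t) (at t)" "kdiff S k g'"
    by auto
  have "kdiff S k f" "kdiff S k g"
    using Suc.prems kdiff_Suc_imp by blast+
  then have "kdiff S k (\<lambda>t. f' t * g t + g' t * f t)"
    using * by (intro kdiff_add Suc.IH)
  then show ?case
    using * by (auto intro!: exI[of _ "\<lambda>t. f' t * g t + g' t * f t"] DERIV_mult)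
qed simp

lemma kdiff_shift: "kdiff UNIV k f \<Longrightarrow> kdiff UNIV k (\<lambda>t. f (c * t + d))"
proof (induction k arbitrary: f)
  case (Suc k)
  then obtain f' where *: "\<forall>t. (f has_real_derivative f' t) (at t)" "kdiff UNIV k f'"
    by auto
  have "((\<lambda>t. f (c * t + d)) has_real_derivative f' (c * t + d) * c) (at t)" for t
    by (rule DERIV_chain2[where g = "\<lambda>t. c * t + d"]) (use * in \<open>auto intro!: derivative_eq_intros\<close>)
  moreover have "kdiff UNIV k (\<lambda>t. f' (c * t + d) * c)"
    by (rule kdiff_mult[OF Suc.IH[OF *(2)] kdiff_const])
  ultimately show ?case by (auto intro!: exI[of _ "\<lambda>t. f' (c * t + d) * c"])
qed simp

lemma kdiff_subset: "kdiff T k f \<Longrightarrow> S \<subseteq> T \<Longrightarrow> kdiff S k f"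
proof (induction k arbitrary: f)
  case (Suc k)
  then show ?case by (metis kdiff.simps(2) subsetD)
qed simp

lemma kdiff_powr: "kdiff {-e<..} k (\<lambda>t. (t + e) powr r)"
proof (induction k arbitrary: r)
  case (Suc k)
  have "((\<lambda>t. (t + e) powr r) has_real_derivative r * (t + e) powr (r - 1)) (at t)" if "t > -e" for t
    using that by (auto intro!: derivative_eq_intros)
  moreover have "kdiff {-e<..} k (\<lambda>t. r * (t + e) powr (r - 1))"
    by (intro kdiff_mult kdiff_const Suc)
  ultimately show ?case by (auto intro!: exI[of _ "\<lambda>t. r * (t + e) powr (r - 1)"])
qed simp

definition bump :: "real \<Rightarrow> real" where
  "bump t = (if t > 0 then exp (- 1 / t) else 0)"

lemma kdiff_bump: "kdiff UNIV k bump"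
proof -
  \<comment> \<open>Derivatives of \<open>exp (- 1 / t) / t ^ j\<close> are linear combinations of
    functions of the same family, so one induction for all \<open>j\<close> together replaces
    formulas for the higher derivatives of \<open>bump\<close>.\<close>
  define b where "b j t = (if t > 0 then exp (- 1 / t) / t ^ j else 0)" for j :: nat and t :: real
  have lim: "((\<lambda>t::real. exp (- 1 / t) / t ^ j) \<longlongrightarrow> 0) (at_right 0)" for j :: nat
  proof -
    have "((\<lambda>x::real. x ^ j / exp x) \<longlongrightarrow> 0) at_top"
      by (rule tendsto_power_div_exp_0)
    then have "((\<lambda>t. (inverse t) ^ j / exp (inverse t)) \<longlongrightarrow> (0::real)) (at_right 0)"
      by (rule filterlim_compose) (rule filterlim_inverse_at_top_right)
    moreover have "(\<lambda>t::real. (inverse t) ^ j / exp (inverse t)) = (\<lambda>t. exp (- 1 / t) / t ^ j)"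
      by (simp add: divide_inverse exp_minus power_inverse mult.commute)
    ultimately show ?thesis by (simp only:)
  qed
  have der: "(b j has_real_derivative b (j + 2) t - j * b (j + 1) t) (at t)" for j t
  proof -
    consider "t > 0" | "t < 0" | "t = 0" by linarith
    then show ?thesis
    proof cases
      case 1
      have "((\<lambda>t. exp (- 1 / t) / t ^ j) has_real_derivative b (j + 2) t - j * b (j + 1) t) (at t)"
        using 1 unfolding b_def
        by (auto intro!: derivative_eq_intros simp: field_simps power2_eq_square)
           (cases j; simp add: field_simps)
      then show ?thesis
        by (rule DERIV_cong_ev[OF refl, THEN iffD1, rotated 2])
           (use 1 in \<open>auto simp: b_def eventually_at_topological intro!: exI[of _ "{0<..}"] eventually_nhds_in_open[of "{0<..}", THEN eventually_mono]\<close>)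
    next
      case 2
      have "((\<lambda>t. 0) has_real_derivative b (j + 2) t - j * b (j + 1) t) (at t)"
        using 2 by (auto simp: b_def)
      then show ?thesis
        by (rule DERIV_cong_ev[OF refl, THEN iffD1, rotated 2])
           (use 2 in \<open>auto simp: b_def intro!: eventually_nhds_in_open[of "{..<0}", THEN eventually_mono]\<close>)
    next
      case 3
      \<comment> \<open>From the right, the difference quotient of \<open>b j\<close> at 0 is
        \<open>b (Suc j)\<close> itself.\<close>
      have "((\<lambda>h. (b j h - b j 0) / h) \<longlongrightarrow> 0) (at_right 0)"
        by (rule Lim_transform_eventually[OF lim[of "Suc j"]])
           (auto simp: b_def eventually_at_right_less intro!: eventually_at_rightI[of 0 1])
      moreover have "((\<lambda>h. (b j h - b j 0) / h) \<longlongrightarrow> 0) (at_left 0)"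
        by (rule Lim_transform_eventually[OF tendsto_const])
           (auto simp: b_def intro!: eventually_at_leftI[of "-1" 0])
      ultimately have "((\<lambda>h. (b j h - b j 0) / h) \<longlongrightarrow> 0) (at 0)"
        using filterlim_split_at by blast
      then show ?thesis
        using 3 by (simp add: b_def has_field_derivative_iff)
    qed
  qed
  have "kdiff UNIV k (b j)" for j
  proof (induction k arbitrary: j)
    case (Suc k)
    have "kdiff UNIV k (\<lambda>t. b (j + 2) t + (- real j) * b (j + 1) t)"
      by (intro kdiff_add kdiff_mult kdiff_const Suc)
    then show ?case
      using der by (auto intro!: exI[of _ "\<lambda>t. b (j + 2) t + (- real j) * b (j + 1) t"])
  qed simp
  moreover have "b 0 = bump"
    by (auto simp: b_def bump_def)
  ultimately show ?thesis by metis
qed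

lemma bump_nonneg: "bump t \<ge> 0" and bump_pos: "t > 0 \<Longrightarrow> bump t > 0"
  and bump_le_1: "bump t \<le> 1" and bump_eq_0: "t \<le> 0 \<Longrightarrow> bump t = 0"
  by (auto simp: bump_def)

text \<open>The recursion peels off the innermost derivative, which suits inductions over sums,
  products and compositions. The lists in \<open>Ck_on\<close> have the outermost derivative at
  their head, which is why \<open>Ck_iff_Ck_on\<close> splits them at the right end.\<close>

primrec Ck :: "nat \<Rightarrow> ('a::euclidean_space \<Rightarrow> real) \<Rightarrow> bool" where
  "Ck 0 f = continuous_on UNIV f"
| "Ck (Suc k) f = ((\<forall>x. f differentiable (at x)) \<and> (\<forall>i\<in>Basis. Ck k (partial i f)))"

lemma Ck_continuous: "Ck k f \<Longrightarrow> continuous_on UNIV f"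
  by (cases k) (auto intro!: continuous_at_imp_continuous_on differentiable_imp_continuous_within)

lemma Ck_Suc_imp: "Ck (Suc k) f \<Longrightarrow> Ck k f"
proof (induction k arbitrary: f)
  case 0
  then show ?case using Ck_continuous[of "Suc 0" f] by simp
next
  case (Suc k)
  then show ?case by (metis Ck.simps(2))
qed

lemma partials_append: "partials (is @ js) f = partials is (partials js f)"
  by (induction "is") auto

lemma Ck_iff_Ck_on: "Ck k f \<longleftrightarrow> Ck_on k UNIV f"
proof (induction k arbitrary: f)
  case 0
  then show ?case by (auto simp: Ck_on_def)
next
  case (Suc k)
  show ?case
  proof
    assume L: "Ck (Suc k) f"
    then have c: "continuous_on UNIV f" by (rule Ck_continuous)
    show "Ck_on (Suc k) UNIV f"
      unfolding Ck_on_def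
    proof (intro allI impI)
      fix js :: "'a list" assume js: "set js \<subseteq> Basis"
      show "(length js < Suc k \<longrightarrow> (\<forall>x\<in>UNIV. partials js f differentiable at x)) \<and>
         (length js \<le> Suc k \<longrightarrow> continuous_on UNIV (partials js f))"
      proof (cases js rule: rev_cases)
        case Nil
        then show ?thesis using L c by auto
      next
        case (snoc is' i)
        then have "Ck_on k UNIV (partial i f)"
          using L Suc js by auto
        then show ?thesis
          using snoc js unfolding Ck_on_def by (auto simp: partials_append)
      qed
    qed
  next
    assume R: "Ck_on (Suc k) UNIV f"
    have "f differentiable at x" for x
      using R unfolding Ck_on_def by (auto dest!: spec[of _ "[]"])
    moreover have "Ck_on k UNIV (partial i f)" if "i \<in> Basis" for i
      unfolding Ck_on_def
    proof (intro allI impI)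
      fix js :: "'a list" assume js: "set js \<subseteq> Basis"
      then show "(length js < k \<longrightarrow> (\<forall>x\<in>UNIV. partials js (partial i f) differentiable at x)) \<and>
         (length js \<le> k \<longrightarrow> continuous_on UNIV (partials js (partial i f)))"
        using R that unfolding Ck_on_def by (auto simp: partials_append dest!: spec[of _ "js @ [i]"])
    qed
    ultimately show "Ck (Suc k) f"
      using Suc by auto
  qed
qed

lemma smooth_on_UNIV_iff: "smooth_on UNIV f \<longleftrightarrow> (\<forall>k. Ck k f)"
  by (simp add: smooth_on_def Ck_iff_Ck_on)

lemma partial_eq: "(f has_derivative D) (at x) \<Longrightarrow> partial i f x = D i"
  unfolding partial_def by (metis frechet_derivative_at)

lemma has_derivative_frechet: "f differentiable at x \<Longrightarrow> (f has_derivative frechet_derivative f (at x)) (at x)"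
  by (simp add: frechet_derivative_works)

lemma partial_add: "f differentiable at x \<Longrightarrow> g differentiable at x \<Longrightarrow>
    partial i (\<lambda>x. f x + g x) x = partial i f x + partial i g x"
  by (subst partial_eq[OF has_derivative_add[OF has_derivative_frechet has_derivative_frechet]])
     (auto simp: partial_def)

lemma partial_mult: "f differentiable at x \<Longrightarrow> g differentiable at x \<Longrightarrow>
    partial i (\<lambda>x. f x * g x) x = f x * partial i g x + partial i f x * g x"
  by (subst partial_eq[OF has_derivative_mult[OF has_derivative_frechet has_derivative_frechet]])
     (auto simp: partial_def)

lemma partial_comp: "f differentiable at x \<Longrightarrow> (h has_real_derivative h') (at (f x)) \<Longrightarrow>
    partial i (\<lambda>x. h (f x)) x = h' * partial i f x"
  by (subst partial_eq[OF has_derivative_compose[OF has_derivative_frechet]])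
     (auto simp: partial_def has_field_derivative_def)

lemma Ck_const: "Ck k (\<lambda>_. c)"
proof (induction k arbitrary: c)
  case (Suc k)
  have "partial i (\<lambda>_. c) = (\<lambda>_. 0)" for i :: 'a
    by (rule ext, subst partial_eq[OF has_derivative_const]) auto
  then show ?case using Suc by auto
qed auto

lemma Ck_inner: "Ck k (\<lambda>x. (x - c) \<bullet> b)"
proof (cases k)
  case (Suc k)
  have d: "((\<lambda>x. (x - c) \<bullet> b) has_derivative (\<lambda>h. h \<bullet> b)) (at x)" for x
    by (auto intro!: derivative_eq_intros)
  then have "partial i (\<lambda>x. (x - c) \<bullet> b) = (\<lambda>_. i \<bullet> b)" for i
    using partial_eq[OF d] by auto
  moreover have "(\<lambda>x. (x - c) \<bullet> b) differentiable (at x)" for x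
    using d differentiable_def by blast
  ultimately show ?thesis using Suc Ck_const by auto
qed (auto intro!: continuous_intros)

lemma Ck_add: "Ck k f \<Longrightarrow> Ck k g \<Longrightarrow> Ck k (\<lambda>x. f x + g x)"
proof (induction k arbitrary: f g)
  case (Suc k)
  then have "partial i (\<lambda>x. f x + g x) = (\<lambda>x. partial i f x + partial i g x)" for i
    by (auto simp: partial_add)
  then show ?case using Suc by auto
qed (auto intro!: continuous_intros)

lemma Ck_mult: "Ck k f \<Longrightarrow> Ck k g \<Longrightarrow> Ck k (\<lambda>x. f x * g x)"
proof (induction k arbitrary: f g)
  case (Suc k)
  then have p: "partial i (\<lambda>x. f x * g x) = (\<lambda>x. f x * partial i g x + partial i f x * g x)" for i
    by (auto simp: partial_mult)
  have "Ck k f" "Ck k g" using Suc.prems Ck_Suc_imp by blast+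
  then have "Ck k (\<lambda>x. f x * partial i g x + partial i f x * g x)" if "i \<in> Basis" for i
    using Suc that by (intro Ck_add Suc.IH) auto
  then show ?case using Suc p by auto
qed (auto intro!: continuous_intros)

lemma Ck_prod: "finite I \<Longrightarrow> (\<And>i. i \<in> I \<Longrightarrow> Ck k (f i)) \<Longrightarrow> Ck k (\<lambda>x. \<Prod>i\<in>I. f i x)"
  by (induction I rule: finite_induct) (auto intro: Ck_mult Ck_const)

lemma Ck_sum: "finite I \<Longrightarrow> (\<And>i. i \<in> I \<Longrightarrow> Ck k (f i)) \<Longrightarrow> Ck k (\<lambda>x. \<Sum>i\<in>I. f i x)"
  by (induction I rule: finite_induct) (auto intro: Ck_add Ck_const)

lemma Ck_sqnorm: "Ck k (\<lambda>x. (norm (x - c))\<^sup>2)"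
proof -
  have "(\<lambda>x. (norm (x - c))\<^sup>2) = (\<lambda>x. \<Sum>b\<in>Basis. ((x - c) \<bullet> b) * ((x - c) \<bullet> b))"
    by (simp add: power2_norm_eq_inner euclidean_inner[of "_ - _" "_ - _"])
  then show ?thesis
    by (simp only:) (intro Ck_sum Ck_mult Ck_inner; simp)
qed

text \<open>\<open>kdiff\<close> does not ask for continuity of the last derivative, hence one order
  more on \<open>h\<close> than the composite receives.\<close>

lemma Ck_comp:
  assumes "kdiff S (Suc k) h" "Ck k f" "range f \<subseteq> S"
  shows "Ck k (\<lambda>x. h (f x))"
  using assms
proof (induction k arbitrary: h)
  case 0
  then obtain h' where h: "\<forall>t\<in>S. (h has_real_derivative h' t) (at t)" by auto
  have "continuous_on S h"
    using h by (meson DERIV_continuous continuous_at_imp_continuous_on)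
  then show ?case
    using 0 by (auto intro: continuous_on_compose2)
next
  case (Suc k)
  then obtain h' where h: "\<forall>t\<in>S. (h has_real_derivative h' t) (at t)" "kdiff S (Suc k) h'" by auto
  have d: "f differentiable at x" for x using Suc by auto
  have p: "partial i (\<lambda>x. h (f x)) = (\<lambda>x. h' (f x) * partial i f x)" for i
    using d h(1) Suc.prems(3) by (intro ext partial_comp) (auto simp: image_subset_iff)
  have "(\<lambda>x. h (f x)) differentiable at x" for x
  proof -
    have "f x \<in> S" using Suc.prems(3) by auto
    then have "(h has_derivative (\<lambda>y. y * h' (f x))) (at (f x))"
      using h by (auto simp: has_field_derivative_def mult.commute[of _ "h' (f x)"])
    then show ?thesis
      using has_derivative_compose[OF has_derivative_frechet[OF d]] differentiable_def by blast
  qed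
  moreover have "Ck k (\<lambda>x. h' (f x) * partial i f x)" if "i \<in> Basis" for i
  proof (intro Ck_mult Suc.IH[OF h(2) Ck_Suc_imp[OF Suc.prems(2)] Suc.prems(3)])
    show "Ck k (partial i f)" using Suc.prems(2) that by simp
  qed
  ultimately show ?case using p by auto
qed

text \<open>Compact support for functions on the whole space, in a form that partial derivatives and
  radial profiles inherit at once.\<close>

definition bdd_supp :: "('a::euclidean_space \<Rightarrow> real) \<Rightarrow> bool" where
  "bdd_supp f \<longleftrightarrow> (\<exists>B. \<forall>x. norm x > B \<longrightarrow> f x = 0)"

lemma frechet_eq_sum:
  assumes "f differentiable at x"
  shows "frechet_derivative f (at x) h = (\<Sum>b\<in>Basis. (h \<bullet> b) * partial b f x)"
proof -
  interpret linear "frechet_derivative f (at x)"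
    using assms linear_frechet_derivative by blast
  have "frechet_derivative f (at x) h = frechet_derivative f (at x) (\<Sum>b\<in>Basis. (h \<bullet> b) *\<^sub>R b)"
    by (simp add: euclidean_representation)
  also have "\<dots> = (\<Sum>b\<in>Basis. (h \<bullet> b) * partial b f x)"
    by (simp add: sum scale partial_def)
  finally show ?thesis .
qed

lemma bdd_supp_partial:
  assumes "bdd_supp f" shows "bdd_supp (partial i f)"
proof -
  obtain B where B: "\<And>x. norm x > B \<Longrightarrow> f x = 0"
    using assms unfolding bdd_supp_def by auto
  have "partial i f x = 0" if "norm x > B" for x
  proof -
    have o: "open {x::'a. norm x > B}"
      by (intro open_Collect_less continuous_intros)
    have "((\<lambda>_. 0) has_derivative (\<lambda>_. 0)) (at x)" by simp
    then have "(f has_derivative (\<lambda>_. 0)) (at x)"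
      by (rule has_derivative_transform_within_open[OF _ o]) (use that B in auto)
    then show ?thesis using partial_eq by fastforce
  qed
  then show ?thesis unfolding bdd_supp_def by auto
qed

lemma bdd_supp_ucont:
  assumes "continuous_on UNIV f" "bdd_supp f"
  shows "uniformly_continuous_on UNIV f" and "\<exists>C. \<forall>x. \<bar>f x\<bar> \<le> C"
proof -
  obtain B where B: "\<And>x. norm x > B \<Longrightarrow> f x = 0"
    using assms unfolding bdd_supp_def by auto
  have c: "compact (cball (0::'a) (B + 1))" by simp
  have "uniformly_continuous_on (cball 0 (B + 1)) f"
    using compact_uniformly_continuous c assms continuous_on_subset by blast
  then have u: "\<exists>d>0. \<forall>x\<in>cball 0 (B+1). \<forall>x'\<in>cball 0 (B+1). dist x' x < d \<longrightarrow> dist (f x') (f x) < e" if "e > 0" for e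
    using that unfolding uniformly_continuous_on_def by auto
  show "uniformly_continuous_on UNIV f"
    unfolding uniformly_continuous_on_def
  proof (intro allI impI)
    fix e :: real assume "e > 0"
    then obtain d where d: "d > 0" "\<And>x x'. norm x \<le> B + 1 \<Longrightarrow> norm x' \<le> B + 1 \<Longrightarrow> dist x' x < d \<Longrightarrow> dist (f x') (f x) < e"
      using u[of e] by auto
    have "dist (f x') (f x) < e" if "dist x' x < min d 1" for x x'
    proof (cases "norm x \<le> B + 1 \<and> norm x' \<le> B + 1")
      case False
      have "\<bar>norm x' - norm x\<bar> < 1"
        using that by (smt (verit) dist_norm norm_triangle_ineq3)
      then have "norm x > B" "norm x' > B" using False by auto
      then show ?thesis using B \<open>e > 0\<close> by auto
    qed (use d that in auto)
    then show "\<exists>d>0. \<forall>x\<in>UNIV. \<forall>x'\<in>UNIV. dist x' x < d \<longrightarrow> dist (f x') (f x) < e"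
      using d(1) by (intro exI[of _ "min d 1"]) auto
  qed
  have "compact (f ` cball 0 (B + 1))"
    using c assms by (meson compact_continuous_image continuous_on_subset subset_UNIV)
  then obtain C where C: "\<And>x. norm x \<le> B + 1 \<Longrightarrow> \<bar>f x\<bar> \<le> C"
    using compact_imp_bounded bounded_iff by (metis imageI mem_cball_0 real_norm_def)
  have "\<bar>f x\<bar> \<le> max C 0" for x
    using C[of x] B[of x] by (cases "norm x \<le> B + 1") auto
  then show "\<exists>C. \<forall>x. \<bar>f x\<bar> \<le> C" by blast
qed

section \<open>Truncated Riesz kernels\<close>

text \<open>With compact support the partial derivatives are uniformly continuous, so the error of
  the linear approximation is small uniformly in the base point \<open>w\<close>. This uniformity
  permits differentiation under the integral against an arbitrary L1 density in
  \<open>conv_has_derivative\<close>.\<close>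

lemma Ck_linearization:
  assumes "Ck 1 f" "bdd_supp f" "\<eta> > 0"
  shows "\<exists>\<delta>>0. \<forall>w v. norm v < \<delta> \<longrightarrow> \<bar>f (w + v) - f w - frechet_derivative f (at w) v\<bar> \<le> \<eta> * norm v"
proof -
  have diff: "f differentiable at x" for x using assms by auto
  let ?n = "real DIM('a)"
  have "\<exists>d>0. \<forall>x x'. dist x' x < d \<longrightarrow> \<bar>partial b f x' - partial b f x\<bar> < \<eta> / ?n" if "b \<in> Basis" for b
    using bdd_supp_ucont(1)[of "partial b f"] assms that bdd_supp_partial[OF assms(2)]
    unfolding uniformly_continuous_on_def by (auto simp: dist_real_def)
  then have "\<forall>b\<in>Basis. \<exists>d>0. \<forall>x x'. dist x' x < d \<longrightarrow> \<bar>partial b f x' - partial b f x\<bar> < \<eta> / ?n"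
    by blast
  from bchoice[OF this] obtain d where d: "\<And>b. b \<in> Basis \<Longrightarrow> d b > 0"
    "\<And>b x x'. b \<in> Basis \<Longrightarrow> dist x' x < d b \<Longrightarrow> \<bar>partial b f x' - partial b f x\<bar> < \<eta> / ?n"
    by blast
  define \<delta> where "\<delta> = Min (d ` Basis)"
  have dpos: "\<delta> > 0" unfolding \<delta>_def using d(1) by (subst Min_gr_iff) auto
  have dle: "\<delta> \<le> d b" if "b \<in> Basis" for b
    unfolding \<delta>_def using that by auto
  have "\<bar>f (w + v) - f w - frechet_derivative f (at w) v\<bar> \<le> \<eta> * norm v" if "norm v < \<delta>" for w v
  proof -
    have "norm (f (w + v) - f w - frechet_derivative f (at w) ((w + v) - w)) \<le> norm ((w + v) - w) * \<eta>"
    proof (rule differentiable_bound_linearization[where S = "ball w \<delta>" and f' = "\<lambda>x. frechet_derivative f (at x)"])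
      show "w + t *\<^sub>R (w + v - w) \<in> ball w \<delta>" if "t \<in> {0..1}" for t
      proof -
        have "\<bar>t\<bar> * norm v \<le> 1 * norm v" using that by (intro mult_right_mono) auto
        then show ?thesis using \<open>norm v < \<delta>\<close> by (auto simp: dist_norm)
      qed
      show "(f has_derivative frechet_derivative f (at x)) (at x within ball w \<delta>)" if "x \<in> ball w \<delta>" for x
        using has_derivative_frechet[OF diff] has_derivative_at_withinI by blast
      show "onorm (frechet_derivative f (at x) - frechet_derivative f (at w)) \<le> \<eta>" if "x \<in> ball w \<delta>" for x
      proof (rule onorm_le)
        fix y
        have "\<bar>frechet_derivative f (at x) y - frechet_derivative f (at w) y\<bar>
           = \<bar>\<Sum>b\<in>Basis. (y \<bullet> b) * (partial b f x - partial b f w)\<bar>"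
          by (simp add: frechet_eq_sum[OF diff] sum_subtractf right_diff_distrib)
        also have "\<dots> \<le> (\<Sum>b\<in>(Basis::'a set). norm y * (\<eta> / ?n))"
        proof (rule order_trans[OF sum_abs], rule sum_mono)
          fix b :: 'a assume b: "b \<in> Basis"
          have "dist x w < d b" using \<open>x \<in> ball w \<delta>\<close> dle[OF b] by (auto simp: dist_commute)
          then have "\<bar>partial b f x - partial b f w\<bar> \<le> \<eta> / ?n" using d(2)[OF b] by fastforce
          then show "\<bar>(y \<bullet> b) * (partial b f x - partial b f w)\<bar> \<le> norm y * (\<eta> / ?n)"
            unfolding abs_mult using b by (intro mult_mono) (auto simp: Basis_le_norm)
        qed
        also have "\<dots> = \<eta> * norm y" by simp
        finally show "norm ((frechet_derivative f (at x) - frechet_derivative f (at w)) y) \<le> \<eta> * norm y" by simp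
      qed
      show "w \<in> ball w \<delta>" using dpos by simp
    qed
    then show ?thesis by (simp add: mult.commute)
  qed
  then show ?thesis using dpos by blast
qed

text \<open>For \<open>t > R\<close> the interval \<open>{t..R}\<close> is empty and the integral is
  0, in agreement with \<open>g\<close> vanishing there, so the formula persists across
  \<open>t = R\<close>.\<close>

lemma tail_integral_DERIV:
  fixes g :: "real \<Rightarrow> real"
  assumes "continuous_on {c<..} g" "\<And>t. t \<ge> R \<Longrightarrow> g t = 0" "t > c"
  shows "((\<lambda>t. integral {t..R} g) has_real_derivative - g t) (at t)"
proof -
  define c' where "c' = (c + t) / 2"
  define M where "M = max R t + 1"
  have c': "c < c'" "c' < t" and M: "R < M" "t < M"
    using assms unfolding c'_def M_def by auto
  have cont: "continuous_on {c'..M} g"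
    by (rule continuous_on_subset[OF assms(1)]) (use c' in auto)
  have d: "((\<lambda>x. integral {x..M} g) has_real_derivative - g t) (at t within {c'..M})"
    by (rule integral_has_real_derivative'[OF cont]) (use c' M in auto)
  have eq: "integral {x..M} g = integral {x..R} g" if "x > c" "x < M" for x
  proof (cases "x \<le> R")
    case True
    have "g integrable_on {x..M}"
      by (rule integrable_continuous_real, rule continuous_on_subset[OF assms(1)]) (use that in auto)
    then have "integral {x..R} g + integral {R..M} g = integral {x..M} g"
      using True M by (intro Henstock_Kurzweil_Integration.integral_combine) auto
    moreover have "integral {R..M} g = 0"
      by (intro integral_unique has_integral_is_0) (use assms(2) in auto)
    ultimately show ?thesis by simp
  next
    case False
    then have "integral {x..M} g = 0"
      by (intro integral_unique has_integral_is_0) (use assms(2) in auto)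
    then show ?thesis using False by simp
  qed
  have "((\<lambda>x. integral {x..M} g) has_real_derivative - g t) (at t)"
    using d at_within_Icc_at[OF c'(2) M(2)] by simp
  then show ?thesis
    by (rule DERIV_cong_ev[OF refl _ refl, THEN iffD1, rotated])
       (use eq assms(3) M in \<open>auto intro!: eventually_nhds_in_open[of "{c<..<M}", THEN eventually_mono]\<close>)
qed

section \<open>Cut-off kernel profiles in the squared distance\<close>

definition beta :: "real \<Rightarrow> real \<Rightarrow> real" where
  "beta R t = bump (t - R / 2) * bump (R - t)"

text \<open>Since \<open>beta R\<close> lives on \<open>R / 2 < t < R\<close>, this is a smooth
  cut-off: constant for \<open>t \<le> R / 2\<close> and zero from \<open>R\<close> on. It is not
  normalised; the constant is absorbed later by the division by \<open>mass0\<close>.\<close>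

definition zeta :: "real \<Rightarrow> real \<Rightarrow> real" where
  "zeta R t = integral {t..R} (beta R)"

text \<open>With \<open>2 q = n + 2 - 2 s\<close> and \<open>t\<close> the squared distance, the
  case \<open>e = 0\<close> behaves near the origin like a multiple of
  \<open>t powr (1 - q)\<close>, that is of \<open>|x|\<close> to the power \<open>2 s - n\<close>,
  as long as \<open>q > 1\<close>. Cutting off the integrand instead of the power itself keeps the
  first derivative an exact product and treats \<open>q \<le> 1\<close> by the same formula.\<close>

definition ker0 :: "real \<Rightarrow> real \<Rightarrow> real \<Rightarrow> real \<Rightarrow> real" where
  "ker0 q R e t = integral {t..R} (\<lambda>\<tau>. zeta R \<tau> * (\<tau> + e) powr (- q))"

definition ker1 :: "real \<Rightarrow> real \<Rightarrow> real \<Rightarrow> real \<Rightarrow> real" where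
  "ker1 q R e t = - (zeta R t * (t + e) powr (- q))"

definition ker2 :: "real \<Rightarrow> real \<Rightarrow> real \<Rightarrow> real \<Rightarrow> real" where
  "ker2 q R e t = beta R t * (t + e) powr (- q) + q * zeta R t * (t + e) powr (- q - 1)"

lemma beta_bounds: "0 \<le> beta R t" "beta R t \<le> 1"
  unfolding beta_def by (auto simp: bump_nonneg bump_le_1 mult_le_one)

lemma beta_eq_0: "t \<le> R / 2 \<or> R \<le> t \<Longrightarrow> beta R t = 0"
  unfolding beta_def by (auto simp: bump_eq_0)

lemma beta_pos: "R / 2 < t \<Longrightarrow> t < R \<Longrightarrow> beta R t > 0"
  unfolding beta_def by (auto simp: bump_pos)

lemma kdiff_beta: "kdiff UNIV k (beta R)"
proof -
  have "kdiff UNIV k (\<lambda>t. bump (1 * t + - (R / 2)) * bump ((- 1) * t + R))"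
    by (intro kdiff_mult kdiff_shift kdiff_bump)
  moreover have "beta R = (\<lambda>t. bump (1 * t + - (R / 2)) * bump ((- 1) * t + R))"
    by (auto simp: beta_def)
  ultimately show ?thesis by simp
qed

lemma kdiff_continuous: "kdiff S (Suc k) f \<Longrightarrow> continuous_on S f"
  by (auto intro!: continuous_at_imp_continuous_on dest: DERIV_continuous)

lemma continuous_on_beta: "continuous_on A (beta R)"
  using kdiff_continuous[OF kdiff_beta] continuous_on_subset by blast

lemma DERIV_zeta: "(zeta R has_real_derivative - beta R t) (at t)"
  unfolding zeta_def[abs_def]
  by (rule tail_integral_DERIV[of "t - 1"]) (auto intro: continuous_on_beta beta_eq_0)

lemma kdiff_zeta: "kdiff UNIV k (zeta R)"
proof (cases k)
  case (Suc n)
  have "kdiff UNIV n (\<lambda>t. (- 1) * beta R t)"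
    by (intro kdiff_mult kdiff_const kdiff_beta)
  then show ?thesis using Suc DERIV_zeta by (auto intro!: exI[of _ "\<lambda>t. - beta R t"])
qed simp

lemma continuous_on_zeta: "continuous_on A (zeta R)"
  using kdiff_continuous[OF kdiff_zeta] continuous_on_subset by blast

lemma zeta_eq_0: "R \<le> t \<Longrightarrow> zeta R t = 0"
  unfolding zeta_def by (cases "t = R") auto

lemma zeta_bounds:
  shows "0 \<le> zeta R t" and "0 \<le> t \<Longrightarrow> 0 \<le> R \<Longrightarrow> zeta R t \<le> R"
proof -
  show "0 \<le> zeta R t"
    unfolding zeta_def by (rule integral_nonneg) (auto intro: integrable_continuous_real continuous_on_beta beta_bounds)
  assume "0 \<le> t" "0 \<le> R"
  have "zeta R t \<le> integral {t..R} (\<lambda>_. 1)"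
    unfolding zeta_def by (rule integral_le) (auto intro: integrable_continuous_real continuous_on_beta beta_bounds)
  also have "\<dots> \<le> R" using \<open>0 \<le> t\<close> \<open>0 \<le> R\<close> by (auto simp: content_real_if)
  finally show "zeta R t \<le> R" .
qed

lemma cont_ker: "continuous_on {- e<..} (\<lambda>\<tau>. zeta R \<tau> * (\<tau> + e) powr r)"
  by (intro continuous_intros continuous_on_zeta) auto

lemma DERIV_ker0: "t > - e \<Longrightarrow> (ker0 q R e has_real_derivative ker1 q R e t) (at t)"
  unfolding ker0_def[abs_def] ker1_def
  by (rule tail_integral_DERIV[OF cont_ker]) (auto simp: zeta_eq_0)

lemma DERIV_ker1: "t > - e \<Longrightarrow> (ker1 q R e has_real_derivative ker2 q R e t) (at t)"
  unfolding ker1_def[abs_def] ker2_def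
  by (auto intro!: derivative_eq_intros DERIV_zeta simp: algebra_simps)

lemma kdiff_ker1: "kdiff {- e<..} k (ker1 q R e)"
proof -
  have "kdiff {- e<..} k (\<lambda>t. (- 1) * (zeta R t * (t + e) powr (- q)))"
    by (intro kdiff_mult kdiff_const kdiff_powr kdiff_subset[OF kdiff_zeta]) auto
  then show ?thesis unfolding ker1_def[abs_def] by simp
qed

lemma kdiff_ker0: "kdiff {- e<..} k (ker0 q R e)"
proof (cases k)
  case (Suc n)
  then show ?thesis
    using kdiff_ker1[of e n q R] DERIV_ker0[of e _ q R] by (auto intro!: exI[of _ "ker1 q R e"])
qed simp

lemma ker0_eq_0: "t \<ge> R \<Longrightarrow> ker0 q R e t = 0"
  unfolding ker0_def by (cases "t = R") auto
lemma ker1_eq_0: "t \<ge> R \<Longrightarrow> ker1 q R e t = 0"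
  unfolding ker1_def by (auto simp: zeta_eq_0)
lemma ker2_eq_0: "t \<ge> R \<Longrightarrow> ker2 q R e t = 0"
  unfolding ker2_def by (auto simp: zeta_eq_0 beta_eq_0)

lemma powr_neg_mono: "0 < t \<Longrightarrow> t \<le> u \<Longrightarrow> 0 \<le> q \<Longrightarrow> u powr (- q) \<le> (t::real) powr (- q)"
  by (rule powr_mono2') auto

lemma int_ker: "t > - e \<Longrightarrow> (\<lambda>\<tau>. zeta R \<tau> * (\<tau> + e) powr r) integrable_on {t..R}"
  by (rule integrable_continuous_real, rule continuous_on_subset[OF cont_ker]) auto

lemma ker0_nonneg: "t > - e \<Longrightarrow> 0 \<le> ker0 q R e t"
  unfolding ker0_def by (rule integral_nonneg[OF int_ker]) (auto simp: zeta_bounds)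

lemma ker0_le: "t > 0 \<Longrightarrow> 0 \<le> e \<Longrightarrow> 0 \<le> q \<Longrightarrow> ker0 q R e t \<le> ker0 q R 0 t"
  unfolding ker0_def
  by (rule integral_le[OF int_ker int_ker]) (auto intro!: mult_left_mono powr_neg_mono simp: zeta_bounds)

text \<open>For \<open>\<tau> \<ge> t\<close> one has
  \<open>\<tau> + e \<le> (1 + e / t) * \<tau>\<close>, so the regularisation costs at most a
  constant factor on the whole tail. Together with \<open>ker0_le\<close> this squeezes
  \<open>ker0 q R e t\<close> to its value at \<open>e = 0\<close>.\<close>

lemma ker0_lower:
  assumes "t > 0" "0 \<le> e" "0 \<le> q"
  shows "(1 + e / t) powr (- q) * ker0 q R 0 t \<le> ker0 q R e t"
proof -
  have "(1 + e / t) powr (- q) * ker0 q R 0 t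
      = integral {t..R} (\<lambda>\<tau>. (1 + e / t) powr (- q) * (zeta R \<tau> * (\<tau> + 0) powr (- q)))"
    unfolding ker0_def by simp
  also have "\<dots> \<le> ker0 q R e t"
    unfolding ker0_def
  proof (rule integral_le)
    show "(\<lambda>\<tau>. (1 + e / t) powr (- q) * (zeta R \<tau> * (\<tau> + 0) powr (- q))) integrable_on {t..R}"
      using assms by (intro integrable_on_mult_right int_ker) auto
    show "(\<lambda>\<tau>. zeta R \<tau> * (\<tau> + e) powr (- q)) integrable_on {t..R}"
      using assms by (intro int_ker) auto
    fix \<tau> assume "\<tau> \<in> {t..R}"
    then have \<tau>: "t \<le> \<tau>" by auto
    have "\<tau> + e \<le> (1 + e / t) * \<tau>"
    proof -
      have "e * t \<le> e * \<tau>" using \<tau> assms by (intro mult_left_mono) auto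
      then show ?thesis using assms by (simp add: field_simps)
    qed
    then have "((1 + e / t) * \<tau>) powr (- q) \<le> (\<tau> + e) powr (- q)"
      using assms \<tau> by (intro powr_neg_mono) auto
    then have "(1 + e / t) powr (- q) * \<tau> powr (- q) \<le> (\<tau> + e) powr (- q)"
      using assms \<tau> by (simp add: powr_mult)
    then have "zeta R \<tau> * ((1 + e / t) powr (- q) * \<tau> powr (- q)) \<le> zeta R \<tau> * (\<tau> + e) powr (- q)"
      by (intro mult_left_mono zeta_bounds)
    then show "(1 + e / t) powr (- q) * (zeta R \<tau> * (\<tau> + 0) powr (- q)) \<le> zeta R \<tau> * (\<tau> + e) powr (- q)"
      by (simp add: algebra_simps)
  qed
  finally show ?thesis .
qed

lemma ker0_tendsto:
  assumes "t > 0" "0 \<le> q" "E \<longlonglongrightarrow> 0" "\<And>m. E m > 0"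
  shows "(\<lambda>m. ker0 q R (E m) t) \<longlonglongrightarrow> ker0 q R 0 t"
proof (rule tendsto_sandwich)
  show "\<forall>\<^sub>F m in sequentially. (1 + E m / t) powr (- q) * ker0 q R 0 t \<le> ker0 q R (E m) t"
    using ker0_lower assms by (intro always_eventually) (auto simp: less_imp_le)
  show "\<forall>\<^sub>F m in sequentially. ker0 q R (E m) t \<le> ker0 q R 0 t"
    using ker0_le assms by (intro always_eventually) (auto simp: less_imp_le)
  have "(\<lambda>m. (1 + E m / t) powr (- q) * ker0 q R 0 t) \<longlonglongrightarrow> (1 + 0 / t) powr (- q) * ker0 q R 0 t"
    using assms by (intro tendsto_intros) auto
  then show "(\<lambda>m. (1 + E m / t) powr (- q) * ker0 q R 0 t) \<longlonglongrightarrow> ker0 q R 0 t" by simp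
qed auto

lemma ker1_tendsto:
  assumes "t > 0" "E \<longlonglongrightarrow> 0"
  shows "(\<lambda>m. ker1 q R (E m) t) \<longlonglongrightarrow> ker1 q R 0 t"
proof -
  have "(\<lambda>m. - (zeta R t * (t + E m) powr (- q))) \<longlonglongrightarrow> - (zeta R t * (t + 0) powr (- q))"
    using assms by (intro tendsto_intros) auto
  then show ?thesis unfolding ker1_def by simp
qed

lemma ker2_tendsto:
  assumes "t > 0" "E \<longlonglongrightarrow> 0"
  shows "(\<lambda>m. ker2 q R (E m) t) \<longlonglongrightarrow> ker2 q R 0 t"
proof -
  have "(\<lambda>m. beta R t * (t + E m) powr (- q) + q * zeta R t * (t + E m) powr (- q - 1)) \<longlonglongrightarrow>
     beta R t * (t + 0) powr (- q) + q * zeta R t * (t + 0) powr (- q - 1)"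
    using assms by (intro tendsto_intros) auto
  then show ?thesis unfolding ker2_def by simp
qed

lemma ker1_bound:
  assumes "t > 0" "0 \<le> e" "0 \<le> q" "0 < R"
  shows "\<bar>ker1 q R e t\<bar> \<le> R * t powr (- q)"
proof -
  have "zeta R t * (t + e) powr (- q) \<le> R * t powr (- q)"
    using assms by (intro mult_mono zeta_bounds powr_neg_mono) auto
  then show ?thesis unfolding ker1_def by (simp add: zeta_bounds)
qed

text \<open>On the support of \<open>beta R\<close> one has \<open>t < R\<close>, so
  \<open>t powr (- q)\<close> may be traded for \<open>R * t powr (- q - 1)\<close>, and both terms
  of \<open>ker2\<close> get the same homogeneity.\<close>

lemma ker2_bound:
  assumes "t > 0" "0 \<le> e" "0 \<le> q" "0 < R"
  shows "\<bar>ker2 q R e t\<bar> \<le> (1 + q) * R * t powr (- q - 1)"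
proof -
  have a: "zeta R t * (t + e) powr (- q - 1) \<le> R * t powr (- q - 1)"
    using assms powr_neg_mono[of t "t + e" "q + 1"] by (intro mult_mono zeta_bounds) auto
  have b: "beta R t * (t + e) powr (- q) \<le> R * t powr (- q - 1)"
  proof (cases "t \<ge> R")
    case False
    have "beta R t * (t + e) powr (- q) \<le> 1 * t powr (- q)"
      using assms by (intro mult_mono beta_bounds powr_neg_mono) auto
    also have "\<dots> = t * t powr (- q - 1)"
      using assms by (simp add: powr_diff)
    also have "\<dots> \<le> R * t powr (- q - 1)"
      using False by (intro mult_right_mono) auto
    finally show ?thesis .
  qed (use assms in \<open>auto simp: beta_eq_0\<close>)
  have "0 \<le> ker2 q R e t"
    unfolding ker2_def using assms by (auto simp: zeta_bounds beta_bounds)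
  moreover have "ker2 q R e t \<le> R * t powr (- q - 1) + q * (R * t powr (- q - 1))"
    unfolding ker2_def using a b assms by (intro add_mono) (auto simp: mult.assoc intro!: mult_left_mono)
  ultimately show ?thesis by (simp add: algebra_simps)
qed

text \<open>As \<open>R \<le> 1\<close>, the integrand is dominated by
  \<open>\<tau> powr (- b - 1)\<close> for every positive \<open>b \<ge> q - 1\<close>. The freedom
  in \<open>b\<close> covers logarithmic and bounded kernels.\<close>

lemma ker0_bound:
  assumes "t > 0" "0 < R" "R \<le> 1" "0 < b" "q - 1 \<le> b"
  shows "\<bar>ker0 q R 0 t\<bar> \<le> (1 / b) * t powr (- b)"
proof (cases "t \<ge> R")
  case True then show ?thesis using ker0_eq_0 assms by simp
next
  case False
  have hi: "((\<lambda>\<tau>. \<tau> powr (- b - 1)) has_integral (- (1 / b) * R powr (- b)) - (- (1 / b) * t powr (- b))) {t..R}"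
  proof (rule fundamental_theorem_of_calculus)
    fix x assume "x \<in> {t..R}"
    then have "((\<lambda>\<tau>. - (1 / b) * \<tau> powr (- b)) has_real_derivative x powr (- b - 1)) (at x)"
      using assms by (auto intro!: derivative_eq_intros)
    then show "((\<lambda>\<tau>. - (1 / b) * \<tau> powr (- b)) has_vector_derivative x powr (- b - 1)) (at x within {t..R})"
      using has_field_derivative_at_within has_real_derivative_iff_has_vector_derivative by blast
  qed (use False in auto)
  have "ker0 q R 0 t \<le> integral {t..R} (\<lambda>\<tau>. \<tau> powr (- b - 1))"
    unfolding ker0_def
  proof (rule integral_le)
    show "(\<lambda>\<tau>. zeta R \<tau> * (\<tau> + 0) powr - q) integrable_on {t..R}"
      using assms by (intro int_ker) auto
    show "(\<lambda>\<tau>. \<tau> powr (- b - 1)) integrable_on {t..R}" using hi by blast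
    fix \<tau> assume "\<tau> \<in> {t..R}"
    then have "\<tau> > 0" "\<tau> \<le> 1" using assms by auto
    then have "zeta R \<tau> * (\<tau> + 0) powr - q \<le> R * \<tau> powr (- b - 1)"
      using assms powr_mono'[of "- b - 1" "- q" \<tau>] by (intro mult_mono zeta_bounds) auto
    also have "\<dots> \<le> 1 * \<tau> powr (- b - 1)" using assms by (intro mult_right_mono) auto
    finally show "zeta R \<tau> * (\<tau> + 0) powr - q \<le> \<tau> powr (- b - 1)" by simp
  qed
  also have "\<dots> \<le> (1 / b) * t powr (- b)"
    using hi assms by (auto dest!: integral_unique)
  finally show ?thesis using ker0_nonneg[of 0 t q R] assms by simp
qed

lemma ker0_diff:
  assumes "0 < t" "t \<le> t'" "0 < R" "0 \<le> q"
  shows "\<bar>ker0 q R 0 t' - ker0 q R 0 t\<bar> \<le> (t' - t) * (R * t powr (- q))"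
proof (cases "t = t'")
  case False
  then have "t < t'" using assms by simp
  then obtain z where z: "t < z" "z < t'" "ker0 q R 0 t' - ker0 q R 0 t = (t' - t) * ker1 q R 0 z"
    using MVT2[of t t' "ker0 q R 0" "ker1 q R 0"] DERIV_ker0 assms by (auto simp: less_le_trans)
  have "\<bar>ker1 q R 0 z\<bar> \<le> R * z powr (- q)" using z assms by (intro ker1_bound) auto
  also have "\<dots> \<le> R * t powr (- q)" using z assms by (intro mult_left_mono powr_neg_mono) auto
  finally show ?thesis using z by (simp add: abs_mult mult_left_mono)
qed simp

section \<open>Radial functions and differentiation of convolutions\<close>

lemma Ck_radial:
  fixes c :: "'a::euclidean_space"
  assumes "\<And>k. kdiff {- e<..} k h" "e > 0"
  shows "Ck k (\<lambda>z. h ((norm (z - c))\<^sup>2))"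
  by (rule Ck_comp[OF assms(1) Ck_sqnorm]) (use assms(2) in \<open>auto intro: less_le_trans[of _ 0]\<close>)

lemma norm_sq_inner_partial:
  fixes x c :: "'a::euclidean_space"
  shows "((\<lambda>z. (norm (z - c))\<^sup>2) has_derivative (\<lambda>h. 2 * ((x - c) \<bullet> h))) (at x)"
proof -
  have "((\<lambda>z. (z - c) \<bullet> (z - c)) has_derivative (\<lambda>h. 2 * ((x - c) \<bullet> h))) (at x)"
    by (auto intro!: derivative_eq_intros simp: inner_commute)
  then show ?thesis by (simp add: power2_norm_eq_inner)
qed

lemma has_derivative_radial:
  fixes x c :: "'a::euclidean_space"
  assumes "(h has_real_derivative h') (at ((norm (x - c))\<^sup>2))"
  shows "((\<lambda>z. h ((norm (z - c))\<^sup>2)) has_derivative (\<lambda>v. h' * (2 * ((x - c) \<bullet> v)))) (at x)"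
  using has_derivative_compose[OF norm_sq_inner_partial, of h "\<lambda>v. h' * v" x c] assms
  by (simp add: has_field_derivative_def)

lemma partial_radial:
  fixes x c :: "'a::euclidean_space"
  assumes "(h has_real_derivative h') (at ((norm (x - c))\<^sup>2))"
  shows "partial i (\<lambda>z. h ((norm (z - c))\<^sup>2)) x = 2 * h' * ((x - c) \<bullet> i)"
  by (subst partial_eq[OF has_derivative_radial[OF assms]]) simp

lemma grad_radial:
  fixes x c :: "'a::euclidean_space"
  assumes "(h has_real_derivative h') (at ((norm (x - c))\<^sup>2))"
  shows "grad (\<lambda>z. h ((norm (z - c))\<^sup>2)) x = (2 * h') *\<^sub>R (x - c)"
  unfolding grad_def partial_radial[OF assms]
  by (simp add: euclidean_representation flip: scaleR_scaleR scaleR_sum_right)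

lemma bdd_supp_radial:
  fixes c :: "'a::euclidean_space"
  assumes "\<And>t. t \<ge> R \<Longrightarrow> h t = 0"
  shows "bdd_supp (\<lambda>z. h ((norm (z - c))\<^sup>2))"
proof -
  have "h ((norm (z - c))\<^sup>2) = 0" if "norm z > norm c + 1 + \<bar>R\<bar>" for z
  proof -
    have n: "1 + \<bar>R\<bar> \<le> norm (z - c)" using norm_triangle_ineq2[of z c] that by linarith
    then have "1 * (1 + \<bar>R\<bar>) \<le> norm (z - c) * norm (z - c)" by (intro mult_mono) auto
    then show ?thesis by (intro assms) (auto simp: power2_eq_square)
  qed
  then show ?thesis unfolding bdd_supp_def by blast
qed

text \<open>All smoothness sits on \<open>\<phi>\<close>, so integrability of \<open>m\<close> is
  enough. The linear map \<open>j\<close> is the identity for potentials in the variable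
  \<open>x\<close>, and the embedding \<open>x \<mapsto> (x, 0)\<close> for averages of
  \<open>u\<close> over the half space.\<close>

lemma conv_has_derivative:
  fixes m :: "'b::euclidean_space \<Rightarrow> real" and j :: "'a::euclidean_space \<Rightarrow> 'b"
  assumes m: "integrable lebesgue m" and \<phi>: "Ck 1 \<phi>" "bdd_supp \<phi>" and j: "bounded_linear j"
  shows "((\<lambda>x. LINT z|lebesgue. m z * \<phi> (j x - z)) has_derivative
     (\<lambda>h. LINT z|lebesgue. m z * frechet_derivative \<phi> (at (j x - z)) (j h))) (at x)"
proof -
  have cont: "continuous_on UNIV \<phi>" using \<phi>(1) Ck_continuous by blast
  have diff: "\<phi> differentiable at x" for x using \<phi> by simp
  have lm: "f \<in> borel_measurable lebesgue" if "continuous_on UNIV f" for f :: "'b \<Rightarrow> real"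
    using that by (intro measurable_completion) (simp add: borel_measurable_continuous_onI)
  have int: "integrable lebesgue (\<lambda>z. m z * f (w - z))" if f: "continuous_on UNIV f" "bdd_supp f" for f w
  proof -
    obtain C where C: "\<And>x. \<bar>f x\<bar> \<le> C" using bdd_supp_ucont(2)[OF f] by blast
    have "continuous_on UNIV (\<lambda>z. f (w - z))"
      by (rule continuous_on_compose2[OF f(1)]) (auto intro!: continuous_intros)
    then have fm: "(\<lambda>z. f (w - z)) \<in> borel_measurable lebesgue" by (rule lm)
    have ae: "AE z in lebesgue. norm (m z * f (w - z)) \<le> norm (C * m z)"
    proof (rule AE_I2)
      fix z
      have "\<bar>m z\<bar> * \<bar>f (w - z)\<bar> \<le> \<bar>m z\<bar> * \<bar>C\<bar>"
        using C[of "w - z"] by (intro mult_left_mono) auto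
      then show "norm (m z * f (w - z)) \<le> norm (C * m z)" by (simp add: abs_mult mult.commute)
    qed
    have Cm: "integrable lebesgue (\<lambda>z. C * m z)" using m by simp
    have mm: "(\<lambda>z. m z * f (w - z)) \<in> borel_measurable lebesgue"
      by (rule borel_measurable_times[OF borel_measurable_integrable[OF m] fm])
    show ?thesis by (rule Bochner_Integration.integrable_bound[OF Cm mm ae])
  qed
  have intd: "integrable lebesgue (\<lambda>z. m z * frechet_derivative \<phi> (at (w - z)) v)" for v w
  proof -
    have "integrable lebesgue (\<lambda>z. \<Sum>b\<in>Basis. (v \<bullet> b) * (m z * partial b \<phi> (w - z)))"
      using \<phi> bdd_supp_partial[OF \<phi>(2)] by (intro Bochner_Integration.integrable_sum integrable_mult_right int) auto
    then show ?thesis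
      by (simp add: frechet_eq_sum[OF diff] sum_distrib_left algebra_simps)
  qed
  let ?D = "\<lambda>h. LINT z|lebesgue. m z * frechet_derivative \<phi> (at (j x - z)) (j h)"
  have bl: "bounded_linear ?D"
  proof -
    have lin: "linear (\<lambda>h. frechet_derivative \<phi> (at w) (j h))" for w
      using linear_compose[of j "frechet_derivative \<phi> (at w)"] bounded_linear.linear[OF j]
        linear_frechet_derivative[OF diff] by (auto simp: o_def)
    have "linear ?D"
      by (rule linearI)
        (simp_all add: linear_add[OF lin] linear_scale[OF lin] distrib_left intd
          Bochner_Integration.integral_add[OF intd intd] mult.left_commute)
    then show ?thesis by (simp add: linear_conv_bounded_linear)
  qed
  obtain K where K: "K > 0" "\<And>x. norm (j x) \<le> norm x * K"
    using bounded_linear.pos_bounded[OF j] by blast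
  let ?M = "LINT z|lebesgue. \<bar>m z\<bar>"
  show ?thesis
    unfolding has_derivative_at_alt
  proof (intro conjI allI impI bl)
    fix e :: real assume e: "e > 0"
    \<comment> \<open>The \<open>+ 1\<close> keeps the denominator positive when \<open>m\<close>
      vanishes almost everywhere.\<close>
    define \<eta> where "\<eta> = e / (K * (?M + 1))"
    have M: "?M \<ge> 0" by simp
    then have M1: "?M + 1 > 0" by linarith
    have \<eta>: "\<eta> > 0" unfolding \<eta>_def using e K M1 by (intro divide_pos_pos mult_pos_pos) simp_all
    obtain \<delta> where \<delta>: "\<delta> > 0" "\<And>w v. norm v < \<delta> \<Longrightarrow> \<bar>\<phi> (w + v) - \<phi> w - frechet_derivative \<phi> (at w) v\<bar> \<le> \<eta> * norm v"
      using Ck_linearization[OF \<phi> \<eta>] by blast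
    show "\<exists>d>0. \<forall>y. norm (y - x) < d \<longrightarrow>
       norm ((LINT z|lebesgue. m z * \<phi> (j y - z)) - (LINT z|lebesgue. m z * \<phi> (j x - z)) - ?D (y - x)) \<le> e * norm (y - x)"
    proof (intro exI[of _ "\<delta> / K"] conjI allI impI)
      fix y assume y: "norm (y - x) < \<delta> / K"
      have jv: "norm (j (y - x)) < \<delta>"
        using K(2)[of "y - x"] y K(1) by (auto simp: field_simps intro: le_less_trans)
      have jd: "j y - z = (j x - z) + j (y - x)" for z
        using bounded_linear.linear[OF j] by (simp add: linear_diff)
      have "(LINT z|lebesgue. m z * \<phi> (j y - z)) - (LINT z|lebesgue. m z * \<phi> (j x - z)) - ?D (y - x)
        = (LINT z|lebesgue. m z * \<phi> (j y - z) - m z * \<phi> (j x - z) - m z * frechet_derivative \<phi> (at (j x - z)) (j (y - x)))"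
        using int[OF cont \<phi>(2)] intd by simp
      also have "norm \<dots> \<le> (LINT z|lebesgue. \<bar>m z\<bar> * (\<eta> * norm (j (y - x))))"
      proof (rule Bochner_Integration.integral_norm_bound_integral)
        show "integrable lebesgue (\<lambda>z. m z * \<phi> (j y - z) - m z * \<phi> (j x - z) - m z * frechet_derivative \<phi> (at (j x - z)) (j (y - x)))"
          using int[OF cont \<phi>(2)] intd by (intro Bochner_Integration.integrable_diff)
        show "integrable lebesgue (\<lambda>z. \<bar>m z\<bar> * (\<eta> * norm (j (y - x))))" using m by simp
        fix z
        have "norm (m z * \<phi> (j y - z) - m z * \<phi> (j x - z) - m z * frechet_derivative \<phi> (at (j x - z)) (j (y - x)))
          = \<bar>m z\<bar> * \<bar>\<phi> ((j x - z) + j (y - x)) - \<phi> (j x - z) - frechet_derivative \<phi> (at (j x - z)) (j (y - x))\<bar>"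
          unfolding jd[of z] real_norm_def abs_mult[symmetric] by (simp add: right_diff_distrib)
        also have "\<dots> \<le> \<bar>m z\<bar> * (\<eta> * norm (j (y - x)))"
          by (intro mult_left_mono \<delta> jv) auto
        finally show "norm (m z * \<phi> (j y - z) - m z * \<phi> (j x - z) - m z * frechet_derivative \<phi> (at (j x - z)) (j (y - x))) \<le> \<bar>m z\<bar> * (\<eta> * norm (j (y - x)))" .
      qed
      also have "\<dots> = ?M * (\<eta> * norm (j (y - x)))" by simp
      also have "\<dots> \<le> (?M + 1) * (\<eta> * (norm (y - x) * K))"
        using K(2)[of "y - x"] \<eta> M by (intro mult_mono) auto
      also have "\<dots> = e * norm (y - x)"
        
      proof -
        have "M * (e / (K * M) * (n * K)) = e * n" if "M > 0" for M n
          using K(1) that by (simp add: field_simps)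
        from this[OF M1] show ?thesis unfolding \<eta>_def .
      qed
      finally show "norm ((LINT z|lebesgue. m z * \<phi> (j y - z)) - (LINT z|lebesgue. m z * \<phi> (j x - z)) - ?D (y - x)) \<le> e * norm (y - x)" .
    qed (use \<delta> K in auto)
  qed
qed

lemma conv_partial:
  assumes "integrable lebesgue m" "Ck 1 \<phi>" "bdd_supp \<phi>" "bounded_linear j"
  shows "partial i (\<lambda>x. LINT z|lebesgue. m z * \<phi> (j x - z)) = (\<lambda>x. LINT z|lebesgue. m z * partial (j i) \<phi> (j x - z))"
  using partial_eq[OF conv_has_derivative[OF assms]] by (auto simp: partial_def)

lemma conv_Ck:
  assumes "integrable lebesgue m" "\<And>k. Ck k \<phi>" "bdd_supp \<phi>" "bounded_linear j" "\<And>i. i \<in> Basis \<Longrightarrow> j i \<in> Basis"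
  shows "Ck k (\<lambda>x. LINT z|lebesgue. m z * \<phi> (j x - z))"
  using assms(2,3)
proof (induction k arbitrary: \<phi>)
  case 0
  have "(\<lambda>x. LINT z|lebesgue. m z * \<phi> (j x - z)) differentiable at x" for x
    using conv_has_derivative[OF assms(1) 0(1,2) assms(4)] differentiable_def by blast
  then show ?case
    by (auto intro!: continuous_at_imp_continuous_on differentiable_imp_continuous_within)
next
  case (Suc k)
  have "(\<lambda>x. LINT z|lebesgue. m z * \<phi> (j x - z)) differentiable at x" for x
    using conv_has_derivative[OF assms(1) Suc.prems assms(4)] differentiable_def by blast
  moreover have "Ck k (partial i (\<lambda>x. LINT z|lebesgue. m z * \<phi> (j x - z)))" if "i \<in> Basis" for i
    unfolding conv_partial[OF assms(1) Suc.prems assms(4)]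
  proof (rule Suc.IH)
    show "Ck n (partial (j i) \<phi>)" for n
      using Suc.prems(1)[of "Suc n"] assms(5)[OF that] by auto
  qed (use bdd_supp_partial[OF Suc.prems(2)] in auto)
  ultimately show ?case by auto
qed

lemma conv_bounded:
  fixes m :: "'b::euclidean_space \<Rightarrow> real" and j :: "'a::euclidean_space \<Rightarrow> 'b"
  assumes m: "integrable lebesgue m" and \<phi>: "continuous_on UNIV \<phi>" "bdd_supp \<phi>"
  shows "\<exists>C. \<forall>x. norm (LINT z|lebesgue. m z * \<phi> (j x - z)) \<le> C"
proof -
  obtain C where C: "\<And>x. \<bar>\<phi> x\<bar> \<le> C" using bdd_supp_ucont(2)[OF \<phi>] by blast
  have "norm (LINT z|lebesgue. m z * \<phi> (j x - z)) \<le> (LINT z|lebesgue. C * \<bar>m z\<bar>)" for x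
  proof (cases "integrable lebesgue (\<lambda>z. m z * \<phi> (j x - z))")
    case True
    have "\<bar>m z\<bar> * \<bar>\<phi> (j x - z)\<bar> \<le> C * \<bar>m z\<bar>" for z
      using mult_right_mono[OF C[of "j x - z"], of "\<bar>m z\<bar>"] by (simp add: mult.commute)
    then show ?thesis
      using Bochner_Integration.integral_norm_bound_integral[of lebesgue "\<lambda>z. m z * \<phi> (j x - z)" "\<lambda>z. C * \<bar>m z\<bar>"] True m C
      by (auto simp: abs_mult)
  next
    case False
    \<comment> \<open>A non-integrable product has integral 0 by convention, so nonnegativity of
      \<open>C\<close> settles this case.\<close>
    have "0 \<le> C" using C[of 0] by linarith
    then show ?thesis using False by (simp add: not_integrable_integral_eq)
  qed
  then show ?thesis by blast
qed

section \<open>Estimates for Riesz potentials\<close>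

lemma ball_in_borel [measurable]: "ball (c::'a::euclidean_space) r \<in> sets borel"
  by simp

lemma lborel_eq_reflect: "(lborel :: 'a::euclidean_space measure) = distr lborel borel (\<lambda>y. x - y)"
proof -
  have "(lborel :: 'a measure) = density (distr lborel borel (\<lambda>y. x + (- 1) *\<^sub>R y)) (\<lambda>_. ennreal (\<bar>- 1\<bar> ^ DIM('a)))"
    by (rule lborel_affine) simp
  then show ?thesis by (simp add: density_1)
qed

lemma nn_integral_lborel_reflect:
  fixes f :: "'a::euclidean_space \<Rightarrow> ennreal"
  assumes [measurable]: "f \<in> borel_measurable borel"
  shows "(\<integral>\<^sup>+y. f (x - y) \<partial>lborel) = (\<integral>\<^sup>+y. f y \<partial>lborel)"
proof -
  have "(\<integral>\<^sup>+y. f y \<partial>lborel) = (\<integral>\<^sup>+y. f y \<partial>distr lborel borel (\<lambda>y. x - y))"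
    by (simp only: lborel_eq_reflect[of x, symmetric])
  also have "\<dots> = (\<integral>\<^sup>+y. f (x - y) \<partial>lborel)"
    by (simp add: nn_integral_distr)
  finally show ?thesis by simp
qed

lemma nn_integral_lborel_translate:
  fixes f :: "'a::euclidean_space \<Rightarrow> ennreal"
  assumes [measurable]: "f \<in> borel_measurable borel"
  shows "(\<integral>\<^sup>+y. f (y + x) \<partial>lborel) = (\<integral>\<^sup>+y. f y \<partial>lborel)"
proof -
  have "(\<integral>\<^sup>+y. f y \<partial>lborel) = (\<integral>\<^sup>+y. f y \<partial>distr lborel borel ((+) x))"
    by (simp add: lborel_distr_plus)
  also have "\<dots> = (\<integral>\<^sup>+y. f (y + x) \<partial>lborel)"
    by (simp add: nn_integral_distr add.commute)
  finally show ?thesis by simp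
qed

text \<open>Dyadic shells: between the radii \<open>D / 2 ^ Suc j\<close> and
  \<open>D / 2 ^ j\<close> the power is at most its value at the inner radius, and with the volumes
  of the balls the sum is geometric with ratio \<open>2 powr (e - n)\<close>, \<open>n\<close> being
  the dimension.\<close>

lemma nn_integral_powr_ball:
  assumes "0 \<le> e" "e < real DIM('a::euclidean_space)"
  shows "\<exists>C\<ge>0. (\<integral>\<^sup>+x. ennreal (norm (x::'a) powr (- e)) * indicator (ball 0 D) x \<partial>lborel) \<le> ennreal C"
proof (cases "D > 0")
  case True
  let ?n = "DIM('a)"
  define V where "V = unit_ball_vol (real ?n)"
  have V: "V \<ge> 0" unfolding V_def by simp
  define c where "c j = (D / 2 ^ Suc j) powr (- e)" for j :: nat
  define r where "r j = D / 2 ^ j" for j :: nat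
  have r: "r j > 0" for j unfolding r_def using True by simp
  have pt: "ennreal (norm x powr (- e)) * indicator (ball 0 D) x \<le> (\<Sum>j. ennreal (c j) * indicator (ball 0 (r j)) x)" for x :: 'a
  proof (cases "x \<in> ball 0 D \<and> x \<noteq> 0")
    case False
    then show ?thesis by (auto simp: indicator_def)
  next
    case x: True
    then have nx: "norm x > 0" "norm x < D" by auto
    have "\<exists>j. D / 2 ^ Suc j \<le> norm x"
    proof -
      obtain k where "D / norm x < 2 ^ k" using real_arch_pow[of 2 "D / norm x"] by auto
      also have "(2::real) ^ k \<le> 2 ^ Suc k" by simp
      finally show ?thesis using nx by (intro exI[of _ k]) (simp add: field_simps)
    qed
    \<comment> \<open>The first shell whose inner radius does not exceed \<open>norm x\<close>;
      minimality puts \<open>x\<close> inside its outer radius.\<close>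
    define j where "j = (LEAST j. D / 2 ^ Suc j \<le> norm x)"
    have j: "D / 2 ^ Suc j \<le> norm x"
      unfolding j_def by (rule LeastI_ex) fact
    have j': "norm x < r j"
    proof (cases j)
      case 0 then show ?thesis using nx by (simp add: r_def)
    next
      case (Suc i)
      then have "\<not> D / 2 ^ Suc i \<le> norm x" using not_less_Least[of i "\<lambda>j. D / 2 ^ Suc j \<le> norm x"] j_def by auto
      then show ?thesis using Suc by (simp add: r_def)
    qed
    have "norm x powr (- e) \<le> c j"
      unfolding c_def using j True assms by (intro powr_neg_mono) auto
    then have "ennreal (norm x powr (- e)) * indicator (ball 0 D) x \<le> ennreal (c j) * indicator (ball 0 (r j)) x"
      using j' x by (auto simp: indicator_def ennreal_leI)
    also have "\<dots> \<le> (\<Sum>j. ennreal (c j) * indicator (ball 0 (r j)) x)"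
    proof -
      have "(\<Sum>j\<in>{j}. ennreal (c j) * indicator (ball 0 (r j)) x) \<le> (\<Sum>j. ennreal (c j) * indicator (ball 0 (r j)) x)"
        by (rule sum_le_suminf) auto
      then show ?thesis by (simp only: sum.insert sum.empty finite.emptyI empty_iff add_0_right simp_thms)
    qed
    finally show ?thesis .
  qed
  define K where "K = D powr (- e) * 2 powr e * V * D ^ ?n"
  have K: "K \<ge> 0" unfolding K_def using V True by simp
  define \<theta> where "\<theta> = 2 powr (e - ?n)"
  have \<theta>: "0 \<le> \<theta>" "\<theta> < 1" unfolding \<theta>_def using assms powr_less_mono[of "e - ?n" 0 2] by auto
  have trm: "c j * (V * r j ^ ?n) = K * \<theta> ^ j" for j
  proof -
    have "c j = D powr (- e) * (2 ^ Suc j) powr e"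
      unfolding c_def using True by (simp add: powr_divide powr_minus field_simps)
    also have "(2 ^ Suc j) powr e = 2 powr e * (2 powr e) ^ j"
      by (simp add: powr_mult powr_power mult.commute powr_realpow[symmetric] powr_powr)
    finally have c: "c j = D powr (- e) * (2 powr e * (2 powr e) ^ j)" .
    have rr: "r j ^ ?n = D ^ ?n * (2 powr (- real ?n)) ^ j"
      unfolding r_def
      by (simp add: power_divide powr_minus powr_realpow power_inverse divide_inverse power_mult_distrib power_mult[symmetric] mult.commute[of j])
    have "\<theta> ^ j = (2 powr e) ^ j * (2 powr (- real ?n)) ^ j"
      unfolding \<theta>_def by (simp add: power_mult_distrib[symmetric] powr_add[symmetric])
    then show ?thesis unfolding c rr K_def by simp
  qed
  have "(\<integral>\<^sup>+x. ennreal (norm (x::'a) powr (- e)) * indicator (ball 0 D) x \<partial>lborel)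
     \<le> (\<integral>\<^sup>+x. (\<Sum>j. ennreal (c j) * indicator (ball 0 (r j)) (x::'a)) \<partial>lborel)"
    by (intro nn_integral_mono pt)
  also have "\<dots> = (\<Sum>j. \<integral>\<^sup>+x. ennreal (c j) * indicator (ball 0 (r j)) (x::'a) \<partial>lborel)"
    by (intro nn_integral_suminf) measurable
  also have "\<dots> = (\<Sum>j. ennreal (K * \<theta> ^ j))"
  proof (intro suminf_cong)
    fix j
    have "(\<integral>\<^sup>+x. ennreal (c j) * indicator (ball 0 (r j)) (x::'a) \<partial>lborel) = ennreal (c j) * emeasure lborel (ball (0::'a) (r j))"
      by (subst nn_integral_cmult) auto
    also have "\<dots> = ennreal (c j) * ennreal (V * r j ^ ?n)"
      using r[of j] by (simp add: emeasure_ball V_def)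
    also have "\<dots> = ennreal (K * \<theta> ^ j)"
      using V r[of j] unfolding trm[symmetric] c_def by (intro ennreal_mult[symmetric]) auto
    finally show "(\<integral>\<^sup>+x. ennreal (c j) * indicator (ball 0 (r j)) (x::'a) \<partial>lborel) = ennreal (K * \<theta> ^ j)" .
  qed
  also have "\<dots> = ennreal (\<Sum>j. K * \<theta> ^ j)"
    using \<theta> K by (intro suminf_ennreal2) (auto intro!: summable_mult summable_geometric)
  finally show ?thesis
    using \<theta> K by (intro exI[of _ "\<Sum>j. K * \<theta> ^ j"] conjI suminf_nonneg) (auto intro!: summable_mult summable_geometric)
next
  case False
  then have "ball (0::'a) D = {}" by auto
  then have "indicator (ball (0::'a) D) x = (0::ennreal)" for x
    using False by (auto simp: indicator_def dest: le_less_trans[OF norm_ge_zero])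
  then show ?thesis by (intro exI[of _ 0]) simp
qed

text \<open>One of the two distances is at least \<open>norm (x - z) / 2\<close>. The power
  \<open>d\<close> is taken from the larger distance and the rest of its exponent is moved to the
  smaller one, where a negative power is larger; the smaller distance then carries the exponent
  \<open>b + c - d\<close>.\<close>

lemma kernel_product_bound:
  fixes x y z :: "'a::real_normed_vector"
  assumes "0 \<le> d" "d \<le> b" "d \<le> c" "x \<noteq> z" "norm (x - y) < \<rho>" "norm (x - z) \<le> D"
  shows "norm (x - y) powr (- b) * norm (y - z) powr (- c) \<le>
     2 powr d * norm (x - z) powr (- d) *
      (norm (x - y) powr (- (b + c - d)) * indicator (ball 0 \<rho>) (x - y) +
       norm (y - z) powr (- (b + c - d)) * indicator (ball 0 (D + \<rho>)) (y - z))"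
proof (cases "y = x \<or> y = z")
  case True
  then show ?thesis by (auto simp: indicator_def)
next
  case False
  have tri: "norm (x - z) \<le> norm (x - y) + norm (y - z)"
    using norm_triangle_ineq[of "x - y" "y - z"] by simp
  have in2: "norm (y - z) < D + \<rho>"
    using norm_triangle_ineq[of "y - x" "x - z"] assms by (simp add: norm_minus_commute)
  have half: "A powr (- d) \<le> 2 powr d * norm (x - z) powr (- d)" if "norm (x - z) / 2 \<le> A" for A
  proof -
    have "A powr (- d) \<le> (norm (x - z) / 2) powr (- d)"
      using that assms by (intro powr_neg_mono) auto
    also have "\<dots> = 2 powr d * norm (x - z) powr (- d)"
      by (simp add: powr_divide powr_minus field_simps)
    finally show ?thesis .
  qed
  show ?thesis
  proof (cases "norm (x - y) \<le> norm (y - z)")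
    case True
    have "norm (y - z) powr (- c) = norm (y - z) powr (- d) * norm (y - z) powr (- (c - d))"
      by (simp add: powr_add[symmetric])
    also have "\<dots> \<le> (2 powr d * norm (x - z) powr (- d)) * norm (x - y) powr (- (c - d))"
      using True False tri assms by (intro mult_mono half powr_neg_mono) auto
    finally have "norm (x - y) powr (- b) * norm (y - z) powr (- c) \<le>
       norm (x - y) powr (- b) * ((2 powr d * norm (x - z) powr (- d)) * norm (x - y) powr (- (c - d)))"
      by (intro mult_left_mono) auto
    also have "\<dots> = 2 powr d * norm (x - z) powr (- d) * norm (x - y) powr (- (b + c - d))"
      using False by (simp add: powr_add[symmetric] algebra_simps)
    finally show ?thesis using assms(5) by (auto simp: indicator_def distrib_left intro: order_trans)
  next
    case F: False
    have "norm (x - y) powr (- b) = norm (x - y) powr (- d) * norm (x - y) powr (- (b - d))"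
      by (simp add: powr_add[symmetric])
    also have "\<dots> \<le> (2 powr d * norm (x - z) powr (- d)) * norm (y - z) powr (- (b - d))"
      using F False tri assms by (intro mult_mono half powr_neg_mono) auto
    finally have "norm (x - y) powr (- b) * norm (y - z) powr (- c) \<le>
       ((2 powr d * norm (x - z) powr (- d)) * norm (y - z) powr (- (b - d))) * norm (y - z) powr (- c)"
      by (intro mult_right_mono) auto
    also have "\<dots> = 2 powr d * norm (x - z) powr (- d) * norm (y - z) powr (- (b + c - d))"
      using False by (simp add: powr_add[symmetric] algebra_simps)
    finally show ?thesis using in2 by (auto simp: indicator_def distrib_left intro: order_trans)
  qed
qed

text \<open>Composition of Riesz kernels with a loss: for \<open>b + c > n\<close> the sharp
  exponent is \<open>b + c - n\<close>, and \<open>d\<close> may be anything above it. The margin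
  makes the remaining singularity integrable.\<close>

lemma kernel_composition:
  assumes "0 \<le> d" "d \<le> b" "d \<le> c" "b + c - d < real DIM('a::euclidean_space)"
  shows "\<exists>K\<ge>0. \<forall>x z :: 'a. x \<noteq> z \<longrightarrow> norm (x - z) \<le> D \<longrightarrow>
     (\<integral>\<^sup>+y. ennreal (norm (x - y) powr (- b) * norm (y - z) powr (- c)) * indicator (ball x \<rho>) y \<partial>lborel)
       \<le> ennreal (K * norm (x - z) powr (- d))"
proof -
  define E where "E = b + c - d"
  have E: "0 \<le> E" "E < real DIM('a)" unfolding E_def using assms by auto
  obtain C1 where C1: "C1 \<ge> 0" "(\<integral>\<^sup>+x. ennreal (norm (x::'a) powr (- E)) * indicator (ball 0 \<rho>) x \<partial>lborel) \<le> ennreal C1"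
    using nn_integral_powr_ball[OF E] by blast
  obtain C2 where C2: "C2 \<ge> 0" "(\<integral>\<^sup>+x. ennreal (norm (x::'a) powr (- E)) * indicator (ball 0 (D + \<rho>)) x \<partial>lborel) \<le> ennreal C2"
    using nn_integral_powr_ball[OF E] by blast
  show ?thesis
  proof (intro exI[of _ "2 powr d * (C1 + C2)"] conjI allI impI)
    fix x z :: 'a assume xz: "x \<noteq> z" "norm (x - z) \<le> D"
    let ?k = "2 powr d * norm (x - z) powr (- d)"
    have "(\<integral>\<^sup>+y. ennreal (norm (x - y) powr (- b) * norm (y - z) powr (- c)) * indicator (ball x \<rho>) y \<partial>lborel)
      \<le> (\<integral>\<^sup>+y. ennreal ?k * (ennreal (norm (x - y) powr (- E)) * indicator (ball 0 \<rho>) (x - y)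
          + ennreal (norm (z - y) powr (- E)) * indicator (ball 0 (D + \<rho>)) (z - y)) \<partial>lborel)"
    proof (rule nn_integral_mono)
      fix y
      show "ennreal (norm (x - y) powr (- b) * norm (y - z) powr (- c)) * indicator (ball x \<rho>) y \<le>
         ennreal ?k * (ennreal (norm (x - y) powr (- E)) * indicator (ball 0 \<rho>) (x - y)
          + ennreal (norm (z - y) powr (- E)) * indicator (ball 0 (D + \<rho>)) (z - y))"
      proof (cases "y \<in> ball x \<rho>")
        case True
        then have "norm (x - y) < \<rho>" by (simp add: dist_norm)
        from kernel_product_bound[OF assms(1-3) xz(1) this xz(2)]
        have le: "norm (x - y) powr (- b) * norm (y - z) powr (- c) \<le>
          ?k * (norm (x - y) powr (- E) * indicator (ball 0 \<rho>) (x - y) +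
            norm (z - y) powr (- E) * indicator (ball 0 (D + \<rho>)) (z - y))"
          unfolding E_def by (simp add: norm_minus_commute[of y z] indicator_def)
        have i: "ennreal (indicator A v) = indicator A v" for A and v :: 'a
          by (simp add: indicator_def)
        from ennreal_leI[OF le] show ?thesis
          using True by (simp add: ennreal_mult ennreal_plus i)
      qed auto
    qed
    also have "\<dots> = ennreal ?k * ((\<integral>\<^sup>+y. ennreal (norm y powr (- E)) * indicator (ball (0::'a) \<rho>) y \<partial>lborel)
       + (\<integral>\<^sup>+y. ennreal (norm y powr (- E)) * indicator (ball (0::'a) (D + \<rho>)) y \<partial>lborel))"
    proof -
      have r: "(\<integral>\<^sup>+y. ennreal (norm (v - y) powr (- E)) * indicator (ball 0 r) (v - y) \<partial>lborel)
         = (\<integral>\<^sup>+y. ennreal (norm y powr (- E)) * indicator (ball (0::'a) r) y \<partial>lborel)" for v :: 'a and r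
        by (rule nn_integral_lborel_reflect) measurable
      have m: "(\<lambda>y. ennreal (norm (v - y) powr (- E)) * indicator (ball 0 r) (v - y)) \<in> borel_measurable lborel" for v :: 'a and r
        by measurable
      show ?thesis
        unfolding r[symmetric, of _ x] r[symmetric, of _ z]
        by (subst nn_integral_cmult[OF borel_measurable_add[OF m m]], subst nn_integral_add[OF m m]) (simp add: r)
    qed
    also have "\<dots> \<le> ennreal ?k * (ennreal C1 + ennreal C2)"
      by (intro mult_left_mono add_mono C1 C2) auto
    also have "\<dots> = ennreal (2 powr d * (C1 + C2) * norm (x - z) powr (- d))"
      using C1 C2 by (simp add: ennreal_mult[symmetric] ennreal_plus[symmetric] algebra_simps del: ennreal_plus)
    finally show "(\<integral>\<^sup>+y. ennreal (norm (x - y) powr (- b) * norm (y - z) powr (- c)) * indicator (ball x \<rho>) y \<partial>lborel)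
       \<le> ennreal (2 powr d * (C1 + C2) * norm (x - z) powr (- d))" .
  qed (use C1 C2 in auto)
qed

section \<open>Interior subsets and local boundedness\<close>

definition inner_set :: "real \<Rightarrow> 'a::euclidean_space set \<Rightarrow> 'a set" where
  "inner_set \<delta> \<Omega> = {x. infdist x (- \<Omega>) > \<delta>}"

lemma open_inner_set: "open (inner_set \<delta> \<Omega>)"
  unfolding inner_set_def by (intro open_Collect_less continuous_intros)

lemma inner_set_mono: "\<delta> \<le> \<delta>' \<Longrightarrow> inner_set \<delta>' \<Omega> \<subseteq> inner_set \<delta> \<Omega>"
  unfolding inner_set_def by auto

lemma inner_set_subset: "0 \<le> \<delta> \<Longrightarrow> inner_set \<delta> \<Omega> \<subseteq> \<Omega>"
  unfolding inner_set_def using infdist_zero[of _ "- \<Omega>"] by (metis (no_types, lifting) ComplI mem_Collect_eq not_less subsetI)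

text \<open>The distance to the complement is 1-Lipschitz, so a move of length \<open>\<rho>\<close>
  costs exactly \<open>\<rho>\<close> in the parameter. This arithmetic takes the place of nested
  compact sets.\<close>

lemma inner_set_near: "x \<in> inner_set \<delta> \<Omega> \<Longrightarrow> dist x y \<le> \<rho> \<Longrightarrow> y \<in> inner_set (\<delta> - \<rho>) \<Omega>"
  unfolding inner_set_def using infdist_triangle[of x "- \<Omega>" y] by auto

lemma compact_subset_inner_set:
  assumes "compact K" "K \<subseteq> \<Omega>" "open \<Omega>" "bounded \<Omega>"
  shows "\<exists>\<delta>>0. K \<subseteq> inner_set \<delta> \<Omega>"
proof (cases "K = {}")
  case False
  have ne: "- \<Omega> \<noteq> {}" using assms(4) not_bounded_UNIV by (metis Compl_empty_eq double_complement)
  have "continuous_on K (\<lambda>x. infdist x (- \<Omega>))" by (intro continuous_intros)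
  then obtain x0 where x0: "x0 \<in> K" "\<And>x. x \<in> K \<Longrightarrow> infdist x0 (- \<Omega>) \<le> infdist x (- \<Omega>)"
    using continuous_attains_inf[OF assms(1) False, of "\<lambda>x. infdist x (- \<Omega>)"] by blast
  have "closed (- \<Omega>)" using assms by auto
  then have "infdist x0 (- \<Omega>) \<noteq> 0"
    using in_closed_iff_infdist_zero[OF _ ne, of x0] x0(1) assms(2) by auto
  then have "infdist x0 (- \<Omega>) > 0" using infdist_nonneg[of x0 "- \<Omega>"] by linarith
  then show ?thesis using x0 unfolding inner_set_def
    by (intro exI[of _ "infdist x0 (- \<Omega>) / 2"]) force
qed (auto intro: exI[of _ 1])

lemma integral_lborel_reflect:
  fixes f :: "'a::euclidean_space \<Rightarrow> real"
  assumes [measurable]: "f \<in> borel_measurable borel"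
  shows "(LINT y|lborel. f (x - y)) = (LINT y|lborel. f y)"
    and "integrable lborel (\<lambda>y. f (x - y)) \<longleftrightarrow> integrable lborel f"
proof -
  have l: "(lborel :: 'a measure) = distr lborel borel (\<lambda>y. x - y)"
    by (rule lborel_eq_reflect)
  show "(LINT y|lborel. f (x - y)) = (LINT y|lborel. f y)"
    by (subst (2) l, subst integral_distr) auto
  show "integrable lborel (\<lambda>y. f (x - y)) \<longleftrightarrow> integrable lborel f"
    by (subst (2) l, subst integrable_distr_eq) auto
qed

text \<open>The estimate \<open>IH\<close> is inserted for \<open>w y\<close> under the integral of
  \<open>hyp\<close>; after Fubini the inner integral is a composition of kernels, and the exponent
  drops from \<open>c\<close> to \<open>d\<close>. Extended nonnegative integrals make this
  meaningful before any of the potentials is known to be finite. The kernel of \<open>hyp\<close>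
  has range \<open>\<rho> \<le> \<delta> / 2\<close>, so from
  \<open>inner_set \<delta> \<Omega>\<close> only points of
  \<open>inner_set (\<delta> / 2) \<Omega>\<close> are seen.\<close>

lemma bounded_bootstrap_step:
  fixes w :: "'a::euclidean_space \<Rightarrow> real"
  assumes \<Omega>: "open \<Omega>" "bounded \<Omega>" and [measurable]: "w \<in> borel_measurable borel"
    and exps: "0 \<le> d" "d \<le> b" "d \<le> c" "b + c - d < real DIM('a)" and \<rho>0: "\<rho>0 > 0"
    and hyp: "\<And>\<rho>. 0 < \<rho> \<Longrightarrow> \<rho> < \<rho>0 \<Longrightarrow> \<exists>C\<ge>0. AE x in lborel. x \<in> inner_set \<rho> \<Omega> \<longrightarrow>
        ennreal \<bar>w x\<bar> \<le> ennreal C * (\<integral>\<^sup>+y. ennreal \<bar>w y\<bar> * (ennreal (norm (x - y) powr (- b)) * indicator (ball x \<rho>) y) \<partial>lborel) + ennreal C"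
    and IH: "\<And>\<delta>. \<delta> > 0 \<Longrightarrow> \<exists>C\<ge>0. AE x in lborel. x \<in> inner_set \<delta> \<Omega> \<longrightarrow>
        ennreal \<bar>w x\<bar> \<le> ennreal C * (\<integral>\<^sup>+y. (ennreal \<bar>w y\<bar> * indicator \<Omega> y) * ennreal (norm (x - y) powr (- c)) \<partial>lborel) + ennreal C"
    and "\<delta> > 0"
  shows "\<exists>C\<ge>0. AE x in lborel. x \<in> inner_set \<delta> \<Omega> \<longrightarrow>
        ennreal \<bar>w x\<bar> \<le> ennreal C * (\<integral>\<^sup>+y. (ennreal \<bar>w y\<bar> * indicator \<Omega> y) * ennreal (norm (x - y) powr (- d)) \<partial>lborel) + ennreal C"
proof -
  have [measurable]: "\<Omega> \<in> sets borel" using \<Omega> by simp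
  obtain D where D: "\<And>x y. x \<in> \<Omega> \<Longrightarrow> y \<in> \<Omega> \<Longrightarrow> norm (x - y) \<le> D"
  proof -
    have "dist x y \<le> diameter \<Omega>" if "x \<in> \<Omega>" "y \<in> \<Omega>" for x y
      using diameter_bounded_bound[OF \<Omega>(2) that] .
    then show ?thesis using that by (metis dist_norm)
  qed
  define \<rho> where "\<rho> = min (\<delta> / 2) (\<rho>0 / 2)"
  have \<rho>: "0 < \<rho>" "\<rho> < \<rho>0" "\<rho> \<le> \<delta> / 2" unfolding \<rho>_def using \<open>\<delta> > 0\<close> \<rho>0 by auto
  define W where "W z = ennreal \<bar>w z\<bar> * indicator \<Omega> z" for z
  have [measurable]: "W \<in> borel_measurable borel" unfolding W_def by measurable
  define J where "J e x = (\<integral>\<^sup>+y. W y * ennreal (norm (x - y) powr (- e)) \<partial>lborel)" for e x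
  have [measurable]: "J e \<in> borel_measurable borel" for e unfolding J_def by measurable
  define k where "k x y = ennreal (norm (x - y) powr (- b)) * indicator (ball 0 \<rho>) (x - y)" for x y :: 'a
  have [measurable]: "(\<lambda>(x, y). k x y) \<in> borel_measurable (borel \<Otimes>\<^sub>M borel)"
    unfolding k_def by measurable
  have [measurable]: "k x \<in> borel_measurable borel" for x unfolding k_def by measurable
  have k_eq: "ennreal (norm (x - y) powr (- b)) * indicator (ball x \<rho>) y = k x y" for x y
    unfolding k_def by (simp add: indicator_def dist_norm norm_minus_commute)
  obtain C1 where C1: "C1 \<ge> 0" and ae1: "AE x in lborel. x \<in> inner_set \<rho> \<Omega> \<longrightarrow>
        ennreal \<bar>w x\<bar> \<le> ennreal C1 * (\<integral>\<^sup>+y. ennreal \<bar>w y\<bar> * k x y \<partial>lborel) + ennreal C1"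
    using hyp[OF \<rho>(1,2)] unfolding k_eq by blast
  have d2: "\<delta> / 2 > 0" using \<open>\<delta> > 0\<close> by simp
  obtain C2 where C2: "C2 \<ge> 0" and ae2: "AE x in lborel. x \<in> inner_set (\<delta> / 2) \<Omega> \<longrightarrow>
        ennreal \<bar>w x\<bar> \<le> ennreal C2 * J c x + ennreal C2"
    using IH[OF d2] unfolding J_def W_def by blast
  have "0 \<le> b" "b < real DIM('a)" using exps by auto
  then obtain I0 where I0: "I0 \<ge> 0" "(\<integral>\<^sup>+x. ennreal (norm (x::'a) powr (- b)) * indicator (ball 0 \<rho>) x \<partial>lborel) \<le> ennreal I0"
    using nn_integral_powr_ball by blast
  obtain K where K: "K \<ge> 0" "\<And>x z :: 'a. x \<noteq> z \<Longrightarrow> norm (x - z) \<le> D \<Longrightarrow>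
     (\<integral>\<^sup>+y. ennreal (norm (x - y) powr (- b) * norm (y - z) powr (- c)) * indicator (ball x \<rho>) y \<partial>lborel)
       \<le> ennreal (K * norm (x - z) powr (- d))"
    using kernel_composition[OF exps, of D \<rho>] by blast
  have main: "(\<integral>\<^sup>+y. ennreal \<bar>w y\<bar> * k x y \<partial>lborel) \<le> ennreal C2 * (ennreal K * J d x) + ennreal C2 * ennreal I0"
    if x: "x \<in> inner_set \<delta> \<Omega>" for x
  proof -
    have x\<Omega>: "x \<in> \<Omega>" using inner_set_subset[of \<delta> \<Omega>] x \<open>\<delta> > 0\<close> by auto
    have "(\<integral>\<^sup>+y. ennreal \<bar>w y\<bar> * k x y \<partial>lborel) \<le> (\<integral>\<^sup>+y. (ennreal C2 * J c y + ennreal C2) * k x y \<partial>lborel)"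
    proof (rule nn_integral_mono_AE)
      show "AE y in lborel. ennreal \<bar>w y\<bar> * k x y \<le> (ennreal C2 * J c y + ennreal C2) * k x y"
        using ae2
      proof eventually_elim
        case (elim y)
        show ?case
        proof (cases "norm (x - y) < \<rho>")
          case True
          then have "y \<in> inner_set (\<delta> - \<rho>) \<Omega>" using inner_set_near[OF x, of y \<rho>] by (simp add: dist_norm)
          then have "y \<in> inner_set (\<delta> / 2) \<Omega>" using inner_set_mono[of "\<delta> / 2" "\<delta> - \<rho>" \<Omega>] \<rho>(3) by auto
          then show ?thesis using elim by (intro mult_right_mono) auto
        next
          case False
          then show ?thesis by (simp add: k_def)
        qed
      qed
    qed
    also have "\<dots> = (\<integral>\<^sup>+y. ennreal C2 * (J c y * k x y) + ennreal C2 * k x y \<partial>lborel)"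
      by (intro nn_integral_cong) (simp add: distrib_right mult.assoc)
    also have "\<dots> = ennreal C2 * (\<integral>\<^sup>+y. J c y * k x y \<partial>lborel) + ennreal C2 * (\<integral>\<^sup>+y. k x y \<partial>lborel)"
      by (subst nn_integral_add) (auto simp: nn_integral_cmult)
    also have "\<dots> \<le> ennreal C2 * (ennreal K * J d x) + ennreal C2 * ennreal I0"
    proof (intro add_mono mult_left_mono)
      have "(\<integral>\<^sup>+y. J c y * k x y \<partial>lborel) = (\<integral>\<^sup>+y. (\<integral>\<^sup>+z. W z * (ennreal (norm (y - z) powr (- c)) * k x y) \<partial>lborel) \<partial>lborel)"
        unfolding J_def by (subst nn_integral_multc[symmetric]) (auto simp: mult.assoc)
      also have "\<dots> = (\<integral>\<^sup>+z. (\<integral>\<^sup>+y. W z * (ennreal (norm (y - z) powr (- c)) * k x y) \<partial>lborel) \<partial>lborel)"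
        by (rule lborel_pair.Fubini') measurable
      also have "\<dots> \<le> (\<integral>\<^sup>+z. ennreal K * (W z * ennreal (norm (x - z) powr (- d))) \<partial>lborel)"
      proof (rule nn_integral_mono_AE)
        have "AE z in lborel. z \<noteq> x"
          by (rule AE_lborel_singleton)
        then show "AE z in lborel. (\<integral>\<^sup>+y. W z * (ennreal (norm (y - z) powr (- c)) * k x y) \<partial>lborel)
           \<le> ennreal K * (W z * ennreal (norm (x - z) powr (- d)))"
        proof eventually_elim
          case (elim z)
          show ?case
          proof (cases "z \<in> \<Omega>")
            case True
            have "(\<integral>\<^sup>+y. W z * (ennreal (norm (y - z) powr (- c)) * k x y) \<partial>lborel) =
                W z * (\<integral>\<^sup>+y. ennreal (norm (y - z) powr (- c)) * k x y \<partial>lborel)"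
              by (rule nn_integral_cmult) measurable
            also have "(\<integral>\<^sup>+y. ennreal (norm (y - z) powr (- c)) * k x y \<partial>lborel) =
              (\<integral>\<^sup>+y. ennreal (norm (x - y) powr (- b) * norm (y - z) powr (- c)) * indicator (ball x \<rho>) y \<partial>lborel)"
              unfolding k_eq[symmetric] by (intro nn_integral_cong) (simp add: ennreal_mult mult_ac)
            also have "W z * \<dots> \<le> W z * ennreal (K * norm (x - z) powr (- d))"
              using elim D[OF x\<Omega> True] by (intro mult_left_mono K) auto
            finally show ?thesis using K(1) by (simp add: ennreal_mult mult_ac)
          next
            case False then show ?thesis by (simp add: W_def)
          qed
        qed
      qed
      also have "\<dots> = ennreal K * J d x" unfolding J_def by (rule nn_integral_cmult) measurable
      finally show "(\<integral>\<^sup>+y. J c y * k x y \<partial>lborel) \<le> ennreal K * J d x" .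
      have "(\<integral>\<^sup>+y. k x y \<partial>lborel) = (\<integral>\<^sup>+x. ennreal (norm (x::'a) powr (- b)) * indicator (ball 0 \<rho>) x \<partial>lborel)"
        unfolding k_def by (rule nn_integral_lborel_reflect) measurable
      then show "(\<integral>\<^sup>+y. k x y \<partial>lborel) \<le> ennreal I0" using I0 by simp
    qed auto
    finally show ?thesis .
  qed
  define C where "C = C1 * C2 * K + C1 * C2 * I0 + C1"
  have Cpos: "C \<ge> 0" unfolding C_def using C1 C2 K I0 by auto
  have "AE x in lborel. x \<in> inner_set \<delta> \<Omega> \<longrightarrow> ennreal \<bar>w x\<bar> \<le> ennreal C * J d x + ennreal C"
    using ae1
  proof eventually_elim
    case (elim x)
    show ?case
    proof
      assume x: "x \<in> inner_set \<delta> \<Omega>"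
      then have "x \<in> inner_set \<rho> \<Omega>" using inner_set_mono[of \<rho> \<delta> \<Omega>] \<rho> by auto
      then have "ennreal \<bar>w x\<bar> \<le> ennreal C1 * (\<integral>\<^sup>+y. ennreal \<bar>w y\<bar> * k x y \<partial>lborel) + ennreal C1"
        using elim by simp
      also have "\<dots> \<le> ennreal C1 * (ennreal C2 * (ennreal K * J d x) + ennreal C2 * ennreal I0) + ennreal C1"
        by (intro add_mono mult_left_mono main x) auto
      also have "\<dots> = ennreal (C1 * C2 * K) * J d x + ennreal (C1 * C2 * I0 + C1)"
        using C1 C2 K I0 by (simp add: ennreal_mult distrib_left mult.assoc add.assoc)
      also have "\<dots> \<le> ennreal C * J d x + ennreal C"
        unfolding C_def using C1 C2 K I0 by (intro add_mono mult_right_mono ennreal_leI) auto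
      finally show "ennreal \<bar>w x\<bar> \<le> ennreal C * J d x + ennreal C" .
    qed
  qed
  then show ?thesis using Cpos unfolding J_def W_def by blast
qed

text \<open>Finitely many steps bring the exponent down to 0, where the potential is at most the L1
  norm of \<open>w\<close> on \<open>\<Omega>\<close>.\<close>

lemma bounded_bootstrap:
  fixes w :: "'a::euclidean_space \<Rightarrow> real"
  assumes \<Omega>: "open \<Omega>" "bounded \<Omega>" and w[measurable]: "w \<in> borel_measurable borel"
    and fin: "(\<integral>\<^sup>+x. ennreal \<bar>w x\<bar> * indicator \<Omega> x \<partial>lborel) < \<infinity>"
    and b: "0 \<le> b" "b < real DIM('a)" and \<rho>0: "\<rho>0 > 0"
    and hyp: "\<And>\<rho>. 0 < \<rho> \<Longrightarrow> \<rho> < \<rho>0 \<Longrightarrow> \<exists>C\<ge>0. AE x in lborel. x \<in> inner_set \<rho> \<Omega> \<longrightarrow>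
        ennreal \<bar>w x\<bar> \<le> ennreal C * (\<integral>\<^sup>+y. ennreal \<bar>w y\<bar> * (ennreal (norm (x - y) powr (- b)) * indicator (ball x \<rho>) y) \<partial>lborel) + ennreal C"
    and \<delta>: "\<delta> > 0"
  shows "\<exists>C\<ge>0. AE x in lborel. x \<in> inner_set \<delta> \<Omega> \<longrightarrow> \<bar>w x\<bar> \<le> C"
proof -
  define P where "P c \<longleftrightarrow> (\<forall>\<delta>>0. \<exists>C\<ge>0. AE x in lborel. x \<in> inner_set \<delta> \<Omega> \<longrightarrow>
        ennreal \<bar>w x\<bar> \<le> ennreal C * (\<integral>\<^sup>+y. (ennreal \<bar>w y\<bar> * indicator \<Omega> y) * ennreal (norm (x - y) powr (- c)) \<partial>lborel) + ennreal C)" for c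
  \<comment> \<open>Half of the available gap: each step lowers the exponent by
    \<open>\<sigma>\<close>, and \<open>b + \<sigma> < n\<close> keeps the composed kernel
    integrable.\<close>
  define \<sigma> where "\<sigma> = (real DIM('a) - b) / 2"
  have \<sigma>: "\<sigma> > 0" "b + \<sigma> < real DIM('a)" unfolding \<sigma>_def using b by (auto simp: field_simps)
  have P0: "P b"
    unfolding P_def
  proof (intro allI impI)
    fix \<delta> :: real assume \<delta>: "\<delta> > 0"
    define \<rho> where "\<rho> = min \<delta> (\<rho>0 / 2)"
    have \<rho>: "0 < \<rho>" "\<rho> < \<rho>0" "\<rho> \<le> \<delta>" unfolding \<rho>_def using \<delta> \<rho>0 by auto
    obtain C where C: "C \<ge> 0" "AE x in lborel. x \<in> inner_set \<rho> \<Omega> \<longrightarrow>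
        ennreal \<bar>w x\<bar> \<le> ennreal C * (\<integral>\<^sup>+y. ennreal \<bar>w y\<bar> * (ennreal (norm (x - y) powr (- b)) * indicator (ball x \<rho>) y) \<partial>lborel) + ennreal C"
      using hyp[OF \<rho>(1,2)] by blast
    have "AE x in lborel. x \<in> inner_set \<delta> \<Omega> \<longrightarrow>
        ennreal \<bar>w x\<bar> \<le> ennreal C * (\<integral>\<^sup>+y. (ennreal \<bar>w y\<bar> * indicator \<Omega> y) * ennreal (norm (x - y) powr (- b)) \<partial>lborel) + ennreal C"
      using C(2)
    proof eventually_elim
      case (elim x)
      show ?case
      proof
        assume x: "x \<in> inner_set \<delta> \<Omega>"
        then have "x \<in> inner_set \<rho> \<Omega>" using inner_set_mono \<rho>(3) by blast
        then have "ennreal \<bar>w x\<bar> \<le> ennreal C * (\<integral>\<^sup>+y. ennreal \<bar>w y\<bar> * (ennreal (norm (x - y) powr (- b)) * indicator (ball x \<rho>) y) \<partial>lborel) + ennreal C"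
          using elim by blast
        also have "\<dots> \<le> ennreal C * (\<integral>\<^sup>+y. (ennreal \<bar>w y\<bar> * indicator \<Omega> y) * ennreal (norm (x - y) powr (- b)) \<partial>lborel) + ennreal C"
        proof (intro add_mono mult_left_mono nn_integral_mono order_refl)
          fix y
          have "y \<in> \<Omega>" if "y \<in> ball x \<rho>"
            using inner_set_near[OF x, of y \<rho>] inner_set_subset[of "\<delta> - \<rho>" \<Omega>] that \<rho> by auto
          then show "ennreal \<bar>w y\<bar> * (ennreal (norm (x - y) powr (- b)) * indicator (ball x \<rho>) y)
             \<le> (ennreal \<bar>w y\<bar> * indicator \<Omega> y) * ennreal (norm (x - y) powr (- b))"
            by (auto simp: indicator_def)
        qed auto
        finally show "ennreal \<bar>w x\<bar> \<le> ennreal C * (\<integral>\<^sup>+y. (ennreal \<bar>w y\<bar> * indicator \<Omega> y) * ennreal (norm (x - y) powr (- b)) \<partial>lborel) + ennreal C" .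
      qed
    qed
    then show "\<exists>C\<ge>0. AE x in lborel. x \<in> inner_set \<delta> \<Omega> \<longrightarrow>
        ennreal \<bar>w x\<bar> \<le> ennreal C * (\<integral>\<^sup>+y. (ennreal \<bar>w y\<bar> * indicator \<Omega> y) * ennreal (norm (x - y) powr (- b)) \<partial>lborel) + ennreal C"
      using C(1) by blast
  qed
  have "P (max 0 (b - real k * \<sigma>))" for k
  proof (induction k)
    case 0 then show ?case using P0 b by simp
  next
    case (Suc k)
    define c where "c = max 0 (b - real k * \<sigma>)"
    define d where "d = max 0 (b - real (Suc k) * \<sigma>)"
    have "0 \<le> real k * \<sigma>" using \<sigma> by simp
    have dd: "d = max 0 (c - \<sigma>)" unfolding c_def d_def using \<sigma>(1) by (auto simp: algebra_simps max_def)
    have cb: "0 \<le> c" "c \<le> b" unfolding c_def using b \<open>0 \<le> real k * \<sigma>\<close> by auto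
    have ex: "0 \<le> d" "d \<le> b" "d \<le> c" "b + c - d < real DIM('a)"
      unfolding dd using cb \<sigma> by auto
    have "P d"
      unfolding P_def
    proof (intro allI impI)
      fix \<delta> :: real assume \<delta>: "\<delta> > 0"
      show "\<exists>C\<ge>0. AE x in lborel. x \<in> inner_set \<delta> \<Omega> \<longrightarrow>
        ennreal \<bar>w x\<bar> \<le> ennreal C * (\<integral>\<^sup>+y. (ennreal \<bar>w y\<bar> * indicator \<Omega> y) * ennreal (norm (x - y) powr (- d)) \<partial>lborel) + ennreal C"
        by (rule bounded_bootstrap_step[OF \<Omega> w ex \<rho>0 hyp _ \<delta>]) (use Suc in \<open>auto simp: P_def c_def\<close>)
    qed
    then show ?case unfolding d_def .
  qed
  moreover obtain k :: nat where "b / \<sigma> < real k" using reals_Archimedean2 by blast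
  then have "b - real k * \<sigma> < 0" using \<sigma> by (simp add: field_simps)
  ultimately have "P 0" by (metis less_eq_real_def max.absorb1)
  then obtain C where C: "C \<ge> 0" "AE x in lborel. x \<in> inner_set \<delta> \<Omega> \<longrightarrow>
        ennreal \<bar>w x\<bar> \<le> ennreal C * (\<integral>\<^sup>+y. (ennreal \<bar>w y\<bar> * indicator \<Omega> y) * ennreal (norm (x - y) powr (- 0)) \<partial>lborel) + ennreal C"
    unfolding P_def using \<delta> by blast
  obtain M where M: "M \<ge> 0" "(\<integral>\<^sup>+x. ennreal \<bar>w x\<bar> * indicator \<Omega> x \<partial>lborel) = ennreal M"
    using fin by (auto simp: less_top_ennreal)
  have "AE x in lborel. x \<in> inner_set \<delta> \<Omega> \<longrightarrow> \<bar>w x\<bar> \<le> C * M + C"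
    using C(2)
  proof eventually_elim
    case (elim x)
    \<comment> \<open>The factor \<open>t powr (- 0)\<close> is 1 for \<open>t \<noteq> 0\<close>
      and 0 at \<open>t = 0\<close>, so it is bounded by 1 in any case.\<close>
    have "(\<integral>\<^sup>+y. (ennreal \<bar>w y\<bar> * indicator \<Omega> y) * ennreal (norm (x - y) powr (- 0)) \<partial>lborel) \<le> ennreal M"
      unfolding M(2)[symmetric] by (intro nn_integral_mono) (auto simp: indicator_def powr_def)
    then have "ennreal C * (\<integral>\<^sup>+y. (ennreal \<bar>w y\<bar> * indicator \<Omega> y) * ennreal (norm (x - y) powr (- 0)) \<partial>lborel) + ennreal C
      \<le> ennreal C * ennreal M + ennreal C"
      by (intro add_mono mult_left_mono) auto
    then have "x \<in> inner_set \<delta> \<Omega> \<longrightarrow> ennreal \<bar>w x\<bar> \<le> ennreal (C * M + C)"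
      using elim C(1) M(1) by (auto simp: ennreal_mult intro: order_trans)
    moreover have "0 \<le> C * M + C" using C(1) M(1) by simp
    ultimately show ?case by (simp only: ennreal_le_iff)
  qed
  then show ?thesis using C(1) M(1) by (intro exI[of _ "C * M + C"]) auto
qed

section \<open>Hoelder gain and singular integrals with Lipschitz density\<close>

lemma integral_norm_bound_AE:
  fixes f :: "'a \<Rightarrow> real"
  assumes "integrable M f" "integrable M g" "AE x in M. norm (f x) \<le> g x"
  shows "norm (LINT x|M. f x) \<le> (LINT x|M. g x)"
proof -
  have "norm (LINT x|M. f x) \<le> (LINT x|M. norm (f x))" by (rule integral_norm_bound)
  also have "\<dots> \<le> (LINT x|M. g x)" using assms by (intro integral_mono_AE) auto
  finally show ?thesis .
qed

lemma integrable_powr_ball: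
  assumes "0 \<le> e" "e < real DIM('a::euclidean_space)"
  shows "integrable lborel (\<lambda>x::'a. norm x powr (- e) * indicator (ball 0 D) x)"
proof -
  obtain C where C: "(\<integral>\<^sup>+x. ennreal (norm (x::'a) powr (- e)) * indicator (ball 0 D) x \<partial>lborel) \<le> ennreal C"
    using nn_integral_powr_ball[OF assms] by blast
  have "(\<integral>\<^sup>+x. ennreal (norm (norm (x::'a) powr (- e) * indicator (ball 0 D) x)) \<partial>lborel)
     = (\<integral>\<^sup>+x. ennreal (norm (x::'a) powr (- e)) * indicator (ball 0 D) x \<partial>lborel)"
    by (intro nn_integral_cong) (auto simp: indicator_def)
  also have "\<dots> < \<infinity>" using C by (auto simp: le_less_trans)
  finally show ?thesis
    by (intro integrableI_bounded) auto
qed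

lemma integrable_dominated_powr:
  fixes f :: "'a::euclidean_space \<Rightarrow> real"
  assumes "f \<in> borel_measurable borel" "\<And>x. norm x \<ge> D \<Longrightarrow> f x = 0"
    and "\<And>x. x \<noteq> 0 \<Longrightarrow> norm x < D \<Longrightarrow> \<bar>f x\<bar> \<le> A * norm x powr (- e)" "0 \<le> e" "e < real DIM('a)"
  shows "integrable lborel f"
proof (rule Bochner_Integration.integrable_bound)
  show "integrable lborel (\<lambda>x::'a. A * (norm x powr (- e) * indicator (ball 0 D) x))"
    using integrable_powr_ball[OF assms(4,5)] by simp
  show "f \<in> borel_measurable lborel" using assms(1) by simp
  have "AE x in lborel. x \<noteq> (0::'a)" by (rule AE_lborel_singleton)
  then show "AE x in lborel. norm (f x) \<le> norm (A * (norm x powr (- e) * indicator (ball 0 D) x))"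
  proof eventually_elim
    case (elim x)
    show ?case
    proof (cases "norm x < D")
      case True
      then show ?thesis using assms(3)[OF elim True] by (auto simp: indicator_def intro: order_trans[OF _ abs_ge_self])
    next
      case False then show ?thesis using assms(2)[of x] by simp
    qed
  qed
qed

text \<open>Interpolation between two regimes. If \<open>norm h \<le> norm w / 2\<close>, the
  difference has size \<open>norm h * norm w powr (- b - 1)\<close>, and the surplus power
  \<open>1 - \<theta>\<close> of \<open>norm h\<close> is exchanged for \<open>norm w\<close>.
  Otherwise the two values are estimated separately, and powers of \<open>norm w\<close> and
  \<open>norm (w + h)\<close> are exchanged for powers of \<open>norm h\<close>. The factor
  \<open>norm w powr \<beta>\<close> stands for the oscillation of a Hoelder density.\<close>

lemma kernel_difference:
  fixes k :: "'a::real_normed_vector \<Rightarrow> real"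
  assumes A: "A \<ge> 0" and b: "b \<ge> 0"
    and k1: "\<And>x. x \<noteq> 0 \<Longrightarrow> \<bar>k x\<bar> \<le> A * norm x powr (- b)"
    and k2: "\<And>x x'. x \<noteq> 0 \<Longrightarrow> norm x \<le> norm x' \<Longrightarrow> norm x' \<le> 3 * norm x \<Longrightarrow>
        \<bar>k x' - k x\<bar> \<le> A * norm (x' - x) * norm x powr (- b - 1)"
    and th: "0 \<le> \<beta>" "\<beta> \<le> \<theta>" "\<theta> \<le> 1" and "w \<noteq> 0" "w + h \<noteq> 0" "h \<noteq> 0"
  shows "norm w powr \<beta> * \<bar>k (w + h) - k w\<bar> \<le>
    (A * 4 powr (b + 2)) * norm h powr \<theta> * (norm w powr (- (b + \<theta> - \<beta>)) + norm (w + h) powr (- (b + \<theta> - \<beta>)))"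
proof -
  let ?e = "b + \<theta> - \<beta>"
  have pos: "norm w > 0" "norm (w + h) > 0" "norm h > 0" using assms by auto
  have tri: "norm (w + h) \<le> norm w + norm h" "norm w \<le> norm (w + h) + norm h"
    using norm_triangle_ineq[of w h] norm_triangle_ineq[of "w + h" "- h"] by auto
  show ?thesis
  proof (cases "norm h \<le> norm w / 2")
    case True
    \<comment> \<open>\<open>k2\<close> takes the point of smaller norm as its base; that norm is
      still at least half of \<open>norm w\<close>.\<close>
    define m where "m = min (norm w) (norm (w + h))"
    have m: "m \<ge> norm w / 2" "m > 0" unfolding m_def using True tri pos by (auto simp: min_def)
    have "\<bar>k (w + h) - k w\<bar> \<le> A * norm h * m powr (- b - 1)"
    proof (cases "norm w \<le> norm (w + h)")
      case T: True
      then show ?thesis using k2[of w "w + h"] assms(8) tri True unfolding m_def by (simp add: min_def)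
    next
      case F: False
      then show ?thesis using k2[of "w + h" w] assms(9) tri True unfolding m_def
        by (simp add: min_def abs_minus_commute)
    qed
    also have "\<dots> \<le> A * norm h * (norm w / 2) powr (- b - 1)"
      using A m pos b powr_neg_mono[of "norm w / 2" m "b + 1"] by (intro mult_left_mono) auto
    also have "(norm w / 2) powr (- b - 1) = 2 powr (b + 1) * norm w powr (- b - 1)"
      using pos by (simp add: powr_divide powr_minus powr_diff powr_add field_simps)
    finally have 1: "\<bar>k (w + h) - k w\<bar> \<le> A * norm h * (2 powr (b + 1) * norm w powr (- b - 1))" .
    have "norm h = norm h powr \<theta> * norm h powr (1 - \<theta>)"
      using pos by (simp add: powr_add[symmetric])
    also have "\<dots> \<le> norm h powr \<theta> * norm w powr (1 - \<theta>)"
      using True th pos by (intro mult_left_mono powr_mono2) (auto intro: order_trans[of _ "norm h * 2"])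
    finally have 2: "norm h \<le> norm h powr \<theta> * norm w powr (1 - \<theta>)" .
    have "norm w powr \<beta> * \<bar>k (w + h) - k w\<bar> \<le>
       norm w powr \<beta> * (A * (norm h powr \<theta> * norm w powr (1 - \<theta>)) * (2 powr (b + 1) * norm w powr (- b - 1)))"
      using 1 A 2 by (intro mult_left_mono order_trans[OF 1] mult_right_mono) auto
    also have "\<dots> = A * 2 powr (b + 1) * norm h powr \<theta> * (norm w powr \<beta> * norm w powr (1 - \<theta>) * norm w powr (- b - 1))"
      by (simp add: mult_ac)
    also have "norm w powr \<beta> * norm w powr (1 - \<theta>) * norm w powr (- b - 1) = norm w powr (- ?e)"
      using pos by (simp add: powr_add[symmetric] algebra_simps)
    also have "A * 2 powr (b + 1) * norm h powr \<theta> * norm w powr (- ?e) \<le>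
       A * 4 powr (b + 2) * norm h powr \<theta> * (norm w powr (- ?e) + norm (w + h) powr (- ?e))"
      using A b order_trans[OF powr_mono2[of "b + 1" 2 4] powr_mono[of "b + 1" "b + 2" 4]]
      by (intro mult_mono mult_right_mono mult_left_mono) auto
    finally show ?thesis .
  next
    case False
    then have hw: "norm w \<le> 2 * norm h" by simp
    then have hw': "norm (w + h) \<le> 3 * norm h" using tri by simp
    have a: "norm w powr \<beta> * \<bar>k w\<bar> \<le> A * 4 powr 1 * norm h powr \<theta> * norm w powr (- ?e)"
    proof -
      have "norm w powr \<beta> * \<bar>k w\<bar> \<le> norm w powr \<beta> * (A * norm w powr (- b))"
        using k1[OF assms(8)] by (intro mult_left_mono) auto
      also have "\<dots> = A * (norm w powr \<theta> * norm w powr (- ?e))"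
        using pos by (simp add: powr_add[symmetric] algebra_simps)
      also have "\<dots> \<le> A * ((2 * norm h) powr \<theta> * norm w powr (- ?e))"
        using A th hw by (intro mult_left_mono mult_right_mono powr_mono2) auto
      also have "\<dots> = A * 2 powr \<theta> * norm h powr \<theta> * norm w powr (- ?e)"
        by (simp add: powr_mult mult_ac)
      also have "\<dots> \<le> A * 4 powr 1 * norm h powr \<theta> * norm w powr (- ?e)"
        using A th order_trans[OF powr_mono[of \<theta> 1 2], of "4 powr 1"] by (intro mult_right_mono mult_left_mono) auto
      finally show ?thesis .
    qed
    have c: "norm w powr \<beta> * \<bar>k (w + h)\<bar> \<le> A * 4 powr 2 * norm h powr \<theta> * norm (w + h) powr (- ?e)"
    proof -
      have "norm w powr \<beta> * \<bar>k (w + h)\<bar> \<le> (2 * norm h) powr \<beta> * (A * norm (w + h) powr (- b))"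
        using k1[OF assms(9)] th hw by (intro mult_mono powr_mono2) auto
      also have "\<dots> = A * (2 * norm h) powr \<beta> * (norm (w + h) powr (\<theta> - \<beta>) * norm (w + h) powr (- ?e))"
        using pos by (simp add: powr_add[symmetric] algebra_simps)
      also have "\<dots> \<le> A * (2 * norm h) powr \<beta> * ((3 * norm h) powr (\<theta> - \<beta>) * norm (w + h) powr (- ?e))"
        using A th hw' by (intro mult_left_mono mult_right_mono powr_mono2) auto
      also have "\<dots> \<le> A * (4 * norm h) powr \<beta> * ((4 * norm h) powr (\<theta> - \<beta>) * norm (w + h) powr (- ?e))"
        using A th by (intro mult_mono mult_right_mono powr_mono2) auto
      also have "\<dots> = A * (4 * norm h) powr \<theta> * norm (w + h) powr (- ?e)"
      proof -
        have "(4 * norm h) powr \<theta> = (4 * norm h) powr \<beta> * (4 * norm h) powr (\<theta> - \<beta>)"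
          by (simp add: powr_add[symmetric])
        then show ?thesis by simp
      qed
      also have "\<dots> = A * 4 powr \<theta> * norm h powr \<theta> * norm (w + h) powr (- ?e)"
        by (simp add: powr_mult mult_ac)
      also have "\<dots> \<le> A * 4 powr 2 * norm h powr \<theta> * norm (w + h) powr (- ?e)"
        using A th powr_mono[of \<theta> 2 4] by (intro mult_right_mono mult_left_mono) auto
      finally show ?thesis .
    qed
    have p1: "(4::real) powr 1 \<le> 4 powr (b + 2)"
      using b by (intro powr_mono) auto
    have p2: "(4::real) powr 2 \<le> 4 powr (b + 2)"
      using b by (intro powr_mono) auto
    have "\<bar>k (w + h) - k w\<bar> \<le> \<bar>k w\<bar> + \<bar>k (w + h)\<bar>" by simp
    from mult_left_mono[OF this, of "norm w powr \<beta>"]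
    have "norm w powr \<beta> * \<bar>k (w + h) - k w\<bar> \<le> norm w powr \<beta> * \<bar>k w\<bar> + norm w powr \<beta> * \<bar>k (w + h)\<bar>"
      by (simp add: distrib_left)
    also have "\<dots> \<le> A * 4 powr (b + 2) * norm h powr \<theta> * norm w powr (- ?e) + A * 4 powr (b + 2) * norm h powr \<theta> * norm (w + h) powr (- ?e)"
    proof (intro add_mono)
      show "norm w powr \<beta> * \<bar>k w\<bar> \<le> A * 4 powr (b + 2) * norm h powr \<theta> * norm w powr (- ?e)"
        by (rule order_trans[OF a]) (intro mult_right_mono mult_left_mono p1 A; simp)
      show "norm w powr \<beta> * \<bar>k (w + h)\<bar> \<le> A * 4 powr (b + 2) * norm h powr \<theta> * norm (w + h) powr (- ?e)"
        by (rule order_trans[OF c]) (intro mult_right_mono mult_left_mono p2 A; simp)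
    qed
    also have "\<dots> = A * 4 powr (b + 2) * norm h powr \<theta> * (norm w powr (- ?e) + norm (w + h) powr (- ?e))"
      by (simp add: distrib_left)
    finally show ?thesis .
  qed
qed

lemma bounded_mult_integrable:
  fixes f g :: "'a::euclidean_space \<Rightarrow> real"
  assumes "integrable lborel f" "g \<in> borel_measurable borel" "\<And>x. \<bar>g x\<bar> \<le> C"
  shows "integrable lborel (\<lambda>x. g x * f x)"
proof (rule Bochner_Integration.integrable_bound[where f = "\<lambda>x. C * \<bar>f x\<bar>"])
  show "integrable lborel (\<lambda>x. C * \<bar>f x\<bar>)" using assms by simp
  show "(\<lambda>x. g x * f x) \<in> borel_measurable lborel" using assms by simp
  have "0 \<le> C" using assms(3)[of undefined] by linarith
  then show "AE x in lborel. norm (g x * f x) \<le> norm (C * \<bar>f x\<bar>)"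
    using assms(3) by (auto simp: abs_mult intro!: mult_right_mono)
qed

text \<open>The integral of \<open>k (x - y)\<close> over all \<open>y\<close> does not depend on
  \<open>x\<close>, so \<open>g x\<close> may be subtracted from the density before the two kernels
  are compared. Its oscillation contributes \<open>norm (x - y) powr \<beta>\<close>, and the gain
  over \<open>\<beta>\<close> is limited by the integrability of the exponent
  \<open>b + \<theta> - \<beta>\<close>.\<close>

lemma holder_gain:
  fixes g k :: "'a::euclidean_space \<Rightarrow> real"
  assumes A: "A \<ge> 0" and b: "b \<ge> 0" "b < real DIM('a)"
    and k[measurable]: "k \<in> borel_measurable borel"
    and k0: "\<And>x. norm x \<ge> \<rho> \<Longrightarrow> k x = 0"
    and k1: "\<And>x. x \<noteq> 0 \<Longrightarrow> \<bar>k x\<bar> \<le> A * norm x powr (- b)"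
    and k2: "\<And>x x'. x \<noteq> 0 \<Longrightarrow> norm x \<le> norm x' \<Longrightarrow> norm x' \<le> 3 * norm x \<Longrightarrow>
        \<bar>k x' - k x\<bar> \<le> A * norm (x' - x) * norm x powr (- b - 1)"
    and th: "0 \<le> \<beta>" "\<beta> \<le> \<theta>" "\<theta> \<le> 1" "b + \<theta> - \<beta> < real DIM('a)"
    and g[measurable]: "g \<in> borel_measurable borel" and gb: "\<And>x. \<bar>g x\<bar> \<le> G"
    and gh: "\<And>x y. x \<in> S \<Longrightarrow> y \<in> S \<Longrightarrow> \<bar>g x - g y\<bar> \<le> G * dist x y powr \<beta>"
  shows "\<exists>C\<ge>0. \<forall>x x'. ball x \<rho> \<subseteq> S \<longrightarrow> ball x' \<rho> \<subseteq> S \<longrightarrow> x \<in> S \<longrightarrow> dist x x' \<le> D \<longrightarrow>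
     \<bar>(LINT y|lborel. g y * k (x - y)) - (LINT y|lborel. g y * k (x' - y))\<bar> \<le> C * dist x x' powr \<theta>"
proof -
  define e where "e = b + \<theta> - \<beta>"
  have e: "0 \<le> e" "e < real DIM('a)" unfolding e_def using b th by auto
  have G: "G \<ge> 0" using gb[of undefined] by linarith
  define I where "I = (LINT x|lborel. norm (x::'a) powr (- e) * indicator (ball 0 (\<rho> + D)) x)"
  have I: "I \<ge> 0" unfolding I_def by (intro integral_nonneg_AE) auto
  define A' where "A' = A * 4 powr (b + 2)"
  have A': "A' \<ge> 0" unfolding A'_def using A by simp
  have ik: "integrable lborel k"
    by (rule integrable_dominated_powr[OF k k0 k1 b])
  have ikx: "integrable lborel (\<lambda>y. k (x - y))" for x
    using integral_lborel_reflect(2)[OF k, of x] ik by simp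
  have igk: "integrable lborel (\<lambda>y. g y * k (x - y))" for x
    by (rule bounded_mult_integrable[OF ikx g gb])
  show ?thesis
  proof (intro exI[of _ "2 * G * A' * I"] conjI allI impI)
    show "0 \<le> 2 * G * A' * I" using G A' I by simp
    fix x x' :: 'a
    assume S: "ball x \<rho> \<subseteq> S" "ball x' \<rho> \<subseteq> S" "x \<in> S" and D: "dist x x' \<le> D"
    show "\<bar>(LINT y|lborel. g y * k (x - y)) - (LINT y|lborel. g y * k (x' - y))\<bar> \<le> 2 * G * A' * I * dist x x' powr \<theta>"
    proof (cases "x = x'")
      case False
      define h where "h = x' - x"
      have h: "h \<noteq> 0" "norm h = dist x x'" using False by (auto simp: h_def dist_norm norm_minus_commute)
      have same: "(LINT y|lborel. k (x' - y)) = (LINT y|lborel. k (x - y))"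
        using integral_lborel_reflect(1)[OF k] by simp
      have "(LINT y|lborel. g y * k (x' - y)) - (LINT y|lborel. g y * k (x - y))
         = (LINT y|lborel. g y * k (x' - y) - g y * k (x - y))"
        using igk by simp
      also have "\<dots> = (LINT y|lborel. g y * k (x' - y) - g y * k (x - y)) - g x * ((LINT y|lborel. k (x' - y)) - (LINT y|lborel. k (x - y)))"
        using same by simp
      also have "\<dots> = (LINT y|lborel. (g y - g x) * (k (x' - y) - k (x - y)))"
        using igk ikx by (simp add: algebra_simps)
      finally have eq: "(LINT y|lborel. g y * k (x' - y)) - (LINT y|lborel. g y * k (x - y))
         = (LINT y|lborel. (g y - g x) * (k (x' - y) - k (x - y)))" .
      define B where "B v y = norm (v - y) powr (- e) * indicator (ball 0 (\<rho> + D)) (v - y)" for v y :: 'a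
      have iB0: "integrable lborel (\<lambda>x::'a. norm x powr (- e) * indicator (ball 0 (\<rho> + D)) x)"
        by (rule integrable_powr_ball[OF e])
      have iB: "integrable lborel (B v)" and iB': "(LINT y|lborel. B v y) = I" for v
        using integral_lborel_reflect[of "\<lambda>x::'a. norm x powr (- e) * indicator (ball 0 (\<rho> + D)) x" v] iB0
        unfolding B_def I_def by auto
      have "norm (LINT y|lborel. (g y - g x) * (k (x' - y) - k (x - y))) \<le>
        (LINT y|lborel. G * (A' * norm h powr \<theta> * (B x y + B x' y)))"
      proof (rule integral_norm_bound_AE)
        show "integrable lborel (\<lambda>y. (g y - g x) * (k (x' - y) - k (x - y)))"
          using igk ikx by (simp add: algebra_simps)
        show "integrable lborel (\<lambda>y. G * (A' * norm h powr \<theta> * (B x y + B x' y)))"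
          using iB by simp
        have "AE y in lborel. y \<noteq> x \<and> y \<noteq> x'"
          using AE_lborel_singleton[of x] AE_lborel_singleton[of x'] by eventually_elim auto
        then show "AE y in lborel. norm ((g y - g x) * (k (x' - y) - k (x - y))) \<le> G * (A' * norm h powr \<theta> * (B x y + B x' y))"
        proof eventually_elim
          case (elim y)
          show ?case
          proof (cases "y \<in> ball x \<rho> \<union> ball x' \<rho>")
            case True
            then have "y \<in> S" using S by auto
            then have g1: "\<bar>g y - g x\<bar> \<le> G * norm (x - y) powr \<beta>"
              using gh[of y x] S by (simp add: dist_norm norm_minus_commute)
            have "norm (x - y) powr \<beta> * \<bar>k ((x - y) + h) - k (x - y)\<bar> \<le>
              A' * norm h powr \<theta> * (norm (x - y) powr (- e) + norm ((x - y) + h) powr (- e))"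
              unfolding A'_def e_def
              by (rule kernel_difference[OF A b(1) k1 k2 th(1-3)]) (use elim h in \<open>auto simp: h_def\<close>)
            then have g2: "norm (x - y) powr \<beta> * \<bar>k (x' - y) - k (x - y)\<bar> \<le>
              A' * norm h powr \<theta> * (norm (x - y) powr (- e) + norm (x' - y) powr (- e))"
              by (simp add: h_def)
            \<comment> \<open>The bound \<open>D\<close> on \<open>dist x x'\<close> places a point
              of either ball within \<open>\<rho> + D\<close> of both centres.\<close>
            have n: "norm (x - y) < \<rho> + D" "norm (x' - y) < \<rho> + D"
              using True D dist_triangle[of x y x'] dist_triangle[of x' y x] norm_ge_zero[of "x - x'"]
              by (auto simp: dist_norm norm_minus_commute)
            have "norm ((g y - g x) * (k (x' - y) - k (x - y))) \<le> (G * norm (x - y) powr \<beta>) * \<bar>k (x' - y) - k (x - y)\<bar>"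
              unfolding real_norm_def abs_mult by (intro mult_right_mono g1) auto
            also have "\<dots> \<le> G * (A' * norm h powr \<theta> * (norm (x - y) powr (- e) + norm (x' - y) powr (- e)))"
              using g2 G by (simp only: mult.assoc[of G]) (intro mult_left_mono)
            finally show ?thesis unfolding B_def using n by (simp add: indicator_def)
          next
            case F: False
            then have "k (x' - y) = 0" "k (x - y) = 0"
              using k0 by (auto simp: dist_norm norm_minus_commute)
            then show ?thesis using G A' by (simp add: B_def)
          qed
        qed
      qed
      also have "\<dots> = 2 * G * A' * I * norm h powr \<theta>"
        using iB iB' by (simp add: algebra_simps)
      finally show ?thesis unfolding eq[symmetric] h(2) by (simp add: abs_minus_commute)
    qed simp
  qed
qed

lemma singular_conv:
  fixes g :: "'a::euclidean_space \<Rightarrow> real" and q :: "nat \<Rightarrow> 'a \<Rightarrow> real" and q0 :: "'a \<Rightarrow> real"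
  assumes A: "A \<ge> 0" and e: "e < real DIM('a) + 1" and \<rho>: "0 < \<rho>" "\<rho> \<le> 1"
    and q[measurable]: "\<And>m. q m \<in> borel_measurable borel" "q0 \<in> borel_measurable borel"
    and qz: "\<And>m x. norm x \<ge> \<rho> \<Longrightarrow> q m x = 0" "\<And>x. norm x \<ge> \<rho> \<Longrightarrow> q0 x = 0"
    and qb: "\<And>m x. x \<noteq> 0 \<Longrightarrow> \<bar>q m x\<bar> \<le> A * norm x powr (- e)" "\<And>x. x \<noteq> 0 \<Longrightarrow> \<bar>q0 x\<bar> \<le> A * norm x powr (- e)"
    and ql: "\<And>x. x \<noteq> 0 \<Longrightarrow> (\<lambda>m. q m x) \<longlonglongrightarrow> q0 x"
    and g[measurable]: "g \<in> borel_measurable borel" and L: "L \<ge> 0"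
    and gl: "\<And>x y. x \<in> S \<Longrightarrow> y \<in> S \<Longrightarrow> \<bar>g x - g y\<bar> \<le> L * norm (x - y)"
    and \<alpha>: "0 < \<alpha>" "\<alpha> \<le> 1" "\<alpha> < real DIM('a) + 1 - e"
  defines "T \<equiv> (\<lambda>Q x. LINT y|lborel. (g y - g x) * Q (x - y))"
  shows "\<exists>a. a \<longlonglongrightarrow> 0 \<and> (\<forall>m. \<forall>x\<in>S. ball x \<rho> \<subseteq> S \<longrightarrow> \<bar>T (q m) x - T q0 x\<bar> \<le> a m)"
    and "\<exists>C\<ge>0. (\<forall>x\<in>S. ball x \<rho> \<subseteq> S \<longrightarrow> \<bar>T q0 x\<bar> \<le> C) \<and>
       (\<forall>x\<in>S. \<forall>x'\<in>S. ball x \<rho> \<subseteq> S \<longrightarrow> ball x' \<rho> \<subseteq> S \<longrightarrow> \<bar>T q0 x - T q0 x'\<bar> \<le> C * dist x x' powr \<alpha>)"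
proof -
  \<comment> \<open>The maximum with 0 concerns weak singularities only:
    \<open>integrable_powr_ball\<close> takes nonnegative exponents, and
    \<open>\<rho> \<le> 1\<close> allows the exponent to be enlarged.\<close>
  define e1 where "e1 = max 0 (e - 1)"
  define e2 where "e2 = max 0 (e + \<alpha> - 1)"
  have e1: "0 \<le> e1" "e1 < real DIM('a)" unfolding e1_def using e by auto
  have e2: "0 \<le> e2" "e2 < real DIM('a)" unfolding e2_def using \<alpha> by auto
  have n1: "norm w * norm w powr (- e) \<le> norm w powr (- e1)" if "w \<noteq> 0" "norm w < \<rho>" for w :: 'a
  proof -
    have "norm w * norm w powr (- e) = norm w powr (1 - e)" using that by (simp add: powr_diff powr_minus divide_inverse)
    also have "\<dots> \<le> norm w powr (- e1)" using that \<rho> by (intro powr_mono') (auto simp: e1_def)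
    finally show ?thesis .
  qed
  have n2: "norm w powr (1 - \<alpha>) * norm w powr (- e) \<le> norm w powr (- e2)" if "w \<noteq> 0" "norm w < \<rho>" for w :: 'a
  proof -
    have "norm w powr (1 - \<alpha>) * norm w powr (- e) = norm w powr (1 - \<alpha> - e)" by (simp add: powr_add[symmetric])
    also have "\<dots> \<le> norm w powr (- e2)" using that \<rho> by (intro powr_mono') (auto simp: e2_def)
    finally show ?thesis .
  qed
  have Teq: "T Q x = (LINT w|lborel. (g (x - w) - g x) * Q w)" if [measurable]: "Q \<in> borel_measurable borel" for Q x
  proof -
    have [measurable]: "(\<lambda>w. (g (x - w) - g x) * Q w) \<in> borel_measurable borel" by measurable
    show ?thesis
      using integral_lborel_reflect(1)[of "\<lambda>w. (g (x - w) - g x) * Q w" x] by (simp add: T_def)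
  qed
  have gw: "\<bar>g (x - w) - g x\<bar> \<le> L * norm w" if "x \<in> S" "ball x \<rho> \<subseteq> S" "norm w < \<rho>" for x w
  proof -
    have "x - w \<in> S" using that by (auto simp: dist_norm subset_iff)
    then show ?thesis using gl[of "x - w" x] that by simp
  qed
  have intT: "integrable lborel (\<lambda>w. (g (x - w) - g x) * Q w)"
    if "Q \<in> borel_measurable borel" "\<And>x. norm x \<ge> \<rho> \<Longrightarrow> Q x = 0" "\<And>x. x \<noteq> 0 \<Longrightarrow> \<bar>Q x\<bar> \<le> A * norm x powr (- e)"
      and x: "x \<in> S" "ball x \<rho> \<subseteq> S" for Q x
  proof (rule integrable_dominated_powr[where A = "L * A" and D = \<rho> and e = e1])
    have [measurable]: "Q \<in> borel_measurable borel" by fact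
    show "(\<lambda>w. (g (x - w) - g x) * Q w) \<in> borel_measurable borel" by measurable
    show "(g (x - w) - g x) * Q w = 0" if "\<rho> \<le> norm w" for w
      using that \<open>\<And>x. norm x \<ge> \<rho> \<Longrightarrow> Q x = 0\<close> by simp
    fix w :: 'a assume w: "w \<noteq> 0" "norm w < \<rho>"
    have "\<bar>(g (x - w) - g x) * Q w\<bar> \<le> (L * norm w) * (A * norm w powr (- e))"
      unfolding abs_mult using gw[OF x w(2)] that(3)[OF w(1)] L by (intro mult_mono) auto
    also have "\<dots> = L * A * (norm w * norm w powr (- e))" by simp
    also have "\<dots> \<le> L * A * norm w powr (- e1)" using n1[OF w] L A by (intro mult_left_mono) auto
    finally show "\<bar>(g (x - w) - g x) * Q w\<bar> \<le> L * A * norm w powr (- e1)" .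
  qed (use e1 in auto)
  have iD: "integrable lborel (\<lambda>w. norm w * \<bar>q m w - q0 w\<bar>)" for m
  proof (rule integrable_dominated_powr[where A = "2 * A" and D = \<rho> and e = e1])
    fix w :: 'a assume w: "w \<noteq> 0" "norm w < \<rho>"
    have "\<bar>norm w * \<bar>q m w - q0 w\<bar>\<bar> \<le> norm w * (2 * A * norm w powr (- e))"
      unfolding abs_mult using qb(1)[OF w(1), of m] qb(2)[OF w(1)] by (intro mult_mono) auto
    also have "\<dots> = 2 * A * (norm w * norm w powr (- e))" by simp
    also have "\<dots> \<le> 2 * A * norm w powr (- e1)" using n1[OF w] A by (intro mult_left_mono) auto
    finally show "\<bar>norm w * \<bar>q m w - q0 w\<bar>\<bar> \<le> 2 * A * norm w powr (- e1)" .
  qed (use qz e1 in auto)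
  define a where "a m = L * (LINT w|lborel. norm w * \<bar>q m w - q0 w\<bar>)" for m
  have "(\<lambda>m. LINT w|lborel. norm w * \<bar>q m w - q0 w\<bar>) \<longlonglongrightarrow> (LINT w|(lborel :: 'a measure). (0::real))"
  proof (rule integral_dominated_convergence[where w = "\<lambda>w::'a. 2 * A * (norm w powr (- e1) * indicator (ball 0 \<rho>) w)"])
    show "integrable lborel (\<lambda>w::'a. 2 * A * (norm w powr (- e1) * indicator (ball 0 \<rho>) w))"
      using integrable_powr_ball[OF e1] by simp
    show "AE w in lborel. (\<lambda>m. norm w * \<bar>q m w - q0 w\<bar>) \<longlonglongrightarrow> 0"
    proof (rule AE_I2)
      fix w :: 'a
      show "(\<lambda>m. norm w * \<bar>q m w - q0 w\<bar>) \<longlonglongrightarrow> 0"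
      proof (cases "w = 0")
        case False
        have "(\<lambda>m. norm w * \<bar>q m w - q0 w\<bar>) \<longlonglongrightarrow> norm w * \<bar>q0 w - q0 w\<bar>"
          by (intro tendsto_intros ql False)
        then show ?thesis by simp
      qed simp
    qed
    fix m
    have "AE w in lborel. w \<noteq> (0::'a)" by (rule AE_lborel_singleton)
    then show "AE w in lborel. norm (norm w * \<bar>q m w - q0 w\<bar>) \<le> 2 * A * (norm w powr (- e1) * indicator (ball 0 \<rho>) w)"
    proof eventually_elim
      case (elim w)
      show ?case
      proof (cases "norm w < \<rho>")
        case True
        have "norm (norm w * \<bar>q m w - q0 w\<bar>) \<le> norm w * (2 * A * norm w powr (- e))"
          unfolding real_norm_def abs_mult using qb(1)[OF elim, of m] qb(2)[OF elim] by (intro mult_mono) auto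
        also have "\<dots> = 2 * A * (norm w * norm w powr (- e))" by simp
        also have "\<dots> \<le> 2 * A * norm w powr (- e1)" using n1[OF elim True] A by (intro mult_left_mono) auto
        finally show ?thesis using True by (simp add: indicator_def)
      next
        case False then show ?thesis using qz by simp
      qed
    qed
  qed auto
  then have "a \<longlonglongrightarrow> L * 0" unfolding a_def by (intro tendsto_intros) simp
  moreover have "\<bar>T (q m) x - T q0 x\<bar> \<le> a m" if x: "x \<in> S" "ball x \<rho> \<subseteq> S" for m x
  proof -
    have i1: "integrable lborel (\<lambda>w. (g (x - w) - g x) * q m w)"
      by (rule intT[OF q(1) qz(1) qb(1) x])
    have i2: "integrable lborel (\<lambda>w. (g (x - w) - g x) * q0 w)"
      by (rule intT[OF q(2) qz(2) qb(2) x])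
    have "T (q m) x - T q0 x = (LINT w|lborel. (g (x - w) - g x) * q m w - (g (x - w) - g x) * q0 w)"
      using i1 i2 by (simp add: Teq)
    also have "norm \<dots> \<le> (LINT w|lborel. L * (norm w * \<bar>q m w - q0 w\<bar>))"
    proof (rule Bochner_Integration.integral_norm_bound_integral)
      fix w
      show "norm ((g (x - w) - g x) * q m w - (g (x - w) - g x) * q0 w) \<le> L * (norm w * \<bar>q m w - q0 w\<bar>)"
      proof (cases "norm w < \<rho>")
        case True
        have "norm ((g (x - w) - g x) * q m w - (g (x - w) - g x) * q0 w) = \<bar>g (x - w) - g x\<bar> * \<bar>q m w - q0 w\<bar>"
          unfolding real_norm_def abs_mult[symmetric] by (simp add: right_diff_distrib)
        also have "\<dots> \<le> (L * norm w) * \<bar>q m w - q0 w\<bar>" by (intro mult_right_mono gw[OF x True]) auto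
        finally show ?thesis by (simp add: mult.assoc)
      next
        case False then show ?thesis using qz by simp
      qed
    qed (use i1 i2 iD in auto)
    also have "\<dots> = a m" unfolding a_def by simp
    finally show ?thesis by simp
  qed
  ultimately show "\<exists>a. a \<longlonglongrightarrow> 0 \<and> (\<forall>m. \<forall>x\<in>S. ball x \<rho> \<subseteq> S \<longrightarrow> \<bar>T (q m) x - T q0 x\<bar> \<le> a m)"
    by auto
  define C1 where "C1 = L * A * (LINT w|lborel. norm (w::'a) powr (- e1) * indicator (ball 0 \<rho>) w)"
  define C2 where "C2 = 2 * L * A * (LINT w|lborel. norm (w::'a) powr (- e2) * indicator (ball 0 \<rho>) w)"
  have C1: "0 \<le> C1" unfolding C1_def using L A by (intro mult_nonneg_nonneg integral_nonneg_AE) auto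
  have C2: "0 \<le> C2" unfolding C2_def using L A by (intro mult_nonneg_nonneg integral_nonneg_AE) auto
  have B1: "\<bar>T q0 x\<bar> \<le> C1" if x: "x \<in> S" "ball x \<rho> \<subseteq> S" for x
  proof -
    have i2: "integrable lborel (\<lambda>w. (g (x - w) - g x) * q0 w)"
      by (rule intT[OF q(2) qz(2) qb(2) x])
    have "norm (LINT w|lborel. (g (x - w) - g x) * q0 w) \<le> (LINT w|lborel. L * A * (norm (w::'a) powr (- e1) * indicator (ball 0 \<rho>) w))"
    proof (rule integral_norm_bound_AE[OF i2])
      show "integrable lborel (\<lambda>w::'a. L * A * (norm w powr (- e1) * indicator (ball 0 \<rho>) w))"
        using integrable_powr_ball[OF e1] by simp
      have "AE w in lborel. w \<noteq> (0::'a)" by (rule AE_lborel_singleton)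
      then show "AE w in lborel. norm ((g (x - w) - g x) * q0 w) \<le> L * A * (norm w powr (- e1) * indicator (ball 0 \<rho>) w)"
      proof eventually_elim
        case (elim w)
        show ?case
        proof (cases "norm w < \<rho>")
          case True
          have "norm ((g (x - w) - g x) * q0 w) \<le> (L * norm w) * (A * norm w powr (- e))"
            unfolding real_norm_def abs_mult using gw[OF x True] qb(2)[OF elim] L by (intro mult_mono) auto
          also have "\<dots> = L * A * (norm w * norm w powr (- e))" by simp
          also have "\<dots> \<le> L * A * norm w powr (- e1)" using n1[OF elim True] L A by (intro mult_left_mono) auto
          finally show ?thesis using True by (simp add: indicator_def)
        next
          case False then show ?thesis using qz by simp
        qed
      qed
    qed
    then show ?thesis by (simp add: C1_def Teq)
  qed
  have B2: "\<bar>T q0 x - T q0 x'\<bar> \<le> C2 * dist x x' powr \<alpha>"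
    if x: "x \<in> S" "ball x \<rho> \<subseteq> S" and x': "x' \<in> S" "ball x' \<rho> \<subseteq> S" for x x'
  proof -
    let ?h = "dist x x'"
    have i1: "integrable lborel (\<lambda>w. (g (x - w) - g x) * q0 w)"
      by (rule intT[OF q(2) qz(2) qb(2) x])
    have i2: "integrable lborel (\<lambda>w. (g (x' - w) - g x') * q0 w)"
      by (rule intT[OF q(2) qz(2) qb(2) x'])
    have "T q0 x - T q0 x' = (LINT w|lborel. (g (x - w) - g x) * q0 w - (g (x' - w) - g x') * q0 w)"
      using i1 i2 by (simp add: Teq)
    also have "norm \<dots> \<le> (LINT w|lborel. 2 * L * A * ?h powr \<alpha> * (norm (w::'a) powr (- e2) * indicator (ball 0 \<rho>) w))"
    proof (rule integral_norm_bound_AE)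
      show "integrable lborel (\<lambda>w::'a. 2 * L * A * ?h powr \<alpha> * (norm w powr (- e2) * indicator (ball 0 \<rho>) w))"
        using integrable_powr_ball[OF e2] by simp
      have "AE w in lborel. w \<noteq> (0::'a)" by (rule AE_lborel_singleton)
      then show "AE w in lborel. norm ((g (x - w) - g x) * q0 w - (g (x' - w) - g x') * q0 w)
         \<le> 2 * L * A * ?h powr \<alpha> * (norm w powr (- e2) * indicator (ball 0 \<rho>) w)"
      proof eventually_elim
        case (elim w)
        show ?case
        proof (cases "norm w < \<rho>")
          case True
          have xw: "x - w \<in> S" "x' - w \<in> S" using x x' True by (auto simp: dist_norm subset_iff)
          have d1: "\<bar>(g (x - w) - g x) - (g (x' - w) - g x')\<bar> \<le> 2 * L * norm w"
            using gw[OF x True] gw[OF x' True] by linarith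
          have d2: "\<bar>(g (x - w) - g x) - (g (x' - w) - g x')\<bar> \<le> 2 * L * ?h"
            using gl[OF xw] gl[OF x(1) x'(1)] by (simp add: dist_norm)
          have mn: "min (norm w) ?h \<le> ?h powr \<alpha> * norm w powr (1 - \<alpha>)"
          proof (cases "?h = 0")
            case F: False
            then have hp: "?h > 0" by simp
            have "min (norm w) ?h = min (norm w) ?h powr \<alpha> * min (norm w) ?h powr (1 - \<alpha>)"
              using elim hp by (simp add: powr_add[symmetric])
            also have "\<dots> \<le> ?h powr \<alpha> * norm w powr (1 - \<alpha>)"
              using \<alpha> elim hp by (intro mult_mono powr_mono2) auto
            finally show ?thesis .
          qed simp
          have "\<bar>(g (x - w) - g x) - (g (x' - w) - g x')\<bar> \<le> 2 * L * min (norm w) ?h"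
            using d1 d2 by (simp add: min_def)
          also have "\<dots> \<le> 2 * L * (?h powr \<alpha> * norm w powr (1 - \<alpha>))"
            using mn L by (intro mult_left_mono) auto
          finally have d: "\<bar>(g (x - w) - g x) - (g (x' - w) - g x')\<bar> \<le> 2 * L * (?h powr \<alpha> * norm w powr (1 - \<alpha>))" .
          have "norm ((g (x - w) - g x) * q0 w - (g (x' - w) - g x') * q0 w)
            = \<bar>(g (x - w) - g x) - (g (x' - w) - g x')\<bar> * \<bar>q0 w\<bar>"
            unfolding real_norm_def abs_mult[symmetric] by (simp add: left_diff_distrib)
          also have "\<dots> \<le> (2 * L * (?h powr \<alpha> * norm w powr (1 - \<alpha>))) * (A * norm w powr (- e))"
            using d qb(2)[OF elim] L by (intro mult_mono) auto
          also have "\<dots> = 2 * L * A * ?h powr \<alpha> * (norm w powr (1 - \<alpha>) * norm w powr (- e))" by (simp add: mult_ac)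
          also have "\<dots> \<le> 2 * L * A * ?h powr \<alpha> * norm w powr (- e2)"
            using n2[OF elim True] L A by (intro mult_left_mono) auto
          finally show ?thesis using True by (simp add: indicator_def)
        next
          case False then show ?thesis using qz by simp
        qed
      qed
    qed (use i1 i2 in auto)
    also have "\<dots> = C2 * ?h powr \<alpha>" unfolding C2_def by simp
    finally show ?thesis by simp
  qed
  have le: "C2 * r \<le> (C1 + C2) * r" if "r \<ge> 0" for r using that C1 by (intro mult_right_mono) auto
  show "\<exists>C\<ge>0. (\<forall>x\<in>S. ball x \<rho> \<subseteq> S \<longrightarrow> \<bar>T q0 x\<bar> \<le> C) \<and>
       (\<forall>x\<in>S. \<forall>x'\<in>S. ball x \<rho> \<subseteq> S \<longrightarrow> ball x' \<rho> \<subseteq> S \<longrightarrow> \<bar>T q0 x - T q0 x'\<bar> \<le> C * dist x x' powr \<alpha>)"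
  proof (intro exI[of _ "C1 + C2"] conjI ballI impI)
    show "0 \<le> C1 + C2" using C1 C2 by simp
    fix x assume x: "x \<in> S" "ball x \<rho> \<subseteq> S"
    show "\<bar>T q0 x\<bar> \<le> C1 + C2" using B1[OF x] C2 by simp
    fix x' assume x': "x' \<in> S" "ball x' \<rho> \<subseteq> S"
    show "\<bar>T q0 x - T q0 x'\<bar> \<le> (C1 + C2) * dist x x' powr \<alpha>"
      using order_trans[OF B2[OF x x'] le] by simp
  qed
qed

section \<open>Limits of derivatives and membership in Hoelder classes\<close>

lemma continuous_AE_eq:
  fixes f g :: "'a::euclidean_space \<Rightarrow> real"
  assumes "open S" "continuous_on S f" "continuous_on S g" "AE x in lborel. x \<in> S \<longrightarrow> f x = g x" "x \<in> S"
  shows "f x = g x"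
proof (rule ccontr)
  assume ne: "f x \<noteq> g x"
  define U where "U = S \<inter> (\<lambda>x. f x - g x) -` (- {0})"
  have "open U" unfolding U_def
    by (rule continuous_open_preimage) (use assms in \<open>auto intro!: continuous_intros\<close>)
  moreover have "U \<noteq> {}" using ne assms(5) by (auto simp: U_def)
  ultimately have "\<not> negligible U" by (rule open_not_negligible)
  moreover have "negligible U"
  proof -
    have "U \<in> sets lborel" using \<open>open U\<close> by simp
    moreover have "AE x in lborel. x \<notin> U"
      using assms(4) by eventually_elim (auto simp: U_def)
    ultimately have "U \<in> null_sets lborel" by (simp add: AE_iff_null_sets)
    then show ?thesis by (simp add: negligible_iff_null_sets null_sets_completionI)
  qed
  ultimately show False by simp
qed

text \<open>The bounds \<open>a i m\<close> make the Frechet derivatives converge uniformly near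
  \<open>x\<close>, with the sum of the \<open>a i m\<close> as modulus. The theorem on sequences of
  derivatives applies on a ball, and its limit function is \<open>F\<close> by uniqueness of
  limits.\<close>

lemma derivative_limit:
  fixes f :: "nat \<Rightarrow> 'a::euclidean_space \<Rightarrow> real"
  assumes S: "open S" and d: "\<And>m x. x \<in> S \<Longrightarrow> f m differentiable (at x)"
    and lim: "\<And>x. x \<in> S \<Longrightarrow> (\<lambda>m. f m x) \<longlonglongrightarrow> F x"
    and pd: "\<And>i m x. i \<in> Basis \<Longrightarrow> x \<in> S \<Longrightarrow> \<bar>partial i (f m) x - G i x\<bar> \<le> a i m"
    and a: "\<And>i. i \<in> Basis \<Longrightarrow> a i \<longlonglongrightarrow> 0" and x: "x \<in> S"
  shows "F differentiable (at x)" and "i \<in> Basis \<Longrightarrow> partial i F x = G i x"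
proof -
  obtain r where r: "r > 0" "ball x r \<subseteq> S" using S x open_contains_ball by blast
  define g' where "g' x h = (\<Sum>b\<in>Basis. (h \<bullet> b) * G b x)" for x h
  have "\<exists>g. \<forall>z\<in>ball x r. (\<lambda>n. f n z) \<longlonglongrightarrow> g z \<and> (g has_derivative g' z) (at z within ball x r)"
  proof (rule has_derivative_sequence[where f' = "\<lambda>m z. frechet_derivative (f m) (at z)"])
    show "(f n has_derivative frechet_derivative (f n) (at z)) (at z within ball x r)" if "z \<in> ball x r" for n z
      using d[of z n] that r(2) has_derivative_frechet has_derivative_at_withinI by blast
    show "(\<lambda>m. f m x) \<longlonglongrightarrow> F x" by (rule lim[OF x])
    show "x \<in> ball x r" using r by simp
    fix e :: real assume e: "e > 0"
    have "(\<lambda>m. \<Sum>b\<in>(Basis::'a set). a b m) \<longlonglongrightarrow> (\<Sum>b\<in>(Basis::'a set). 0)"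
      by (intro tendsto_sum a)
    then have "\<forall>\<^sub>F m in sequentially. (\<Sum>b\<in>(Basis::'a set). a b m) < e"
      using e by (intro order_tendstoD) simp_all
    then show "\<forall>\<^sub>F m in sequentially. \<forall>z\<in>ball x r. \<forall>h. norm (frechet_derivative (f m) (at z) h - g' z h) \<le> e * norm h"
    proof eventually_elim
      case (elim m)
      show ?case
      proof (intro ballI allI)
        fix z h assume z: "z \<in> ball x r"
        have dz: "f m differentiable (at z)" using d z r by blast
        have "frechet_derivative (f m) (at z) h - g' z h = (\<Sum>b\<in>Basis. (h \<bullet> b) * (partial b (f m) z - G b z))"
          unfolding frechet_eq_sum[OF dz] g'_def by (simp add: sum_subtractf right_diff_distrib)
        also have "norm \<dots> \<le> (\<Sum>b\<in>Basis. norm h * a b m)"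
        proof (rule order_trans[OF norm_sum], rule sum_mono)
          fix b :: 'a assume b: "b \<in> Basis"
          show "norm ((h \<bullet> b) * (partial b (f m) z - G b z)) \<le> norm h * a b m"
            unfolding norm_mult using pd[OF b, of z m] z r(2) b by (intro mult_mono) (auto simp: Basis_le_norm)
        qed
        also have "\<dots> = norm h * (\<Sum>b\<in>Basis. a b m)" by (simp add: sum_distrib_left)
        also have "\<dots> \<le> norm h * e" using elim by (intro mult_left_mono) auto
        finally show "norm (frechet_derivative (f m) (at z) h - g' z h) \<le> e * norm h" by (simp add: mult.commute)
      qed
    qed
  qed auto
  then obtain g where g: "\<And>z. z \<in> ball x r \<Longrightarrow> (\<lambda>n. f n z) \<longlonglongrightarrow> g z"
    "\<And>z. z \<in> ball x r \<Longrightarrow> (g has_derivative g' z) (at z within ball x r)" by blast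
  have gF: "g z = F z" if "z \<in> ball x r" for z
    using LIMSEQ_unique[OF g(1)[OF that] lim] that r by blast
  have "(g has_derivative g' x) (at x)"
    using g(2)[of x] r at_within_open[of x "ball x r"] by auto
  then have FD: "(F has_derivative g' x) (at x)"
    by (rule has_derivative_transform_within_open[of _ _ _ _ "ball x r"]) (use r gF in auto)
  then show "F differentiable (at x)" using differentiable_def by blast
  assume i: "i \<in> Basis"
  have "partial i F x = g' x i" by (rule partial_eq[OF FD])
  also have "\<dots> = (\<Sum>b\<in>Basis. if b = i then G b x else 0)"
    unfolding g'_def using i by (intro sum.cong) (auto simp: inner_Basis)
  also have "\<dots> = G i x" using i by simp
  finally show "partial i F x = G i x" .
qed

lemma partial_cong_open:
  fixes f g :: "'a::euclidean_space \<Rightarrow> real"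
  assumes "open S" "\<And>x. x \<in> S \<Longrightarrow> f x = g x" "x \<in> S"
  shows "partial i f x = partial i g x" "f differentiable (at x) \<longleftrightarrow> g differentiable (at x)"
proof -
  have h: "(f has_derivative D) (at x) \<longleftrightarrow> (g has_derivative D) (at x)" for D
    using has_derivative_transform_within_open[OF _ assms(1,3), of f D UNIV g]
      has_derivative_transform_within_open[OF _ assms(1,3), of g D UNIV f] assms(2) by auto
  show "partial i f x = partial i g x"
    unfolding partial_def frechet_derivative_def h ..
  show "f differentiable (at x) \<longleftrightarrow> g differentiable (at x)"
    unfolding differentiable_def h ..
qed

lemma holder_on_1I:
  fixes f :: "'a::euclidean_space \<Rightarrow> real"
  assumes S: "open S" and d: "\<And>x. x \<in> S \<Longrightarrow> f differentiable (at x)"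
    and b: "\<And>x. x \<in> S \<Longrightarrow> \<bar>f x\<bar> \<le> C" "\<And>i x. i \<in> Basis \<Longrightarrow> x \<in> S \<Longrightarrow> \<bar>partial i f x\<bar> \<le> C"
    and h: "\<And>i x y. i \<in> Basis \<Longrightarrow> x \<in> S \<Longrightarrow> y \<in> S \<Longrightarrow> \<bar>partial i f x - partial i f y\<bar> \<le> C * dist x y powr \<alpha>"
    and c: "\<And>i. i \<in> Basis \<Longrightarrow> continuous_on S (partial i f)"
  shows "holder_on 1 \<alpha> S f"
  unfolding holder_on_def
proof (intro conjI)
  have cf: "continuous_on S f"
    using d by (auto intro!: continuous_at_imp_continuous_on differentiable_imp_continuous_within)
  have cs: "js = [] \<or> (\<exists>i. js = [i])" if "length js \<le> 1" for js :: "'a list"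
    using that by (cases js) auto
  show "\<exists>V. open V \<and> S \<subseteq> V \<and> Ck_on 1 V f"
  proof (intro exI[of _ S] conjI S order_refl)
    show "Ck_on 1 S f"
      unfolding Ck_on_def using cs d c cf by fastforce
  qed
  show "\<exists>C. \<forall>is. set is \<subseteq> Basis \<longrightarrow> (length is \<le> 1 \<longrightarrow> (\<forall>x\<in>S. \<bar>partials is f x\<bar> \<le> C)) \<and>
      (length is = 1 \<longrightarrow> (\<forall>x\<in>S. \<forall>y\<in>S. \<bar>partials is f x - partials is f y\<bar> \<le> C * dist x y powr \<alpha>))"
  proof (intro exI[of _ C] allI impI conjI)
    fix js :: "'a list" assume js: "set js \<subseteq> Basis"
    { assume "length js \<le> 1"
      with cs[OF this] js show "\<forall>x\<in>S. \<bar>partials js f x\<bar> \<le> C" using b by auto }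
    { assume "length js = 1"
      then obtain i where "js = [i]" by (cases js) auto
      with js show "\<forall>x\<in>S. \<forall>y\<in>S. \<bar>partials js f x - partials js f y\<bar> \<le> C * dist x y powr \<alpha>" using h by auto }
  qed
qed

lemma holder_on_2I:
  fixes f :: "'a::euclidean_space \<Rightarrow> real"
  assumes S: "open S" and d: "\<And>x. x \<in> S \<Longrightarrow> f differentiable (at x)"
    and d2: "\<And>i x. i \<in> Basis \<Longrightarrow> x \<in> S \<Longrightarrow> partial i f differentiable (at x)"
    and b: "\<And>x. x \<in> S \<Longrightarrow> \<bar>f x\<bar> \<le> C" "\<And>i x. i \<in> Basis \<Longrightarrow> x \<in> S \<Longrightarrow> \<bar>partial i f x\<bar> \<le> C"
      "\<And>i j x. i \<in> Basis \<Longrightarrow> j \<in> Basis \<Longrightarrow> x \<in> S \<Longrightarrow> \<bar>partial j (partial i f) x\<bar> \<le> C"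
    and h: "\<And>i j x y. i \<in> Basis \<Longrightarrow> j \<in> Basis \<Longrightarrow> x \<in> S \<Longrightarrow> y \<in> S \<Longrightarrow>
       \<bar>partial j (partial i f) x - partial j (partial i f) y\<bar> \<le> C * dist x y powr \<alpha>"
    and c: "\<And>i j. i \<in> Basis \<Longrightarrow> j \<in> Basis \<Longrightarrow> continuous_on S (partial j (partial i f))"
  shows "holder_on 2 \<alpha> S f"
  unfolding holder_on_def
proof (intro conjI)
  have cf: "continuous_on S f"
    using d by (auto intro!: continuous_at_imp_continuous_on differentiable_imp_continuous_within)
  have cf1: "continuous_on S (partial i f)" if "i \<in> Basis" for i
    using d2[OF that] by (auto intro!: continuous_at_imp_continuous_on differentiable_imp_continuous_within)
  have cs: "js = [] \<or> (\<exists>i. js = [i]) \<or> (\<exists>i j. js = [j, i])" if "length js \<le> 2" for js :: "'a list"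
  proof (cases js)
    case (Cons j l)
    then show ?thesis using that by (cases l) auto
  qed simp
  show "\<exists>V. open V \<and> S \<subseteq> V \<and> Ck_on 2 V f"
  proof (intro exI[of _ S] conjI S order_refl)
    show "Ck_on 2 S f"
      unfolding Ck_on_def
    proof (intro allI impI conjI)
      fix js :: "'a list" assume js: "set js \<subseteq> Basis"
      { assume l: "length js < 2"
        then have "js = [] \<or> (\<exists>i. js = [i])" using cs[of js] by auto
        then show "\<forall>x\<in>S. partials js f differentiable (at x)" using d d2 js by auto }
      { assume "length js \<le> 2"
        from cs[OF this] show "continuous_on S (partials js f)" using cf cf1 c js by auto }
    qed
  qed
  show "\<exists>C. \<forall>is. set is \<subseteq> Basis \<longrightarrow> (length is \<le> 2 \<longrightarrow> (\<forall>x\<in>S. \<bar>partials is f x\<bar> \<le> C)) \<and>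
      (length is = 2 \<longrightarrow> (\<forall>x\<in>S. \<forall>y\<in>S. \<bar>partials is f x - partials is f y\<bar> \<le> C * dist x y powr \<alpha>))"
  proof (intro exI[of _ C] allI impI conjI)
    fix js :: "'a list" assume js: "set js \<subseteq> Basis"
    { assume "length js \<le> 2"
      with cs[OF this] js show "\<forall>x\<in>S. \<bar>partials js f x\<bar> \<le> C" using b by auto }
    { assume l: "length js = 2"
      then obtain i j where "js = [j, i]" using cs[of js] by auto
      with js show "\<forall>x\<in>S. \<forall>y\<in>S. \<bar>partials js f x - partials js f y\<bar> \<le> C * dist x y powr \<alpha>" using h by auto }
  qed
qed

lemma holder_continuous_on:
  fixes f :: "'a::metric_space \<Rightarrow> real"
  assumes "\<And>x y. x \<in> S \<Longrightarrow> y \<in> S \<Longrightarrow> \<bar>f x - f y\<bar> \<le> C * dist x y powr \<alpha>" "\<alpha> > 0"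
  shows "continuous_on S f"
  unfolding continuous_on_def
proof
  fix x assume x: "x \<in> S"
  have "((\<lambda>y. C * dist y x powr \<alpha>) \<longlongrightarrow> C * dist x x powr \<alpha>) (at x within S)"
    using assms(2) by (intro tendsto_intros tendsto_powr2) (auto intro!: always_eventually)
  then have "((\<lambda>y. C * dist y x powr \<alpha>) \<longlongrightarrow> 0) (at x within S)" using assms(2) by simp
  then have "((\<lambda>y. f y - f x) \<longlongrightarrow> 0) (at x within S)"
    by (rule Lim_null_comparison[rotated]) (auto simp: eventually_at_filter x assms(1))
  then show "(f \<longlongrightarrow> f x) (at x within S)" by (simp add: LIM_zero_iff)
qed

lemma holder_on_subset: "holder_on k \<alpha> S f \<Longrightarrow> K \<subseteq> S \<Longrightarrow> holder_on k \<alpha> K f"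
  unfolding holder_on_def by (meson order_trans subsetD)

lemma Ck_Lipschitz:
  fixes f :: "'a::euclidean_space \<Rightarrow> real"
  assumes "Ck 1 f" "\<And>i x. i \<in> Basis \<Longrightarrow> \<bar>partial i f x\<bar> \<le> C"
  shows "\<bar>f x - f y\<bar> \<le> (real DIM('a) * C) * norm (x - y)"
proof -
  have d: "f differentiable (at x)" for x using assms(1) by simp
  have "norm (f x - f y) \<le> (real DIM('a) * C) * norm (x - y)"
  proof (rule differentiable_bound[where S = UNIV and f' = "\<lambda>x. frechet_derivative f (at x)"])
    show "(f has_derivative frechet_derivative f (at x)) (at x within UNIV)" for x
      using has_derivative_frechet[OF d] by simp
    show "onorm (frechet_derivative f (at x)) \<le> real DIM('a) * C" for x
    proof (rule onorm_le)
      fix h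
      have "norm (frechet_derivative f (at x) h) \<le> (\<Sum>b\<in>(Basis::'a set). norm h * C)"
        unfolding frechet_eq_sum[OF d]
      proof (rule order_trans[OF norm_sum], rule sum_mono)
        fix b :: 'a assume b: "b \<in> Basis"
        show "norm ((h \<bullet> b) * partial b f x) \<le> norm h * C"
          unfolding norm_mult using assms(2)[OF b] b by (intro mult_mono) (auto simp: Basis_le_norm)
      qed
      also have "\<dots> = real DIM('a) * C * norm h" by simp
      finally show "norm (frechet_derivative f (at x) h) \<le> real DIM('a) * C * norm h" .
    qed
  qed auto
  then show ?thesis by simp
qed

lemma continuous_lebesgue_measurable:
  "continuous_on UNIV f \<Longrightarrow> f \<in> borel_measurable lborel"
  "continuous_on UNIV f \<Longrightarrow> f \<in> borel_measurable lebesgue"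
  by (auto intro!: borel_measurable_continuous_onI measurable_completion)

text \<open>The convolution of \<open>\<phi>\<close> with the indicator of a large ball is constant
  near 0 by translation invariance, and its derivative at 0 is the integral in question up to a
  reflection.\<close>

lemma integral_partial_zero:
  fixes \<phi> :: "'a::euclidean_space \<Rightarrow> real"
  assumes \<phi>: "Ck 1 \<phi>" "bdd_supp \<phi>" and i: "i \<in> Basis"
  shows "(LINT y|lborel. partial i \<phi> y) = 0"
proof -
  obtain B0 where B0: "\<And>x. norm x > B0 \<Longrightarrow> \<phi> x = 0" using \<phi>(2) unfolding bdd_supp_def by blast
  obtain B1 where B1: "\<And>x. norm x > B1 \<Longrightarrow> partial i \<phi> x = 0"
    using bdd_supp_partial[OF \<phi>(2)] unfolding bdd_supp_def by blast
  \<comment> \<open>Large enough that \<open>ball 0 (M + 1)\<close> contains every \<open>z\<close>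
    that matters: outside it, \<open>\<phi> (x - z)\<close> vanishes for all \<open>x\<close> in the
    unit ball, and so does the derivative at \<open>- z\<close>.\<close>
  define M where "M = max (max B0 B1) 0 + 1"
  define m where "m = (indicator (ball (0::'a) (M + 1)) :: 'a \<Rightarrow> real)"
  have im: "integrable lebesgue m"
    unfolding m_def by (subst integrable_completion) (auto simp: integrable_indicator_iff intro!: emeasure_bounded_finite[unfolded infinity_ennreal_def])
  have c0: "continuous_on UNIV \<phi>" by (rule Ck_continuous[OF \<phi>(1)])
  have c1: "continuous_on UNIV (partial i \<phi>)" using \<phi>(1) i by simp
  have [measurable]: "\<phi> \<in> borel_measurable borel" "partial i \<phi> \<in> borel_measurable borel"
    using c0 c1 by (auto intro: borel_measurable_continuous_onI)
  define G where "G x = (LINT z|lebesgue. m z * \<phi> (id x - z))" for x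
  have Gc: "G x = (LINT y|lborel. \<phi> y)" if "x \<in> ball 0 1" for x
  proof -
    have "m z * \<phi> (x - z) = \<phi> (x - z)" for z
    proof (cases "z \<in> ball 0 (M + 1)")
      case False
      then have "norm (x - z) > B0" using that norm_triangle_ineq2[of z x] by (auto simp: M_def norm_minus_commute)
      then show ?thesis using B0 by simp
    qed (simp add: m_def)
    then have "G x = (LINT z|lebesgue. \<phi> (x - z))" by (simp only: G_def id_apply)
    also have "\<dots> = (LINT z|lborel. \<phi> (x - z))" by (rule integral_completion) measurable
    also have "\<dots> = (LINT y|lborel. \<phi> y)" by (rule integral_lborel_reflect) measurable
    finally show ?thesis .
  qed
  have "partial i G 0 = partial i (\<lambda>_. LINT y|lborel. \<phi> y) 0"
    by (rule partial_cong_open(1)[of "ball 0 1"]) (use Gc in auto)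
  also have "\<dots> = 0" by (subst partial_eq[OF has_derivative_const]) simp
  finally have "0 = (LINT z|lebesgue. m z * partial i \<phi> (id 0 - z))"
    unfolding G_def using conv_partial[OF im \<phi>, of id i] by (simp add: bounded_linear_ident[unfolded id_def[symmetric]] id_def)
  also have "\<dots> = (LINT z|lebesgue. partial i \<phi> (0 - z))"
  proof (rule Bochner_Integration.integral_cong[OF refl])
    fix z
    show "m z * partial i \<phi> (id 0 - z) = partial i \<phi> (0 - z)"
    proof (cases "z \<in> ball 0 (M + 1)")
      case False
      then have "norm (0 - z) > B1" by (auto simp: M_def)
      then show ?thesis using B1[of "0 - z"] by simp
    qed (simp add: m_def)
  qed
  also have "\<dots> = (LINT z|lborel. partial i \<phi> (0 - z))" by (rule integral_completion) measurable
  also have "\<dots> = (LINT y|lborel. partial i \<phi> y)" by (rule integral_lborel_reflect) measurable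
  finally show ?thesis by simp
qed

section \<open>Regularity of functions represented by a potential\<close>

lemma powr_norm_sq: "(norm x)\<^sup>2 powr r = norm x powr (2 * r)"
proof (cases "norm x = 0")
  case False
  then have "(norm x)\<^sup>2 = norm x powr 2" by simp
  then show ?thesis by (simp only: powr_powr)
qed simp

text \<open>The natural exponent \<open>n - 2 * s\<close> is replaced by \<open>b\<close>, which is
  positive and still below \<open>n\<close>; the logarithmic and bounded kernels in dimension 1 are
  thereby included. In the constant, \<open>2 / b\<close> comes from \<open>ker0_bound\<close> with
  the exponent \<open>b / 2\<close> for the squared norm, and 4 from
  \<open>norm x' + norm x \<le> 4 * norm x\<close>.\<close>

lemma kernel_at_zero_bounds:
  fixes n s q \<rho> b :: real
  defines "q \<equiv> n / 2 - s + 1" and "b \<equiv> max (n - 2 * s) (n - 1 / 2)"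
  assumes n: "n \<ge> 1" and s: "0 < s" "s < 1" and \<rho>: "0 < \<rho>" "\<rho> \<le> 1"
  defines "k \<equiv> \<lambda>x::'a::real_normed_vector. ker0 q (\<rho>\<^sup>2) 0 ((norm x)\<^sup>2)"
  shows "norm x \<ge> \<rho> \<Longrightarrow> k x = 0"
    and "x \<noteq> 0 \<Longrightarrow> \<bar>k x\<bar> \<le> (2 / b + 4) * norm x powr (- b)"
    and "x \<noteq> 0 \<Longrightarrow> norm x \<le> norm x' \<Longrightarrow> norm x' \<le> 3 * norm x \<Longrightarrow>
        \<bar>k x' - k x\<bar> \<le> (2 / b + 4) * norm (x' - x) * norm x powr (- b - 1)"
proof -
  have b: "b > 0" unfolding b_def using n by auto
  have q: "q > 0" unfolding q_def using n s by auto
  have R: "0 < \<rho>\<^sup>2" "\<rho>\<^sup>2 \<le> 1" using \<rho> by (auto simp: power_le_one)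
  show k0: "k x = 0" if "norm x \<ge> \<rho>" for x
    unfolding k_def using that \<rho> by (intro ker0_eq_0 power_mono) auto
  show "\<bar>k x\<bar> \<le> (2 / b + 4) * norm x powr (- b)" if "x \<noteq> 0"
  proof -
    have "\<bar>k x\<bar> \<le> (1 / (b / 2)) * ((norm x)\<^sup>2) powr (- (b / 2))"
      unfolding k_def using that R b by (intro ker0_bound) (auto simp: q_def b_def)
    also have "\<dots> = (2 / b) * norm x powr (- b)" by (simp add: powr_norm_sq)
    also have "\<dots> \<le> (2 / b + 4) * norm x powr (- b)" by (intro mult_right_mono) auto
    finally show ?thesis .
  qed
  show "\<bar>k x' - k x\<bar> \<le> (2 / b + 4) * norm (x' - x) * norm x powr (- b - 1)"
    if x: "x \<noteq> 0" "norm x \<le> norm x'" "norm x' \<le> 3 * norm x"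
  proof (cases "norm x \<ge> \<rho>")
    case True
    then show ?thesis using k0[of x] k0[of x'] x b by auto
  next
    case False
    have x0: "norm x > 0" using x by simp
    have "\<bar>k x' - k x\<bar> \<le> ((norm x')\<^sup>2 - (norm x)\<^sup>2) * (\<rho>\<^sup>2 * ((norm x)\<^sup>2) powr (- q))"
      unfolding k_def using x R q by (intro ker0_diff power_mono) auto
    also have "\<dots> \<le> (norm (x' - x) * (4 * norm x)) * (1 * norm x powr (- 2 * q))"
    proof (intro mult_mono)
      have "(norm x')\<^sup>2 - (norm x)\<^sup>2 = (norm x' - norm x) * (norm x' + norm x)"
        by (simp add: power2_eq_square algebra_simps)
      also have "\<dots> \<le> norm (x' - x) * (4 * norm x)"
        using x norm_triangle_ineq2[of x' x] by (intro mult_mono) auto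
      finally show "(norm x')\<^sup>2 - (norm x)\<^sup>2 \<le> norm (x' - x) * (4 * norm x)" .
    qed (use R in \<open>auto simp: powr_norm_sq\<close>)
    also have "\<dots> = 4 * norm (x' - x) * (norm x * norm x powr (- 2 * q))" by simp
    also have "norm x * norm x powr (- 2 * q) = norm x powr (1 - 2 * q)"
      using x0 by (simp add: powr_diff powr_minus divide_inverse)
    also have "4 * norm (x' - x) * norm x powr (1 - 2 * q) \<le> (2 / b + 4) * norm (x' - x) * norm x powr (- b - 1)"
      using x0 False \<rho> b by (intro mult_mono mult_right_mono powr_mono') (auto simp: q_def b_def)
    finally show ?thesis .
  qed
qed

text \<open>A globally bounded Borel version of \<open>w\<close> that is Hoelder on one inner set
  only. It may change with \<open>\<delta>\<close>, as \<open>w\<close> is so far determined merely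
  almost everywhere.\<close>

definition holder_rep :: "'a::euclidean_space set \<Rightarrow> ('a \<Rightarrow> real) \<Rightarrow> real \<Rightarrow> real \<Rightarrow> ('a \<Rightarrow> real) \<Rightarrow> bool" where
  "holder_rep \<Omega> w \<beta> \<delta> \<phi> \<longleftrightarrow> \<phi> \<in> borel_measurable borel \<and>
     (AE x in lborel. x \<in> inner_set \<delta> \<Omega> \<longrightarrow> \<phi> x = w x) \<and>
     (\<exists>C\<ge>0. (\<forall>x. \<bar>\<phi> x\<bar> \<le> C) \<and> (\<forall>x\<in>inner_set \<delta> \<Omega>. \<forall>y\<in>inner_set \<delta> \<Omega>. \<bar>\<phi> x - \<phi> y\<bar> \<le> C * dist x y powr \<beta>))"

text \<open>The outcome of the extension problem, detached from it. The range \<open>\<rho>\<close>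
  of the kernel is variable so that it can be adapted to the distance from the boundary;
  \<open>\<kappa>\<close> and the smooth remainder \<open>H\<close> may change with it.\<close>

locale potential_representation =
  fixes \<Omega> :: "'a::euclidean_space set" and w :: "'a \<Rightarrow> real" and s \<rho>0 n :: real
  assumes n_def: "n = real DIM('a)" and \<Omega>: "open \<Omega>" "bounded \<Omega>"
    and w[measurable]: "w \<in> borel_measurable borel"
    and w_fin: "(\<integral>\<^sup>+x. ennreal \<bar>w x\<bar> * indicator \<Omega> x \<partial>lborel) < \<infinity>"
    and s: "0 < s" "s < 1" and \<rho>0: "\<rho>0 > 0" "\<rho>0 \<le> 1"
    and rep: "\<And>\<rho>. 0 < \<rho> \<Longrightarrow> \<rho> < \<rho>0 \<Longrightarrow> \<exists>\<kappa> H. (\<forall>k. Ck k H) \<and>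
        (\<forall>is. set is \<subseteq> Basis \<longrightarrow> (\<exists>C. \<forall>x. \<bar>partials is H x\<bar> \<le> C)) \<and>
        (AE x in lborel. x \<in> inner_set \<rho> \<Omega> \<longrightarrow>
          w x = \<kappa> * (LINT y|lborel. max (w y) 0 * ker0 (n / 2 - s + 1) (\<rho>\<^sup>2) 0 ((norm (x - y))\<^sup>2)) + H x)"
begin

abbreviation "core \<delta> \<equiv> inner_set \<delta> \<Omega>"

definition "q = n / 2 - s + 1"
definition "b = max (n - 2 * s) (n - 1 / 2)"
definition "A = 2 / b + 4"
definition K :: "real \<Rightarrow> 'a \<Rightarrow> real" where "K \<rho> x = ker0 q (\<rho>\<^sup>2) 0 ((norm x)\<^sup>2)"

lemma n1: "n \<ge> 1" unfolding n_def using DIM_positive[where 'a = 'a] by linarith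
lemma q_pos: "q > 0" unfolding q_def using n1 s by auto
lemma b_pos: "b > 0" "b < n" unfolding b_def using n1 s by auto
lemma A_pos: "A > 0" unfolding A_def using b_pos by (auto intro: add_pos_pos)

lemma b_less: "b < real DIM('a)" using b_pos n_def by simp

lemma K_bounds:
  assumes \<rho>: "0 < \<rho>" "\<rho> \<le> 1"
  shows "norm x \<ge> \<rho> \<Longrightarrow> K \<rho> x = 0"
    and "x \<noteq> 0 \<Longrightarrow> \<bar>K \<rho> x\<bar> \<le> A * norm x powr (- b)"
    and "x \<noteq> 0 \<Longrightarrow> norm x \<le> norm x' \<Longrightarrow> norm x' \<le> 3 * norm x \<Longrightarrow>
        \<bar>K \<rho> x' - K \<rho> x\<bar> \<le> A * norm (x' - x) * norm x powr (- b - 1)"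
  using kernel_at_zero_bounds(1)[OF n1 s \<rho>, of x] kernel_at_zero_bounds(2)[OF n1 s \<rho>, of x]
    kernel_at_zero_bounds(3)[OF n1 s \<rho>, of x x']
  unfolding K_def q_def b_def A_def by (blast+)

lemma K_measurable [measurable]: "0 < \<rho> \<Longrightarrow> \<rho> \<le> 1 \<Longrightarrow> K \<rho> \<in> borel_measurable borel"
proof -
  assume \<rho>: "0 < \<rho>" "\<rho> \<le> 1"
  have "isCont (ker0 q (\<rho>\<^sup>2) 0) t" if "t > 0" for t
    using DERIV_isCont[OF DERIV_ker0[of 0 t]] that by simp
  then have "continuous_on {0<..} (ker0 q (\<rho>\<^sup>2) 0)"
    by (auto intro: continuous_at_imp_continuous_on)
  then have "continuous_on (- {0}) (\<lambda>x::'a. ker0 q (\<rho>\<^sup>2) 0 ((norm x)\<^sup>2))"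
    by (rule continuous_on_compose2) (auto intro!: continuous_intros)
  then have "(\<lambda>x. indicator (- {0}) x *\<^sub>R K \<rho> x) \<in> borel_measurable borel"
    unfolding K_def by (intro borel_measurable_continuous_on_indicator) auto
  moreover have "(\<lambda>x::'a. indicator {0} x * K \<rho> 0) \<in> borel_measurable borel" by measurable
  ultimately have "(\<lambda>x. indicator (- {0}) x *\<^sub>R K \<rho> x + indicator {0} x * K \<rho> 0) \<in> borel_measurable borel"
    by (rule borel_measurable_add)
  moreover have "(\<lambda>x. indicator (- {0}) x *\<^sub>R K \<rho> x + indicator {0} x * K \<rho> 0) = K \<rho>"
    by (auto simp: indicator_def)
  ultimately show ?thesis by simp
qed

lemma \<Omega>_diam: "\<exists>D>0. \<forall>x\<in>\<Omega>. \<forall>y\<in>\<Omega>. dist x y \<le> D"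
proof (intro exI[of _ "diameter \<Omega> + 1"] conjI ballI)
  show "0 < diameter \<Omega> + 1" using diameter_ge_0[OF \<Omega>(2)] by simp
  show "dist x y \<le> diameter \<Omega> + 1" if "x \<in> \<Omega>" "y \<in> \<Omega>" for x y
    using diameter_bounded_bound[OF \<Omega>(2) that] by simp
qed

text \<open>Only the size of the kernel and \<open>max (w y) 0 \<le> \<bar>w y\<bar>\<close> are
  used. Where the potential is not integrable, its value is 0 by convention and the required
  estimate is trivial.\<close>

lemma w_bounded: "\<delta> > 0 \<Longrightarrow> \<exists>C\<ge>0. AE x in lborel. x \<in> core \<delta> \<longrightarrow> \<bar>w x\<bar> \<le> C"
proof (rule bounded_bootstrap[OF \<Omega> w w_fin less_imp_le[OF b_pos(1)] b_less \<rho>0(1)])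
  fix \<rho> assume \<rho>: "0 < \<rho>" "\<rho> < \<rho>0"
  then have \<rho>1: "\<rho> \<le> 1" using \<rho>0 by simp
  note [measurable] = K_measurable[OF \<rho>(1) \<rho>1]
  obtain \<kappa> H where H: "\<forall>is. set is \<subseteq> Basis \<longrightarrow> (\<exists>C. \<forall>x. \<bar>partials is H x\<bar> \<le> C)"
    and ae: "AE x in lborel. x \<in> core \<rho> \<longrightarrow> w x = \<kappa> * (LINT y|lborel. max (w y) 0 * K \<rho> (x - y)) + H x"
    using rep[OF \<rho>] unfolding K_def q_def by blast
  obtain C where C: "\<And>x. \<bar>H x\<bar> \<le> C" using H[rule_format, of "[]"] by auto
  have C0: "C \<ge> 0" using C[of undefined] by linarith
  define C' where "C' = \<bar>\<kappa>\<bar> * A + C"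
  have "AE x in lborel. x \<in> core \<rho> \<longrightarrow>
        ennreal \<bar>w x\<bar> \<le> ennreal C' * (\<integral>\<^sup>+y. ennreal \<bar>w y\<bar> * (ennreal (norm (x - y) powr (- b)) * indicator (ball x \<rho>) y) \<partial>lborel) + ennreal C'"
    using ae
  proof eventually_elim
    case (elim x)
    show ?case
    proof
      assume "x \<in> core \<rho>"
      then have wx: "w x = \<kappa> * (LINT y|lborel. max (w y) 0 * K \<rho> (x - y)) + H x" using elim by blast
      let ?I = "LINT y|lborel. max (w y) 0 * K \<rho> (x - y)"
      let ?J = "\<integral>\<^sup>+y. ennreal \<bar>w y\<bar> * (ennreal (norm (x - y) powr (- b)) * indicator (ball x \<rho>) y) \<partial>lborel"
      have IJ: "ennreal \<bar>?I\<bar> \<le> ennreal A * ?J"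
      proof (cases "integrable lborel (\<lambda>y. max (w y) 0 * K \<rho> (x - y))")
        case True
        have "ennreal \<bar>?I\<bar> \<le> (\<integral>\<^sup>+y. ennreal (norm (max (w y) 0 * K \<rho> (x - y))) \<partial>lborel)"
          using integral_norm_bound_ennreal[OF True] by simp
        also have "\<dots> \<le> (\<integral>\<^sup>+y. ennreal A * (ennreal \<bar>w y\<bar> * (ennreal (norm (x - y) powr (- b)) * indicator (ball x \<rho>) y)) \<partial>lborel)"
        proof (rule nn_integral_mono_AE)
          have "AE y in lborel. y \<noteq> x" by (rule AE_lborel_singleton)
          then show "AE y in lborel. ennreal (norm (max (w y) 0 * K \<rho> (x - y))) \<le>
            ennreal A * (ennreal \<bar>w y\<bar> * (ennreal (norm (x - y) powr (- b)) * indicator (ball x \<rho>) y))"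
          proof eventually_elim
            case (elim y)
            show ?case
            proof (cases "norm (x - y) < \<rho>")
              case T: True
              have "norm (max (w y) 0 * K \<rho> (x - y)) \<le> \<bar>w y\<bar> * (A * norm (x - y) powr (- b))"
                unfolding real_norm_def abs_mult using K_bounds(2)[OF \<rho>(1) \<rho>1, of "x - y"] elim
                by (intro mult_mono) auto
              then have "ennreal (norm (max (w y) 0 * K \<rho> (x - y))) \<le> ennreal (A * (\<bar>w y\<bar> * norm (x - y) powr (- b)))"
                by (intro ennreal_leI) (simp add: mult_ac)
              also have "\<dots> = ennreal A * (ennreal \<bar>w y\<bar> * ennreal (norm (x - y) powr (- b)))"
                using A_pos by (simp add: ennreal_mult)
              finally show ?thesis using T by (simp add: dist_norm)
            next
              case F: False
              then have "K \<rho> (x - y) = 0" by (intro K_bounds(1)[OF \<rho>(1) \<rho>1]) simp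
              then show ?thesis by simp
            qed
          qed
        qed
        also have "\<dots> = ennreal A * ?J" by (rule nn_integral_cmult) measurable
        finally show ?thesis .
      next
        case False
        then show ?thesis by (simp add: not_integrable_integral_eq)
      qed
      have "\<bar>w x\<bar> \<le> \<bar>\<kappa> * ?I\<bar> + \<bar>H x\<bar>" unfolding wx by (rule abs_triangle_ineq)
      also have "\<dots> \<le> \<bar>\<kappa>\<bar> * \<bar>?I\<bar> + C" unfolding abs_mult by (rule add_left_mono[OF C])
      finally have "\<bar>w x\<bar> \<le> \<bar>\<kappa>\<bar> * \<bar>?I\<bar> + C" .
      then have "ennreal \<bar>w x\<bar> \<le> ennreal (\<bar>\<kappa>\<bar> * \<bar>?I\<bar> + C)" by (rule ennreal_leI)
      also have "\<dots> = ennreal \<bar>\<kappa>\<bar> * ennreal \<bar>?I\<bar> + ennreal C" using C0 by (simp add: ennreal_mult)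
      also have "\<dots> \<le> ennreal \<bar>\<kappa>\<bar> * (ennreal A * ?J) + ennreal C" by (intro add_mono mult_left_mono IJ) auto
      also have "\<dots> = ennreal (\<bar>\<kappa>\<bar> * A) * ?J + ennreal C" using A_pos by (simp add: ennreal_mult mult.assoc)
      also have "\<dots> \<le> ennreal C' * ?J + ennreal C'"
        unfolding C'_def using C0 A_pos by (intro add_mono mult_right_mono ennreal_leI) auto
      finally show "ennreal \<bar>w x\<bar> \<le> ennreal C' * ?J + ennreal C'" .
    qed
  qed
  moreover have "C' \<ge> 0" unfolding C'_def using C0 A_pos by simp
  ultimately show "\<exists>C\<ge>0. AE x in lborel. x \<in> core \<rho> \<longrightarrow>
        ennreal \<bar>w x\<bar> \<le> ennreal C * (\<integral>\<^sup>+y. ennreal \<bar>w y\<bar> * (ennreal (norm (x - y) powr (- b)) * indicator (ball x \<rho>) y) \<partial>lborel) + ennreal C"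
    by blast
qed

text \<open>Truncation of \<open>w\<close> at its almost everywhere bound gives the exponent 0. The
  factor 2 bounds a difference of two values; at \<open>x = y\<close> the right side is 0 because
  \<open>0 powr 0 = 0\<close>, and so is the left side.\<close>

lemma holder_rep_base: "\<delta> > 0 \<Longrightarrow> \<exists>\<phi>. holder_rep \<Omega> w 0 \<delta> \<phi>"
proof -
  assume "\<delta> > 0"
  then obtain C where C: "C \<ge> 0" "AE x in lborel. x \<in> core \<delta> \<longrightarrow> \<bar>w x\<bar> \<le> C"
    using w_bounded by blast
  define \<phi> where "\<phi> x = max (- C) (min C (w x))" for x
  have b: "\<bar>\<phi> x\<bar> \<le> C" for x unfolding \<phi>_def using C by auto
  have "\<bar>\<phi> x - \<phi> y\<bar> \<le> 2 * C * dist x y powr 0" for x y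
  proof (cases "x = y")
    case False
    then show ?thesis using b[of x] b[of y] by (simp add: powr_def)
  qed simp
  moreover have "\<bar>\<phi> x\<bar> \<le> 2 * C" for x using b[of x] C by simp
  moreover have "\<phi> \<in> borel_measurable borel" unfolding \<phi>_def by measurable
  moreover have "AE x in lborel. x \<in> core \<delta> \<longrightarrow> \<phi> x = w x"
    using C(2) by eventually_elim (auto simp: \<phi>_def)
  ultimately have "holder_rep \<Omega> w 0 \<delta> \<phi>" unfolding holder_rep_def using C(1) by (intro conjI exI[of _ "2 * C"]) auto
  then show ?thesis by blast
qed

lemma K_integrable:
  assumes \<rho>: "0 < \<rho>" "\<rho> \<le> 1"
  shows "integrable lborel (K \<rho>)"
  by (rule integrable_dominated_powr[OF K_measurable[OF \<rho>] K_bounds(1)[OF \<rho>] K_bounds(2)[OF \<rho>] less_imp_le[OF b_pos(1)] b_less])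

text \<open>On \<open>core \<delta>\<close> only the values of \<open>w\<close> on \<open>core (\<delta>/2)\<close> enter the potential.\<close>

lemma rep_local:
  assumes \<delta>: "\<delta> > 0" and \<phi>: "holder_rep \<Omega> w \<beta> (\<delta> / 2) \<phi>"
  defines g_def: "g \<equiv> (\<lambda>y. indicator (core (\<delta> / 2)) y * max (\<phi> y) 0)"
  obtains \<rho> \<kappa> H where "0 < \<rho>" "\<rho> \<le> 1" "\<rho> \<le> \<delta> / 2" "\<forall>k. Ck k H"
    "\<forall>is. set is \<subseteq> Basis \<longrightarrow> (\<exists>C. \<forall>x. \<bar>partials is H x\<bar> \<le> C)"
    "AE x in lborel. x \<in> core \<delta> \<longrightarrow> w x = \<kappa> * (LINT y|lborel. g y * K \<rho> (x - y)) + H x"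
    "g \<in> borel_measurable borel" "\<exists>C\<ge>0. (\<forall>x. \<bar>g x\<bar> \<le> C) \<and>
      (\<forall>x\<in>core (\<delta>/2). \<forall>y\<in>core (\<delta>/2). \<bar>g x - g y\<bar> \<le> C * dist x y powr \<beta>)"
    "\<And>x. x \<in> core \<delta> \<Longrightarrow> ball x \<rho> \<subseteq> core (\<delta> / 2)"
proof -
  \<comment> \<open>Below \<open>\<rho>0\<close> the representation is available, and
    \<open>\<rho> \<le> \<delta> / 2\<close> keeps the kernel inside
    \<open>core (\<delta> / 2)\<close>.\<close>
  define \<rho> where "\<rho> = min (\<delta> / 2) (\<rho>0 / 2)"
  have \<rho>: "0 < \<rho>" "\<rho> < \<rho>0" "\<rho> \<le> \<delta> / 2" "\<rho> \<le> 1" unfolding \<rho>_def using \<delta> \<rho>0 by auto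
  note [measurable] = K_measurable[OF \<rho>(1,4)]
  have [measurable]: "\<phi> \<in> borel_measurable borel" using \<phi> by (simp add: holder_rep_def)
  have [measurable]: "core (\<delta> / 2) \<in> sets borel" by (rule borel_open[OF open_inner_set])
  have gm[measurable]: "g \<in> borel_measurable borel" unfolding g_def by measurable
  have sub: "ball x \<rho> \<subseteq> core (\<delta> / 2)" if "x \<in> core \<delta>" for x
  proof
    fix y assume "y \<in> ball x \<rho>"
    then have "y \<in> core (\<delta> - \<rho>)" using inner_set_near[OF that, of y \<rho>] by simp
    then show "y \<in> core (\<delta> / 2)" using inner_set_mono[of "\<delta> / 2" "\<delta> - \<rho>" \<Omega>] \<rho>(3) by auto
  qed
  obtain \<kappa> H where H: "\<forall>k. Ck k H" "\<forall>is. set is \<subseteq> Basis \<longrightarrow> (\<exists>C. \<forall>x. \<bar>partials is H x\<bar> \<le> C)"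
    and ae: "AE x in lborel. x \<in> core \<rho> \<longrightarrow> w x = \<kappa> * (LINT y|lborel. max (w y) 0 * K \<rho> (x - y)) + H x"
    using rep[OF \<rho>(1,2)] unfolding K_def q_def by blast
  have ae2: "AE x in lborel. x \<in> core (\<delta> / 2) \<longrightarrow> \<phi> x = w x" using \<phi> by (simp add: holder_rep_def)
  have "AE x in lborel. x \<in> core \<delta> \<longrightarrow> w x = \<kappa> * (LINT y|lborel. g y * K \<rho> (x - y)) + H x"
    using ae
  proof eventually_elim
    case (elim x)
    show ?case
    proof
      assume x: "x \<in> core \<delta>"
      have "(LINT y|lborel. max (w y) 0 * K \<rho> (x - y)) = (LINT y|lborel. g y * K \<rho> (x - y))"
      proof (rule integral_cong_AE)
        show "AE y in lborel. max (w y) 0 * K \<rho> (x - y) = g y * K \<rho> (x - y)"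
          using ae2
        proof eventually_elim
          case (elim y)
          show ?case
          proof (cases "norm (x - y) < \<rho>")
            case True
            then have "y \<in> core (\<delta> / 2)" using sub[OF x] by (auto simp: dist_norm subset_iff)
            then show ?thesis using elim by (simp add: g_def)
          next
            case False
            then have "K \<rho> (x - y) = 0" by (intro K_bounds(1)[OF \<rho>(1,4)]) simp
            then show ?thesis by simp
          qed
        qed
      qed measurable
      moreover have "x \<in> core \<rho>" using x inner_set_mono[of \<rho> \<delta> \<Omega>] \<rho> by auto
      ultimately show "w x = \<kappa> * (LINT y|lborel. g y * K \<rho> (x - y)) + H x" using elim by simp
    qed
  qed
  moreover have "\<exists>C\<ge>0. (\<forall>x. \<bar>g x\<bar> \<le> C) \<and>
      (\<forall>x\<in>core (\<delta>/2). \<forall>y\<in>core (\<delta>/2). \<bar>g x - g y\<bar> \<le> C * dist x y powr \<beta>)"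
  proof -
    obtain C where C: "C \<ge> 0" "\<forall>x. \<bar>\<phi> x\<bar> \<le> C"
       "\<forall>x\<in>core (\<delta>/2). \<forall>y\<in>core (\<delta>/2). \<bar>\<phi> x - \<phi> y\<bar> \<le> C * dist x y powr \<beta>"
      using \<phi> unfolding holder_rep_def by blast
    have "\<bar>g x\<bar> \<le> C" for x
    proof -
      have "\<bar>\<phi> x\<bar> \<le> C" using C by blast
      then show ?thesis unfolding g_def using C(1) by (auto simp: indicator_def)
    qed
    moreover have "\<bar>g x - g y\<bar> \<le> C * dist x y powr \<beta>" if "x\<in>core (\<delta>/2)" "y\<in>core (\<delta>/2)" for x y
    proof -
      have "\<bar>g x - g y\<bar> \<le> \<bar>\<phi> x - \<phi> y\<bar>" unfolding g_def using that by (auto simp: max_def)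
      then show ?thesis using C(3) that by (meson order_trans)
    qed
    ultimately show ?thesis using C(1) by blast
  qed
  ultimately show thesis using that \<rho> H gm sub by blast
qed

text \<open>One pass through the representation: the density inherits the exponent
  \<open>\<beta>\<close> from the version on the larger set, the potential improves it to
  \<open>\<theta>\<close>, and the smooth remainder, being Lipschitz, is Hoelder with every exponent
  up to 1 on a bounded set.\<close>

lemma holder_rep_step:
  assumes \<delta>: "\<delta> > 0" and IH: "\<exists>\<phi>. holder_rep \<Omega> w \<beta> (\<delta> / 2) \<phi>"
    and th: "0 \<le> \<beta>" "\<beta> \<le> \<theta>" "\<theta> \<le> 1" "b + \<theta> - \<beta> < real DIM('a)"
  shows "\<exists>\<phi>. holder_rep \<Omega> w \<theta> \<delta> \<phi>"
proof -
  obtain \<phi> where \<phi>: "holder_rep \<Omega> w \<beta> (\<delta> / 2) \<phi>" using IH by blast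
  define g where "g y = indicator (core (\<delta> / 2)) y * max (\<phi> y) 0" for y
  show ?thesis
  proof (rule rep_local[OF \<delta> \<phi>, folded g_def])
  fix \<rho> \<kappa> H
  assume \<rho>: "0 < \<rho>" "\<rho> \<le> 1" "\<rho> \<le> \<delta> / 2" and H: "\<forall>k. Ck k H"
    "\<forall>is. set is \<subseteq> Basis \<longrightarrow> (\<exists>C. \<forall>x. \<bar>partials is H x\<bar> \<le> C)"
    and ae: "AE x in lborel. x \<in> core \<delta> \<longrightarrow> w x = \<kappa> * (LINT y|lborel. g y * K \<rho> (x - y)) + H x"
    and gm[measurable]: "g \<in> borel_measurable borel" and gC: "\<exists>C\<ge>0. (\<forall>x. \<bar>g x\<bar> \<le> C) \<and>
      (\<forall>x\<in>core (\<delta>/2). \<forall>y\<in>core (\<delta>/2). \<bar>g x - g y\<bar> \<le> C * dist x y powr \<beta>)"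
    and sub: "\<And>x. x \<in> core \<delta> \<Longrightarrow> ball x \<rho> \<subseteq> core (\<delta> / 2)"
  note [measurable] = K_measurable[OF \<rho>(1,2)]
  obtain G where G: "G \<ge> 0" "\<And>x. \<bar>g x\<bar> \<le> G"
      "\<And>x y. x\<in>core (\<delta>/2) \<Longrightarrow> y\<in>core (\<delta>/2) \<Longrightarrow> \<bar>g x - g y\<bar> \<le> G * dist x y powr \<beta>"
    using gC by blast
  obtain D where D: "D > 0" "\<And>x y. x \<in> \<Omega> \<Longrightarrow> y \<in> \<Omega> \<Longrightarrow> dist x y \<le> D" using \<Omega>_diam by blast
  have in\<Omega>: "x \<in> \<Omega>" if "x \<in> core \<delta>" for x using inner_set_subset[of \<delta> \<Omega>] \<delta> that by auto
  have "\<exists>C\<ge>0. \<forall>x x'. ball x \<rho> \<subseteq> core (\<delta> / 2) \<longrightarrow> ball x' \<rho> \<subseteq> core (\<delta> / 2) \<longrightarrow>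
     x \<in> core (\<delta> / 2) \<longrightarrow> dist x x' \<le> D \<longrightarrow>
     \<bar>(LINT y|lborel. g y * K \<rho> (x - y)) - (LINT y|lborel. g y * K \<rho> (x' - y))\<bar> \<le> C * dist x x' powr \<theta>"
    by (rule holder_gain[where A = A and b = b and k = "K \<rho>" and \<rho> = \<rho> and \<beta> = \<beta> and \<theta> = \<theta> and g = g and G = G])
      ((rule less_imp_le[OF A_pos] less_imp_le[OF b_pos(1)] b_less K_measurable[OF \<rho>(1,2)]
      K_bounds(1)[OF \<rho>(1,2)] K_bounds(2)[OF \<rho>(1,2)] K_bounds(3)[OF \<rho>(1,2)] th gm G(2) G(3); assumption)+)
  then obtain C1 where C1: "C1 \<ge> 0" and C1h: "\<And>x x'. ball x \<rho> \<subseteq> core (\<delta> / 2) \<Longrightarrow> ball x' \<rho> \<subseteq> core (\<delta> / 2) \<Longrightarrow>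
     x \<in> core (\<delta> / 2) \<Longrightarrow> dist x x' \<le> D \<Longrightarrow>
     \<bar>(LINT y|lborel. g y * K \<rho> (x - y)) - (LINT y|lborel. g y * K \<rho> (x' - y))\<bar> \<le> C1 * dist x x' powr \<theta>"
    by (elim exE conjE) (fast)
  obtain CH where CH: "\<And>x. \<bar>H x\<bar> \<le> CH" using H(2)[rule_format, of "[]"] by auto
  have "\<forall>i\<in>Basis. \<exists>C. \<forall>x. \<bar>partial i H x\<bar> \<le> C"
  proof
    fix i :: 'a assume "i \<in> Basis"
    then show "\<exists>C. \<forall>x. \<bar>partial i H x\<bar> \<le> C" using H(2)[rule_format, of "[i]"] by auto
  qed
  from bchoice[OF this] obtain cH where cH: "\<And>i x. i \<in> Basis \<Longrightarrow> \<bar>partial i H x\<bar> \<le> cH i" by blast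
  define LH where "LH = (\<Sum>i\<in>(Basis::'a set). cH i)"
  have cH0: "cH i \<ge> 0" if "i \<in> Basis" for i using cH[OF that, of undefined] by linarith
  have LH: "\<bar>partial i H x\<bar> \<le> LH" if "i \<in> Basis" for i x
    using cH[OF that, of x] member_le_sum[of i Basis cH] that cH0 unfolding LH_def by fastforce
  have LH0: "LH \<ge> 0" unfolding LH_def by (intro sum_nonneg cH0)
  have HL: "\<bar>H x - H y\<bar> \<le> (n * LH) * norm (x - y)" for x y
    unfolding n_def by (rule Ck_Lipschitz[OF H(1)[rule_format] LH])
  define V where "V x = \<kappa> * (LINT y|lborel. g y * K \<rho> (x - y)) + H x" for x
  define I where "I = (LINT y|lborel. \<bar>K \<rho> y\<bar>)"
  have "(\<lambda>x. LINT y|lborel. g y * K \<rho> (x - y)) \<in> borel_measurable borel"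
    by (rule lborel.borel_measurable_lebesgue_integral) measurable
  moreover have "H \<in> borel_measurable borel"
    using H(1) Ck_continuous borel_measurable_continuous_onI by blast
  ultimately have [measurable]: "V \<in> borel_measurable borel" unfolding V_def by measurable
  have Vb: "\<bar>V x\<bar> \<le> \<bar>\<kappa>\<bar> * (G * I) + CH" for x
  proof -
    have ik: "integrable lborel (\<lambda>y. K \<rho> (x - y))"
      using integral_lborel_reflect(2)[OF K_measurable[OF \<rho>(1,2)], of x] K_integrable[OF \<rho>(1,2)] by simp
    have "norm (LINT y|lborel. g y * K \<rho> (x - y)) \<le> (LINT y|lborel. G * \<bar>K \<rho> (x - y)\<bar>)"
    proof (rule integral_norm_bound_AE)
      show "integrable lborel (\<lambda>y. g y * K \<rho> (x - y))" by (rule bounded_mult_integrable[OF ik gm G(2)])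
      show "integrable lborel (\<lambda>y. G * \<bar>K \<rho> (x - y)\<bar>)" using ik by simp
      show "AE y in lborel. norm (g y * K \<rho> (x - y)) \<le> G * \<bar>K \<rho> (x - y)\<bar>"
        using G by (auto simp: abs_mult intro!: mult_right_mono)
    qed
    also have "\<dots> = G * I"
      using integral_lborel_reflect(1)[of "\<lambda>y. \<bar>K \<rho> y\<bar>" x] by (simp add: I_def)
    finally have "\<bar>\<kappa>\<bar> * \<bar>LINT y|lborel. g y * K \<rho> (x - y)\<bar> \<le> \<bar>\<kappa>\<bar> * (G * I)" by (intro mult_left_mono) auto
    then show ?thesis unfolding V_def using CH[of x] abs_triangle_ineq[of "\<kappa> * (LINT y|lborel. g y * K \<rho> (x - y))" "H x"]
      by (simp add: abs_mult)
  qed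
  define C2 where "C2 = \<bar>\<kappa>\<bar> * C1 + n * LH * D powr (1 - \<theta>)"
  have C2: "C2 \<ge> 0" unfolding C2_def using C1 LH0 n1 by (intro add_nonneg_nonneg mult_nonneg_nonneg) auto
  have Vh: "\<bar>V x - V y\<bar> \<le> C2 * dist x y powr \<theta>" if x: "x \<in> core \<delta>" and y: "y \<in> core \<delta>" for x y
  proof -
    have dxy: "dist x y \<le> D" using D in\<Omega> x y by blast
    have xin: "x \<in> core (\<delta> / 2)" using inner_set_mono[of "\<delta>/2" \<delta> \<Omega>] \<delta> x by auto
    have 1: "\<bar>\<kappa> * ((LINT z|lborel. g z * K \<rho> (x - z)) - (LINT z|lborel. g z * K \<rho> (y - z)))\<bar> \<le> \<bar>\<kappa>\<bar> * (C1 * dist x y powr \<theta>)"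
      unfolding abs_mult by (intro mult_left_mono C1h sub x y xin dxy) auto
    have 2: "\<bar>H x - H y\<bar> \<le> n * LH * D powr (1 - \<theta>) * dist x y powr \<theta>"
    proof (cases "x = y")
      case False
      then have "norm (x - y) = dist x y powr (1 - \<theta>) * dist x y powr \<theta>"
        by (simp add: dist_norm powr_add[symmetric])
      also have "\<dots> \<le> D powr (1 - \<theta>) * dist x y powr \<theta>"
        using dxy th by (intro mult_right_mono powr_mono2) auto
      finally have "n * LH * norm (x - y) \<le> n * LH * (D powr (1 - \<theta>) * dist x y powr \<theta>)"
        using LH0 n1 by (intro mult_left_mono mult_nonneg_nonneg) auto
      then show ?thesis using HL[of x y] by (simp add: mult.assoc)
    qed simp
    have "\<bar>V x - V y\<bar> \<le> \<bar>\<kappa> * ((LINT z|lborel. g z * K \<rho> (x - z)) - (LINT z|lborel. g z * K \<rho> (y - z)))\<bar> + \<bar>H x - H y\<bar>"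
      unfolding V_def by (simp add: algebra_simps)
    also have "\<dots> \<le> C2 * dist x y powr \<theta>" using 1 2 unfolding C2_def by (simp add: algebra_simps)
    finally show ?thesis .
  qed
  have [measurable]: "core \<delta> \<in> sets borel" by (rule borel_open[OF open_inner_set])
  define \<phi>' where "\<phi>' x = indicator (core \<delta>) x * V x" for x
  have m: "\<phi>' \<in> borel_measurable borel" unfolding \<phi>'_def by measurable
  have ae': "AE x in lborel. x \<in> core \<delta> \<longrightarrow> \<phi>' x = w x"
    using ae by eventually_elim (auto simp: \<phi>'_def V_def)
  have CH0: "CH \<ge> 0" using CH[of undefined] by linarith
  have "0 \<le> I" unfolding I_def by (intro integral_nonneg_AE) auto
  then have GI: "0 \<le> \<bar>\<kappa>\<bar> * (G * I) + CH" using G(1) CH0 by simp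
  let ?C = "\<bar>\<kappa>\<bar> * (G * I) + CH + C2"
  have "\<bar>\<phi>' x\<bar> \<le> ?C" for x
    using Vb[of x] C2 GI by (auto simp: \<phi>'_def indicator_def)
  moreover have "\<bar>\<phi>' x - \<phi>' y\<bar> \<le> ?C * dist x y powr \<theta>" if "x \<in> core \<delta>" "y \<in> core \<delta>" for x y
  proof -
    have "C2 * dist x y powr \<theta> \<le> ?C * dist x y powr \<theta>" using GI by (intro mult_right_mono) auto
    then show ?thesis using Vh[OF that] that by (simp add: \<phi>'_def)
  qed
  ultimately have "holder_rep \<Omega> w \<theta> \<delta> \<phi>'"
    unfolding holder_rep_def using m ae' C2 GI by (intro conjI exI[of _ ?C]) auto
  then show ?thesis by blast
  qed
qed

text \<open>The gain per step is half of the gap \<open>n - b\<close>, whatever the current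
  exponent, so the exponent 1 is reached after finitely many steps. Each step doubles the distance
  to the boundary, which is harmless because the induction claim is about all
  \<open>\<delta>\<close>.\<close>

lemma holder_rep_Lipschitz: "\<delta> > 0 \<Longrightarrow> \<exists>\<phi>. holder_rep \<Omega> w 1 \<delta> \<phi>"
proof -
  define \<sigma> where "\<sigma> = (n - b) / 2"
  have \<sigma>: "\<sigma> > 0" "b + \<sigma> < n" unfolding \<sigma>_def using b_pos by (auto simp: field_simps)
  have *: "\<forall>\<delta>>0. \<exists>\<phi>. holder_rep \<Omega> w (min 1 (real k * \<sigma>)) \<delta> \<phi>" for k
  proof (induction k)
    case 0 then show ?case using holder_rep_base by simp
  next
    case (Suc k)
    show ?case
    proof (intro allI impI)
      fix \<delta> :: real assume \<delta>: "\<delta> > 0"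
      have le: "min 1 (real k * \<sigma>) \<le> min 1 (real (Suc k) * \<sigma>)"
        using \<sigma> by (intro min.mono mult_right_mono) auto
      have "real (Suc k) * \<sigma> = real k * \<sigma> + \<sigma>" by (simp add: algebra_simps)
      then have lt: "b + min 1 (real (Suc k) * \<sigma>) - min 1 (real k * \<sigma>) < real DIM('a)"
        using \<sigma> n_def by (auto simp: min_def)
      show "\<exists>\<phi>. holder_rep \<Omega> w (min 1 (real (Suc k) * \<sigma>)) \<delta> \<phi>"
        by (rule holder_rep_step[OF \<delta> _ _ le _ lt]) (use Suc \<delta> \<sigma> in auto)
    qed
  qed
  assume "\<delta> > 0"
  obtain k :: nat where "1 / \<sigma> < real k" using reals_Archimedean2 by blast
  then have "min 1 (real k * \<sigma>) = 1" using \<sigma> by (simp add: field_simps)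
  then show ?thesis using *[of k] \<open>\<delta> > 0\<close> by auto
qed

end

section \<open>Derivatives of the potential of a Lipschitz density\<close>

lemma radial_measurable:
  assumes "\<And>t. t > 0 \<Longrightarrow> isCont h t"
  shows "(\<lambda>x::'a::euclidean_space. h ((norm x)\<^sup>2) :: real) \<in> borel_measurable borel"
proof -
  have "continuous_on {0<..} h"
    using assms by (auto intro: continuous_at_imp_continuous_on)
  then have "continuous_on (- {0}) (\<lambda>x::'a. h ((norm x)\<^sup>2))"
    by (rule continuous_on_compose2) (auto intro!: continuous_intros)
  then have "(\<lambda>x::'a. indicator (- {0}) x *\<^sub>R h ((norm x)\<^sup>2)) \<in> borel_measurable borel"
    by (intro borel_measurable_continuous_on_indicator) auto
  moreover have "(\<lambda>x::'a. indicator {0} x * h 0) \<in> borel_measurable borel" by measurable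
  ultimately have "(\<lambda>x::'a. indicator (- {0}) x *\<^sub>R h ((norm x)\<^sup>2) + indicator {0} x * h 0) \<in> borel_measurable borel"
    by (rule borel_measurable_add)
  moreover have "(\<lambda>x::'a. indicator (- {0}) x *\<^sub>R h ((norm x)\<^sup>2) + indicator {0} x * h 0) = (\<lambda>x. h ((norm x)\<^sup>2))"
    by (auto simp: indicator_def)
  ultimately show ?thesis by simp
qed

abbreviation "E (m::nat) \<equiv> 1 / (real m + 1)"

lemma E: "E \<longlonglongrightarrow> 0" "E (m::nat) > 0" "E (m::nat) \<ge> 0"
proof -
  have "(\<lambda>m. 1 / real (Suc m)) \<longlonglongrightarrow> 0" by (rule lim_1_over_n[THEN LIMSEQ_Suc])
  then show "E \<longlonglongrightarrow> 0" by (simp add: add.commute)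
qed auto

context potential_representation
begin

text \<open>The kernel and its partial derivatives of order one and two, with the regularisation
  \<open>e\<close> as a parameter. At \<open>e = 0\<close> the formulas remain, but
  \<open>Q1\<close> and \<open>Q2\<close> need not be integrable near 0.\<close>

definition Q0 :: "real \<Rightarrow> real \<Rightarrow> 'a \<Rightarrow> real" where
  "Q0 \<rho> e p = ker0 q (\<rho>\<^sup>2) e ((norm p)\<^sup>2)"
definition Q1 :: "real \<Rightarrow> real \<Rightarrow> 'a \<Rightarrow> 'a \<Rightarrow> real" where
  "Q1 \<rho> e i p = 2 * ker1 q (\<rho>\<^sup>2) e ((norm p)\<^sup>2) * (p \<bullet> i)"
definition Q2 :: "real \<Rightarrow> real \<Rightarrow> 'a \<Rightarrow> 'a \<Rightarrow> 'a \<Rightarrow> real" where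
  "Q2 \<rho> e i j p = 4 * ker2 q (\<rho>\<^sup>2) e ((norm p)\<^sup>2) * (p \<bullet> i) * (p \<bullet> j) + 2 * ker1 q (\<rho>\<^sup>2) e ((norm p)\<^sup>2) * (j \<bullet> i)"
text \<open>Convolution with the density recentred at \<open>x\<close>. For an integrable kernel of
  mean zero it is the ordinary convolution, but it also makes sense for kernels too singular to be
  integrated, such as \<open>Q1 \<rho> 0 i\<close> when \<open>s \<le> 1/2\<close>.\<close>

definition T :: "('a \<Rightarrow> real) \<Rightarrow> ('a \<Rightarrow> real) \<Rightarrow> 'a \<Rightarrow> real" where
  "T g Q x = (LINT y|lborel. (g y - g x) * Q (x - y))"

lemma Q0_props:
  assumes "0 < \<rho>" "e > 0"
  shows "Ck k (Q0 \<rho> e)" "bdd_supp (Q0 \<rho> e)" "partial i (Q0 \<rho> e) = Q1 \<rho> e i"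
proof -
  have eq: "Q0 \<rho> e = (\<lambda>z. ker0 q (\<rho>\<^sup>2) e ((norm (z - 0))\<^sup>2))" by (simp add: Q0_def[abs_def])
  show "Ck k (Q0 \<rho> e)" unfolding eq by (rule Ck_radial[OF kdiff_ker0 assms(2)])
  show "bdd_supp (Q0 \<rho> e)" unfolding eq by (rule bdd_supp_radial[OF ker0_eq_0])
  have "partial i (Q0 \<rho> e) p = Q1 \<rho> e i p" for p
    unfolding eq Q1_def
    by (subst partial_radial[OF DERIV_ker0]) (use assms in \<open>auto intro: less_le_trans[of _ 0]\<close>)
  then show "partial i (Q0 \<rho> e) = Q1 \<rho> e i" by blast
qed

lemma Q1_props:
  assumes \<rho>: "0 < \<rho>" and e: "e > 0" and i: "i \<in> Basis"
  shows "Ck k (Q1 \<rho> e i)" "bdd_supp (Q1 \<rho> e i)" "partial j (Q1 \<rho> e i) = Q2 \<rho> e i j"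
proof -
  show "Ck k (Q1 \<rho> e i)" using Q0_props(1)[OF \<rho> e, of "Suc k"] i by (simp add: Q0_props(3)[OF \<rho> e])
  show "bdd_supp (Q1 \<rho> e i)" using bdd_supp_partial[OF Q0_props(2)[OF \<rho> e], of i] by (simp add: Q0_props(3)[OF \<rho> e])
  have "partial j (Q1 \<rho> e i) p = Q2 \<rho> e i j p" for p
  proof -
    have "- e < (norm (p - 0))\<^sup>2" using e by (auto intro: less_le_trans[of _ 0])
    from has_derivative_radial[OF DERIV_ker1[OF this], of q "\<rho>\<^sup>2"]
    have d: "((\<lambda>z. ker1 q (\<rho>\<^sup>2) e ((norm z)\<^sup>2)) has_derivative (\<lambda>v. ker2 q (\<rho>\<^sup>2) e ((norm p)\<^sup>2) * (2 * (p \<bullet> v)))) (at p)"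
      by simp
    have d2: "((\<lambda>z. z \<bullet> i) has_derivative (\<lambda>h. h \<bullet> i)) (at p)"
      by (auto intro!: derivative_eq_intros)
    have "((\<lambda>p. 2 * ker1 q (\<rho>\<^sup>2) e ((norm p)\<^sup>2) * (p \<bullet> i)) has_derivative
       (\<lambda>h. 2 * ker1 q (\<rho>\<^sup>2) e ((norm p)\<^sup>2) * (h \<bullet> i) + 2 * (ker2 q (\<rho>\<^sup>2) e ((norm p)\<^sup>2) * (2 * (p \<bullet> h))) * (p \<bullet> i))) (at p)"
      by (rule has_derivative_mult[OF has_derivative_mult_right[OF d] d2])
    from partial_eq[OF this, of j] show ?thesis
      unfolding Q1_def[abs_def] Q2_def by (simp add: algebra_simps)
  qed
  then show "partial j (Q1 \<rho> e i) = Q2 \<rho> e i j" by blast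
qed

lemma Q_measurable:
  assumes "e \<ge> 0"
  shows "Q0 \<rho> e \<in> borel_measurable borel" "Q1 \<rho> e i \<in> borel_measurable borel" "Q2 \<rho> e i j \<in> borel_measurable borel"
proof -
  have c1: "isCont (ker1 q (\<rho>\<^sup>2) e) t" if "t > 0" for t
    using DERIV_isCont[OF DERIV_ker1[of e t]] that assms by simp
  have c0: "isCont (ker0 q (\<rho>\<^sup>2) e) t" if "t > 0" for t
    using DERIV_isCont[OF DERIV_ker0[of e t]] that assms by simp
  have c2: "isCont (ker2 q (\<rho>\<^sup>2) e) t" if "t > 0" for t
  proof -
    have "continuous_on {0<..} (\<lambda>t. beta (\<rho>\<^sup>2) t * (t + e) powr (- q) + q * zeta (\<rho>\<^sup>2) t * (t + e) powr (- q - 1))"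
      by (intro continuous_intros continuous_on_beta continuous_on_zeta) (use assms in auto)
    then show ?thesis using that unfolding ker2_def[abs_def]
      by (simp add: continuous_on_eq_continuous_at)
  qed
  note [measurable] = radial_measurable[OF c0] radial_measurable[OF c1] radial_measurable[OF c2]
  show "Q0 \<rho> e \<in> borel_measurable borel" unfolding Q0_def[abs_def] by measurable
  show "Q1 \<rho> e i \<in> borel_measurable borel" unfolding Q1_def[abs_def] by measurable
  show "Q2 \<rho> e i j \<in> borel_measurable borel" unfolding Q2_def[abs_def] by measurable
qed

lemma Q_zero:
  assumes "norm p \<ge> \<rho>" "0 < \<rho>"
  shows "Q0 \<rho> e p = 0" "Q1 \<rho> e i p = 0" "Q2 \<rho> e i j p = 0"
proof -
  have "(norm p)\<^sup>2 \<ge> \<rho>\<^sup>2" using assms by (intro power_mono) auto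
  then show "Q0 \<rho> e p = 0" "Q1 \<rho> e i p = 0" "Q2 \<rho> e i j p = 0"
    by (simp_all add: Q0_def Q1_def Q2_def ker0_eq_0 ker1_eq_0 ker2_eq_0)
qed

lemma Q1_bound:
  assumes "p \<noteq> 0" "e \<ge> 0" "0 < \<rho>" "i \<in> Basis"
  shows "\<bar>Q1 \<rho> e i p\<bar> \<le> (2 * \<rho>\<^sup>2) * norm p powr (- (2 * q - 1))"
proof -
  have "\<bar>ker1 q (\<rho>\<^sup>2) e ((norm p)\<^sup>2)\<bar> \<le> \<rho>\<^sup>2 * ((norm p)\<^sup>2) powr (- q)"
    using assms q_pos by (intro ker1_bound) auto
  moreover have "\<bar>p \<bullet> i\<bar> \<le> norm p" using assms(4) by (rule Basis_le_norm)
  ultimately have "\<bar>ker1 q (\<rho>\<^sup>2) e ((norm p)\<^sup>2)\<bar> * \<bar>p \<bullet> i\<bar> \<le> (\<rho>\<^sup>2 * ((norm p)\<^sup>2) powr (- q)) * norm p"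
    by (intro mult_mono) auto
  also have "\<dots> = \<rho>\<^sup>2 * norm p powr (- (2 * q - 1))"
    using assms(1) by (simp add: powr_norm_sq powr_diff powr_minus field_simps)
  finally show ?thesis unfolding Q1_def by (simp add: abs_mult)
qed

lemma Q2_bound:
  assumes "p \<noteq> 0" "e \<ge> 0" "0 < \<rho>" "i \<in> Basis" "j \<in> Basis"
  shows "\<bar>Q2 \<rho> e i j p\<bar> \<le> (4 * (1 + q) * \<rho>\<^sup>2 + 2 * \<rho>\<^sup>2) * norm p powr (- (2 * q))"
proof -
  have 1: "\<bar>ker1 q (\<rho>\<^sup>2) e ((norm p)\<^sup>2)\<bar> \<le> \<rho>\<^sup>2 * norm p powr (- (2 * q))"
    using ker1_bound[of "(norm p)\<^sup>2" e q "\<rho>\<^sup>2"] assms q_pos by (simp add: powr_norm_sq)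
  have 2: "\<bar>ker2 q (\<rho>\<^sup>2) e ((norm p)\<^sup>2)\<bar> \<le> (1 + q) * \<rho>\<^sup>2 * ((norm p)\<^sup>2) powr (- q - 1)"
    using assms q_pos by (intro ker2_bound) auto
  have wi: "\<bar>p \<bullet> i\<bar> \<le> norm p" "\<bar>p \<bullet> j\<bar> \<le> norm p" using assms by (auto intro: Basis_le_norm)
  have "\<bar>ker2 q (\<rho>\<^sup>2) e ((norm p)\<^sup>2)\<bar> * \<bar>p \<bullet> i\<bar> * \<bar>p \<bullet> j\<bar> \<le> ((1 + q) * \<rho>\<^sup>2 * ((norm p)\<^sup>2) powr (- q - 1)) * norm p * norm p"
    using q_pos by (intro mult_mono[OF mult_mono[OF 2 wi(1)] wi(2)] mult_nonneg_nonneg) auto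
  also have "\<dots> = (1 + q) * \<rho>\<^sup>2 * (((norm p)\<^sup>2) powr (- q - 1) * (norm p)\<^sup>2)" by (simp add: power2_eq_square)
  also have "((norm p)\<^sup>2) powr (- q - 1) * (norm p)\<^sup>2 = norm p powr (- (2 * q))"
    using assms(1) by (simp add: powr_diff powr_minus powr_norm_sq[symmetric] field_simps)
  finally have 3: "\<bar>4 * ker2 q (\<rho>\<^sup>2) e ((norm p)\<^sup>2) * (p \<bullet> i) * (p \<bullet> j)\<bar> \<le> 4 * ((1 + q) * \<rho>\<^sup>2 * norm p powr (- (2 * q)))"
    by (simp add: abs_mult)
  have ji: "\<bar>j \<bullet> i\<bar> \<le> 1" using assms by (simp add: inner_Basis)
  have "\<bar>2 * ker1 q (\<rho>\<^sup>2) e ((norm p)\<^sup>2) * (j \<bullet> i)\<bar> = (2 * \<bar>ker1 q (\<rho>\<^sup>2) e ((norm p)\<^sup>2)\<bar>) * \<bar>j \<bullet> i\<bar>"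
    by (simp add: abs_mult)
  also have "\<dots> \<le> (2 * (\<rho>\<^sup>2 * norm p powr (- (2 * q)))) * 1"
    using 1 ji by (intro mult_mono) auto
  finally have 4: "\<bar>2 * ker1 q (\<rho>\<^sup>2) e ((norm p)\<^sup>2) * (j \<bullet> i)\<bar> \<le> 2 * (\<rho>\<^sup>2 * norm p powr (- (2 * q)))" by simp
  have "\<bar>Q2 \<rho> e i j p\<bar> \<le> 4 * ((1 + q) * \<rho>\<^sup>2 * norm p powr (- (2 * q))) + 2 * (\<rho>\<^sup>2 * norm p powr (- (2 * q)))"
    unfolding Q2_def by (rule order_trans[OF abs_triangle_ineq add_mono[OF 3 4]])
  then show ?thesis by (simp add: algebra_simps)
qed

text \<open>The density may jump at the boundary of \<open>core (\<delta> / 2)\<close>; kernels of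
  range \<open>\<rho>\<close> centred in \<open>core \<delta>\<close> do not reach that
  boundary.\<close>

definition good :: "real \<Rightarrow> real \<Rightarrow> ('a \<Rightarrow> real) \<Rightarrow> real \<Rightarrow> bool" where
  "good \<delta> \<rho> g G \<longleftrightarrow> \<delta> > 0 \<and> 0 < \<rho> \<and> \<rho> \<le> 1 \<and> g \<in> borel_measurable borel \<and> 0 \<le> G \<and> (\<forall>x. \<bar>g x\<bar> \<le> G) \<and>
     (\<forall>x. x \<notin> core (\<delta> / 2) \<longrightarrow> g x = 0) \<and>
     (\<forall>x\<in>core (\<delta> / 2). \<forall>y\<in>core (\<delta> / 2). \<bar>g x - g y\<bar> \<le> G * norm (x - y)) \<and>
     (\<forall>x\<in>core \<delta>. ball x \<rho> \<subseteq> core (\<delta> / 2))"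

lemma inner_sub: "good \<delta> \<rho> g G \<Longrightarrow> x \<in> core \<delta> \<Longrightarrow> x \<in> core (\<delta> / 2)"
  using inner_set_mono[of "\<delta> / 2" \<delta> \<Omega>] by (auto simp: good_def)

lemma good_integrable:
  assumes "good \<delta> \<rho> g G" shows "integrable lborel g" "integrable lebesgue g"
proof -
  have [measurable]: "g \<in> borel_measurable borel" "\<Omega> \<in> sets borel" using assms \<Omega> by (auto simp: good_def)
  have sub: "core (\<delta> / 2) \<subseteq> \<Omega>" using assms by (intro inner_set_subset) (auto simp: good_def)
  show i: "integrable lborel g"
  proof (rule Bochner_Integration.integrable_bound[where f = "\<lambda>x. G * indicator \<Omega> x"])
    have "emeasure lborel \<Omega> < \<infinity>" using \<Omega>(2) by (rule emeasure_bounded_finite)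
    then show "integrable lborel (\<lambda>x. G * indicator \<Omega> x :: real)"
      by (intro integrable_mult_right) (auto simp: integrable_indicator_iff)
    have "\<bar>g x\<bar> \<le> G * indicator \<Omega> x" for x
      using assms sub by (cases "x \<in> \<Omega>") (auto simp: good_def)
    then show "AE x in lborel. norm (g x) \<le> norm (G * indicator \<Omega> x :: real)"
      using assms by (auto simp: good_def)
  qed measurable
  then show "integrable lebesgue g" by (subst integrable_completion) auto
qed

text \<open>Subtracting \<open>g x\<close> is free because \<open>\<psi>\<close> has integral 0.
  Rewriting the convolution in this way before the limit \<open>e = 0\<close> lets the
  regularisation be removed after differentiation.\<close>

lemma conv_T:
  assumes g: "good \<delta> \<rho> g G" and \<psi>: "continuous_on UNIV \<psi>" "bdd_supp \<psi>" "(LINT y|lborel. \<psi> y) = 0"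
  shows "(LINT z|lebesgue. g z * \<psi> (id x - z)) = T g \<psi> x"
proof -
  have [measurable]: "g \<in> borel_measurable borel" using g by (simp add: good_def)
  have [measurable]: "\<psi> \<in> borel_measurable borel" using \<psi>(1) by (rule borel_measurable_continuous_onI)
  obtain C where C: "\<And>x. \<bar>\<psi> x\<bar> \<le> C" using bdd_supp_ucont(2)[OF \<psi>(1,2)] by blast
  obtain B where B: "\<And>x. norm x > B \<Longrightarrow> \<psi> x = 0" using \<psi>(2) unfolding bdd_supp_def by blast
  have i\<psi>: "integrable lborel \<psi>"
    by (rule integrable_dominated_powr[where D = "B + 1" and A = C and e = 0])
      (use C B in \<open>auto simp: powr_def\<close>)
  have i1: "integrable lborel (\<lambda>y. \<psi> (x - y))" using integral_lborel_reflect(2)[of \<psi> x] i\<psi> by simp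
  have i2: "integrable lborel (\<lambda>y. g y * \<psi> (x - y))"
    by (rule bounded_mult_integrable[OF i1]) (use g in \<open>auto simp: good_def\<close>)
  have "(LINT z|lebesgue. g z * \<psi> (id x - z)) = (LINT z|lborel. g z * \<psi> (x - z))"
    unfolding id_apply by (rule integral_completion) measurable
  also have "\<dots> = (LINT z|lborel. g z * \<psi> (x - z)) - g x * (LINT z|lborel. \<psi> (x - z))"
    using integral_lborel_reflect(1)[of \<psi> x] \<psi>(3) by simp
  also have "\<dots> = T g \<psi> x"
    unfolding T_def using i1 i2 by (simp add: left_diff_distrib)
  finally show ?thesis .
qed

text \<open>Both derivatives fall on the kernel, and derivatives of a compactly supported function
  have integral 0; hence the derivatives of the convolution take the form \<open>T\<close>.\<close>

lemma partial_conv: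
  assumes g: "good \<delta> \<rho> g G" and e: "e > 0" and i: "i \<in> Basis" and j: "j \<in> Basis"
  defines "V \<equiv> \<lambda>x. LINT z|lebesgue. g z * Q0 \<rho> e (id x - z)"
  shows "Ck k V" "partial i V = T g (Q1 \<rho> e i)" "partial j (partial i V) = T g (Q2 \<rho> e i j)"
proof -
  have \<rho>: "0 < \<rho>" using g by (simp add: good_def)
  have bl: "bounded_linear id" by (simp add: id_def bounded_linear_ident)
  note ig = good_integrable(2)[OF g]
  show "Ck k V" unfolding V_def by (rule conv_Ck[OF ig Q0_props(1,2)[OF \<rho> e] bl]) simp
  have 1: "partial i V = (\<lambda>x. LINT z|lebesgue. g z * Q1 \<rho> e i (id x - z))"
    unfolding V_def using conv_partial[OF ig Q0_props(1,2)[OF \<rho> e] bl] by (simp add: Q0_props(3)[OF \<rho> e])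
  have 2: "partial j (\<lambda>x. LINT z|lebesgue. g z * Q1 \<rho> e i (id x - z)) = (\<lambda>x. LINT z|lebesgue. g z * Q2 \<rho> e i j (id x - z))"
    using conv_partial[OF ig Q1_props(1,2)[OF \<rho> e i] bl] by (simp add: Q1_props(3)[OF \<rho> e i])
  have z1: "(LINT y|lborel. Q1 \<rho> e i y) = 0"
    using integral_partial_zero[OF Q0_props(1,2)[OF \<rho> e] i] by (simp add: Q0_props(3)[OF \<rho> e])
  have z2: "(LINT y|lborel. Q2 \<rho> e i j y) = 0"
    using integral_partial_zero[OF Q1_props(1,2)[OF \<rho> e i] j] by (simp add: Q1_props(3)[OF \<rho> e i])
  have c1: "continuous_on UNIV (Q1 \<rho> e i)" by (rule Ck_continuous[OF Q1_props(1)[OF \<rho> e i]])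
  have c2: "continuous_on UNIV (Q2 \<rho> e i j)"
    using Q1_props(1)[OF \<rho> e i, of 1] j by (simp add: Q1_props(3)[OF \<rho> e i])
  have b2: "bdd_supp (Q2 \<rho> e i j)"
    using bdd_supp_partial[OF Q1_props(2)[OF \<rho> e i], of j] by (simp add: Q1_props(3)[OF \<rho> e i])
  show "partial i V = T g (Q1 \<rho> e i)"
    unfolding 1 using conv_T[OF g c1 Q1_props(2)[OF \<rho> e i] z1] by auto
  show "partial j (partial i V) = T g (Q2 \<rho> e i j)"
    unfolding 1 2 using conv_T[OF g c2 b2 z2] by auto
qed

lemma T_limits:
  assumes g: "good \<delta> \<rho> g G" and B: "B \<ge> 0" and ee: "ee < real DIM('a) + 1"
    and m: "\<And>k. F k \<in> borel_measurable borel" "Z \<in> borel_measurable borel"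
    and z: "\<And>k x. norm x \<ge> \<rho> \<Longrightarrow> F k x = 0" "\<And>x. norm x \<ge> \<rho> \<Longrightarrow> Z x = 0"
    and bd: "\<And>k x. x \<noteq> 0 \<Longrightarrow> \<bar>F k x\<bar> \<le> B * norm x powr (- ee)" "\<And>x. x \<noteq> 0 \<Longrightarrow> \<bar>Z x\<bar> \<le> B * norm x powr (- ee)"
    and lim: "\<And>x. x \<noteq> 0 \<Longrightarrow> (\<lambda>k. F k x) \<longlonglongrightarrow> Z x"
    and \<alpha>: "0 < \<alpha>" "\<alpha> \<le> 1" "\<alpha> < real DIM('a) + 1 - ee"
  shows "\<exists>a. a \<longlonglongrightarrow> 0 \<and> (\<forall>m. \<forall>x\<in>core \<delta>. \<bar>T g (F m) x - T g Z x\<bar> \<le> a m)"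
    and "\<exists>C\<ge>0. (\<forall>x\<in>core \<delta>. \<bar>T g Z x\<bar> \<le> C) \<and>
       (\<forall>x\<in>core \<delta>. \<forall>x'\<in>core \<delta>. \<bar>T g Z x - T g Z x'\<bar> \<le> C * dist x x' powr \<alpha>)"
proof -
  have \<rho>: "0 < \<rho>" "\<rho> \<le> 1" and gm: "g \<in> borel_measurable borel" and G: "0 \<le> G"
    and gl: "\<And>x y. x \<in> core (\<delta> / 2) \<Longrightarrow> y \<in> core (\<delta> / 2) \<Longrightarrow> \<bar>g x - g y\<bar> \<le> G * norm (x - y)"
    and sub: "\<And>x. x \<in> core \<delta> \<Longrightarrow> ball x \<rho> \<subseteq> core (\<delta> / 2)"
    using g unfolding good_def by (blast+)
  let ?S = "core (\<delta> / 2)"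
  have "\<exists>a. a \<longlonglongrightarrow> 0 \<and> (\<forall>m. \<forall>x\<in>?S. ball x \<rho> \<subseteq> ?S \<longrightarrow> \<bar>T g (F m) x - T g Z x\<bar> \<le> a m)"
    unfolding T_def
    by (rule singular_conv(1)[where q = F and ?q0.0 = Z and g = g and S = ?S and A = B and e = ee and \<rho> = \<rho> and L = G and \<alpha> = \<alpha>,
        OF B ee \<rho> m z bd lim gm G gl \<alpha>])
  then obtain a where a: "a \<longlonglongrightarrow> 0" "\<And>m x. x \<in> ?S \<Longrightarrow> ball x \<rho> \<subseteq> ?S \<Longrightarrow> \<bar>T g (F m) x - T g Z x\<bar> \<le> a m"
    by blast
  show "\<exists>a. a \<longlonglongrightarrow> 0 \<and> (\<forall>m. \<forall>x\<in>core \<delta>. \<bar>T g (F m) x - T g Z x\<bar> \<le> a m)"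
    by (intro exI[of _ a] conjI allI ballI a sub inner_sub[OF g])
  have "\<exists>C\<ge>0. (\<forall>x\<in>?S. ball x \<rho> \<subseteq> ?S \<longrightarrow> \<bar>T g Z x\<bar> \<le> C) \<and>
       (\<forall>x\<in>?S. \<forall>x'\<in>?S. ball x \<rho> \<subseteq> ?S \<longrightarrow> ball x' \<rho> \<subseteq> ?S \<longrightarrow> \<bar>T g Z x - T g Z x'\<bar> \<le> C * dist x x' powr \<alpha>)"
    unfolding T_def
    by (rule singular_conv(2)[where q = F and ?q0.0 = Z and g = g and S = ?S and A = B and e = ee and \<rho> = \<rho> and L = G and \<alpha> = \<alpha>,
        OF B ee \<rho> m z bd lim gm G gl \<alpha>])
  then obtain C where C: "C \<ge> 0" "\<And>x. x \<in> ?S \<Longrightarrow> ball x \<rho> \<subseteq> ?S \<Longrightarrow> \<bar>T g Z x\<bar> \<le> C"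
     "\<And>x x'. x \<in> ?S \<Longrightarrow> x' \<in> ?S \<Longrightarrow> ball x \<rho> \<subseteq> ?S \<Longrightarrow> ball x' \<rho> \<subseteq> ?S \<Longrightarrow> \<bar>T g Z x - T g Z x'\<bar> \<le> C * dist x x' powr \<alpha>"
    by blast
  show "\<exists>C\<ge>0. (\<forall>x\<in>core \<delta>. \<bar>T g Z x\<bar> \<le> C) \<and>
       (\<forall>x\<in>core \<delta>. \<forall>x'\<in>core \<delta>. \<bar>T g Z x - T g Z x'\<bar> \<le> C * dist x x' powr \<alpha>)"
    by (intro exI[of _ C] conjI allI ballI C sub inner_sub[OF g])
qed

text \<open>The order of \<open>Q1\<close> is \<open>2 * q - 1 = n + 1 - 2 * s\<close>. It lies
  below \<open>n + 1\<close> since \<open>s > 0\<close>, and the margin left for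
  \<open>\<alpha>\<close> is \<open>2 * s\<close>.\<close>

lemma T_limits1:
  assumes g: "good \<delta> \<rho> g G" and i: "i \<in> Basis" and \<alpha>: "0 < \<alpha>" "\<alpha> \<le> 1" "\<alpha> < 2 * s"
  shows "\<exists>a. a \<longlonglongrightarrow> 0 \<and> (\<forall>m. \<forall>x\<in>core \<delta>. \<bar>T g (Q1 \<rho> (E m) i) x - T g (Q1 \<rho> 0 i) x\<bar> \<le> a m)"
    and "\<exists>C\<ge>0. (\<forall>x\<in>core \<delta>. \<bar>T g (Q1 \<rho> 0 i) x\<bar> \<le> C) \<and>
       (\<forall>x\<in>core \<delta>. \<forall>x'\<in>core \<delta>. \<bar>T g (Q1 \<rho> 0 i) x - T g (Q1 \<rho> 0 i) x'\<bar> \<le> C * dist x x' powr \<alpha>)"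
proof -
  have \<rho>: "0 < \<rho>" using g by (simp add: good_def)
  have e1: "2 * q - 1 < real DIM('a) + 1" and e2: "\<alpha> < real DIM('a) + 1 - (2 * q - 1)"
    using s \<alpha> by (auto simp: q_def n_def[symmetric])
  have A: "0 \<le> 2 * \<rho>\<^sup>2" by simp
  have lim: "(\<lambda>m. Q1 \<rho> (E m) i x) \<longlonglongrightarrow> Q1 \<rho> 0 i x" if "x \<noteq> 0" for x
    unfolding Q1_def using that by (intro tendsto_intros ker1_tendsto E) auto
  note TL = T_limits[where F = "\<lambda>m. Q1 \<rho> (E m) i" and Z = "Q1 \<rho> 0 i" and \<alpha> = \<alpha>,
      OF g A e1 Q_measurable(2)[OF E(3)] Q_measurable(2)[OF order_refl] Q_zero(2)[OF _ \<rho>] Q_zero(2)[OF _ \<rho>]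
        Q1_bound[OF _ E(3) \<rho> i] Q1_bound[OF _ order_refl \<rho> i] lim \<alpha>(1,2) e2]
  show "\<exists>a. a \<longlonglongrightarrow> 0 \<and> (\<forall>m. \<forall>x\<in>core \<delta>. \<bar>T g (Q1 \<rho> (E m) i) x - T g (Q1 \<rho> 0 i) x\<bar> \<le> a m)"
    by (rule TL(1))
  show "\<exists>C\<ge>0. (\<forall>x\<in>core \<delta>. \<bar>T g (Q1 \<rho> 0 i) x\<bar> \<le> C) \<and>
       (\<forall>x\<in>core \<delta>. \<forall>x'\<in>core \<delta>. \<bar>T g (Q1 \<rho> 0 i) x - T g (Q1 \<rho> 0 i) x'\<bar> \<le> C * dist x x' powr \<alpha>)"
    by (rule TL(2))
qed

text \<open>The order is now \<open>2 * q = n + 2 - 2 * s\<close>, which lies below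
  \<open>n + 1\<close> exactly when \<open>s > 1 / 2\<close>; the margin \<open>2 * s - 1\<close> is
  the origin of the second-order range of exponents.\<close>

lemma T_limits2:
  assumes g: "good \<delta> \<rho> g G" and i: "i \<in> Basis" and j: "j \<in> Basis"
    and \<alpha>: "0 < \<alpha>" "\<alpha> \<le> 1" "\<alpha> < 2 * s - 1"
  shows "\<exists>a. a \<longlonglongrightarrow> 0 \<and> (\<forall>m. \<forall>x\<in>core \<delta>. \<bar>T g (Q2 \<rho> (E m) i j) x - T g (Q2 \<rho> 0 i j) x\<bar> \<le> a m)"
    and "\<exists>C\<ge>0. (\<forall>x\<in>core \<delta>. \<bar>T g (Q2 \<rho> 0 i j) x\<bar> \<le> C) \<and>
       (\<forall>x\<in>core \<delta>. \<forall>x'\<in>core \<delta>. \<bar>T g (Q2 \<rho> 0 i j) x - T g (Q2 \<rho> 0 i j) x'\<bar> \<le> C * dist x x' powr \<alpha>)"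
proof -
  have \<rho>: "0 < \<rho>" using g by (simp add: good_def)
  have e1: "2 * q < real DIM('a) + 1" and e2: "\<alpha> < real DIM('a) + 1 - 2 * q"
    using \<alpha> by (auto simp: q_def n_def[symmetric])
  have A: "0 \<le> 4 * (1 + q) * \<rho>\<^sup>2 + 2 * \<rho>\<^sup>2" using q_pos by simp
  have lim: "(\<lambda>m. Q2 \<rho> (E m) i j x) \<longlonglongrightarrow> Q2 \<rho> 0 i j x" if "x \<noteq> 0" for x
    unfolding Q2_def using that by (intro tendsto_intros ker1_tendsto ker2_tendsto E) auto
  note TL = T_limits[where F = "\<lambda>m. Q2 \<rho> (E m) i j" and Z = "Q2 \<rho> 0 i j" and \<alpha> = \<alpha>,
      OF g A e1 Q_measurable(3)[OF E(3)] Q_measurable(3)[OF order_refl] Q_zero(3)[OF _ \<rho>] Q_zero(3)[OF _ \<rho>]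
        Q2_bound[OF _ E(3) \<rho> i j] Q2_bound[OF _ order_refl \<rho> i j] lim \<alpha>(1,2) e2]
  show "\<exists>a. a \<longlonglongrightarrow> 0 \<and> (\<forall>m. \<forall>x\<in>core \<delta>. \<bar>T g (Q2 \<rho> (E m) i j) x - T g (Q2 \<rho> 0 i j) x\<bar> \<le> a m)"
    by (rule TL(1))
  show "\<exists>C\<ge>0. (\<forall>x\<in>core \<delta>. \<bar>T g (Q2 \<rho> 0 i j) x\<bar> \<le> C) \<and>
       (\<forall>x\<in>core \<delta>. \<forall>x'\<in>core \<delta>. \<bar>T g (Q2 \<rho> 0 i j) x - T g (Q2 \<rho> 0 i j) x'\<bar> \<le> C * dist x x' powr \<alpha>)"
    by (rule TL(2))
qed

lemma conv_Q0_tendsto: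
  assumes g: "good \<delta> \<rho> g G"
  shows "(\<lambda>m. LINT z|lebesgue. g z * Q0 \<rho> (E m) (id x - z)) \<longlonglongrightarrow> (LINT z|lborel. g z * K \<rho> (x - z))"
proof -
  have \<rho>: "0 < \<rho>" "\<rho> \<le> 1" and [measurable]: "g \<in> borel_measurable borel" and G: "0 \<le> G" "\<And>x. \<bar>g x\<bar> \<le> G"
    using g by (auto simp: good_def)
  note [measurable] = K_measurable[OF \<rho>] Q_measurable(1)[OF E(3)]
  have "(LINT z|lebesgue. g z * Q0 \<rho> (E m) (id x - z)) = (LINT z|lborel. g z * Q0 \<rho> (E m) (x - z))" for m
    unfolding id_apply by (rule integral_completion) measurable
  moreover have "(\<lambda>m. LINT z|lborel. g z * Q0 \<rho> (E m) (x - z)) \<longlonglongrightarrow> (LINT z|lborel. g z * K \<rho> (x - z))"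
  \<comment> \<open>\<open>ker0\<close> grows as \<open>e\<close> decreases, so the limit kernel
    dominates the whole sequence.\<close>
  proof (rule integral_dominated_convergence[where w = "\<lambda>z. G * K \<rho> (x - z)"])
    show "integrable lborel (\<lambda>z. G * K \<rho> (x - z))"
      using integral_lborel_reflect(2)[OF K_measurable[OF \<rho>], of x] K_integrable[OF \<rho>] by simp
    have nz: "AE z in lborel. z \<noteq> x" by (rule AE_lborel_singleton)
    show "AE z in lborel. (\<lambda>m. g z * Q0 \<rho> (E m) (x - z)) \<longlonglongrightarrow> g z * K \<rho> (x - z)"
      using nz
    proof eventually_elim
      case (elim z)
      then show ?case unfolding Q0_def K_def using q_pos by (intro tendsto_intros ker0_tendsto E) auto
    qed
    fix m
    show "AE z in lborel. norm (g z * Q0 \<rho> (E m) (x - z)) \<le> G * K \<rho> (x - z)"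
      using nz
    proof eventually_elim
      case (elim z)
      have a: "0 \<le> Q0 \<rho> (E m) (x - z)"
        unfolding Q0_def using E(2)[of m] by (intro ker0_nonneg) (auto intro: less_le_trans[of _ 0])
      have b: "Q0 \<rho> (E m) (x - z) \<le> K \<rho> (x - z)"
        unfolding Q0_def K_def using elim q_pos E(3) by (intro ker0_le) auto
      show ?case using a b G by (simp add: abs_mult mult_mono)
    qed
  qed measurable
  ultimately show ?thesis by simp
qed

text \<open>The regularised potentials are smooth with partial derivatives
  \<open>T g (Q1 \<rho> (E m) i)\<close>, and these converge uniformly on
  \<open>core \<delta>\<close>. The singular potential itself is never differentiated under the
  integral.\<close>

lemma potential_C1:
  assumes g: "good \<delta> \<rho> g G" and x: "x \<in> core \<delta>"
  shows "(\<lambda>x. LINT z|lborel. g z * K \<rho> (x - z)) differentiable (at x)"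
    and "i \<in> Basis \<Longrightarrow> partial i (\<lambda>x. LINT z|lborel. g z * K \<rho> (x - z)) x = T g (Q1 \<rho> 0 i) x"
proof -
  \<comment> \<open>A convenient exponent in the range \<open>0 < \<alpha> < 2 * s\<close>, so that
    the uniform convergence of \<open>T_limits1\<close> is at hand.\<close>
  define \<alpha> where "\<alpha> = min 1 s"
  have \<alpha>: "0 < \<alpha>" "\<alpha> \<le> 1" "\<alpha> < 2 * s" using s by (auto simp: \<alpha>_def)
  have "\<forall>i\<in>Basis. \<exists>a. a \<longlonglongrightarrow> 0 \<and> (\<forall>m. \<forall>x\<in>core \<delta>. \<bar>T g (Q1 \<rho> (E m) i) x - T g (Q1 \<rho> 0 i) x\<bar> \<le> a m)"
    using T_limits1(1)[OF g _ \<alpha>] by blast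
  from bchoice[OF this] obtain a where a: "\<And>i. i \<in> Basis \<Longrightarrow> a i \<longlonglongrightarrow> 0"
    "\<And>i m x. i \<in> Basis \<Longrightarrow> x \<in> core \<delta> \<Longrightarrow> \<bar>T g (Q1 \<rho> (E m) i) x - T g (Q1 \<rho> 0 i) x\<bar> \<le> a i m" by blast
  define V where "V m x = (LINT z|lebesgue. g z * Q0 \<rho> (E m) (id x - z))" for m x
  obtain i0 :: 'a where i0: "i0 \<in> Basis" using nonempty_Basis by blast
  have d: "V m differentiable (at x)" for m x
    using partial_conv(1)[OF g E(2)[of m] i0 i0, of 1] by (simp add: V_def[abs_def])
  have pd: "\<bar>partial i (V m) x - T g (Q1 \<rho> 0 i) x\<bar> \<le> a i m" if "i \<in> Basis" "x \<in> core \<delta>" for i m x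
    using a(2)[OF that] partial_conv(2)[OF g E(2)[of m] that(1) i0] by (simp add: V_def[abs_def])
  have lim: "(\<lambda>m. V m x) \<longlonglongrightarrow> (LINT z|lborel. g z * K \<rho> (x - z))" for x
    unfolding V_def by (rule conv_Q0_tendsto[OF g])
  note D = derivative_limit[OF open_inner_set d lim pd a(1) x]
  show "(\<lambda>x. LINT z|lborel. g z * K \<rho> (x - z)) differentiable (at x)" by (rule D(1))
  show "partial i (\<lambda>x. LINT z|lborel. g z * K \<rho> (x - z)) x = T g (Q1 \<rho> 0 i) x" if "i \<in> Basis" using D(2)[OF _ _ _ that] by simp
qed

lemma potential_C2:
  assumes g: "good \<delta> \<rho> g G" and x: "x \<in> core \<delta>" and i: "i \<in> Basis" and s2: "s > 1 / 2"
  shows "T g (Q1 \<rho> 0 i) differentiable (at x)"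
    and "j \<in> Basis \<Longrightarrow> partial j (T g (Q1 \<rho> 0 i)) x = T g (Q2 \<rho> 0 i j) x"
proof -
  \<comment> \<open>The midpoint of the range \<open>0 < \<alpha> < 2 * s - 1\<close>, which is
    nonempty because \<open>s > 1 / 2\<close>.\<close>
  define \<alpha> where "\<alpha> = s - 1 / 2"
  have \<alpha>: "0 < \<alpha>" "\<alpha> \<le> 1" "\<alpha> < 2 * s - 1" using s s2 by (auto simp: \<alpha>_def)
  have \<alpha>': "\<alpha> < 2 * s" using \<alpha> by simp
  have "\<forall>j\<in>Basis. \<exists>a. a \<longlonglongrightarrow> 0 \<and> (\<forall>m. \<forall>x\<in>core \<delta>. \<bar>T g (Q2 \<rho> (E m) i j) x - T g (Q2 \<rho> 0 i j) x\<bar> \<le> a m)"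
    using T_limits2(1)[OF g i _ \<alpha>] by blast
  from bchoice[OF this] obtain a where a: "\<And>j. j \<in> Basis \<Longrightarrow> a j \<longlonglongrightarrow> 0"
    "\<And>j m x. j \<in> Basis \<Longrightarrow> x \<in> core \<delta> \<Longrightarrow> \<bar>T g (Q2 \<rho> (E m) i j) x - T g (Q2 \<rho> 0 i j) x\<bar> \<le> a j m" by blast
  obtain a1 where a1: "a1 \<longlonglongrightarrow> 0" "\<And>m x. x \<in> core \<delta> \<Longrightarrow> \<bar>T g (Q1 \<rho> (E m) i) x - T g (Q1 \<rho> 0 i) x\<bar> \<le> a1 m"
    using T_limits1(1)[OF g i \<alpha>(1,2) \<alpha>'] by blast
  define V where "V m x = (LINT z|lebesgue. g z * Q0 \<rho> (E m) (id x - z))" for m x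
  have PV: "partial i (V m) = T g (Q1 \<rho> (E m) i)" for m
    using partial_conv(2)[OF g E(2)[of m] i i] by (simp add: V_def[abs_def])
  have C: "Ck 2 (V m)" for m
    using partial_conv(1)[OF g E(2)[of m] i i, of 2] by (simp add: V_def[abs_def])
  have d: "T g (Q1 \<rho> (E m) i) differentiable (at x)" for m x
    using C[of m] i unfolding PV[symmetric] by (simp add: numeral_2_eq_2)
  have pd: "\<bar>partial j (T g (Q1 \<rho> (E m) i)) x - T g (Q2 \<rho> 0 i j) x\<bar> \<le> a j m" if "j \<in> Basis" "x \<in> core \<delta>" for j m x
    using a(2)[OF that, of m] partial_conv(2,3)[OF g E(2)[of m] i that(1)] by simp
  have lim: "(\<lambda>m. T g (Q1 \<rho> (E m) i) x) \<longlonglongrightarrow> T g (Q1 \<rho> 0 i) x" if "x \<in> core \<delta>" for x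
  proof -
    have "(\<lambda>m. T g (Q1 \<rho> (E m) i) x - T g (Q1 \<rho> 0 i) x) \<longlonglongrightarrow> 0"
      by (rule Lim_null_comparison[OF _ a1(1)]) (use a1(2)[OF that] in auto)
    then show ?thesis by (simp add: LIM_zero_iff)
  qed
  note D = derivative_limit[OF open_inner_set d lim pd a(1) x]
  show "T g (Q1 \<rho> 0 i) differentiable (at x)" by (rule D(1))
  show "partial j (T g (Q1 \<rho> 0 i)) x = T g (Q2 \<rho> 0 i j) x" if "j \<in> Basis" using D(2)[OF _ _ _ _ that] by simp
qed

end

lemma uniform_constant:
  fixes P :: "'i \<Rightarrow> real \<Rightarrow> bool"
  assumes "finite I" "\<And>i. i \<in> I \<Longrightarrow> \<exists>C\<ge>0. P i C" "\<And>i C C'. P i C \<Longrightarrow> C \<le> C' \<Longrightarrow> P i C'"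
  shows "\<exists>C\<ge>0. \<forall>i\<in>I. P i C"
proof -
  have "\<forall>i\<in>I. \<exists>C. C \<ge> 0 \<and> P i C" using assms(2) by blast
  from bchoice[OF this] obtain c where c: "\<And>i. i \<in> I \<Longrightarrow> c i \<ge> 0" "\<And>i. i \<in> I \<Longrightarrow> P i (c i)" by blast
  have "c i \<le> (\<Sum>i\<in>I. c i)" if "i \<in> I" for i using member_le_sum[of i I c] that c(1) assms(1) by auto
  then have "\<forall>i\<in>I. P i (\<Sum>i\<in>I. c i)" using c(2) assms(3) by blast
  moreover have "0 \<le> (\<Sum>i\<in>I. c i)" by (rule sum_nonneg) (rule c(1))
  ultimately show ?thesis by blast
qed

section \<open>Interior regularity and gluing of the versions\<close>

context potential_representation
begin

lemma smooth_holder: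
  assumes "Ck 1 f" "\<forall>i\<in>Basis. \<exists>C. \<forall>x. \<bar>partial i f x\<bar> \<le> C" "0 < \<alpha>" "\<alpha> \<le> 1"
  shows "\<exists>C\<ge>0. \<forall>x\<in>\<Omega>. \<forall>y\<in>\<Omega>. \<bar>f x - f y\<bar> \<le> C * dist x y powr \<alpha>"
proof -
  have "\<exists>C\<ge>0. \<forall>i\<in>(Basis::'a set). \<forall>x. \<bar>partial i f x\<bar> \<le> C"
  proof (rule uniform_constant)
    fix i :: 'a assume "i \<in> Basis"
    then obtain C where C: "\<forall>x. \<bar>partial i f x\<bar> \<le> C" using assms(2) by blast
    then have "C \<ge> 0" by (meson abs_ge_zero order_trans)
    then show "\<exists>C\<ge>0. \<forall>x. \<bar>partial i f x\<bar> \<le> C" using C by blast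
  qed (auto intro: order_trans)
  then obtain L where L: "L \<ge> 0" "\<And>i x. i \<in> Basis \<Longrightarrow> \<bar>partial i f x\<bar> \<le> L" by blast
  obtain D where D: "D > 0" "\<And>x y. x \<in> \<Omega> \<Longrightarrow> y \<in> \<Omega> \<Longrightarrow> dist x y \<le> D" using \<Omega>_diam by blast
  have nL: "0 \<le> n * L" using n1 L(1) by simp
  have "\<bar>f x - f y\<bar> \<le> (n * L * D powr (1 - \<alpha>)) * dist x y powr \<alpha>" if "x \<in> \<Omega>" "y \<in> \<Omega>" for x y
  proof (cases "x = y")
    case False
    have "norm (x - y) = dist x y powr (1 - \<alpha>) * dist x y powr \<alpha>"
      using False by (simp add: dist_norm powr_add[symmetric])
    also have "\<dots> \<le> D powr (1 - \<alpha>) * dist x y powr \<alpha>"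
      using D(2)[OF that] assms(3,4) by (intro mult_right_mono powr_mono2) auto
    finally have "n * L * norm (x - y) \<le> n * L * (D powr (1 - \<alpha>) * dist x y powr \<alpha>)"
      using nL by (intro mult_left_mono) auto
    moreover have "\<bar>f x - f y\<bar> \<le> n * L * norm (x - y)"
      unfolding n_def by (rule Ck_Lipschitz[OF assms(1) L(2)])
    ultimately show ?thesis by (simp only: mult.assoc)
  qed simp
  then show ?thesis using nL by (intro exI[of _ "n * L * D powr (1 - \<alpha>)"]) auto
qed

lemma potential_holder:
  assumes T: "\<exists>C\<ge>0. (\<forall>x\<in>core \<delta>. \<bar>F x\<bar> \<le> C) \<and>
       (\<forall>x\<in>core \<delta>. \<forall>x'\<in>core \<delta>. \<bar>F x - F x'\<bar> \<le> C * dist x x' powr \<alpha>)"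
    and f: "Ck 1 f" "\<exists>C. \<forall>x. \<bar>f x\<bar> \<le> C" "\<forall>i\<in>Basis. \<exists>C. \<forall>x. \<bar>partial i f x\<bar> \<le> C"
    and \<alpha>: "0 < \<alpha>" "\<alpha> \<le> 1" and \<delta>: "\<delta> > 0"
  shows "\<exists>C\<ge>0. (\<forall>x\<in>core \<delta>. \<bar>\<kappa> * F x + f x\<bar> \<le> C) \<and>
       (\<forall>x\<in>core \<delta>. \<forall>x'\<in>core \<delta>. \<bar>(\<kappa> * F x + f x) - (\<kappa> * F x' + f x')\<bar> \<le> C * dist x x' powr \<alpha>)"
proof -
  obtain C1 where C1: "C1 \<ge> 0" "\<And>x. x \<in> core \<delta> \<Longrightarrow> \<bar>F x\<bar> \<le> C1"
    "\<And>x x'. x \<in> core \<delta> \<Longrightarrow> x' \<in> core \<delta> \<Longrightarrow> \<bar>F x - F x'\<bar> \<le> C1 * dist x x' powr \<alpha>"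
    using T by blast
  obtain C2 where C2: "C2 \<ge> 0" "\<And>x y. x \<in> \<Omega> \<Longrightarrow> y \<in> \<Omega> \<Longrightarrow> \<bar>f x - f y\<bar> \<le> C2 * dist x y powr \<alpha>"
    using smooth_holder[OF f(1,3) \<alpha>] by blast
  obtain C3 where C3: "\<And>x. \<bar>f x\<bar> \<le> C3" using f(2) by blast
  have C3p: "C3 \<ge> 0" using C3[of undefined] by linarith
  have sub: "x \<in> \<Omega>" if "x \<in> core \<delta>" for x using inner_set_subset[of \<delta> \<Omega>] \<delta> that by auto
  let ?C = "\<bar>\<kappa>\<bar> * C1 + C2 + C3"
  have k: "0 \<le> \<bar>\<kappa>\<bar> * C1" using C1(1) by simp
  have "\<bar>\<kappa> * F x + f x\<bar> \<le> ?C" if x: "x \<in> core \<delta>" for x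
  proof -
    have "\<bar>\<kappa> * F x + f x\<bar> \<le> \<bar>\<kappa> * F x\<bar> + \<bar>f x\<bar>" by (rule abs_triangle_ineq)
    also have "\<bar>\<kappa> * F x\<bar> \<le> \<bar>\<kappa>\<bar> * C1" unfolding abs_mult by (intro mult_left_mono C1 x) auto
    finally show ?thesis using C3[of x] C2(1) by simp
  qed
  moreover have "\<bar>(\<kappa> * F x + f x) - (\<kappa> * F y + f y)\<bar> \<le> ?C * dist x y powr \<alpha>"
    if x: "x \<in> core \<delta>" and y: "y \<in> core \<delta>" for x y
  proof -
    have "(\<kappa> * F x + f x) - (\<kappa> * F y + f y) = \<kappa> * (F x - F y) + (f x - f y)" by (simp add: algebra_simps)
    then have "\<bar>(\<kappa> * F x + f x) - (\<kappa> * F y + f y)\<bar> \<le> \<bar>\<kappa> * (F x - F y)\<bar> + \<bar>f x - f y\<bar>"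
      using abs_triangle_ineq[of "\<kappa> * (F x - F y)" "f x - f y"] by simp
    also have "\<bar>\<kappa> * (F x - F y)\<bar> \<le> \<bar>\<kappa>\<bar> * (C1 * dist x y powr \<alpha>)"
      unfolding abs_mult by (intro mult_left_mono C1 x y) auto
    also have "\<bar>f x - f y\<bar> \<le> C2 * dist x y powr \<alpha>" by (intro C2 sub x y)
    finally have "\<bar>(\<kappa> * F x + f x) - (\<kappa> * F y + f y)\<bar> \<le> (\<bar>\<kappa>\<bar> * C1 + C2) * dist x y powr \<alpha>"
      by (simp add: algebra_simps)
    also have "\<dots> \<le> ?C * dist x y powr \<alpha>" using C3p by (intro mult_right_mono) auto
    finally show ?thesis .
  qed
  ultimately show ?thesis using k C2(1) C3p by (intro exI[of _ ?C]) auto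
qed

lemma holder_rep_continuous: "holder_rep \<Omega> w 1 \<delta> \<phi> \<Longrightarrow> continuous_on (core \<delta>) \<phi>"
proof -
  assume "holder_rep \<Omega> w 1 \<delta> \<phi>"
  then obtain C where "\<forall>x\<in>core \<delta>. \<forall>y\<in>core \<delta>. \<bar>\<phi> x - \<phi> y\<bar> \<le> C * dist x y powr 1"
    unfolding holder_rep_def by blast
  then show ?thesis by (intro holder_continuous_on[where \<alpha> = 1 and C = C]) auto
qed

text \<open>The continuous version \<open>\<phi>'\<close> on \<open>core \<delta>\<close> agrees
  almost everywhere with the right side of the representation, built from the Lipschitz version
  \<open>\<phi>\<close> on \<open>core (\<delta> / 2)\<close>. Continuous functions that agree
  almost everywhere on an open set coincide there, so derivatives may be read off the
  formula.\<close>

lemma local_regularity: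
  assumes \<delta>: "\<delta> > 0" and \<phi>: "holder_rep \<Omega> w 1 (\<delta> / 2) \<phi>" and \<phi>': "holder_rep \<Omega> w 1 \<delta> \<phi>'"
    and v: "\<And>x. x \<in> core \<delta> \<Longrightarrow> v x = \<phi>' x" and \<alpha>: "0 < \<alpha>"
  shows "s \<le> 1 / 2 \<Longrightarrow> \<alpha> < 2 * s \<Longrightarrow> holder_on 1 \<alpha> (core \<delta>) v"
    and "s > 1 / 2 \<Longrightarrow> \<alpha> < 2 * s - 1 \<Longrightarrow> holder_on 2 \<alpha> (core \<delta>) v"
proof -
  define g where "g y = indicator (core (\<delta> / 2)) y * max (\<phi> y) 0" for y
  have "(s \<le> 1 / 2 \<longrightarrow> \<alpha> < 2 * s \<longrightarrow> holder_on 1 \<alpha> (core \<delta>) v) \<and>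
    (s > 1 / 2 \<longrightarrow> \<alpha> < 2 * s - 1 \<longrightarrow> holder_on 2 \<alpha> (core \<delta>) v)"
  proof (rule rep_local[OF \<delta> \<phi>, folded g_def])
    fix \<rho> \<kappa> H
    assume \<rho>: "0 < \<rho>" "\<rho> \<le> 1" "\<rho> \<le> \<delta> / 2" and H: "\<forall>k. Ck k H"
      "\<forall>is. set is \<subseteq> Basis \<longrightarrow> (\<exists>C. \<forall>x. \<bar>partials is H x\<bar> \<le> C)"
      and ae: "AE x in lborel. x \<in> core \<delta> \<longrightarrow> w x = \<kappa> * (LINT y|lborel. g y * K \<rho> (x - y)) + H x"
      and gm[measurable]: "g \<in> borel_measurable borel" and gC: "\<exists>C\<ge>0. (\<forall>x. \<bar>g x\<bar> \<le> C) \<and>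
        (\<forall>x\<in>core (\<delta>/2). \<forall>y\<in>core (\<delta>/2). \<bar>g x - g y\<bar> \<le> C * dist x y powr 1)"
      and sub: "\<And>x. x \<in> core \<delta> \<Longrightarrow> ball x \<rho> \<subseteq> core (\<delta> / 2)"
    obtain G where G: "G \<ge> 0" "\<And>x. \<bar>g x\<bar> \<le> G"
        "\<And>x y. x \<in> core (\<delta>/2) \<Longrightarrow> y \<in> core (\<delta>/2) \<Longrightarrow> \<bar>g x - g y\<bar> \<le> G * norm (x - y)"
      using gC by (auto simp: dist_norm)
    have good: "good \<delta> \<rho> g G"
      unfolding good_def using \<delta> \<rho> gm G sub by (auto simp: g_def)
    let ?S = "core \<delta>"
    let ?P = "\<lambda>x. LINT z|lborel. g z * K \<rho> (x - z)"
    define V where "V x = \<kappa> * ?P x + H x" for x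
    have Hd: "H differentiable (at x)" for x using H(1)[rule_format, of 1] by simp
    have Hp: "Ck k (partial i H)" if "i \<in> Basis" for i k using H(1)[rule_format, of "Suc k"] that by simp
    have Hpd: "partial i H differentiable (at x)" if "i \<in> Basis" for i x using Hp[OF that, of 1] by simp
    have Hpp: "Ck k (partial j (partial i H))" if "i \<in> Basis" "j \<in> Basis" for i j k
      using Hp[OF that(1), of "Suc k"] that by simp
    have Hb1: "\<exists>C. \<forall>x. \<bar>partial i H x\<bar> \<le> C" if "i \<in> Basis" for i using H(2)[rule_format, of "[i]"] that by simp
    have Hb2: "\<exists>C. \<forall>x. \<bar>partial j (partial i H) x\<bar> \<le> C" if "i \<in> Basis" "j \<in> Basis" for i j
      using H(2)[rule_format, of "[j, i]"] that by simp
    have Hb3: "\<exists>C. \<forall>x. \<bar>partial l (partial j (partial i H)) x\<bar> \<le> C" if "i \<in> Basis" "j \<in> Basis" "l \<in> Basis" for i j l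
      using H(2)[rule_format, of "[l, j, i]"] that by simp
    have lin: "(\<lambda>x. \<kappa> * f x + h x) differentiable (at x) \<and> partial i (\<lambda>x. \<kappa> * f x + h x) x = \<kappa> * partial i f x + partial i h x"
      if "f differentiable (at x)" "h differentiable (at x)" for f h :: "'a \<Rightarrow> real" and x i
    proof -
      have d: "((\<lambda>x. \<kappa> * f x + h x) has_derivative (\<lambda>v. \<kappa> * frechet_derivative f (at x) v + frechet_derivative h (at x) v)) (at x)"
        by (intro has_derivative_add has_derivative_mult_right has_derivative_frechet that)
      then show ?thesis using partial_eq[OF d, of i] by (auto simp: partial_def differentiable_def)
    qed
    have Pd: "?P differentiable (at x)" if "x \<in> ?S" for x by (rule potential_C1(1)[OF good that])
    have Vd: "V differentiable (at x)" if "x \<in> ?S" for x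
      using lin[OF Pd[OF that] Hd] by (simp add: V_def[abs_def])
    have Vc: "continuous_on ?S V"
      using Vd by (auto intro!: continuous_at_imp_continuous_on differentiable_imp_continuous_within)
    have aeq: "AE x in lborel. x \<in> ?S \<longrightarrow> \<phi>' x = V x"
    proof -
      have "AE x in lborel. x \<in> ?S \<longrightarrow> \<phi>' x = w x" using \<phi>' by (simp add: holder_rep_def)
      then show ?thesis using ae by eventually_elim (auto simp: V_def)
    qed
    have vV: "v x = V x" if "x \<in> ?S" for x
      using continuous_AE_eq[OF open_inner_set holder_rep_continuous[OF \<phi>'] Vc aeq that] v[OF that] by simp
    have vd: "v differentiable (at x)" if "x \<in> ?S" for x
      using partial_cong_open(2)[OF open_inner_set vV that] Vd[OF that] by simp
    define G1 where "G1 i x = \<kappa> * T g (Q1 \<rho> 0 i) x + partial i H x" for i x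
    have v1: "partial i v x = G1 i x" if i: "i \<in> Basis" and x: "x \<in> ?S" for i x
    proof -
      have "partial i v x = partial i V x" by (rule partial_cong_open(1)[OF open_inner_set vV x])
      also have "\<dots> = \<kappa> * partial i ?P x + partial i H x" using lin[OF Pd[OF x] Hd] by (simp add: V_def[abs_def])
      also have "\<dots> = G1 i x" unfolding G1_def by (simp add: potential_C1(2)[OF good x i])
      finally show ?thesis .
    qed
    have "\<exists>C\<ge>0. \<forall>x\<in>?S. \<bar>v x\<bar> \<le> C"
      using \<phi>' v unfolding holder_rep_def by metis
    then obtain C0 where C0: "C0 \<ge> 0" "\<And>x. x \<in> ?S \<Longrightarrow> \<bar>v x\<bar> \<le> C0" by blast
    have hold1: "\<exists>C\<ge>0. \<forall>i\<in>Basis. (\<forall>x\<in>?S. \<bar>G1 i x\<bar> \<le> C) \<and> (\<forall>x\<in>?S. \<forall>y\<in>?S. \<bar>G1 i x - G1 i y\<bar> \<le> C * dist x y powr \<gamma>)"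
      if \<gamma>: "0 < \<gamma>" "\<gamma> \<le> 1" "\<gamma> < 2 * s" for \<gamma>
    proof (rule uniform_constant)
      fix i :: 'a assume i: "i \<in> Basis"
      show "\<exists>C\<ge>0. (\<forall>x\<in>?S. \<bar>G1 i x\<bar> \<le> C) \<and> (\<forall>x\<in>?S. \<forall>y\<in>?S. \<bar>G1 i x - G1 i y\<bar> \<le> C * dist x y powr \<gamma>)"
        unfolding G1_def
        by (rule potential_holder[OF T_limits1(2)[OF good i \<gamma>] Hp[OF i] Hb1[OF i] _ \<gamma>(1,2) \<delta>]) (use Hb2[OF i] in blast)
    next
      fix i C C' assume h: "(\<forall>x\<in>?S. \<bar>G1 i x\<bar> \<le> C) \<and> (\<forall>x\<in>?S. \<forall>y\<in>?S. \<bar>G1 i x - G1 i y\<bar> \<le> C * dist x y powr \<gamma>)" and le: "C \<le> C'"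
      have "C * dist x y powr \<gamma> \<le> C' * dist x y powr \<gamma>" for x y using le by (intro mult_right_mono) auto
      then show "(\<forall>x\<in>?S. \<bar>G1 i x\<bar> \<le> C') \<and> (\<forall>x\<in>?S. \<forall>y\<in>?S. \<bar>G1 i x - G1 i y\<bar> \<le> C' * dist x y powr \<gamma>)"
        using h le by (meson order_trans)
    qed simp
    have part1: "holder_on 1 \<alpha> ?S v" if s1: "s \<le> 1 / 2" and \<alpha>2: "\<alpha> < 2 * s"
    proof -
      \<comment> \<open>For \<open>s \<le> 1 / 2\<close> the range \<open>\<alpha> < 2 * s\<close>
        stays below 1, as the Hoelder estimates for the potential require.\<close>
      have \<alpha>1: "\<alpha> \<le> 1" using s1 \<alpha>2 by simp
      obtain C1 where C1: "C1 \<ge> 0" "\<And>i x. i \<in> Basis \<Longrightarrow> x \<in> ?S \<Longrightarrow> \<bar>G1 i x\<bar> \<le> C1"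
        "\<And>i x y. i \<in> Basis \<Longrightarrow> x \<in> ?S \<Longrightarrow> y \<in> ?S \<Longrightarrow> \<bar>G1 i x - G1 i y\<bar> \<le> C1 * dist x y powr \<alpha>"
        using hold1[OF \<alpha> \<alpha>1 \<alpha>2] by blast
      have le: "C1 * dist x y powr \<alpha> \<le> (C0 + C1) * dist x y powr \<alpha>" for x y :: 'a
        using C0(1) by (intro mult_right_mono) auto
      have h: "\<bar>partial i v x - partial i v y\<bar> \<le> (C0 + C1) * dist x y powr \<alpha>" if "i \<in> Basis" "x \<in> ?S" "y \<in> ?S" for i x y
        using C1(3)[OF that] le[of x y] v1 that by simp
      show ?thesis
      proof (rule holder_on_1I[OF open_inner_set vd _ _ h])
        show "\<bar>v x\<bar> \<le> C0 + C1" if "x \<in> ?S" for x using C0(2)[OF that] C1(1) by simp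
        show "\<bar>partial i v x\<bar> \<le> C0 + C1" if "i \<in> Basis" "x \<in> ?S" for i x using C1(2)[OF that] v1[OF that] C0(1) by simp
        show "continuous_on ?S (partial i v)" if "i \<in> Basis" for i
          by (rule holder_continuous_on[OF h[OF that] \<alpha>])
      qed
    qed
    have part2: "holder_on 2 \<alpha> ?S v" if s2: "s > 1 / 2" and \<alpha>2: "\<alpha> < 2 * s - 1"
    proof -
      have \<alpha>1: "\<alpha> \<le> 1" "\<alpha> < 2 * s" using s \<alpha>2 by auto
      obtain C1 where C1: "C1 \<ge> 0" "\<And>i x. i \<in> Basis \<Longrightarrow> x \<in> ?S \<Longrightarrow> \<bar>G1 i x\<bar> \<le> C1"
        using hold1[OF \<alpha> \<alpha>1] by blast
      define G2 where "G2 i j x = \<kappa> * T g (Q2 \<rho> 0 i j) x + partial j (partial i H) x" for i j x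
      have G1d: "G1 i differentiable (at x) \<and> partial j (G1 i) x = G2 i j x" if "i \<in> Basis" "j \<in> Basis" "x \<in> ?S" for i j x
        using lin[OF potential_C2(1)[OF good that(3,1) s2] Hpd[OF that(1)]] potential_C2(2)[OF good that(3,1) s2 that(2)]
        unfolding G1_def[abs_def] G2_def by simp
      have v1d: "partial i v differentiable (at x)" if "i \<in> Basis" "x \<in> ?S" for i x
        using partial_cong_open(2)[OF open_inner_set v1[OF that(1)] that(2)] G1d[OF that(1) that(1,2)] by simp
      have v2: "partial j (partial i v) x = G2 i j x" if "i \<in> Basis" "j \<in> Basis" "x \<in> ?S" for i j x
        using partial_cong_open(1)[OF open_inner_set v1[OF that(1)] that(3), where i = j] G1d[OF that] by simp
      have "\<exists>C\<ge>0. \<forall>ij\<in>Basis \<times> Basis. (\<forall>x\<in>?S. \<bar>G2 (fst ij) (snd ij) x\<bar> \<le> C) \<and>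
         (\<forall>x\<in>?S. \<forall>y\<in>?S. \<bar>G2 (fst ij) (snd ij) x - G2 (fst ij) (snd ij) y\<bar> \<le> C * dist x y powr \<alpha>)"
      proof (rule uniform_constant)
        fix ij :: "'a \<times> 'a" assume "ij \<in> Basis \<times> Basis"
        then have i: "fst ij \<in> Basis" and j: "snd ij \<in> Basis" by auto
        show "\<exists>C\<ge>0. (\<forall>x\<in>?S. \<bar>G2 (fst ij) (snd ij) x\<bar> \<le> C) \<and>
         (\<forall>x\<in>?S. \<forall>y\<in>?S. \<bar>G2 (fst ij) (snd ij) x - G2 (fst ij) (snd ij) y\<bar> \<le> C * dist x y powr \<alpha>)"
          unfolding G2_def
          by (rule potential_holder[OF T_limits2(2)[OF good i j \<alpha> \<alpha>1(1) \<alpha>2] Hpp[OF i j] Hb2[OF i j] _ \<alpha> \<alpha>1(1) \<delta>])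
            (use Hb3[OF i j] in blast)
      next
        fix ij C C' assume h: "(\<forall>x\<in>?S. \<bar>G2 (fst ij) (snd ij) x\<bar> \<le> C) \<and>
         (\<forall>x\<in>?S. \<forall>y\<in>?S. \<bar>G2 (fst ij) (snd ij) x - G2 (fst ij) (snd ij) y\<bar> \<le> C * dist x y powr \<alpha>)" and le: "C \<le> C'"
        have "C * dist x y powr \<alpha> \<le> C' * dist x y powr \<alpha>" for x y using le by (intro mult_right_mono) auto
        then show "(\<forall>x\<in>?S. \<bar>G2 (fst ij) (snd ij) x\<bar> \<le> C') \<and>
         (\<forall>x\<in>?S. \<forall>y\<in>?S. \<bar>G2 (fst ij) (snd ij) x - G2 (fst ij) (snd ij) y\<bar> \<le> C' * dist x y powr \<alpha>)"
          using h le by (meson order_trans)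
      qed simp
      then obtain C2 where C2: "C2 \<ge> 0" and C2ij: "\<forall>ij\<in>Basis \<times> Basis. (\<forall>x\<in>?S. \<bar>G2 (fst ij) (snd ij) x\<bar> \<le> C2) \<and>
         (\<forall>x\<in>?S. \<forall>y\<in>?S. \<bar>G2 (fst ij) (snd ij) x - G2 (fst ij) (snd ij) y\<bar> \<le> C2 * dist x y powr \<alpha>)" by blast
      have C2b: "\<bar>G2 i j x\<bar> \<le> C2" if "i \<in> Basis" "j \<in> Basis" "x \<in> ?S" for i j x
        using bspec[OF C2ij, of "(i, j)"] that by simp
      have C2h: "\<bar>G2 i j x - G2 i j y\<bar> \<le> C2 * dist x y powr \<alpha>" if "i \<in> Basis" "j \<in> Basis" "x \<in> ?S" "y \<in> ?S" for i j x y
        using bspec[OF C2ij, of "(i, j)"] that by simp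
      have le: "C2 * dist x y powr \<alpha> \<le> (C0 + C1 + C2) * dist x y powr \<alpha>" for x y :: 'a
        using C0(1) C1(1) by (intro mult_right_mono) auto
      have h: "\<bar>partial j (partial i v) x - partial j (partial i v) y\<bar> \<le> (C0 + C1 + C2) * dist x y powr \<alpha>"
        if "i \<in> Basis" "j \<in> Basis" "x \<in> ?S" "y \<in> ?S" for i j x y
        using C2h[OF that] le[of x y] v2 that by simp
      show ?thesis
      proof (rule holder_on_2I[OF open_inner_set vd v1d _ _ _ h])
        show "\<bar>v x\<bar> \<le> C0 + C1 + C2" if "x \<in> ?S" for x using C0(2)[OF that] C1(1) C2 by simp
        show "\<bar>partial i v x\<bar> \<le> C0 + C1 + C2" if "i \<in> Basis" "x \<in> ?S" for i x
          using C1(2)[OF that] v1[OF that] C0(1) C2 by simp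
        show "\<bar>partial j (partial i v) x\<bar> \<le> C0 + C1 + C2" if "i \<in> Basis" "j \<in> Basis" "x \<in> ?S" for i j x
          using C2b[OF that] v2[OF that] C0(1) C1(1) by simp
        show "continuous_on ?S (partial j (partial i v))" if "i \<in> Basis" "j \<in> Basis" for i j
          by (rule holder_continuous_on[OF h[OF that] \<alpha>])
      qed
    qed
    show "(s \<le> 1 / 2 \<longrightarrow> \<alpha> < 2 * s \<longrightarrow> holder_on 1 \<alpha> ?S v) \<and> (s > 1 / 2 \<longrightarrow> \<alpha> < 2 * s - 1 \<longrightarrow> holder_on 2 \<alpha> ?S v)"
      using part1 part2 by blast
  qed
  then show "s \<le> 1 / 2 \<Longrightarrow> \<alpha> < 2 * s \<Longrightarrow> holder_on 1 \<alpha> (core \<delta>) v"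
    and "s > 1 / 2 \<Longrightarrow> \<alpha> < 2 * s - 1 \<Longrightarrow> holder_on 2 \<alpha> (core \<delta>) v" by auto
qed

text \<open>The versions for different \<open>\<delta>\<close> agree on their common domain by
  continuity, so they glue to a single \<open>v\<close> that serves all inner sets and exponents at
  once.\<close>

theorem regularity:
  "\<exists>v. (AE x in lborel. x \<in> \<Omega> \<longrightarrow> v x = w x) \<and> (\<forall>\<delta>>0. \<forall>\<alpha>>0.
     (s \<le> 1 / 2 \<longrightarrow> \<alpha> < 2 * s \<longrightarrow> holder_on 1 \<alpha> (core \<delta>) v) \<and>
     (s > 1 / 2 \<longrightarrow> \<alpha> < 2 * s - 1 \<longrightarrow> holder_on 2 \<alpha> (core \<delta>) v))"
proof -
  have "\<forall>\<delta>. \<exists>\<phi>. \<delta> > 0 \<longrightarrow> holder_rep \<Omega> w 1 \<delta> \<phi>" using holder_rep_Lipschitz by blast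
  from choice[OF this] obtain \<phi> where \<phi>: "\<And>\<delta>. \<delta> > 0 \<Longrightarrow> holder_rep \<Omega> w 1 \<delta> (\<phi> \<delta>)" by blast
  \<comment> \<open>Half of the distance to the complement is a parameter whose inner set contains
    \<open>x\<close>; by \<open>agree\<close> every other such parameter gives the same
    value.\<close>
  define v where "v x = \<phi> (infdist x (- \<Omega>) / 2) x" for x
  have agree: "\<phi> \<delta> x = \<phi> \<delta>' x" if d: "\<delta> > 0" "\<delta>' > 0" and x: "x \<in> core \<delta>" "x \<in> inner_set \<delta>' \<Omega>" for \<delta> \<delta>' x
  proof -
    let ?M = "max \<delta> \<delta>'"
    have s1: "inner_set ?M \<Omega> \<subseteq> core \<delta>" and s2: "inner_set ?M \<Omega> \<subseteq> inner_set \<delta>' \<Omega>"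
      by (auto intro!: inner_set_mono)
    have xM: "x \<in> inner_set ?M \<Omega>" using x by (auto simp: inner_set_def)
    have "AE x in lborel. x \<in> core \<delta> \<longrightarrow> \<phi> \<delta> x = w x" using \<phi>[OF d(1)] by (simp add: holder_rep_def)
    moreover have "AE x in lborel. x \<in> inner_set \<delta>' \<Omega> \<longrightarrow> \<phi> \<delta>' x = w x" using \<phi>[OF d(2)] by (simp add: holder_rep_def)
    ultimately have "AE x in lborel. x \<in> inner_set ?M \<Omega> \<longrightarrow> \<phi> \<delta> x = \<phi> \<delta>' x"
      by eventually_elim (use s1 s2 in auto)
    then show ?thesis
      using continuous_AE_eq[OF open_inner_set continuous_on_subset[OF holder_rep_continuous[OF \<phi>[OF d(1)]] s1]
        continuous_on_subset[OF holder_rep_continuous[OF \<phi>[OF d(2)]] s2] _ xM] by blast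
  qed
  have v_eq: "v x = \<phi> \<delta> x" if "\<delta> > 0" "x \<in> core \<delta>" for \<delta> x
  proof -
    have "infdist x (- \<Omega>) > 0" using that by (auto simp: inner_set_def)
    then have "infdist x (- \<Omega>) / 2 > 0" "x \<in> core (infdist x (- \<Omega>) / 2)" by (auto simp: inner_set_def)
    then show ?thesis unfolding v_def using agree that by blast
  qed
  \<comment> \<open>Inner sets with parameters \<open>1 / (real k + 1)\<close> exhaust
    \<open>\<Omega>\<close>, so a countable union of null sets covers all exceptions.\<close>
  have "AE x in lborel. \<forall>k::nat. x \<in> core (1 / (real k + 1)) \<longrightarrow> \<phi> (1 / (real k + 1)) x = w x"
    unfolding AE_all_countable
  proof
    fix k :: nat
    show "AE x in lborel. x \<in> core (1 / (real k + 1)) \<longrightarrow> \<phi> (1 / (real k + 1)) x = w x"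
      using \<phi>[of "1 / (real k + 1)"] by (simp add: holder_rep_def)
  qed
  then have ae: "AE x in lborel. x \<in> \<Omega> \<longrightarrow> v x = w x"
  proof eventually_elim
    case (elim x)
    show ?case
    proof
      assume "x \<in> \<Omega>"
      then obtain \<delta> where \<delta>: "\<delta> > 0" "{x} \<subseteq> core \<delta>" using compact_subset_inner_set[of "{x}" \<Omega>] \<Omega> by auto
      obtain k where k: "inverse (real (Suc k)) < \<delta>" using reals_Archimedean[OF \<delta>(1)] by blast
      then have "x \<in> core (1 / (real k + 1))"
        using \<delta>(2) inner_set_mono[of "1 / (real k + 1)" \<delta> \<Omega>] by (auto simp: inverse_eq_divide add.commute)
      then show "v x = w x" using elim v_eq[of "1 / (real k + 1)" x] by simp
    qed
  qed
  show ?thesis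
  proof (intro exI[of _ v] conjI ae allI impI)
    fix \<delta> \<alpha> :: real assume d: "\<delta> > 0" "\<alpha> > 0"
    have d2: "\<delta> / 2 > 0" using d by simp
    note L = local_regularity[OF d(1) \<phi>[OF d2] \<phi>[OF d(1)] v_eq[OF d(1)] d(2)]
    show "holder_on 1 \<alpha> (core \<delta>) v" if "s \<le> 1 / 2" "\<alpha> < 2 * s" by (rule L(1)[OF _ that])
    show "holder_on 2 \<alpha> (core \<delta>) v" if "1 / 2 < s" "\<alpha> < 2 * s - 1" by (rule L(2)[OF _ that])
  qed
qed

end

section \<open>Uniqueness of weak gradients\<close>

text \<open>Each factor tends to 1 where its argument is positive and vanishes elsewhere, so these
  smooth functions approximate the indicator of \<open>box l u\<close> from below.\<close>

definition box_cutoff :: "nat \<Rightarrow> 'a::euclidean_space \<Rightarrow> 'a \<Rightarrow> 'a \<Rightarrow> real" where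
  "box_cutoff m l u z = (\<Prod>b\<in>Basis. bump (real (Suc m) * ((z - l) \<bullet> b)) * bump (- real (Suc m) * ((z - u) \<bullet> b)))"

lemma Ck_box_cutoff: "Ck k (box_cutoff m l u)"
proof -
  have b: "kdiff UNIV j (\<lambda>t. bump (c * t))" for j c
    using kdiff_shift[OF kdiff_bump, of j c 0] by simp
  show ?thesis
    unfolding box_cutoff_def[abs_def]
    by (intro Ck_prod Ck_mult Ck_comp[OF b] Ck_inner) auto
qed

lemma box_cutoff_bounds: "0 \<le> box_cutoff m l u z" "box_cutoff m l u z \<le> 1"
  unfolding box_cutoff_def
  by (auto intro!: prod_nonneg prod_le_1 mult_le_one mult_nonneg_nonneg simp: bump_nonneg bump_le_1)

lemma box_cutoff_eq_0:
  assumes "z \<notin> box l u" shows "box_cutoff m l u z = 0"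
proof -
  obtain b where b: "b \<in> Basis" "\<not> (l \<bullet> b < z \<bullet> b \<and> z \<bullet> b < u \<bullet> b)" using assms by (auto simp: mem_box)
  have "bump (real (Suc m) * ((z - l) \<bullet> b)) * bump (- real (Suc m) * ((z - u) \<bullet> b)) = 0"
  proof (cases "l \<bullet> b < z \<bullet> b")
    case True
    then have "0 \<le> real (Suc m) * ((z - u) \<bullet> b)" using b by (intro mult_nonneg_nonneg) (auto simp: inner_diff_left)
    then have "- real (Suc m) * ((z - u) \<bullet> b) \<le> 0" by (simp only: mult_minus_left neg_le_0_iff_le)
    then show ?thesis by (simp add: bump_eq_0)
  next
    case False
    then have "real (Suc m) * ((z - l) \<bullet> b) \<le> 0" by (auto simp: inner_diff_left mult_le_0_iff)
    then show ?thesis by (simp add: bump_eq_0)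
  qed
  then show ?thesis unfolding box_cutoff_def using b(1) by (intro prod_zero) auto
qed

lemma bump_scale_tendsto: "t > 0 \<Longrightarrow> (\<lambda>m. bump (real (Suc m) * t)) \<longlonglongrightarrow> 1"
proof -
  assume t: "t > 0"
  have "(\<lambda>m. exp (- (1 / t) * inverse (real (Suc m)))) \<longlonglongrightarrow> exp (- (1 / t) * 0)"
    by (intro tendsto_intros LIMSEQ_inverse_real_of_nat)
  moreover have "bump (real (Suc m) * t) = exp (- (1 / t) * inverse (real (Suc m)))" for m
    using t by (simp add: bump_def divide_inverse)
  ultimately show ?thesis by simp
qed

lemma box_cutoff_tendsto: "(\<lambda>m. box_cutoff m l u z) \<longlonglongrightarrow> indicator (box l u) z"
proof (cases "z \<in> box l u")
  case True
  have "(\<lambda>m. box_cutoff m l u z) \<longlonglongrightarrow> (\<Prod>b\<in>(Basis::'a set). 1 * 1)"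
    unfolding box_cutoff_def
  proof (intro tendsto_prod tendsto_mult)
    fix b :: 'a assume "b \<in> Basis"
    then have "l \<bullet> b < z \<bullet> b" "z \<bullet> b < u \<bullet> b" using True by (auto simp: mem_box)
    then have p: "(z - l) \<bullet> b > 0" "- ((z - u) \<bullet> b) > 0" by (auto simp: inner_diff_left)
    show "(\<lambda>m. bump (real (Suc m) * ((z - l) \<bullet> b))) \<longlonglongrightarrow> 1" by (rule bump_scale_tendsto[OF p(1)])
    show "(\<lambda>m. bump (- real (Suc m) * ((z - u) \<bullet> b))) \<longlonglongrightarrow> 1"
      using bump_scale_tendsto[OF p(2)] by (simp only: mult_minus_left mult_minus_right)
  qed
  then show ?thesis using True by simp
next
  case False
  then show ?thesis by (simp add: box_cutoff_eq_0)
qed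

lemma box_cutoff_test:
  assumes "cbox l u \<subseteq> U" shows "box_cutoff m l u \<in> test_functions U"
proof -
  have "{x. box_cutoff m l u x \<noteq> 0} \<subseteq> cbox l u"
    using box_cutoff_eq_0[of _ l u m] box_subset_cbox[of l u] by auto
  then have c: "closure {x. box_cutoff m l u x \<noteq> 0} \<subseteq> cbox l u" by (rule closure_minimal) auto
  have "compact (closure {x. box_cutoff m l u x \<noteq> 0})"
    using bounded_subset[OF bounded_cbox c] by (simp only: compact_eq_bounded_closed closed_closure simp_thms)
  moreover have "smooth_on UNIV (box_cutoff m l u)" unfolding smooth_on_UNIV_iff by (intro allI Ck_box_cutoff)
  ultimately show ?thesis unfolding test_functions_def using c assms by blast
qed

text \<open>Open boxes are an intersection-stable generator of the Borel sets. The sets with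
  vanishing integral are closed under complements, thanks to \<open>all\<close>, and under disjoint
  countable unions; hence they are all Borel sets.\<close>

lemma AE_zero_of_box_integrals:
  fixes H :: "'a::euclidean_space \<Rightarrow> real"
  assumes H: "integrable lborel H" and box: "\<And>a b. (LINT x:box a b|lborel. H x) = 0" and all: "(LINT x|lborel. H x) = 0"
  shows "AE x in lborel. H x = 0"
proof -
  have [measurable]: "H \<in> borel_measurable borel" using borel_measurable_integrable[OF H] by simp
  have si: "set_integrable lborel A H" if "A \<in> sets borel" for A
    unfolding set_integrable_def using integrable_mult_indicator[of A lborel H] that H by simp
  have "(LINT x:A|lborel. H x) = 0" if "A \<in> sets borel" for A
  proof -
    have "Int_stable (range (\<lambda>(a, b). box a b :: 'a set))"
      by (auto simp: Int_stable_def box_Int_box)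
    moreover have "range (\<lambda>(a, b). box a b :: 'a set) \<subseteq> Pow UNIV" by simp
    moreover have "A \<in> sigma_sets UNIV (range (\<lambda>(a, b). box a b :: 'a set))"
      using that by (simp add: borel_eq_box)
    ultimately show ?thesis
    proof (induction rule: sigma_sets_induct_disjoint)
      case (basic A) then show ?case using box by auto
    next
      case empty then show ?case by (simp add: set_lebesgue_integral_def)
    next
      case (compl A)
      then have A: "A \<in> sets borel" by (simp add: borel_eq_box)
      have "(LINT x:UNIV - A|lborel. H x) + (LINT x:A|lborel. H x) = (LINT x:(UNIV - A) \<union> A|lborel. H x)"
        using A by (intro set_integral_Un[symmetric] si) auto
      also have "\<dots> = (LINT x|lborel. H x)" by (simp add: set_lebesgue_integral_def)
      finally show ?case using compl all by simp
    next
      case (union A)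
      then have A: "A i \<in> sets borel" for i by (auto simp: borel_eq_box)
      have "(LINT x:(\<Union>i. A i)|lborel. H x) = (\<Sum>i. LINT x:(A i)|lborel. H x)"
        using union(1) A by (intro lebesgue_integral_countable_add si) (auto simp: disjoint_family_on_def)
      then show ?case using union by simp
    qed
  qed
  then show ?thesis
    by (intro density_unique_real[OF H]) (auto simp: set_lebesgue_integral_def)
qed

text \<open>Testing with the cut-offs of a box and dominated convergence give zero integral over
  every box whose closure lies in \<open>U\<close>. Inside such a box
  \<open>AE_zero_of_box_integrals\<close> applies, and countably many closed boxes cover
  \<open>U\<close>.\<close>

lemma fundamental_lemma:
  fixes h :: "'a::euclidean_space \<Rightarrow> real"
  assumes U: "open U" and int: "\<And>K. compact K \<Longrightarrow> K \<subseteq> U \<Longrightarrow> set_integrable lebesgue K h"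
    and zero: "\<And>\<phi>. \<phi> \<in> test_functions U \<Longrightarrow> (LINT x:U|lebesgue. h x * \<phi> x) = 0"
  shows "AE x in lebesgue. x \<in> U \<longrightarrow> h x = 0"
proof -
  have box0: "(LINT x:box l u|lebesgue. h x) = 0" if sub: "cbox l u \<subseteq> U" for l u
  proof -
    have ic: "integrable lebesgue (\<lambda>x. indicator (cbox l u) x *\<^sub>R h x)"
      using int[OF compact_cbox sub] by (simp add: set_integrable_def)
    have ib: "integrable lebesgue (\<lambda>x. \<bar>indicator (cbox l u) x *\<^sub>R h x\<bar>)" using ic by (rule integrable_abs)
    have cm: "box_cutoff m l u \<in> borel_measurable lebesgue" for m
      using continuous_lebesgue_measurable(2)[OF Ck_continuous[OF Ck_box_cutoff[of 0]]] .
    have eq: "indicator U x *\<^sub>R (h x * box_cutoff m l u x) = (indicator (cbox l u) x *\<^sub>R h x) * box_cutoff m l u x" for x m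
    proof (cases "x \<in> box l u")
      case True
      then have "x \<in> cbox l u" using box_subset_cbox by blast
      then show ?thesis using sub by auto
    qed (simp add: box_cutoff_eq_0)
    have "(\<lambda>m. LINT x|lebesgue. (indicator (cbox l u) x *\<^sub>R h x) * box_cutoff m l u x) \<longlonglongrightarrow>
       (LINT x|lebesgue. (indicator (cbox l u) x *\<^sub>R h x) * indicator (box l u) x)"
    proof (rule integral_dominated_convergence[OF _ _ ib])
      show "(\<lambda>x. (indicator (cbox l u) x *\<^sub>R h x) * indicator (box l u) x) \<in> borel_measurable lebesgue"
        using ic by (intro borel_measurable_times borel_measurable_integrable borel_measurable_indicator) auto
      show "(\<lambda>x. (indicator (cbox l u) x *\<^sub>R h x) * box_cutoff m l u x) \<in> borel_measurable lebesgue" for m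
        by (intro borel_measurable_times borel_measurable_integrable[OF ic] cm)
      show "AE x in lebesgue. (\<lambda>m. (indicator (cbox l u) x *\<^sub>R h x) * box_cutoff m l u x) \<longlonglongrightarrow>
         (indicator (cbox l u) x *\<^sub>R h x) * indicator (box l u) x"
        by (intro AE_I2 tendsto_mult tendsto_const box_cutoff_tendsto)
      have "\<bar>indicator (cbox l u) x *\<^sub>R h x\<bar> * \<bar>box_cutoff m l u x\<bar> \<le> \<bar>indicator (cbox l u) x *\<^sub>R h x\<bar> * 1" for x m
        using box_cutoff_bounds[of m l u x] by (intro mult_left_mono) auto
      then show "AE x in lebesgue. norm ((indicator (cbox l u) x *\<^sub>R h x) * box_cutoff m l u x) \<le> \<bar>indicator (cbox l u) x *\<^sub>R h x\<bar>" for m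
        unfolding norm_mult by (intro AE_I2) simp
    qed
    moreover have "(LINT x|lebesgue. (indicator (cbox l u) x *\<^sub>R h x) * box_cutoff m l u x) = 0" for m
      using zero[OF box_cutoff_test[OF sub, of m]] unfolding set_lebesgue_integral_def eq .
    moreover have "(indicator (cbox l u) x *\<^sub>R h x) * indicator (box l u) x = indicator (box l u) x *\<^sub>R h x" for x
      using box_subset_cbox[of l u] by (auto simp: indicator_def)
    ultimately have "(\<lambda>m. 0) \<longlonglongrightarrow> (LINT x|lebesgue. indicator (box l u) x *\<^sub>R h x)" by (simp only:)
    then show ?thesis unfolding set_lebesgue_integral_def by (simp only: LIMSEQ_const_iff)
  qed
  have boxAE: "AE x in lebesgue. x \<in> cbox l u \<longrightarrow> h x = 0" if sub: "cbox l u \<subseteq> U" for l u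
  proof -
    \<comment> \<open>Restriction to one box turns local integrability into integrability, and every
      box integral of \<open>H\<close> is an integral of \<open>h\<close> over a smaller
      box.\<close>
    define H where "H x = indicator (box l u) x * h x" for x
    have "set_integrable lebesgue (box l u) h"
      by (rule set_integrable_subset[OF int[OF compact_cbox sub]]) (auto simp: box_subset_cbox)
    then have iH: "integrable lebesgue H" by (simp add: set_integrable_def H_def[abs_def])
    obtain H' where H': "H' \<in> borel_measurable lborel" "AE x in lborel. H x = H' x"
      using completion_ex_borel_measurable_real[of H lborel] iH borel_measurable_integrable by blast
    have aeq: "AE x in lebesgue. H x = H' x" using H'(2) by (rule AE_completion)
    have H'm: "H' \<in> borel_measurable lebesgue" using H'(1) by (rule measurable_completion)
    have Hm: "H \<in> borel_measurable lebesgue" using iH by (rule borel_measurable_integrable)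
    have "integrable lebesgue H'"
      using integrable_cong_AE[OF Hm H'm aeq] iH by simp
    then have iH': "integrable lborel H'" using H'(1) by (simp add: integrable_completion)
    have tr: "(LINT x:A|lborel. H' x) = (LINT x:A|lebesgue. H x)" if "A \<in> sets borel" for A
    proof -
      have "(LINT x:A|lborel. H' x) = (LINT x:A|lebesgue. H' x)"
        unfolding set_lebesgue_integral_def using that H'(1) by (intro integral_completion[symmetric]) auto
      also have "\<dots> = (LINT x:A|lebesgue. H x)"
        unfolding set_lebesgue_integral_def
      proof (rule integral_cong_AE)
        show "AE x in lebesgue. indicator A x *\<^sub>R H' x = indicator A x *\<^sub>R H x"
          using aeq by eventually_elim simp
      qed (use that H'm Hm in \<open>auto intro!: borel_measurable_scaleR borel_measurable_indicator simp del: real_scaleR_def\<close>)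
      finally show ?thesis .
    qed
    have Hbox: "(LINT x:box a b|lebesgue. H x) = 0" for a b
    proof -
      define l' where "l' = (\<Sum>i\<in>Basis. max (a \<bullet> i) (l \<bullet> i) *\<^sub>R i)"
      define u' where "u' = (\<Sum>i\<in>Basis. min (b \<bullet> i) (u \<bullet> i) *\<^sub>R i)"
      have e: "box a b \<inter> box l u = box l' u'" unfolding l'_def u'_def by (rule box_Int_box)
      have "(LINT x:box a b|lebesgue. H x) = (LINT x:box l' u'|lebesgue. h x)"
        unfolding set_lebesgue_integral_def H_def e[symmetric] by (simp add: indicator_inter_arith mult.assoc)
      also have "\<dots> = 0"
      proof (rule box0)
        have "cbox l' u' \<subseteq> cbox l u" unfolding l'_def u'_def by (auto simp: mem_box)
        then show "cbox l' u' \<subseteq> U" using sub by blast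
      qed
      finally show ?thesis .
    qed
    have "(LINT x|lborel. H' x) = (LINT x:UNIV|lborel. H' x)" by (simp add: set_lebesgue_integral_def)
    also have "\<dots> = (LINT x:UNIV|lebesgue. H x)" by (rule tr) simp
    also have "\<dots> = (LINT x:box l u|lebesgue. H x)"
      unfolding set_lebesgue_integral_def H_def by (intro Bochner_Integration.integral_cong) (auto simp: indicator_def)
    finally have all: "(LINT x|lborel. H' x) = 0" using Hbox by simp
    have "AE x in lborel. H' x = 0"
      by (rule AE_zero_of_box_integrals[OF iH' _ all]) (simp add: tr Hbox)
    then have "AE x in lebesgue. H x = 0" using aeq AE_completion[of _ lborel] by fastforce
    \<comment> \<open>The boundary of a box is a null set, which carries the conclusion over to the
      closed box.\<close>
    moreover have "AE x in lebesgue. x \<notin> cbox l u - box l u"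
      using negligible_frontier_interval[of l u] by (intro AE_not_in) (simp add: negligible_iff_null_sets)
    ultimately show ?thesis by eventually_elim (auto simp: H_def)
  qed
  obtain \<D> where D: "countable \<D>" "\<And>X. X \<in> \<D> \<Longrightarrow> \<exists>a b. X = cbox a b" "\<Union>\<D> = U"
    using open_countable_Union_open_cbox[OF U] by metis
  have "AE x in lebesgue. \<forall>X\<in>\<D>. x \<in> X \<longrightarrow> h x = 0"
  proof (subst AE_ball_countable[OF D(1)], intro ballI)
    fix X assume "X \<in> \<D>"
    moreover then obtain a b where "X = cbox a b" using D(2) by blast
    ultimately show "AE x in lebesgue. x \<in> X \<longrightarrow> h x = 0" using boxAE[of a b] D(3) by blast
  qed
  then show ?thesis by eventually_elim (use D(3) in auto)
qed

text \<open>The weak equation and the trace come with separate weak gradients of \<open>u\<close>;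
  this lemma identifies them almost everywhere.\<close>

lemma weak_gradient_unique:
  fixes u :: "'a::euclidean_space \<Rightarrow> real"
  assumes U: "open U" and g: "weak_gradient U u g" and g': "weak_gradient U u g'"
  shows "AE x in lebesgue. x \<in> U \<longrightarrow> g x = g' x"
proof -
  have "AE x in lebesgue. x \<in> U \<longrightarrow> (g x - g' x) \<bullet> i = 0" if i: "i \<in> Basis" for i
  proof (rule fundamental_lemma[OF U])
    fix K assume K: "compact K" "K \<subseteq> U"
    have "set_integrable lebesgue K g" "set_integrable lebesgue K g'" using g g' K by (auto simp: weak_gradient_def)
    then have "set_integrable lebesgue K (\<lambda>x. g x - g' x)" by (rule set_integral_diff(1))
    then have "integrable lebesgue (\<lambda>x. (indicator K x *\<^sub>R (g x - g' x)) \<bullet> i)" unfolding set_integrable_def by (rule integrable_inner_left)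
    then show "set_integrable lebesgue K (\<lambda>x. (g x - g' x) \<bullet> i)" by (simp add: set_integrable_def)
  next
    fix \<phi> assume \<phi>: "\<phi> \<in> test_functions U"
    have e: "(LINT x:U|lebesgue. (g x \<bullet> i) * \<phi> x) = (LINT x:U|lebesgue. (g' x \<bullet> i) * \<phi> x)"
    proof -
      have "(LINT x:U|lebesgue. u x * partial i \<phi> x) = - (LINT x:U|lebesgue. (g x \<bullet> i) * \<phi> x)"
        "(LINT x:U|lebesgue. u x * partial i \<phi> x) = - (LINT x:U|lebesgue. (g' x \<bullet> i) * \<phi> x)"
        using g g' \<phi> i by (simp_all add: weak_gradient_def)
      then show ?thesis by simp
    qed
    let ?K = "closure {x. \<phi> x \<noteq> 0}"
    have K: "compact ?K" "?K \<subseteq> U" using \<phi> by (auto simp: test_functions_def)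
    have ck: "Ck k \<phi>" for k using \<phi> by (auto simp: test_functions_def smooth_on_UNIV_iff)
    have pm: "\<phi> \<in> borel_measurable lebesgue" by (rule continuous_lebesgue_measurable(2)[OF Ck_continuous[OF ck[of 0]]])
    obtain B where B: "\<And>x. x \<in> ?K \<Longrightarrow> norm x \<le> B"
      using compact_imp_bounded[OF K(1)] by (auto simp: bounded_iff)
    have "\<phi> x = 0" if "norm x > B" for x using B[of x] that closure_subset[of "{x. \<phi> x \<noteq> 0}"] by fastforce
    then have "bdd_supp \<phi>" unfolding bdd_supp_def by blast
    then obtain C where C: "\<And>x. \<bar>\<phi> x\<bar> \<le> C" using bdd_supp_ucont(2)[OF Ck_continuous[OF ck[of 0]]] by blast
    have si: "set_integrable lebesgue U (\<lambda>x. (f x \<bullet> i) * \<phi> x)" if f: "set_integrable lebesgue ?K f" for f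
    proof -
      have fi: "integrable lebesgue (\<lambda>x. (indicator ?K x *\<^sub>R f x) \<bullet> i)"
        using f unfolding set_integrable_def by (rule integrable_inner_left)
      have "integrable lebesgue (\<lambda>x. ((indicator ?K x *\<^sub>R f x) \<bullet> i) * \<phi> x)"
      proof (rule Bochner_Integration.integrable_bound[where f = "\<lambda>x. C * ((indicator ?K x *\<^sub>R f x) \<bullet> i)"])
        show "integrable lebesgue (\<lambda>x. C * ((indicator ?K x *\<^sub>R f x) \<bullet> i))" using fi by (rule integrable_mult_right)
        show "(\<lambda>x. ((indicator ?K x *\<^sub>R f x) \<bullet> i) * \<phi> x) \<in> borel_measurable lebesgue"
          by (rule borel_measurable_times[OF borel_measurable_integrable[OF fi] pm])
        have "\<bar>a\<bar> * \<bar>\<phi> x\<bar> \<le> \<bar>C\<bar> * \<bar>a\<bar>" for a x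
          using mult_left_mono[OF order_trans[OF C[of x] abs_ge_self[of C]], of "\<bar>a\<bar>"] by (simp add: mult.commute)
        then show "AE x in lebesgue. norm (((indicator ?K x *\<^sub>R f x) \<bullet> i) * \<phi> x) \<le> norm (C * ((indicator ?K x *\<^sub>R f x) \<bullet> i))"
          unfolding real_norm_def abs_mult by (intro AE_I2) simp
      qed
      moreover have "((indicator ?K x *\<^sub>R f x) \<bullet> i) * \<phi> x = indicator U x *\<^sub>R ((f x \<bullet> i) * \<phi> x)" for x
        using K(2) closure_subset[of "{x. \<phi> x \<noteq> 0}"] by (cases "\<phi> x = 0") (auto simp: indicator_def)
      ultimately show ?thesis by (simp only: set_integrable_def)
    qed
    have "(LINT x:U|lebesgue. ((g x - g' x) \<bullet> i) * \<phi> x) = (LINT x:U|lebesgue. (g x \<bullet> i) * \<phi> x - (g' x \<bullet> i) * \<phi> x)"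
      by (simp add: inner_diff_left left_diff_distrib)
    also have "\<dots> = (LINT x:U|lebesgue. (g x \<bullet> i) * \<phi> x) - (LINT x:U|lebesgue. (g' x \<bullet> i) * \<phi> x)"
      using g g' K by (intro set_integral_diff(2) si) (auto simp: weak_gradient_def)
    also have "\<dots> = 0" using e by simp
    finally show "(LINT x:U|lebesgue. ((g x - g' x) \<bullet> i) * \<phi> x) = 0" .
  qed
  then have "AE x in lebesgue. \<forall>i\<in>Basis. x \<in> U \<longrightarrow> (g x - g' x) \<bullet> i = 0"
    by (subst AE_ball_countable) (auto intro: countable_finite)
  then show ?thesis
  proof eventually_elim
    case (elim x)
    show ?case
    proof
      assume "x \<in> U"
      then have "(g x - g' x) \<bullet> i = 0 \<bullet> i" if "i \<in> Basis" for i using elim that by simp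
      then have "g x - g' x = 0" by (rule euclidean_eqI)
      then show "g x = g' x" by simp
    qed
  qed
qed

lemma weak_gradient_subset:
  assumes "weak_gradient U u g" "V \<subseteq> U"
  shows "weak_gradient V u g"
  unfolding weak_gradient_def
proof (intro conjI allI ballI impI)
  show "set_integrable lebesgue K u" "set_integrable lebesgue K g" if "compact K \<and> K \<subseteq> V" for K
    using assms that by (auto simp: weak_gradient_def)
  fix \<phi> and i :: 'a assume \<phi>: "\<phi> \<in> test_functions V" and i: "i \<in> Basis"
  have z: "\<phi> x = 0" if "x \<notin> V" for x
    using \<phi> that closure_subset[of "{x. \<phi> x \<noteq> 0}"] by (auto simp: test_functions_def)
  have z': "partial i \<phi> x = 0" if "x \<notin> V" for x
  proof -
    have o: "open (- closure {x. \<phi> x \<noteq> 0})" by (intro open_Compl closed_closure)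
    have x: "x \<in> - closure {x. \<phi> x \<noteq> 0}" using \<phi> that by (auto simp: test_functions_def)
    have "\<phi> y = 0" if "y \<in> - closure {x. \<phi> x \<noteq> 0}" for y using that closure_subset[of "{x. \<phi> x \<noteq> 0}"] by auto
    then have "partial i \<phi> x = partial i (\<lambda>_. 0) x" by (rule partial_cong_open(1)[OF o _ x])
    also have "\<dots> = 0" by (subst partial_eq[OF has_derivative_const]) simp
    finally show ?thesis .
  qed
  have e: "(LINT x:V|lebesgue. F x * \<psi> x) = (LINT x:U|lebesgue. F x * \<psi> x)" if "\<And>x. x \<notin> V \<Longrightarrow> \<psi> x = 0" for F \<psi> :: "'a \<Rightarrow> real"
    unfolding set_lebesgue_integral_def using assms(2) that
    by (intro Bochner_Integration.integral_cong) (auto simp: indicator_def)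
  have "\<phi> \<in> test_functions U" using \<phi> assms(2) by (auto simp: test_functions_def)
  then have "(LINT x:U|lebesgue. u x * partial i \<phi> x) = - (LINT x:U|lebesgue. (g x \<bullet> i) * \<phi> x)"
    using assms(1) i by (simp add: weak_gradient_def)
  moreover have "(LINT x:V|lebesgue. u x * partial i \<phi> x) = (LINT x:U|lebesgue. u x * partial i \<phi> x)"
    by (rule e) (rule z')
  moreover have "(LINT x:V|lebesgue. (g x \<bullet> i) * \<phi> x) = (LINT x:U|lebesgue. (g x \<bullet> i) * \<phi> x)"
    by (rule e) (rule z)
  ultimately show "(LINT x:V|lebesgue. u x * partial i \<phi> x) = - (LINT x:V|lebesgue. (g x \<bullet> i) * \<phi> x)" by simp
qed

section \<open>Green's identity for the weighted Laplacian\<close>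

lemma Ck_differentiable: "Ck 1 f \<Longrightarrow> f differentiable (at x)"
  and Ck_partial: "Ck 1 f \<Longrightarrow> i \<in> Basis \<Longrightarrow> continuous_on UNIV (partial i f)"
  unfolding One_nat_def Ck.simps by (blast+)

lemma nn_integral_lborel_prod:
  fixes f :: "'a::euclidean_space \<times> 'b::euclidean_space \<Rightarrow> ennreal"
  assumes "f \<in> borel_measurable borel"
  shows "(\<integral>\<^sup>+z. f z \<partial>lborel) = (\<integral>\<^sup>+x. \<integral>\<^sup>+y. f (x, y) \<partial>lborel \<partial>lborel)"
proof -
  have "f \<in> borel_measurable (lborel \<Otimes>\<^sub>M lborel)"
    using assms by (simp add: lborel_prod)
  from lborel.nn_integral_fst[OF this] show ?thesis by (simp add: lborel_prod)
qed

text \<open>The weight extended by 0 below the boundary, so that integrals over the half space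
  become integrals over the whole space. It is homogeneous of degree \<open>a\<close> under positive
  dilations about boundary points and invariant under horizontal translations.\<close>

definition wt :: "real \<Rightarrow> 'a::euclidean_space \<times> real \<Rightarrow> real" where
  "wt a z = indicator {0<..} (snd z) * snd z powr a"

lemma fst_snd_borel [measurable]:
  "(fst :: 'a::euclidean_space \<times> 'b::euclidean_space \<Rightarrow> 'a) \<in> borel_measurable borel"
  "(snd :: 'a::euclidean_space \<times> 'b::euclidean_space \<Rightarrow> 'b) \<in> borel_measurable borel"
  by (rule borel_measurable_continuous_onI, rule continuous_on_fst[OF continuous_on_id])
    (rule borel_measurable_continuous_onI, rule continuous_on_snd[OF continuous_on_id])

lemma wt_measurable [measurable]: "wt a \<in> borel_measurable borel"
  unfolding wt_def[abs_def] by measurable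

lemma wt_nonneg: "0 \<le> wt a z"
  unfolding wt_def by simp

lemma nn_integral_powr_interval:
  assumes "a > -1"
  shows "(\<integral>\<^sup>+y. ennreal (indicator {0<..<T} y * y powr a) \<partial>lborel) < \<infinity>"
proof (cases "a \<ge> 0")
  case True
  have "(\<integral>\<^sup>+y. ennreal (indicator {0<..<T} y * y powr a) \<partial>lborel) \<le> (\<integral>\<^sup>+y. ennreal (T powr a) * indicator {0<..<T} y \<partial>lborel)"
    using True by (intro nn_integral_mono) (auto simp: indicator_def intro!: ennreal_leI powr_mono2)
  also have "\<dots> = ennreal (T powr a) * emeasure lborel {0<..<T}"
    by (subst nn_integral_cmult) auto
  also have "\<dots> < \<infinity>" by (cases "0 \<le> T") (auto simp: ennreal_mult_less_top)
  finally show ?thesis .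
next
  case False
  obtain C where C: "(\<integral>\<^sup>+x. ennreal (norm (x::real) powr (- (- a))) * indicator (ball 0 T) x \<partial>lborel) \<le> ennreal C"
    using nn_integral_powr_ball[where 'a = real, of "- a" T] False assms by auto
  have "(\<integral>\<^sup>+y. ennreal (indicator {0<..<T} y * y powr a) \<partial>lborel) \<le> (\<integral>\<^sup>+x. ennreal (norm (x::real) powr (- (- a))) * indicator (ball 0 T) x \<partial>lborel)"
    by (intro nn_integral_mono) (auto simp: indicator_def)
  also have "\<dots> < \<infinity>" using C by (auto simp: le_less_trans)
  finally show ?thesis .
qed

lemma nn_integral_wt_cylinder:
  fixes A :: "'a::euclidean_space set"
  assumes a: "a > -1" and A: "A \<in> sets borel" "emeasure lborel A < \<infinity>"
  shows "(\<integral>\<^sup>+z. ennreal (wt a z) * indicator (A \<times> {..<T}) z \<partial>lborel) < \<infinity>"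
proof -
  have [measurable]: "A \<in> sets borel" by fact
  have [measurable]: "A \<times> {..<T} \<in> sets borel" by (simp add: borel_prod[symmetric])
  have "(\<integral>\<^sup>+z. ennreal (wt a z) * indicator (A \<times> {..<T}) z \<partial>lborel)
     = (\<integral>\<^sup>+x. \<integral>\<^sup>+y. ennreal (wt a (x, y)) * indicator (A \<times> {..<T}) (x, y) \<partial>lborel \<partial>lborel)"
    by (rule nn_integral_lborel_prod) measurable
  also have "\<dots> = (\<integral>\<^sup>+x. \<integral>\<^sup>+y. indicator A x * ennreal (indicator {0<..<T} y * y powr a) \<partial>lborel \<partial>lborel)"
    by (intro nn_integral_cong) (auto simp: wt_def indicator_def)
  also have "\<dots> = (\<integral>\<^sup>+x. indicator A x * (\<integral>\<^sup>+y. ennreal (indicator {0<..<T} y * y powr a) \<partial>lborel) \<partial>(lborel::'a measure))"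
    by (intro nn_integral_cong nn_integral_cmult) measurable
  also have "\<dots> = (\<integral>\<^sup>+y. ennreal (indicator {0<..<T} y * y powr a) \<partial>lborel) * emeasure lborel A"
    by (subst nn_integral_multc) (auto simp: mult.commute)
  also have "\<dots> < \<infinity>"
    using nn_integral_powr_interval[OF a, of T] A(2) by (simp add: ennreal_mult_less_top)
  finally show ?thesis .
qed

lemma integrable_wt_ball:
  assumes "a > -1"
  shows "integrable lborel (\<lambda>z. wt a z * indicator (ball c r) z)"
proof (rule integrableI_bounded)
  show "(\<lambda>z. wt a z * indicator (ball c r) z) \<in> borel_measurable lborel" by measurable
  have "(\<integral>\<^sup>+z. ennreal (norm (wt a z * indicator (ball c r) z)) \<partial>lborel)
     \<le> (\<integral>\<^sup>+z. ennreal (wt a z) * indicator (ball (fst c) r \<times> {..<snd c + r}) z \<partial>lborel)"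
  proof (rule nn_integral_mono)
    fix z :: "'a \<times> real"
    have "dist (fst c) (fst z) \<le> dist c z" by (rule dist_fst_le)
    moreover have "\<bar>snd c - snd z\<bar> \<le> dist c z" using dist_snd_le[of c z] by (simp add: dist_real_def)
    ultimately show "ennreal (norm (wt a z * indicator (ball c r) z)) \<le> ennreal (wt a z) * indicator (ball (fst c) r \<times> {..<snd c + r}) z"
      by (cases z) (auto simp: indicator_def wt_nonneg)
  qed
  also have "\<dots> < \<infinity>"
    by (rule nn_integral_wt_cylinder[OF assms]) (auto intro: emeasure_bounded_finite[unfolded infinity_ennreal_def])
  finally show "(\<integral>\<^sup>+z. ennreal (norm (wt a z * indicator (ball c r) z)) \<partial>lborel) < \<infinity>" .
qed

lemma integrable_wt_bounded:
  assumes "a > -1" "f \<in> borel_measurable borel" "\<And>z. \<bar>f z\<bar> \<le> C" "\<And>z. z \<notin> ball c r \<Longrightarrow> f z = 0"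
  shows "integrable lborel (\<lambda>z. wt a z * f z)"
proof -
  have "integrable lborel (\<lambda>z. f z * (wt a z * indicator (ball c r) z))"
    by (rule bounded_mult_integrable[OF integrable_wt_ball[OF assms(1)] assms(2,3)])
  moreover have "f z * (wt a z * indicator (ball c r) z) = wt a z * f z" for z
    using assms(4)[of z] by (cases "z \<in> ball c r") auto
  ultimately show ?thesis by simp
qed

lemma Ck_bdd_supp_Lipschitz:
  fixes V :: "'b::euclidean_space \<Rightarrow> real"
  assumes "Ck 1 V" "bdd_supp V"
  shows "\<exists>L\<ge>0. \<forall>x y. \<bar>V x - V y\<bar> \<le> L * norm (x - y)"
proof -
  have "\<exists>C\<ge>0. \<forall>i\<in>(Basis::'b set). \<forall>x. \<bar>partial i V x\<bar> \<le> C"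
  proof (rule uniform_constant)
    fix i :: 'b assume i: "i \<in> Basis"
    then obtain C where C: "\<forall>x. \<bar>partial i V x\<bar> \<le> C"
      using bdd_supp_ucont(2)[OF _ bdd_supp_partial[OF assms(2)], of i] assms(1) by auto
    then have "C \<ge> 0" by (meson abs_ge_zero order_trans)
    then show "\<exists>C\<ge>0. \<forall>x. \<bar>partial i V x\<bar> \<le> C" using C by blast
  qed (auto intro: order_trans)
  then obtain C where C: "C \<ge> 0" "\<And>i x. i \<in> Basis \<Longrightarrow> \<bar>partial i V x\<bar> \<le> C" by blast
  have "\<bar>V x - V y\<bar> \<le> (real DIM('b) * C) * norm (x - y)" for x y
    by (rule Ck_Lipschitz[OF assms(1) C(2)])
  then show ?thesis using C(1) by (intro exI[of _ "real DIM('b) * C"]) auto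
qed

lemma integral_lborel_affine:
  fixes f :: "'b::euclidean_space \<Rightarrow> real"
  assumes [measurable]: "f \<in> borel_measurable borel" and "c \<noteq> 0"
  shows "(LINT z|lborel. f z) = \<bar>c\<bar> ^ DIM('b) * (LINT z|lborel. f (t + c *\<^sub>R z))"
proof -
  have "(LINT z|lborel. f z) = (LINT z|density (distr lborel borel (\<lambda>z. t + c *\<^sub>R z)) (\<lambda>_. ennreal (\<bar>c\<bar> ^ DIM('b))). f z)"
    using lborel_affine[OF assms(2), of t] by simp
  also have "\<dots> = (LINT z|distr lborel borel (\<lambda>z. t + c *\<^sub>R z). \<bar>c\<bar> ^ DIM('b) *\<^sub>R f z)"
    by (rule integral_density) auto
  also have "\<dots> = (LINT z|lborel. \<bar>c\<bar> ^ DIM('b) *\<^sub>R f (t + c *\<^sub>R z))"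
    by (rule integral_distr) auto
  finally show ?thesis by simp
qed

text \<open>Both sides are the derivative at \<open>c = 1\<close> of the integral of \<open>wt a z * V (z0 + c (z - z0))\<close>,
  which is homogeneous in \<open>c\<close> because the weight is, as long as \<open>z0\<close> lies on the boundary of the half space.\<close>

lemma dilation_identity:
  fixes V :: "'a::euclidean_space \<times> real \<Rightarrow> real"
  assumes a: "a > -1" and V: "Ck 1 V" "bdd_supp V" and z0: "snd z0 = 0"
  shows "(LINT z|lborel. wt a z * frechet_derivative V (at z) (z - z0))
     = - (real DIM('a) + 1 + a) * (LINT z|lborel. wt a z * V z)"
proof -
  define N where "N = real DIM('a) + 1 + a"
  obtain B0 where B0: "\<And>z. norm z > B0 \<Longrightarrow> V z = 0" using V(2) unfolding bdd_supp_def by blast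
  define B where "B = \<bar>B0\<bar> + norm z0 + 1"
  have B: "V z = 0" if "norm (z - z0) \<ge> B" for z
    using that norm_triangle_ineq4[of z z0] by (intro B0) (auto simp: B_def)
  obtain L where L: "L \<ge> 0" "\<And>x y. \<bar>V x - V y\<bar> \<le> L * norm (x - y)" using Ck_bdd_supp_Lipschitz[OF V] by blast
  have cV: "continuous_on UNIV V" by (rule Ck_continuous[OF V(1)])
  have [measurable]: "V \<in> borel_measurable borel" by (rule borel_measurable_continuous_onI[OF cV])
  obtain C where C: "\<And>z. \<bar>V z\<bar> \<le> C" using bdd_supp_ucont(2)[OF cV V(2)] by blast
  have Vd: "V differentiable (at z)" for z by (rule Ck_differentiable[OF V(1)])
  define I where "I = (LINT z|lborel. wt a z * V z)"
  \<comment> \<open>Change of variables by the dilation with factor \<open>c = 1 + t\<close> about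
    \<open>z0\<close>: the volume contributes the dimension \<open>DIM('a) + 1\<close> and the
    weight contributes \<open>a\<close> to the exponent \<open>N\<close>.\<close>
  have scale: "(LINT z|lborel. wt a z * V (z + t *\<^sub>R (z - z0))) = (1 + t) powr (- N) * I" if t: "t > 0" for t
  proof -
    define c where "c = 1 + t"
    have c: "c > 0" using t by (simp add: c_def)
    have "I = \<bar>c\<bar> ^ DIM('a \<times> real) * (LINT z|lborel. wt a ((z0 - c *\<^sub>R z0) + c *\<^sub>R z) * V ((z0 - c *\<^sub>R z0) + c *\<^sub>R z))"
      unfolding I_def using c by (intro integral_lborel_affine[where f = "\<lambda>z. wt a z * V z"]) auto
    also have "(LINT z|lborel. wt a ((z0 - c *\<^sub>R z0) + c *\<^sub>R z) * V ((z0 - c *\<^sub>R z0) + c *\<^sub>R z))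
       = (LINT z|lborel. c powr a * (wt a z * V (z + t *\<^sub>R (z - z0))))"
    proof (intro Bochner_Integration.integral_cong refl)
      fix z :: "'a \<times> real"
      have 1: "(z0 - c *\<^sub>R z0) + c *\<^sub>R z = z + t *\<^sub>R (z - z0)" by (simp add: c_def algebra_simps)
      have 2: "wt a ((z0 - c *\<^sub>R z0) + c *\<^sub>R z) = c powr a * wt a z"
        using c z0 by (simp add: wt_def powr_mult indicator_def zero_less_mult_iff)
      show "wt a ((z0 - c *\<^sub>R z0) + c *\<^sub>R z) * V ((z0 - c *\<^sub>R z0) + c *\<^sub>R z) = c powr a * (wt a z * V (z + t *\<^sub>R (z - z0)))"
        unfolding 2 unfolding 1 by simp
    qed
    also have "\<bar>c\<bar> ^ DIM('a \<times> real) * (LINT z|lborel. c powr a * (wt a z * V (z + t *\<^sub>R (z - z0))))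
        = (c powr (real DIM('a) + 1) * c powr a) * (LINT z|lborel. wt a z * V (z + t *\<^sub>R (z - z0)))"
    proof -
      have "\<bar>c\<bar> ^ DIM('a \<times> real) = c powr (real DIM('a) + 1)"
        using c powr_realpow[of c "DIM('a) + 1"] by (simp add: add.commute)
      then show ?thesis by simp
    qed
    also have "c powr (real DIM('a) + 1) * c powr a = c powr N" by (simp add: N_def powr_add[symmetric])
    finally show ?thesis using c by (simp add: c_def powr_minus field_simps)
  qed
  define F where "F m z = wt a z * ((V (z + E m *\<^sub>R (z - z0)) - V z) / E m)" for m z
  have cF: "continuous_on UNIV (\<lambda>z. V (z + s *\<^sub>R (z - z0)))" for s
    by (intro continuous_on_compose2[OF cV] continuous_intros) auto
  have i0: "integrable lborel (\<lambda>z. wt a z * V z)"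
    by (rule integrable_wt_bounded[OF a _ C, where c = z0 and r = B]) (use B in \<open>auto simp: dist_norm norm_minus_commute\<close>)
  \<comment> \<open>Dilations with factor above 1 move points away from \<open>z0\<close>, so all
    difference quotients vanish outside one fixed ball.\<close>
  have zero: "V (z + E m *\<^sub>R (z - z0)) = 0" if "norm (z - z0) \<ge> B" for z m
  proof (rule B)
    have "(z + E m *\<^sub>R (z - z0)) - z0 = (1 + E m) *\<^sub>R (z - z0)" by (simp add: algebra_simps)
    then have "norm ((z + E m *\<^sub>R (z - z0)) - z0) = (1 + E m) * norm (z - z0)" using E(2)[of m] by simp
    also have "\<dots> \<ge> 1 * norm (z - z0)" using E(2)[of m] by (intro mult_right_mono) auto
    finally show "B \<le> norm ((z + E m *\<^sub>R (z - z0)) - z0)" using that by simp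
  qed
  have i1: "integrable lborel (\<lambda>z. wt a z * V (z + E m *\<^sub>R (z - z0)))" for m
  proof (rule integrable_wt_bounded[OF a, where c = z0 and r = B and C = C])
    show "(\<lambda>z. V (z + E m *\<^sub>R (z - z0))) \<in> borel_measurable borel"
      by (rule borel_measurable_continuous_onI[OF cF])
    show "V (z + E m *\<^sub>R (z - z0)) = 0" if "z \<notin> ball z0 B" for z
      using zero that by (auto simp: dist_norm norm_minus_commute)
  qed (rule C)
  have IF: "(LINT z|lborel. F m z) = (((1 + E m) powr (- N) - 1) / E m) * I" for m
  proof -
    have "(LINT z|lborel. F m z) = (LINT z|lborel. (wt a z * V (z + E m *\<^sub>R (z - z0)) - wt a z * V z) / E m)"
      unfolding F_def by (intro Bochner_Integration.integral_cong) (auto simp: field_simps)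
    also have "\<dots> = ((LINT z|lborel. wt a z * V (z + E m *\<^sub>R (z - z0))) - I) / E m"
      unfolding I_def using i0 i1 by simp
    finally show ?thesis using scale[OF E(2)[of m]] by (simp add: field_simps)
  qed
  have "(\<lambda>m. LINT z|lborel. F m z) \<longlonglongrightarrow> (LINT z|lborel. wt a z * frechet_derivative V (at z) (z - z0))"
  proof (rule integral_dominated_convergence[where w = "\<lambda>z. (L * B) * (wt a z * indicator (ball z0 B) z)"])
    have meq: "frechet_derivative V (at z) (z - z0) = (\<Sum>b\<in>Basis. ((z - z0) \<bullet> b) * partial b V z)" for z
      by (rule frechet_eq_sum[OF Vd])
    have "continuous_on UNIV (\<lambda>z. \<Sum>b\<in>Basis. ((z - z0) \<bullet> b) * partial b V z)"
      by (intro continuous_intros Ck_partial[OF V(1)])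
    then have [measurable]: "(\<lambda>z. frechet_derivative V (at z) (z - z0)) \<in> borel_measurable borel"
      unfolding meq by (rule borel_measurable_continuous_onI)
    show "(\<lambda>z. wt a z * frechet_derivative V (at z) (z - z0)) \<in> borel_measurable lborel" by measurable
    have [measurable]: "(\<lambda>z. V (z + E m *\<^sub>R (z - z0))) \<in> borel_measurable borel" for m
      by (rule borel_measurable_continuous_onI[OF cF])
    show "F m \<in> borel_measurable lborel" for m unfolding F_def[abs_def] by measurable
    show "integrable lborel (\<lambda>z. (L * B) * (wt a z * indicator (ball z0 B) z))"
      using integrable_wt_ball[OF a] by (rule integrable_mult_right)
    show "AE z in lborel. norm (F m z) \<le> (L * B) * (wt a z * indicator (ball z0 B) z)" for m
    proof (rule AE_I2)
      fix z :: "'a \<times> real"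
      show "norm (F m z) \<le> (L * B) * (wt a z * indicator (ball z0 B) z)"
      proof (cases "norm (z - z0) < B")
        case True
        have "\<bar>V (z + E m *\<^sub>R (z - z0)) - V z\<bar> \<le> L * (E m * norm (z - z0))"
          using L(2)[of "z + E m *\<^sub>R (z - z0)" z] E(2)[of m] by simp
        also have "\<dots> \<le> L * (E m * B)" using L(1) E(2)[of m] True by (intro mult_left_mono) auto
        finally have "\<bar>V (z + E m *\<^sub>R (z - z0)) - V z\<bar> / E m \<le> L * B" using E(2)[of m] by (simp add: field_simps)
        then have "wt a z * (\<bar>V (z + E m *\<^sub>R (z - z0)) - V z\<bar> / E m) \<le> wt a z * (L * B)"
          by (intro mult_left_mono wt_nonneg)
        moreover have "z \<in> ball z0 B" using True by (simp add: dist_norm norm_minus_commute)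
        ultimately show ?thesis using E(2)[of m] by (simp add: F_def abs_mult wt_nonneg mult.commute)
      next
        case False
        then show ?thesis using zero[of z m] B[of z] by (simp add: F_def dist_norm norm_minus_commute)
      qed
    qed
    show "AE z in lborel. (\<lambda>m. F m z) \<longlonglongrightarrow> wt a z * frechet_derivative V (at z) (z - z0)"
    proof (intro AE_I2)
      fix z :: "'a \<times> real"
      let ?v = "z - z0" and ?D = "frechet_derivative V (at z)"
      have "(V has_derivative ?D) (at (z + 0 *\<^sub>R ?v))" using has_derivative_frechet[OF Vd] by simp
      moreover have "((\<lambda>t. z + t *\<^sub>R ?v) has_derivative (\<lambda>t. t *\<^sub>R ?v)) (at 0)"
        by (auto intro!: derivative_eq_intros)
      ultimately have "((\<lambda>t. V (z + t *\<^sub>R ?v)) has_derivative (\<lambda>t. ?D (t *\<^sub>R ?v))) (at 0)"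
        by (rule has_derivative_compose[rotated])
      moreover have "?D (t *\<^sub>R ?v) = ?D ?v * t" for t
        by (simp add: linear_scale[OF linear_frechet_derivative[OF Vd]])
      ultimately have "((\<lambda>t. V (z + t *\<^sub>R ?v)) has_real_derivative ?D ?v) (at 0)"
        by (simp add: has_field_derivative_def)
      then have "((\<lambda>t. (V (z + t *\<^sub>R ?v) - V z) / t) \<longlongrightarrow> ?D ?v) (at 0)"
        by (simp add: has_field_derivative_iff)
      moreover have "filterlim E (at 0) sequentially"
        using E(1,2) unfolding filterlim_at by (auto simp: less_imp_neq[symmetric])
      ultimately have "(\<lambda>m. (V (z + E m *\<^sub>R ?v) - V z) / E m) \<longlonglongrightarrow> ?D ?v"
        by (rule filterlim_compose)
      then show "(\<lambda>m. F m z) \<longlonglongrightarrow> wt a z * ?D ?v" unfolding F_def by (intro tendsto_mult tendsto_const)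
    qed
  qed
  moreover have "(\<lambda>m. LINT z|lborel. F m z) \<longlonglongrightarrow> - N * I"
  proof -
    have "((\<lambda>t. (1 + t) powr (- N)) has_real_derivative - N) (at 0)"
      by (auto intro!: derivative_eq_intros)
    then have "((\<lambda>t. ((1 + t) powr (- N) - 1) / t) \<longlongrightarrow> - N) (at 0)"
      by (simp add: has_field_derivative_iff)
    moreover have "filterlim E (at 0) sequentially"
      using E(1,2) unfolding filterlim_at by (auto simp: less_imp_neq[symmetric])
    ultimately have "(\<lambda>m. ((1 + E m) powr (- N) - 1) / E m) \<longlonglongrightarrow> - N"
      by (rule filterlim_compose)
    then show ?thesis unfolding IF by (intro tendsto_mult tendsto_const)
  qed
  ultimately have "(LINT z|lborel. wt a z * frechet_derivative V (at z) (z - z0)) = - N * I"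
    by (rule LIMSEQ_unique)
  then show ?thesis by (simp add: N_def I_def)
qed

text \<open>For \<open>F = ker0 q R e\<close> the difference \<open>Pk - Rk\<close> is
  \<open>- (4 t F'' + 4 q F')\<close>. The leading powers cancel; what survives is a term with the
  factor \<open>e\<close>, which concentrates at \<open>t = 0\<close>, and a term from the
  derivative of the cut-off, which lives on \<open>R / 2 < t < R\<close>.\<close>

definition Pk :: "real \<Rightarrow> real \<Rightarrow> real \<Rightarrow> real \<Rightarrow> real" where
  "Pk q R e t = 4 * q * e * zeta R t * (t + e) powr (- q - 1)"
definition Rk :: "real \<Rightarrow> real \<Rightarrow> real \<Rightarrow> real \<Rightarrow> real" where
  "Rk q R e t = 4 * t * beta R t * (t + e) powr (- q)"

lemma grad_inner:
  assumes "f differentiable (at z)" shows "grad f z \<bullet> v = frechet_derivative f (at z) v"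
  unfolding frechet_eq_sum[OF assms] grad_def
  by (subst inner_sum_left) (simp add: inner_commute[of _ v] mult.commute)

text \<open>The radial function \<open>F t = ker0 q R e t\<close> with \<open>t = |z - z0|\<^sup>2\<close> satisfies
  \<open>div (y\<^sup>a grad F) = y\<^sup>a (4 t F'' + 4 q F')\<close>, as \<open>2 q = DIM('a) + 1 + a\<close>.\<close>

lemma green_identity:
  fixes \<Phi> :: "'a::euclidean_space \<times> real \<Rightarrow> real" and q R e :: real
  assumes a: "a > -1" and q: "2 * q = real DIM('a) + 1 + a" and e: "e > 0" and \<Phi>: "Ck 1 \<Phi>" and z0: "snd z0 = 0"
  defines "\<psi> \<equiv> \<lambda>z. ker0 q R e ((norm (z - z0))\<^sup>2)"
  shows "(LINT z|lborel. wt a z * (grad \<Phi> z \<bullet> grad \<psi> z))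
     = (LINT z|lborel. wt a z * (\<Phi> z * (Pk q R e ((norm (z - z0))\<^sup>2) - Rk q R e ((norm (z - z0))\<^sup>2))))"
proof -
  \<comment> \<open>Differentiating \<open>V\<close> along the Euler field \<open>z - z0\<close>
    produces \<open>grad \<Phi> z \<bullet> grad \<psi> z\<close> plus a multiple of
    \<open>\<Phi> z\<close>. The dilation identity then replaces integration by parts, and no
    boundary term at \<open>y = 0\<close> appears although \<open>\<Phi>\<close> need not vanish
    there.\<close>
  define V where "V z = \<Phi> z * (2 * ker1 q R e ((norm (z - z0))\<^sup>2))" for z
  have te: "- e < (norm (z - z0))\<^sup>2" for z using e by (auto intro: less_le_trans[of _ 0])
  have ck1: "Ck k (\<lambda>z. ker1 q R e ((norm (z - z0))\<^sup>2))" for k by (rule Ck_radial[OF kdiff_ker1 e])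
  have V1: "Ck 1 V" unfolding V_def[abs_def] by (intro Ck_mult \<Phi> ck1 Ck_const)
  have b1: "bdd_supp (\<lambda>z. ker1 q R e ((norm (z - z0))\<^sup>2))" by (rule bdd_supp_radial[OF ker1_eq_0])
  then have V2: "bdd_supp V" unfolding V_def bdd_supp_def by auto
  have \<Phi>d: "\<Phi> differentiable (at z)" for z by (rule Ck_differentiable[OF \<Phi>])
  have Vd: "frechet_derivative V (at z) (z - z0) = grad \<Phi> z \<bullet> grad \<psi> z + \<Phi> z * (4 * (norm (z - z0))\<^sup>2 * ker2 q R e ((norm (z - z0))\<^sup>2))" for z
  proof -
    let ?t = "(norm (z - z0))\<^sup>2"
    have d1: "((\<lambda>z. 2 * ker1 q R e ((norm (z - z0))\<^sup>2)) has_derivative (\<lambda>v. 2 * (ker2 q R e ?t * (2 * ((z - z0) \<bullet> v))))) (at z)"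
      by (rule has_derivative_mult_right[OF has_derivative_radial[OF DERIV_ker1[OF te]]])
    have "(V has_derivative (\<lambda>v. \<Phi> z * (2 * (ker2 q R e ?t * (2 * ((z - z0) \<bullet> v)))) + frechet_derivative \<Phi> (at z) v * (2 * ker1 q R e ?t))) (at z)"
      unfolding V_def[abs_def] by (rule has_derivative_mult[OF has_derivative_frechet[OF \<Phi>d] d1])
    from fun_cong[OF frechet_derivative_at[OF this], of "z - z0"]
    have E1: "frechet_derivative V (at z) (z - z0) =
      \<Phi> z * (2 * (ker2 q R e ?t * (2 * ?t))) + frechet_derivative \<Phi> (at z) (z - z0) * (2 * ker1 q R e ?t)"
      by (simp only: power2_norm_eq_inner)
    have E2: "grad \<psi> z = (2 * ker1 q R e ?t) *\<^sub>R (z - z0)"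
      unfolding \<psi>_def by (rule grad_radial[OF DERIV_ker0[OF te]])
    show ?thesis
      unfolding E1 E2 inner_scaleR_right grad_inner[OF \<Phi>d, of z "z - z0"] by algebra
  qed
  have cg: "continuous_on UNIV (\<lambda>z. frechet_derivative V (at z) (z - z0))"
  proof -
    have "frechet_derivative V (at z) (z - z0) = (\<Sum>b\<in>Basis. ((z - z0) \<bullet> b) * partial b V z)" for z
      by (rule frechet_eq_sum[OF Ck_differentiable[OF V1]])
    moreover have "continuous_on UNIV (\<lambda>z. \<Sum>b\<in>Basis. ((z - z0) \<bullet> b) * partial b V z)"
      by (intro continuous_intros Ck_partial[OF V1])
    ultimately show ?thesis by simp
  qed
  have int: "integrable lborel (\<lambda>z. wt a z * f z)" if f: "continuous_on UNIV f" "bdd_supp f" for f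
  proof -
    obtain C where C: "\<And>z. \<bar>f z\<bar> \<le> C" using bdd_supp_ucont(2)[OF f] by blast
    obtain B where B: "\<And>z. norm z > B \<Longrightarrow> f z = 0" using f(2) unfolding bdd_supp_def by blast
    show ?thesis
      by (rule integrable_wt_bounded[OF a borel_measurable_continuous_onI[OF f(1)] C, where c = 0 and r = "B + 1"]) (use B in auto)
  qed
  have "bdd_supp (\<lambda>z. frechet_derivative V (at z) (z - z0))"
  proof -
    have "\<exists>B. \<forall>z. norm z > B \<longrightarrow> (\<forall>b\<in>Basis. partial b V z = 0)"
    proof -
      have "\<exists>B\<ge>0. \<forall>b\<in>(Basis::('a\<times>real) set). \<forall>z. norm z > B \<longrightarrow> partial b V z = 0"
      proof (rule uniform_constant)
        fix b :: "'a \<times> real"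
        obtain B where "\<forall>z. norm z > B \<longrightarrow> partial b V z = 0" using bdd_supp_partial[OF V2, of b] unfolding bdd_supp_def by blast
        then show "\<exists>B\<ge>0. \<forall>z. norm z > B \<longrightarrow> partial b V z = 0" by (intro exI[of _ "max 0 B"]) auto
      qed auto
      then show ?thesis by blast
    qed
    moreover have "frechet_derivative V (at z) (z - z0) = (\<Sum>b\<in>Basis. ((z - z0) \<bullet> b) * partial b V z)" for z
      by (rule frechet_eq_sum[OF Ck_differentiable[OF V1]])
    moreover obtain B where B: "\<And>z b. norm z > B \<Longrightarrow> b \<in> Basis \<Longrightarrow> partial b V z = 0" using calculation(1) by blast
    ultimately have "frechet_derivative V (at z) (z - z0) = 0" if "norm z > B" for z using B[OF that] by simp
    then show ?thesis unfolding bdd_supp_def by blast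
  qed
  then have i1: "integrable lborel (\<lambda>z. wt a z * frechet_derivative V (at z) (z - z0))" by (rule int[OF cg])
  have i2: "integrable lborel (\<lambda>z. wt a z * V z)" by (rule int[OF Ck_continuous[OF V1] V2])
  have c3: "continuous_on UNIV (\<lambda>z. \<Phi> z * (4 * (norm (z - z0))\<^sup>2 * ker2 q R e ((norm (z - z0))\<^sup>2)))"
  proof -
    have "kdiff {- e<..} 1 (ker1 q R e)" by (rule kdiff_ker1)
    have "continuous_on {- e<..} (\<lambda>t. beta R t * (t + e) powr (- q) + q * zeta R t * (t + e) powr (- q - 1))"
      by (intro continuous_intros continuous_on_beta continuous_on_zeta) auto
    then have "continuous_on {- e<..} (ker2 q R e)" unfolding ker2_def[abs_def] .
    then have "continuous_on UNIV (\<lambda>z. ker2 q R e ((norm (z - z0))\<^sup>2))"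
      by (rule continuous_on_compose2) (use te in \<open>auto intro!: continuous_intros\<close>)
    then show ?thesis by (intro continuous_intros Ck_continuous[OF \<Phi>])
  qed
  have "bdd_supp (\<lambda>z. ker2 q R e ((norm (z - z0))\<^sup>2))" by (rule bdd_supp_radial[OF ker2_eq_0])
  then have "bdd_supp (\<lambda>z. \<Phi> z * (4 * (norm (z - z0))\<^sup>2 * ker2 q R e ((norm (z - z0))\<^sup>2)))" unfolding bdd_supp_def by auto
  then have i3: "integrable lborel (\<lambda>z. wt a z * (\<Phi> z * (4 * (norm (z - z0))\<^sup>2 * ker2 q R e ((norm (z - z0))\<^sup>2))))"
    by (rule int[OF c3])
  \<comment> \<open>With \<open>(t + e) powr (- q)\<close> written as
    \<open>(t + e) * (t + e) powr (- q - 1)\<close> the terms proportional to \<open>t\<close>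
    cancel and the factor \<open>e\<close> remains.\<close>
  have alg: "4 * t * ker2 q R e t + 2 * q * (2 * ker1 q R e t) = - (Pk q R e t - Rk q R e t)" if "t \<ge> 0" for t
  proof -
    have "(t + e) powr (- q) = (t + e) * (t + e) powr (- q - 1)"
      using that e by (simp add: powr_diff)
    then have k1: "ker1 q R e t = - (zeta R t * ((t + e) * (t + e) powr (- q - 1)))" unfolding ker1_def by simp
    have "4 * t * (b * A + q * z * P) + 2 * q * (2 * (- (z * ((t + e) * P)))) = - (4 * q * e * z * P - 4 * t * b * A)" for b A z P :: real
      by (simp add: algebra_simps)
    then show ?thesis unfolding k1 ker2_def Pk_def Rk_def .
  qed
  have "(LINT z|lborel. wt a z * (grad \<Phi> z \<bullet> grad \<psi> z)) =
    (LINT z|lborel. wt a z * frechet_derivative V (at z) (z - z0)) -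
    (LINT z|lborel. wt a z * (\<Phi> z * (4 * (norm (z - z0))\<^sup>2 * ker2 q R e ((norm (z - z0))\<^sup>2))))"
    using i1 i3 by (subst Bochner_Integration.integral_diff[symmetric]) (auto simp: Vd algebra_simps)
  also have "\<dots> = - (2 * q) * (LINT z|lborel. wt a z * V z) - (LINT z|lborel. wt a z * (\<Phi> z * (4 * (norm (z - z0))\<^sup>2 * ker2 q R e ((norm (z - z0))\<^sup>2))))"
    using dilation_identity[OF a V1 V2 z0] q by simp
  also have "\<dots> = (LINT z|lborel. - (2 * q) * (wt a z * V z) - wt a z * (\<Phi> z * (4 * (norm (z - z0))\<^sup>2 * ker2 q R e ((norm (z - z0))\<^sup>2))))"
    using i2 i3 by simp
  also have "\<dots> = (LINT z|lborel. wt a z * (\<Phi> z * (Pk q R e ((norm (z - z0))\<^sup>2) - Rk q R e ((norm (z - z0))\<^sup>2))))"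
  proof (intro Bochner_Integration.integral_cong refl)
    fix z :: "'a \<times> real"
    let ?t = "(norm (z - z0))\<^sup>2"
    have "- (2 * q) * (wt a z * V z) - wt a z * (\<Phi> z * (4 * ?t * ker2 q R e ?t)) = - (wt a z * (\<Phi> z * (4 * ?t * ker2 q R e ?t + 2 * q * (2 * ker1 q R e ?t))))"
      unfolding V_def by (simp add: algebra_simps)
    also have "\<dots> = wt a z * (\<Phi> z * (Pk q R e ?t - Rk q R e ?t))"
      by (simp only: alg[OF zero_le_power2] mult_minus_right minus_minus)
    finally show "- (2 * q) * (wt a z * V z) - wt a z * (\<Phi> z * (4 * ?t * ker2 q R e ?t)) = wt a z * (\<Phi> z * (Pk q R e ?t - Rk q R e ?t))" .
  qed
  finally show ?thesis .
qed

text \<open>The bound by \<open>e powr (- q)\<close> gives integrability for fixed \<open>e\<close>;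
  the one with the factor \<open>e\<close> gives decay away from \<open>t = 0\<close> as
  \<open>e\<close> tends to 0.\<close>

lemma Pk_bounds:
  assumes "0 < q" "0 < e" "0 \<le> t" "0 < R"
  shows "0 \<le> Pk q R e t" "Pk q R e t \<le> 4 * q * R * e powr (- q)" "t > 0 \<Longrightarrow> Pk q R e t \<le> 4 * q * R * e * t powr (- q - 1)"
    "t \<ge> R \<Longrightarrow> Pk q R e t = 0"
proof -
  have 0: "0 \<le> zeta R t" "zeta R t \<le> R" using assms zeta_bounds[where R = R and t = t] by auto
  then show "0 \<le> Pk q R e t" using assms by (simp add: Pk_def)
  have "(t + e) powr (- q - 1) \<le> e powr (- q - 1)"
    using assms powr_neg_mono[of e "t + e" "q + 1"] by simp
  then have "4 * q * e * zeta R t * (t + e) powr (- q - 1) \<le> 4 * q * e * R * e powr (- q - 1)"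
    using assms 0 by (intro mult_mono mult_left_mono mult_nonneg_nonneg) auto
  also have "\<dots> = 4 * q * R * e powr (- q)" using assms by (simp add: powr_diff)
  finally show "Pk q R e t \<le> 4 * q * R * e powr (- q)" by (simp add: Pk_def)
  show "Pk q R e t \<le> 4 * q * R * e * t powr (- q - 1)" if "t > 0"
  proof -
    have "(t + e) powr (- q - 1) \<le> t powr (- q - 1)"
      using assms that powr_neg_mono[of t "t + e" "q + 1"] by simp
    then have "4 * q * e * zeta R t * (t + e) powr (- q - 1) \<le> 4 * q * e * R * t powr (- q - 1)"
      using assms 0 by (intro mult_mono mult_left_mono mult_nonneg_nonneg) auto
    then show ?thesis by (simp add: Pk_def mult_ac)
  qed
  show "Pk q R e t = 0" if "t \<ge> R" using that by (simp add: Pk_def zeta_eq_0)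
qed

lemma Rk_bounds:
  assumes "0 < q" "0 \<le> e" "0 \<le> t" "0 < R"
  shows "0 \<le> Rk q R e t" "Rk q R e t \<le> 4 * R * (R / 2) powr (- q)" "t \<ge> R \<Longrightarrow> Rk q R e t = 0"
proof -
  show "0 \<le> Rk q R e t" using assms by (simp add: Rk_def beta_bounds)
  show "Rk q R e t = 0" if "t \<ge> R" using that by (simp add: Rk_def beta_eq_0)
  show "Rk q R e t \<le> 4 * R * (R / 2) powr (- q)"
  proof (cases "R / 2 < t \<and> t < R")
    case True
    have "(t + e) powr (- q) \<le> (R / 2) powr (- q)"
      using True assms by (intro powr_neg_mono) auto
    then have "4 * t * beta R t * (t + e) powr (- q) \<le> 4 * R * 1 * (R / 2) powr (- q)"
      using True assms by (intro mult_mono beta_bounds mult_nonneg_nonneg) auto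
    then show ?thesis by (simp add: Rk_def)
  next
    case False
    then have "beta R t = 0" by (intro beta_eq_0) auto
    then show ?thesis using assms by (simp add: Rk_def)
  qed
qed

lemma Rk_tendsto:
  assumes "X \<longlonglongrightarrow> 0" "t \<ge> 0" "R > 0"
  shows "(\<lambda>m. Rk q R (X m) t) \<longlonglongrightarrow> Rk q R 0 t"
proof (cases "t = 0")
  case False
  have "(\<lambda>m. 4 * t * beta R t * (t + X m) powr (- q)) \<longlonglongrightarrow> 4 * t * beta R t * (t + 0) powr (- q)"
    using assms False by (intro tendsto_intros) auto
  then show ?thesis by (simp add: Rk_def)
qed (simp add: Rk_def)

lemma kdiff_Pk: "kdiff {- e<..} k (Pk q R e)"
proof -
  have "kdiff {- e<..} k (\<lambda>t. (4 * q * e) * (zeta R t * (t + e) powr (- q - 1)))"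
    by (intro kdiff_mult kdiff_const kdiff_powr kdiff_subset[OF kdiff_zeta]) auto
  then show ?thesis unfolding Pk_def[abs_def] by (simp add: mult.assoc)
qed

lemma kdiff_Rk: "kdiff {- e<..} k (Rk q R e)"
proof -
  have "kdiff {- e<..} k (\<lambda>t. 4 * (t * (beta R t * (t + e) powr (- q))))"
    by (intro kdiff_mult kdiff_const kdiff_powr kdiff_id kdiff_subset[OF kdiff_beta]) auto
  then show ?thesis unfolding Rk_def[abs_def] by (simp add: mult.assoc)
qed

section \<open>The boundary limit of the Poisson extension\<close>

lemma kdiff_cong:
  assumes "open S" "\<And>t. t \<in> S \<Longrightarrow> f t = g t" "kdiff S k f"
  shows "kdiff S k g"
proof (cases k)
  case (Suc n)
  then obtain f' where f': "\<And>t. t \<in> S \<Longrightarrow> (f has_real_derivative f' t) (at t)" "kdiff S n f'" using assms(3) by auto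
  have "(g has_real_derivative f' t) (at t)" if t: "t \<in> S" for t
    using has_field_derivative_transform_within_open[OF f'(1)[OF t] assms(1) t assms(2)] by simp
  then show ?thesis using f'(2) Suc by auto
qed simp

lemma kdiff_glue:
  assumes S: "open S" "open T"
  shows "kdiff S k f \<Longrightarrow> kdiff T k f \<Longrightarrow> kdiff (S \<union> T) k f"
proof (induction k arbitrary: f)
  case (Suc k)
  obtain g where g: "\<And>t. t \<in> S \<Longrightarrow> (f has_real_derivative g t) (at t)" "kdiff S k g" using Suc.prems by auto
  obtain h where h: "\<And>t. t \<in> T \<Longrightarrow> (f has_real_derivative h t) (at t)" "kdiff T k h" using Suc.prems by auto
  define f' where "f' t = (if t \<in> S then g t else h t)" for t
  \<comment> \<open>On the overlap the two derivatives agree by uniqueness, so the glued one is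
    correct on both sets.\<close>
  have fT: "f' t = h t" if "t \<in> T" for t
    using DERIV_unique[OF g(1) h(1)[OF that]] by (auto simp: f'_def)
  have "kdiff S k f'" by (rule kdiff_cong[OF S(1) _ g(2)]) (simp add: f'_def)
  moreover have "kdiff T k f'" by (rule kdiff_cong[OF S(2) _ h(2)]) (simp add: fT)
  ultimately have "kdiff (S \<union> T) k f'" by (rule Suc.IH)
  moreover have "(f has_real_derivative f' t) (at t)" if "t \<in> S \<union> T" for t
    using that g(1)[of t] h(1)[of t] by (cases "t \<in> S") (auto simp: f'_def)
  ultimately show ?case by auto
qed simp

text \<open>\<open>beta R\<close> vanishes near 0, so the singularity of \<open>t powr - q\<close> is harmless even for \<open>e = 0\<close>.\<close>

lemma kdiff_Rk0: "R > 0 \<Longrightarrow> kdiff UNIV k (Rk q R 0)"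
proof -
  assume "R > 0"
  have "kdiff {..<R / 2} k (Rk q R 0)"
    by (rule kdiff_cong[OF _ _ kdiff_const[of _ _ 0]]) (auto simp: Rk_def beta_eq_0)
  moreover have "kdiff {0<..} k (Rk q R 0)" using kdiff_Rk[of 0] by simp
  ultimately have "kdiff ({..<R / 2} \<union> {0<..}) k (Rk q R 0)" by (intro kdiff_glue) auto
  moreover have "{..<R / 2} \<union> {0<..} = UNIV" using \<open>R > 0\<close> by auto
  ultimately show ?thesis by simp
qed

lemma Ck_radial_UNIV:
  assumes "\<And>k. kdiff UNIV k h"
  shows "Ck k (\<lambda>z. h ((norm (z - c))\<^sup>2))"
  by (rule Ck_comp[OF assms Ck_sqnorm]) simp

text \<open>For \<open>a = 1 - 2 * s\<close> the relation on \<open>q\<close> reads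
  \<open>2 q = n + 2 - 2 s\<close>. The condition \<open>\<rho> \<le> T\<close> keeps the upper half
  of the ball of radius \<open>\<rho>\<close> around a boundary point over \<open>core\<close>
  inside the cylinder \<open>U\<close>.\<close>

locale extension =
  fixes \<Omega> :: "'a::euclidean_space set" and a q \<rho> T :: real
  assumes \<Omega>: "open \<Omega>" "bounded \<Omega>" and a: "- 1 < a" "a < 1" and q: "2 * q = real DIM('a) + 1 + a"
    and \<rho>: "0 < \<rho>" "\<rho> \<le> 1" "\<rho> \<le> T"
begin

abbreviation "core \<equiv> inner_set \<rho> \<Omega>"

text \<open>\<open>P e\<close> is an unnormalised approximate identity, concentrating at the origin
  as \<open>e\<close> tends to 0. \<open>S e\<close> is supported in a shell and stays smooth down
  to \<open>e = 0\<close>; it produces the smooth remainder of the representation.\<close>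

definition P :: "real \<Rightarrow> 'a \<times> real \<Rightarrow> real" where "P e z = Pk q (\<rho>\<^sup>2) e ((norm z)\<^sup>2)"
definition S :: "real \<Rightarrow> 'a \<times> real \<Rightarrow> real" where "S e z = Rk q (\<rho>\<^sup>2) e ((norm z)\<^sup>2)"
definition U :: "('a \<times> real) set" where "U = \<Omega> \<times> {0<..<T}"
definition mass :: "real \<Rightarrow> real" where "mass e = (LINT z|lborel. wt a (z :: 'a \<times> real) * P e z)"

lemma q_pos: "q > 0" using q a DIM_positive[where 'a = 'a] by linarith
lemma R_pos: "\<rho>\<^sup>2 > 0" using \<rho> by simp

lemma P_Ck: "e > 0 \<Longrightarrow> Ck k (P e)"
  using Ck_radial[OF kdiff_Pk, of e k q "\<rho>\<^sup>2" "0 :: 'a \<times> real"] by (simp only: P_def[abs_def] diff_zero)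

lemma S_Ck: "e \<ge> 0 \<Longrightarrow> Ck k (S e)"
proof (cases "e = 0")
  case True
  show ?thesis
    using Ck_radial_UNIV[OF kdiff_Rk0[OF R_pos], of k q "0 :: 'a \<times> real"] by (simp only: S_def[abs_def] diff_zero True)
next
  case False
  assume "e \<ge> 0"
  with False have "e > 0" by simp
  from Ck_radial[OF kdiff_Rk this, of k q "\<rho>\<^sup>2" "0 :: 'a \<times> real"] show ?thesis by (simp only: S_def[abs_def] diff_zero)
qed

lemma S_supp: "bdd_supp (S e)"
proof -
  have "bdd_supp (\<lambda>z :: 'a \<times> real. Rk q (\<rho>\<^sup>2) e ((norm (z - 0))\<^sup>2))"
    by (rule bdd_supp_radial[of "\<rho>\<^sup>2"]) (simp add: Rk_def beta_eq_0)
  then show ?thesis by (simp only: S_def[abs_def] diff_zero)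
qed

lemma P_bounds:
  assumes "e > 0"
  shows "0 \<le> P e z" "P e z \<le> 4 * q * \<rho>\<^sup>2 * e powr (- q)" "norm z \<ge> \<rho> \<Longrightarrow> P e z = 0"
    "z \<noteq> 0 \<Longrightarrow> P e z \<le> 4 * q * \<rho>\<^sup>2 * e * norm z powr (- 2 * q - 2)"
proof -
  show "0 \<le> P e z" "P e z \<le> 4 * q * \<rho>\<^sup>2 * e powr (- q)"
    using Pk_bounds(1,2)[OF q_pos assms _ R_pos, of "(norm z)\<^sup>2"] by (auto simp: P_def)
  show "P e z = 0" if "norm z \<ge> \<rho>"
    unfolding P_def using \<rho> that by (intro Pk_bounds(4)[OF q_pos assms _ R_pos] power_mono) auto
  show "P e z \<le> 4 * q * \<rho>\<^sup>2 * e * norm z powr (- 2 * q - 2)" if "z \<noteq> 0"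
    using Pk_bounds(3)[OF q_pos assms _ R_pos, of "(norm z)\<^sup>2"] that by (simp add: P_def powr_norm_sq algebra_simps)
qed

lemma S_bounds:
  assumes "e \<ge> 0"
  shows "0 \<le> S e z" "S e z \<le> 4 * \<rho>\<^sup>2 * (\<rho>\<^sup>2 / 2) powr (- q)" "norm z \<ge> \<rho> \<Longrightarrow> S e z = 0"
proof -
  show "0 \<le> S e z" "S e z \<le> 4 * \<rho>\<^sup>2 * (\<rho>\<^sup>2 / 2) powr (- q)"
    using Rk_bounds(1,2)[OF q_pos assms _ R_pos, of "(norm z)\<^sup>2"] by (auto simp: S_def)
  show "S e z = 0" if "norm z \<ge> \<rho>"
    unfolding S_def using \<rho> that by (intro Rk_bounds(3)[OF q_pos assms _ R_pos] power_mono) auto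
qed

lemma P_measurable [measurable]: "e > 0 \<Longrightarrow> P e \<in> borel_measurable borel"
  by (rule borel_measurable_continuous_onI[OF Ck_continuous[OF P_Ck[of e 0]]])

lemma S_measurable [measurable]: "e \<ge> 0 \<Longrightarrow> S e \<in> borel_measurable borel"
  by (rule borel_measurable_continuous_onI[OF Ck_continuous[OF S_Ck[of e 0]]])

lemma wtP_integrable: "e > 0 \<Longrightarrow> integrable lborel (\<lambda>z. wt a z * P e z)"
proof (rule integrable_wt_bounded[OF a(1) P_measurable, where c = 0 and r = \<rho>])
  assume e: "e > 0"
  show "\<bar>P e z\<bar> \<le> 4 * q * \<rho>\<^sup>2 * e powr (- q)" for z using P_bounds(1,2)[OF e, of z] by simp
  show "P e z = 0" if "z \<notin> ball 0 \<rho>" for z using that P_bounds(3)[OF e, of z] by simp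
qed

lemma wtS_integrable: "e \<ge> 0 \<Longrightarrow> integrable lborel (\<lambda>z. wt a z * S e z)"
proof (rule integrable_wt_bounded[OF a(1) S_measurable, where c = 0 and r = \<rho>])
  assume e: "e \<ge> 0"
  show "\<bar>S e z\<bar> \<le> 4 * \<rho>\<^sup>2 * (\<rho>\<^sup>2 / 2) powr (- q)" for z using S_bounds(1,2)[OF e, of z] by simp
  show "S e z = 0" if "z \<notin> ball 0 \<rho>" for z using that S_bounds(3)[OF e, of z] by simp
qed

text \<open>Green's identity for the constant function 1 computes the mass of the approximate identity.\<close>

lemma mass_eq: "e > 0 \<Longrightarrow> mass e = (LINT z|lborel. wt a (z :: 'a \<times> real) * S e z)"
proof -
  assume e: "e > 0"
  have g: "grad (\<lambda>_::'a \<times> real. 1) z = 0" for z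
    unfolding grad_def by (subst partial_eq[OF has_derivative_const]) simp
  have "(LINT z|lborel. wt a (z :: 'a \<times> real) * (1 * (P e z - S e z))) = 0"
    using green_identity[OF a(1) q e Ck_const[of 1 1], of 0 "\<rho>\<^sup>2"] by (simp add: g P_def S_def)
  then have "(LINT z|lborel. wt a (z :: 'a \<times> real) * P e z - wt a z * S e z) = 0"
    by (simp add: right_diff_distrib)
  then show ?thesis
    using wtP_integrable[OF e] wtS_integrable[of e] e by (simp add: mass_def)
qed

definition mass0 :: real where "mass0 = (LINT z|lborel. wt a (z :: 'a \<times> real) * S 0 z)"

lemma S_tendsto: "(\<lambda>m. S (E m) z) \<longlonglongrightarrow> S 0 z"
  unfolding S_def by (rule Rk_tendsto[OF E(1) _ R_pos]) simp

lemma mass_tendsto: "(\<lambda>m. mass (E m)) \<longlonglongrightarrow> mass0"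
proof -
  let ?C = "4 * \<rho>\<^sup>2 * (\<rho>\<^sup>2 / 2) powr (- q)"
  have "(\<lambda>m. LINT z|lborel. wt a (z :: 'a \<times> real) * S (E m) z) \<longlonglongrightarrow> mass0"
    unfolding mass0_def
  proof (rule integral_dominated_convergence[where w = "\<lambda>z :: 'a \<times> real. ?C * (wt a z * indicator (ball 0 \<rho>) z)"])
    show "integrable lborel (\<lambda>z :: 'a \<times> real. ?C * (wt a z * indicator (ball 0 \<rho>) z))"
      using integrable_wt_ball[OF a(1)] by (rule integrable_mult_right)
    show "AE z in lborel. (\<lambda>m. wt a (z :: 'a \<times> real) * S (E m) z) \<longlonglongrightarrow> wt a z * S 0 z"
      by (intro AE_I2 tendsto_mult tendsto_const S_tendsto)
    show "(\<lambda>z :: 'a \<times> real. wt a z * S (E m) z) \<in> borel_measurable lborel" for m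
      using wtS_integrable[OF E(3)] by (rule borel_measurable_integrable)
    show "(\<lambda>z :: 'a \<times> real. wt a z * S 0 z) \<in> borel_measurable lborel"
      using wtS_integrable[OF order_refl] by (rule borel_measurable_integrable)
    show "AE z in lborel. norm (wt a (z :: 'a \<times> real) * S (E m) z) \<le> ?C * (wt a z * indicator (ball 0 \<rho>) z)" for m
    proof (rule AE_I2)
      fix z :: "'a \<times> real"
      show "norm (wt a z * S (E m) z) \<le> ?C * (wt a z * indicator (ball 0 \<rho>) z)"
      proof (cases "norm z < \<rho>")
        case True
        have "wt a z * S (E m) z \<le> wt a z * ?C" by (intro mult_left_mono S_bounds(2) E wt_nonneg)
        then show ?thesis using True S_bounds(1)[OF E(3)[of m], of z] by (simp add: wt_nonneg mult.commute)
      next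
        case False
        then show ?thesis using S_bounds(3)[OF E(3)[of m], of z] by simp
      qed
    qed
  qed
  then show ?thesis using mass_eq[OF E(2)] by simp
qed

text \<open>The integrand is nonnegative, and positive on an open half shell, so the averages may
  later be normalised by \<open>mass0\<close>.\<close>

lemma mass0_pos: "mass0 > 0"
proof -
  have nn: "0 \<le> wt a z * S 0 z" for z :: "'a \<times> real" using S_bounds(1)[of 0 z] wt_nonneg[of a z] by simp
  have "mass0 \<ge> 0" unfolding mass0_def by (intro integral_nonneg_AE AE_I2 nn)
  moreover have "mass0 \<noteq> 0"
  proof
    assume "mass0 = 0"
    then have ae: "AE z in lborel. wt a z * S 0 (z :: 'a \<times> real) = 0"
      unfolding mass0_def using integral_nonneg_eq_0_iff_AE[OF wtS_integrable[OF order_refl]] nn by auto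
    define W where "W = {z :: 'a \<times> real. \<rho>\<^sup>2 / 2 < (norm z)\<^sup>2 \<and> (norm z)\<^sup>2 < \<rho>\<^sup>2 \<and> 0 < snd z}"
    have "open W" unfolding W_def by (intro open_Collect_conj open_Collect_less continuous_intros)
    \<comment> \<open>The squared norm of this point is \<open>9/16 * \<rho>\<^sup>2\<close>,
      strictly between \<open>\<rho>\<^sup>2 / 2\<close> and \<open>\<rho>\<^sup>2\<close>.\<close>
    have "(0, \<rho> * (3 / 4)) \<in> W"
      unfolding W_def using \<rho> by (auto simp: norm_Pair power2_eq_square field_simps)
    then have "W \<noteq> {}" by blast
    then have "\<not> negligible W" using open_not_negligible[OF \<open>open W\<close>] by blast
    moreover have "negligible W"
    proof -
      have "AE z in lborel. z \<notin> W"
        using ae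
      proof eventually_elim
        case (elim z)
        show ?case
        proof
          assume z: "z \<in> W"
          then have "wt a z > 0" by (simp add: W_def wt_def)
          moreover have "S 0 z > 0"
          proof -
            have "beta (\<rho>\<^sup>2) ((norm z)\<^sup>2) > 0" using z by (intro beta_pos) (auto simp: W_def)
            moreover have "norm z \<noteq> 0" using z by (auto simp: W_def)
            ultimately show ?thesis by (simp add: S_def Rk_def)
          qed
          ultimately show False using elim by simp
        qed
      qed
      then have "W \<in> null_sets lborel" using \<open>open W\<close> by (simp add: AE_iff_null_sets)
      then show ?thesis by (simp add: negligible_iff_null_sets null_sets_completionI)
    qed
    ultimately show False by simp
  qed
  ultimately show ?thesis by simp
qed

lemma wt_shift: "wt a (z + (x, 0)) = wt a z"
  by (simp add: wt_def)

lemma integral_translate: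
  fixes f :: "'b::euclidean_space \<Rightarrow> real"
  assumes "f \<in> borel_measurable borel"
  shows "(LINT z|lborel. f (z + c)) = (LINT z|lborel. f z)"
  using integral_lborel_affine[OF assms, where c = 1 and t = c] by (simp add: add.commute[of c])

end

section \<open>Averages at the boundary, controlled by trace and gradient\<close>

lemma norm_fst_snd_le: "norm (fst z) \<le> norm z" "norm (snd z) \<le> norm z"
  using norm_fst_le[of "fst z" "snd z"] norm_snd_le[of "snd z" "fst z"] by simp_all

lemma grad_continuous: "Ck 1 h \<Longrightarrow> continuous_on UNIV (grad h)"
  unfolding grad_def by (intro continuous_intros Ck_partial)

lemma norm_partial_le_grad:
  assumes "f differentiable (at z)" "i \<in> Basis" shows "\<bar>partial i f z\<bar> \<le> norm (grad f z)"
proof -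
  have "partial i f z = grad f z \<bullet> i" using grad_inner[OF assms(1), of i] by (simp add: partial_def)
  then show ?thesis using Cauchy_Schwarz_ineq2[of "grad f z" i] assms(2) by simp
qed

text \<open>The fundamental theorem of calculus on the vertical segment above \<open>(x, 0)\<close>.
  The right side does not depend on \<open>y\<close>, so one bound serves all heights in the support
  of the kernel.\<close>

lemma slice_bound:
  fixes h :: "'a::euclidean_space \<times> real \<Rightarrow> real"
  assumes h: "Ck 1 h" and y: "0 < y" "y < T"
  shows "ennreal \<bar>h (x, y)\<bar> \<le> ennreal \<bar>h (x, 0)\<bar> + (\<integral>\<^sup>+\<tau>. ennreal (norm (grad h (x, \<tau>))) * indicator {0<..<T} \<tau> \<partial>lborel)"
proof -
  have bs: "(0, 1) \<in> (Basis :: ('a \<times> real) set)" by (simp add: Basis_prod_def)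
  define p where "p = (\<lambda>\<tau>. partial (0, 1) h (x, \<tau>))"
  have cp: "continuous_on UNIV p"
    unfolding p_def by (intro continuous_on_compose2[OF Ck_partial[OF h bs]] continuous_intros) auto
  have dh: "((\<lambda>\<tau>. h (x, \<tau>)) has_vector_derivative p \<tau>) (at \<tau> within {0..y})" for \<tau>
  proof -
    have "((\<lambda>\<tau>. h (x, \<tau>)) has_derivative (\<lambda>t. frechet_derivative h (at (x, \<tau>)) (0, t))) (at \<tau> within {0..y})"
      by (rule has_derivative_compose[OF _ has_derivative_frechet[OF Ck_differentiable[OF h]]])
        (auto intro!: derivative_eq_intros)
    moreover have "frechet_derivative h (at (x, \<tau>)) (0, t) = t *\<^sub>R p \<tau>" for t
      using linear_scale[OF linear_frechet_derivative[OF Ck_differentiable[OF h]], of "(x, \<tau>)" t "(0, 1)"]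
      by (simp add: p_def partial_def)
    ultimately show ?thesis by (simp add: has_vector_derivative_def)
  qed
  have F: "has_bochner_integral lborel (\<lambda>\<tau>. indicator {0..y} \<tau> *\<^sub>R p \<tau>) (h (x, y) - h (x, 0))"
    using y by (intro has_bochner_integral_FTC_Icc dh continuous_on_subset[OF cp]) auto
  then have "ennreal \<bar>h (x, y) - h (x, 0)\<bar> = ennreal (norm (LINT \<tau>|lborel. indicator {0..y} \<tau> *\<^sub>R p \<tau>))"
    by (simp add: has_bochner_integral_iff)
  also have "\<dots> \<le> (\<integral>\<^sup>+\<tau>. ennreal (norm (indicator {0..y} \<tau> *\<^sub>R p \<tau>)) \<partial>lborel)"
    using F by (intro integral_norm_bound_ennreal) (simp add: has_bochner_integral_iff)
  also have "\<dots> \<le> (\<integral>\<^sup>+\<tau>. ennreal (norm (grad h (x, \<tau>))) * indicator {0<..<T} \<tau> \<partial>lborel)"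
  proof (rule nn_integral_mono_AE)
    show "AE \<tau> in lborel. ennreal (norm (indicator {0..y} \<tau> *\<^sub>R p \<tau>)) \<le> ennreal (norm (grad h (x, \<tau>))) * indicator {0<..<T} \<tau>"
      using AE_lborel_singleton[of "0::real"]
    proof eventually_elim
      case (elim \<tau>)
      show ?case
        using elim y norm_partial_le_grad[OF Ck_differentiable[OF h] bs, of "(x, \<tau>)"]
        by (auto simp: indicator_def p_def intro!: ennreal_leI)
    qed
  qed
  finally have *: "ennreal \<bar>h (x, y) - h (x, 0)\<bar> \<le> \<dots>" .
  have "ennreal \<bar>h (x, y)\<bar> \<le> ennreal (\<bar>h (x, 0)\<bar> + \<bar>h (x, y) - h (x, 0)\<bar>)" by (intro ennreal_leI) linarith
  also have "\<dots> = ennreal \<bar>h (x, 0)\<bar> + ennreal \<bar>h (x, y) - h (x, 0)\<bar>" by simp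
  finally show ?thesis using * by (meson add_left_mono order_trans)
qed

context extension
begin

lemma U_open: "open U" and U_borel [measurable]: "U \<in> sets borel" and \<Omega>_borel [measurable]: "\<Omega> \<in> sets borel"
proof -
  show "open U" unfolding U_def by (intro open_Times \<Omega> open_greaterThanLessThan)
  then show "U \<in> sets borel" by (rule borel_open)
  show "\<Omega> \<in> sets borel" by (rule borel_open[OF \<Omega>(1)])
qed

lemma inner_borel [measurable]: "inner_set r \<Omega> \<in> sets borel"
  by (rule borel_open[OF open_inner_set])

lemma near_boundary:
  assumes "x \<in> core" "norm (z - (x, 0)) < \<rho>" shows "fst z \<in> \<Omega>" "snd z > 0 \<Longrightarrow> z \<in> U"
proof -
  have "norm (fst z - x) \<le> norm (z - (x, 0))" using norm_fst_snd_le(1)[of "z - (x, 0)"] by simp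
  then have "fst z \<in> inner_set (\<rho> - \<rho>) \<Omega>"
    using assms(2) by (intro inner_set_near[OF assms(1)]) (simp add: dist_norm norm_minus_commute)
  then show *: "fst z \<in> \<Omega>" using inner_set_subset[of 0 \<Omega>] by auto
  have "\<bar>snd z\<bar> \<le> norm (z - (x, 0))" using norm_fst_snd_le(2)[of "z - (x, 0)"] by simp
  then show "z \<in> U" if "snd z > 0" using * that \<rho> assms(2) by (cases z) (auto simp: U_def)
qed

text \<open>Outside \<open>U\<close> a point either lies at height at most 0, where the weight
  vanishes, or at distance at least \<open>\<rho>\<close> from \<open>(x, 0)\<close>, where the
  kernel does.\<close>

lemma outside_U:
  assumes "x \<in> core" "z \<notin> U" "norm (z - (x, 0)) \<ge> \<rho> \<Longrightarrow> f = 0" shows "wt a z * f = 0"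
proof (cases "norm (z - (x, 0)) < \<rho>")
  case True
  then have "\<not> snd z > 0" using near_boundary(2)[OF assms(1)] assms(2) by blast
  then show ?thesis by (simp add: wt_def)
next
  case False
  then show ?thesis using assms(3) by simp
qed

lemma P_even: "P e (z - c) = P e (c - z)" and S_even: "S e (z - c) = S e (c - z)"
  unfolding P_def S_def by (simp_all add: norm_minus_commute)

definition Ab where "Ab e h x = (LINT z|lborel. wt a z * (h z * P e (z - (x, 0))))"

lemma Ab_measurable [measurable]:
  assumes [measurable]: "h \<in> borel_measurable borel" and e: "e > 0"
  shows "Ab e h \<in> borel_measurable borel"
proof -
  note P_measurable[OF e, measurable]
  have "(\<lambda>p. P e (snd p - (fst p, 0))) \<in> borel_measurable (borel \<Otimes>\<^sub>M borel)" by measurable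
  then have "(\<lambda>x. (LINT z|lborel. wt a z * (h z * P e (z - (x, 0))))) \<in> borel_measurable borel"
    by (intro lborel.borel_measurable_lebesgue_integral) measurable
  then show ?thesis unfolding Ab_def[abs_def] .
qed

lemma cont_bounded_ball:
  fixes h :: "'b::euclidean_space \<Rightarrow> real"
  assumes "continuous_on UNIV h" obtains C where "C \<ge> 0" "\<And>z. z \<in> cball c r \<Longrightarrow> \<bar>h z\<bar> \<le> C"
proof -
  have "bounded (h ` cball c r)"
    by (intro compact_imp_bounded compact_continuous_image continuous_on_subset[OF assms] compact_cball) simp
  then obtain C where "\<And>z. z \<in> cball c r \<Longrightarrow> \<bar>h z\<bar> \<le> C" unfolding bounded_iff by (auto simp del: mem_cball)
  then show ?thesis using that[of "\<bar>C\<bar>"] by (meson abs_ge_self abs_ge_zero order_trans)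
qed

lemma Ab_integrable:
  assumes h: "continuous_on UNIV h" and e: "e > 0"
  shows "integrable lborel (\<lambda>z. wt a z * (h z * P e (z - (x, 0))))"
proof -
  note P_measurable[OF e, measurable]
  have [measurable]: "h \<in> borel_measurable borel" by (rule borel_measurable_continuous_onI[OF h])
  obtain C where C: "C \<ge> 0" "\<And>z. z \<in> cball (x, 0) \<rho> \<Longrightarrow> \<bar>h z\<bar> \<le> C" using cont_bounded_ball[OF h] by blast
  show ?thesis
  proof (rule integrable_wt_bounded[OF a(1), where c = "(x, 0)" and r = \<rho>])
    show "(\<lambda>z. h z * P e (z - (x, 0))) \<in> borel_measurable borel" by measurable
    show "h z * P e (z - (x, 0)) = 0" if "z \<notin> ball (x, 0) \<rho>" for z
      using that P_bounds(3)[OF e, of "z - (x, 0)"] by (simp add: dist_norm norm_minus_commute)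
    show "\<bar>h z * P e (z - (x, 0))\<bar> \<le> C * (4 * q * \<rho>\<^sup>2 * e powr (- q))" for z
    proof (cases "z \<in> cball (x, 0) \<rho>")
      case True
      then show ?thesis unfolding abs_mult using P_bounds(1,2)[OF e, of "z - (x, 0)"] C by (intro mult_mono) auto
    next
      case False
      then have "P e (z - (x, 0)) = 0" using P_bounds(3)[OF e, of "z - (x, 0)"] by (simp add: dist_norm norm_minus_commute)
      then show ?thesis using C(1) q_pos by simp
    qed
  qed
qed

text \<open>The constant depends on \<open>e\<close> through the total mass only, which makes the
  averages stable while \<open>e\<close> tends to 0. After translation by \<open>(x, 0)\<close> the
  kernel variable \<open>\<zeta>\<close> is frozen; for each \<open>\<zeta>\<close> the integral
  over \<open>x\<close> sees a single horizontal slice of \<open>h\<close>, which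
  \<open>slice_bound\<close> controls by the boundary values and the gradient without
  weight.\<close>

lemma Ab_L1:
  assumes h: "Ck 1 h" and e: "e > 0"
  shows "(\<integral>\<^sup>+x. ennreal \<bar>Ab e h x\<bar> * indicator core x \<partial>lborel)
     \<le> ennreal (mass e) * ((\<integral>\<^sup>+x. ennreal \<bar>h (x, 0)\<bar> * indicator \<Omega> x \<partial>lborel)
         + (\<integral>\<^sup>+z. ennreal (norm (grad h z)) * indicator U z \<partial>lborel))" (is "?L \<le> ennreal (mass e) * ?D")
proof -
  note P_measurable[OF e, measurable]
  have ch: "continuous_on UNIV h" by (rule Ck_continuous[OF h])
  have [measurable]: "h \<in> borel_measurable borel" by (rule borel_measurable_continuous_onI[OF ch])
  have [measurable]: "grad h \<in> borel_measurable borel" by (rule borel_measurable_continuous_onI[OF grad_continuous[OF h]])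
  have A1: "ennreal \<bar>Ab e h x\<bar> \<le> (\<integral>\<^sup>+\<zeta>. ennreal (wt a \<zeta> * P e \<zeta>) * ennreal \<bar>h (\<zeta> + (x, 0))\<bar> \<partial>lborel)" for x
  proof -
    have "ennreal \<bar>Ab e h x\<bar> \<le> (\<integral>\<^sup>+z. ennreal (norm (wt a z * (h z * P e (z - (x, 0))))) \<partial>lborel)"
      unfolding Ab_def real_norm_def[symmetric] by (rule integral_norm_bound_ennreal[OF Ab_integrable[OF ch e]])
    also have "\<dots> = (\<integral>\<^sup>+\<zeta>. ennreal (norm (wt a (\<zeta> + (x, 0)) * (h (\<zeta> + (x, 0)) * P e (\<zeta> + (x, 0) - (x, 0))))) \<partial>lborel)"
      by (rule nn_integral_lborel_translate[symmetric, where f = "\<lambda>z. ennreal (norm (wt a z * (h z * P e (z - (x, 0)))))"]) measurable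
    also have "\<dots> = (\<integral>\<^sup>+\<zeta>. ennreal (wt a \<zeta> * P e \<zeta>) * ennreal \<bar>h (\<zeta> + (x, 0))\<bar> \<partial>lborel)"
      using P_bounds(1)[OF e] by (intro nn_integral_cong) (simp add: wt_shift wt_nonneg abs_mult ennreal_mult'[symmetric] ac_simps)
    finally show ?thesis .
  qed
  have A2: "ennreal (wt a \<zeta> * P e \<zeta>) * (\<integral>\<^sup>+x. ennreal \<bar>h (\<zeta> + (x, 0))\<bar> * indicator core x \<partial>lborel)
      \<le> ennreal (wt a \<zeta> * P e \<zeta>) * ?D" for \<zeta> :: "'a \<times> real"
  proof (cases "norm \<zeta> < \<rho> \<and> snd \<zeta> > 0")
    case False
    then have "wt a \<zeta> * P e \<zeta> = 0" using P_bounds(3)[OF e, of \<zeta>] by (auto simp: wt_def)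
    then show ?thesis by (simp only: ennreal_0 mult_zero_left order_refl)
  next
    case True
    obtain \<xi> \<eta> where \<zeta>: "\<zeta> = (\<xi>, \<eta>)" by (cases \<zeta>) auto
    have \<eta>: "0 < \<eta>" "\<eta> < T" using True \<rho> norm_fst_snd_le(2)[of \<zeta>] by (auto simp: \<zeta>)
    have "(\<integral>\<^sup>+x. ennreal \<bar>h (\<zeta> + (x, 0))\<bar> * indicator core x \<partial>lborel)
        \<le> (\<integral>\<^sup>+x. ennreal \<bar>h (x + \<xi>, \<eta>)\<bar> * indicator \<Omega> (x + \<xi>) \<partial>lborel)"
    proof (rule nn_integral_mono)
      fix x :: 'a
      show "ennreal \<bar>h (\<zeta> + (x, 0))\<bar> * indicator core x \<le> ennreal \<bar>h (x + \<xi>, \<eta>)\<bar> * indicator \<Omega> (x + \<xi>)"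
      proof (cases "x \<in> core")
        case x: True
        have "x + \<xi> \<in> \<Omega>" using near_boundary(1)[OF x, of "\<zeta> + (x, 0)"] True by (simp add: \<zeta> add.commute)
        then show ?thesis by (simp add: \<zeta> add.commute indicator_def)
      qed simp
    qed
    also have "\<dots> = (\<integral>\<^sup>+x. ennreal \<bar>h (x, \<eta>)\<bar> * indicator \<Omega> x \<partial>lborel)"
      by (rule nn_integral_lborel_translate[where f = "\<lambda>x. ennreal \<bar>h (x, \<eta>)\<bar> * indicator \<Omega> x"]) measurable
    also have "\<dots> \<le> (\<integral>\<^sup>+x. ennreal \<bar>h (x, 0)\<bar> * indicator \<Omega> x + (\<integral>\<^sup>+\<tau>. ennreal (norm (grad h (x, \<tau>))) * indicator U (x, \<tau>) \<partial>lborel) \<partial>lborel)"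
    proof (rule nn_integral_mono)
      fix x :: 'a
      show "ennreal \<bar>h (x, \<eta>)\<bar> * indicator \<Omega> x \<le> ennreal \<bar>h (x, 0)\<bar> * indicator \<Omega> x + (\<integral>\<^sup>+\<tau>. ennreal (norm (grad h (x, \<tau>))) * indicator U (x, \<tau>) \<partial>lborel)"
      proof (cases "x \<in> \<Omega>")
        case True
        then have "indicator U (x, \<tau>) = (indicator {0<..<T} \<tau> :: ennreal)" for \<tau> by (auto simp: U_def indicator_def)
        then show ?thesis using slice_bound[OF h \<eta>, of x] True by simp
      qed simp
    qed
    also have "\<dots> = (\<integral>\<^sup>+x. ennreal \<bar>h (x, 0)\<bar> * indicator \<Omega> x \<partial>lborel) + (\<integral>\<^sup>+x. \<integral>\<^sup>+\<tau>. ennreal (norm (grad h (x, \<tau>))) * indicator U (x, \<tau>) \<partial>lborel \<partial>lborel)"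
      by (rule nn_integral_add) measurable
    also have "(\<integral>\<^sup>+x. \<integral>\<^sup>+\<tau>. ennreal (norm (grad h (x, \<tau>))) * indicator U (x, \<tau>) \<partial>lborel \<partial>lborel) = (\<integral>\<^sup>+z. ennreal (norm (grad h z)) * indicator U z \<partial>lborel)"
      by (rule nn_integral_lborel_prod[symmetric]) measurable
    finally show ?thesis by (rule mult_left_mono) simp
  qed
  have "?L \<le> (\<integral>\<^sup>+x. \<integral>\<^sup>+\<zeta>. ennreal (wt a \<zeta> * P e \<zeta>) * ennreal \<bar>h (\<zeta> + (x, 0))\<bar> * indicator core x \<partial>lborel \<partial>lborel)"
  proof (rule nn_integral_mono)
    fix x :: 'a
    show "ennreal \<bar>Ab e h x\<bar> * indicator core x \<le> (\<integral>\<^sup>+\<zeta>. ennreal (wt a \<zeta> * P e \<zeta>) * ennreal \<bar>h (\<zeta> + (x, 0))\<bar> * indicator core x \<partial>lborel)"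
      using A1[of x] by (cases "x \<in> core") auto
  qed
  also have "\<dots> = (\<integral>\<^sup>+\<zeta>. \<integral>\<^sup>+x. ennreal (wt a \<zeta> * P e \<zeta>) * ennreal \<bar>h (\<zeta> + (x, 0))\<bar> * indicator core x \<partial>lborel \<partial>lborel)"
  proof (rule lborel_pair.Fubini'[symmetric])
    show "(\<lambda>(x, \<zeta>). ennreal (wt a \<zeta> * P e \<zeta>) * ennreal \<bar>h (\<zeta> + (x, 0))\<bar> * indicator core x) \<in> borel_measurable (lborel \<Otimes>\<^sub>M lborel)"
      by measurable
  qed
  also have "\<dots> = (\<integral>\<^sup>+\<zeta>. ennreal (wt a \<zeta> * P e \<zeta>) * (\<integral>\<^sup>+x. ennreal \<bar>h (\<zeta> + (x, 0))\<bar> * indicator core x \<partial>lborel) \<partial>lborel)"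
    unfolding mult.assoc by (intro nn_integral_cong nn_integral_cmult) measurable
  also have "\<dots> \<le> (\<integral>\<^sup>+\<zeta>. ennreal (wt a (\<zeta> :: 'a \<times> real) * P e \<zeta>) * ?D \<partial>lborel)"
    by (intro nn_integral_mono A2)
  also have "\<dots> = (\<integral>\<^sup>+\<zeta>. ennreal (wt a (\<zeta> :: 'a \<times> real) * P e \<zeta>) \<partial>lborel) * ?D"
    by (rule nn_integral_multc) measurable
  also have "(\<integral>\<^sup>+\<zeta>. ennreal (wt a (\<zeta> :: 'a \<times> real) * P e \<zeta>) \<partial>lborel) = ennreal (mass e)"
    unfolding mass_def using P_bounds(1)[OF e]
    by (intro nn_integral_eq_integral[OF wtP_integrable[OF e]] AE_I2) (simp add: wt_nonneg)
  finally show ?thesis .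
qed

lemma grad_kernel:
  fixes c :: "'a \<times> real"
  assumes e: "e > 0"
  obtains C where "\<And>z. norm (grad (\<lambda>z. ker0 q (\<rho>\<^sup>2) e ((norm (z - c))\<^sup>2)) z) \<le> C"
    "\<And>z. norm (z - c) \<ge> \<rho> \<Longrightarrow> grad (\<lambda>z. ker0 q (\<rho>\<^sup>2) e ((norm (z - c))\<^sup>2)) z = 0"
    "continuous_on UNIV (grad (\<lambda>z. ker0 q (\<rho>\<^sup>2) e ((norm (z - c))\<^sup>2)))"
proof -
  let ?\<psi> = "\<lambda>z. ker0 q (\<rho>\<^sup>2) e ((norm (z - c))\<^sup>2)"
  have cont: "continuous_on UNIV (grad ?\<psi>)" by (rule grad_continuous[OF Ck_radial[OF kdiff_ker0 e]])
  have zero: "grad ?\<psi> z = 0" if "norm (z - c) \<ge> \<rho>" for z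
  proof -
    have "- e < (norm (z - c))\<^sup>2" using e by (auto intro: less_le_trans[of _ 0])
    from grad_radial[OF DERIV_ker0[OF this]]
    have "grad ?\<psi> z = (2 * ker1 q (\<rho>\<^sup>2) e ((norm (z - c))\<^sup>2)) *\<^sub>R (z - c)" .
    moreover have "ker1 q (\<rho>\<^sup>2) e ((norm (z - c))\<^sup>2) = 0" using that \<rho> by (intro ker1_eq_0 power_mono) auto
    ultimately show ?thesis by simp
  qed
  have "bdd_supp (\<lambda>z. norm (grad ?\<psi> z))"
    unfolding bdd_supp_def
  proof (intro exI allI impI)
    fix z :: "'a \<times> real" assume "norm z > norm c + \<rho>"
    then have "norm (z - c) \<ge> \<rho>" using norm_triangle_ineq2[of z c] by simp
    then show "norm (grad ?\<psi> z) = 0" by (simp add: zero)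
  qed
  from bdd_supp_ucont(2)[OF continuous_on_norm[OF cont] this]
  obtain C where "\<And>z. norm (grad ?\<psi> z) \<le> C" by auto
  then show ?thesis using that zero cont by blast
qed

lemma mass_nonneg: "e > 0 \<Longrightarrow> mass e \<ge> 0"
  unfolding mass_def using P_bounds(1) by (intro integral_nonneg_AE AE_I2) (simp add: wt_nonneg)

lemma mass_bounded: obtains M where "M \<ge> 0" "\<And>m. mass (E m) \<le> M"
proof -
  have "Bseq (\<lambda>m. mass (E m))" using mass_tendsto by (intro convergent_imp_Bseq convergentI)
  then obtain K where "K > 0" "\<forall>m. norm (mass (E m)) \<le> K" by (auto simp: Bseq_def)
  then show ?thesis by (intro that[of K]) (auto simp: abs_le_iff)
qed

text \<open>Splitting at a radius \<open>d\<close> of uniform continuity: inside, the oscillation of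
  \<open>h\<close> is small; outside, \<open>P (E m)\<close> is at most a constant times
  \<open>E m\<close>.\<close>

lemma Ab_uniform:
  assumes h: "continuous_on UNIV h" and eps: "\<epsilon> > 0"
  shows "\<forall>\<^sub>F m in sequentially. \<forall>x\<in>\<Omega>. \<bar>Ab (E m) h x - mass (E m) * h (x, 0)\<bar> \<le> \<epsilon>"
proof -
  obtain B where B: "\<And>x. x \<in> \<Omega> \<Longrightarrow> norm x \<le> B" using \<Omega>(2) by (auto simp: bounded_iff)
  define X where "X = cball (0 :: 'a \<times> real) (B + \<rho>)"
  have X: "(x, 0) + \<zeta> \<in> X" "(x, 0) \<in> X" if "x \<in> \<Omega>" "norm \<zeta> \<le> \<rho>" for x \<zeta>
    using B[OF that(1)] that(2) \<rho> norm_triangle_ineq[of "(x, 0)" \<zeta>] by (auto simp: X_def norm_Pair)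
  obtain C where C: "C \<ge> 0" "\<And>z. z \<in> X \<Longrightarrow> \<bar>h z\<bar> \<le> C" using cont_bounded_ball[OF h] unfolding X_def by blast
  obtain M where M: "M \<ge> 0" "\<And>m. mass (E m) \<le> M" using mass_bounded by blast
  have "uniformly_continuous_on X h"
    unfolding X_def by (intro compact_uniformly_continuous continuous_on_subset[OF h]) auto
  \<comment> \<open>The masses are bounded by \<open>M\<close>, so the part near the centre
    contributes at most \<open>\<epsilon> / 2\<close>.\<close>
  moreover define \<epsilon>' where "\<epsilon>' = \<epsilon> / (2 * (M + 1))"
  moreover have e': "\<epsilon>' > 0" using eps M(1) by (simp add: \<epsilon>'_def)
  ultimately obtain d where d: "d > 0" "\<And>z z'. z \<in> X \<Longrightarrow> z' \<in> X \<Longrightarrow> dist z' z < d \<Longrightarrow> dist (h z') (h z) < \<epsilon>'"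
    unfolding uniformly_continuous_on_def by metis
  define J where "J = (LINT z|lborel. wt a (z :: 'a \<times> real) * indicator (ball 0 \<rho>) z)"
  define c where "c = 2 * C * (4 * q * \<rho>\<^sup>2 * d powr (- 2 * q - 2))"
  have c0: "c \<ge> 0" using C(1) q_pos by (simp add: c_def)
  have main: "\<bar>Ab (E m) h x - mass (E m) * h (x, 0)\<bar> \<le> \<epsilon>' * mass (E m) + c * E m * J" if x: "x \<in> \<Omega>" for m x
  proof -
    note P_measurable[OF E(2), measurable]
    have [measurable]: "h \<in> borel_measurable borel" by (rule borel_measurable_continuous_onI[OF h])
    have "Ab (E m) h x = (LINT z|lborel. wt a (z + (x, 0)) * (h (z + (x, 0)) * P (E m) (z + (x, 0) - (x, 0))))"
      unfolding Ab_def by (rule integral_translate[symmetric]) measurable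
    then have 1: "Ab (E m) h x = (LINT z|lborel. wt a z * (h (z + (x, 0)) * P (E m) z))" by (simp add: wt_shift)
    have i1: "integrable lborel (\<lambda>z. wt a z * (h (z + (x, 0)) * P (E m) z))"
      using Ab_integrable[of "\<lambda>z. h (z + (x, 0))" "E m" 0]
      by (simp add: E zero_prod_def[symmetric] continuous_on_compose2[OF h] continuous_intros)
    have i2: "integrable lborel (\<lambda>z. h (x, 0) * (wt a z * P (E m) z))"
      by (rule integrable_mult_right[OF wtP_integrable[OF E(2)]])
    have i3: "integrable lborel (\<lambda>z. \<epsilon>' * (wt a z * P (E m) z))"
      by (rule integrable_mult_right[OF wtP_integrable[OF E(2)]])
    have i4: "integrable lborel (\<lambda>z :: 'a \<times> real. (c * E m) * (wt a z * indicator (ball 0 \<rho>) z))"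
      by (rule integrable_mult_right[OF integrable_wt_ball[OF a(1)]])
    have eq0: "Ab (E m) h x - mass (E m) * h (x, 0) = (LINT z|lborel. wt a z * (h (z + (x, 0)) * P (E m) z) - h (x, 0) * (wt a z * P (E m) z))"
      using i1 i2 by (simp add: 1 mass_def mult.commute)
    have "\<bar>Ab (E m) h x - mass (E m) * h (x, 0)\<bar> \<le> (LINT z|lborel. \<epsilon>' * (wt a z * P (E m) z) + (c * E m) * (wt a z * indicator (ball 0 \<rho>) z))"
      unfolding real_norm_def[symmetric] eq0
    proof (rule Bochner_Integration.integral_norm_bound_integral)
      show "integrable lborel (\<lambda>z. wt a z * (h (z + (x, 0)) * P (E m) z) - h (x, 0) * (wt a z * P (E m) z))"
        using i1 i2 by simp
      show "integrable lborel (\<lambda>z. \<epsilon>' * (wt a z * P (E m) z) + (c * E m) * (wt a z * indicator (ball 0 \<rho>) z))"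
        using i3 i4 by simp
      fix z :: "'a \<times> real"
      have eq: "norm (wt a z * (h (z + (x, 0)) * P (E m) z) - h (x, 0) * (wt a z * P (E m) z)) = wt a z * (\<bar>h (z + (x, 0)) - h (x, 0)\<bar> * P (E m) z)"
      proof -
        have "wt a z * (h (z + (x, 0)) * P (E m) z) - h (x, 0) * (wt a z * P (E m) z) = wt a z * ((h (z + (x, 0)) - h (x, 0)) * P (E m) z)"
          by (simp add: algebra_simps)
        then show ?thesis by (simp add: abs_mult wt_nonneg P_bounds(1)[OF E(2)])
      qed
      have "\<bar>h (z + (x, 0)) - h (x, 0)\<bar> * P (E m) z \<le> \<epsilon>' * P (E m) z + c * E m * indicator (ball 0 \<rho>) z"
      proof (cases "norm z < \<rho>")
        case False
        then have "P (E m) z = 0" using P_bounds(3)[OF E(2)[of m], of z] by simp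
        then show ?thesis using c0 by simp
      next
        case z: True
        then have XX: "z + (x, 0) \<in> X" "(x, 0) \<in> X" using X[OF x, of z] by (auto simp: add.commute)
        show ?thesis
        proof (cases "norm z < d")
          case True
          then have "\<bar>h (z + (x, 0)) - h (x, 0)\<bar> < \<epsilon>'" using d(2)[OF XX(2,1)] by (simp add: dist_norm)
          then have "\<bar>h (z + (x, 0)) - h (x, 0)\<bar> * P (E m) z \<le> \<epsilon>' * P (E m) z"
            by (intro mult_right_mono P_bounds(1)[OF E(2)]) simp
          then show ?thesis using z c0 by (simp add: add_increasing2)
        next
          case False
          then have "z \<noteq> 0" using d(1) by auto
          have "P (E m) z \<le> 4 * q * \<rho>\<^sup>2 * E m * norm z powr (- 2 * q - 2)" by (rule P_bounds(4)[OF E(2) \<open>z \<noteq> 0\<close>])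
          also have "\<dots> \<le> 4 * q * \<rho>\<^sup>2 * E m * d powr (- 2 * q - 2)"
            using False d(1) q_pos by (intro mult_left_mono powr_mono2') auto
          finally have "\<bar>h (z + (x, 0)) - h (x, 0)\<bar> * P (E m) z \<le> (2 * C) * (4 * q * \<rho>\<^sup>2 * E m * d powr (- 2 * q - 2))"
            using C(2)[OF XX(1)] C(2)[OF XX(2)] C(1) P_bounds(1)[OF E(2)[of m], of z] by (intro mult_mono) auto
          then show ?thesis using z e' P_bounds(1)[OF E(2)[of m], of z] by (simp add: c_def mult_ac add_increasing)
        qed
      qed
      from mult_left_mono[OF this wt_nonneg[of a z]]
      show "norm (wt a z * (h (z + (x, 0)) * P (E m) z) - h (x, 0) * (wt a z * P (E m) z)) \<le> \<epsilon>' * (wt a z * P (E m) z) + (c * E m) * (wt a z * indicator (ball 0 \<rho>) z)"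
        unfolding eq by (simp add: algebra_simps)
    qed
    also have "\<dots> = \<epsilon>' * mass (E m) + c * E m * J"
      unfolding Bochner_Integration.integral_add[OF i3 i4] by (simp only: integral_mult_right_zero mass_def J_def)
    finally show ?thesis .
  qed
  have "(\<lambda>m. c * E m * J) \<longlonglongrightarrow> c * 0 * J" by (intro tendsto_mult tendsto_const E(1))
  then have "\<forall>\<^sub>F m in sequentially. c * E m * J < \<epsilon> / 2"
    using eps by (intro order_tendstoD(2)[where y = "c * 0 * J"]) auto
  then show ?thesis
  proof eventually_elim
    case (elim m)
    have "\<epsilon>' * mass (E m) \<le> \<epsilon>' * (M + 1)" using e' M(2)[of m] by (intro mult_left_mono) auto
    also have "\<dots> = \<epsilon> / 2" using M(1) by (simp add: \<epsilon>'_def field_simps)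
    finally have "\<epsilon>' * mass (E m) + c * E m * J \<le> \<epsilon>" using elim by linarith
    then show ?case using main[of _ m] by (blast intro: order_trans)
  qed
qed

end

section \<open>Convergence of the averages to the trace\<close>

lemma ennreal_tendsto_0:
  fixes X Y :: "nat \<Rightarrow> ennreal"
  assumes Y: "Y \<longlonglongrightarrow> 0" and le: "\<And>k. \<exists>Z. Z \<longlonglongrightarrow> Y k \<and> (\<forall>\<^sub>F m in sequentially. X m \<le> Z m)"
  shows "X \<longlonglongrightarrow> 0"
proof -
  \<comment> \<open>The approximation error \<open>Y k\<close> is uniform in \<open>m\<close>, and
    the remaining error disappears for fixed \<open>k\<close>; in terms of the limsup no diagonal
    sequence has to be chosen.\<close>
  have "limsup X \<le> Y k" for k
  proof -
    obtain Z where Z: "Z \<longlonglongrightarrow> Y k" "\<forall>\<^sub>F m in sequentially. X m \<le> Z m" using le by blast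
    have "limsup X \<le> limsup Z" by (rule Limsup_mono[OF Z(2)])
    also have "\<dots> = Y k" by (rule lim_imp_Limsup[OF sequentially_bot Z(1)])
    finally show ?thesis .
  qed
  then have "limsup X \<le> 0" by (intro LIMSEQ_le_const[OF Y]) auto
  then show ?thesis
    using Liminf_le_Limsup[OF sequentially_bot, of X]
    by (subst tendsto_iff_Liminf_eq_Limsup) auto
qed

lemma grad_diff:
  assumes "f differentiable (at z)" "h differentiable (at z)"
  shows "grad (\<lambda>z. f z - h z) z = grad f z - grad h z"
proof -
  have "partial i (\<lambda>z. f z - h z) z = partial i f z - partial i h z" for i
    by (subst partial_eq[OF has_derivative_diff[OF has_derivative_frechet has_derivative_frechet, OF assms]]) (simp add: partial_def)
  then show ?thesis by (simp add: grad_def scaleR_left_diff_distrib sum_subtractf)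
qed

lemma Ck_diff: "Ck k f \<Longrightarrow> Ck k g \<Longrightarrow> Ck k (\<lambda>x. f x - g x)"
  using Ck_add[of k f "\<lambda>x. - 1 * g x"] Ck_mult[OF Ck_const[of k "- 1"], of g] by simp

lemma AE_sub_of_L1:
  fixes f :: "nat \<Rightarrow> 'b \<Rightarrow> real"
  assumes [measurable]: "\<And>m. f m \<in> borel_measurable M"
    and lim: "(\<lambda>m. \<integral>\<^sup>+x. ennreal \<bar>f m x\<bar> \<partial>M) \<longlonglongrightarrow> 0"
  shows "\<exists>r::nat\<Rightarrow>nat. strict_mono r \<and> (AE x in M. (\<lambda>m. f (r m) x) \<longlonglongrightarrow> 0)"
proof -
  have "\<forall>\<^sub>F m in sequentially. (\<integral>\<^sup>+x. ennreal \<bar>f m x\<bar> \<partial>M) < 1" using lim by (rule order_tendstoD) simp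
  then obtain N where N: "\<And>m. m \<ge> N \<Longrightarrow> (\<integral>\<^sup>+x. ennreal \<bar>f m x\<bar> \<partial>M) < 1" by (auto simp: eventually_sequentially)
  have int: "integrable M (f (m + N))" for m
    using N[of "m + N"] by (intro integrableI_bounded) (auto intro: less_trans)
  have "(\<lambda>m. LINT x|M. norm (f (m + N) x)) = (\<lambda>m. enn2real (\<integral>\<^sup>+x. ennreal \<bar>f (m + N) x\<bar> \<partial>M))"
    by (intro ext) (subst integral_eq_nn_integral, auto)
  moreover have "(\<lambda>m. enn2real (\<integral>\<^sup>+x. ennreal \<bar>f (m + N) x\<bar> \<partial>M)) \<longlonglongrightarrow> 0"
    using LIMSEQ_ignore_initial_segment[OF lim, of N] by (intro tendsto_enn2real) auto
  ultimately have "\<exists>r::nat\<Rightarrow>nat. strict_mono r \<and> (AE x in M. (\<lambda>m. f (r m + N) x) \<longlonglongrightarrow> 0)"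
    by (intro tendsto_L1_AE_subseq[of M "\<lambda>m. f (m + N)"] int) simp
  then show ?thesis
  proof (elim exE conjE)
    fix r :: "nat \<Rightarrow> nat" assume r: "strict_mono r" "AE x in M. (\<lambda>m. f (r m + N) x) \<longlonglongrightarrow> 0"
    then show ?thesis by (intro exI[of _ "\<lambda>m. r m + N"]) (auto simp: strict_mono_def)
  qed
qed

lemma L1_limit:
  fixes f :: "'b \<Rightarrow> real"
  assumes [measurable]: "f \<in> borel_measurable M" and F: "\<And>k. integrable M (F k)"
    and lim: "(\<lambda>k. \<integral>\<^sup>+x. ennreal \<bar>f x - F k x\<bar> \<partial>M) \<longlonglongrightarrow> 0"
  shows "integrable M f" "(\<lambda>k. LINT x|M. F k x) \<longlonglongrightarrow> (LINT x|M. f x)"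
proof -
  note borel_measurable_integrable[OF F, measurable]
  have "\<forall>\<^sub>F k in sequentially. (\<integral>\<^sup>+x. ennreal \<bar>f x - F k x\<bar> \<partial>M) < 1" using lim by (rule order_tendstoD) simp
  then obtain k where "(\<integral>\<^sup>+x. ennreal \<bar>f x - F k x\<bar> \<partial>M) < 1" using eventually_happens by fastforce
  then have "integrable M (\<lambda>x. f x - F k x)" by (intro integrableI_bounded) (auto intro: less_trans)
  from Bochner_Integration.integrable_add[OF this F[of k]] show f: "integrable M f" by simp
  show "(\<lambda>k. LINT x|M. F k x) \<longlonglongrightarrow> (LINT x|M. f x)"
    by (rule tendsto_L1_int[OF F f]) (use lim in \<open>simp add: abs_minus_commute\<close>)
qed

text \<open>Borel versions of \<open>u\<close>, its gradient and its trace, with the approximating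
  smooth functions. Of the convergence in weighted L2 only three L1 consequences are kept: weighted
  for \<open>u\<close>, without weight for the gradient, and on the boundary for the trace.\<close>

locale trace_data = extension \<Omega> a q \<rho> T
  for \<Omega> :: "'a::euclidean_space set" and a q \<rho> T +
  fixes u :: "'a \<times> real \<Rightarrow> real" and g :: "'a \<times> real \<Rightarrow> 'a \<times> real" and \<Phi> :: "nat \<Rightarrow> 'a \<times> real \<Rightarrow> real" and w :: "'a \<Rightarrow> real"
  assumes u [measurable]: "u \<in> borel_measurable borel" and g [measurable]: "g \<in> borel_measurable borel"
    and w [measurable]: "w \<in> borel_measurable borel" and \<Phi>: "Ck j (\<Phi> k)"
    and u_lim: "(\<lambda>k. \<integral>\<^sup>+z. ennreal (wt a z * \<bar>u z - \<Phi> k z\<bar>) * indicator U z \<partial>lborel) \<longlonglongrightarrow> 0"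
    and g_lim: "(\<lambda>k. \<integral>\<^sup>+z. ennreal (norm (g z - grad (\<Phi> k) z)) * indicator U z \<partial>lborel) \<longlonglongrightarrow> 0"
    and w_lim: "(\<lambda>k. \<integral>\<^sup>+x. ennreal \<bar>w x - \<Phi> k (x, 0)\<bar> * indicator \<Omega> x \<partial>lborel) \<longlonglongrightarrow> 0"
begin

definition "du k = (\<integral>\<^sup>+z. ennreal (wt a z * \<bar>u z - \<Phi> k z\<bar>) * indicator U z \<partial>lborel)"
definition "dg k = (\<integral>\<^sup>+z. ennreal (norm (g z - grad (\<Phi> k) z)) * indicator U z \<partial>lborel)"
definition "dw k = (\<integral>\<^sup>+x. ennreal \<bar>w x - \<Phi> k (x, 0)\<bar> * indicator \<Omega> x \<partial>lborel)"

lemma d_lim: "du \<longlonglongrightarrow> 0" "dg \<longlonglongrightarrow> 0" "dw \<longlonglongrightarrow> 0"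
  using u_lim g_lim w_lim by (simp_all add: du_def[abs_def] dg_def[abs_def] dw_def[abs_def])

lemma \<Phi>_cont: "continuous_on UNIV (\<Phi> k)"
  by (rule Ck_continuous[OF \<Phi>[of 0]])

lemma \<Phi>_measurable [measurable]: "\<Phi> k \<in> borel_measurable borel" "grad (\<Phi> k) \<in> borel_measurable borel"
  by (rule borel_measurable_continuous_onI[OF \<Phi>_cont], rule borel_measurable_continuous_onI[OF grad_continuous[OF \<Phi>]])

text \<open>Absorbing weight and cylinder into an integrable function on the whole space makes the
  lemmas on convolutions applicable.\<close>

definition mu where "mu z = indicator U z * (wt a z * u z)"

lemma mu_measurable [measurable]: "mu \<in> borel_measurable borel"
  unfolding mu_def[abs_def] by measurable

lemma U_bounded: obtains r where "r > 0" "U \<subseteq> cball 0 r"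
proof -
  have "bounded U" unfolding U_def using \<Omega>(2) by (intro bounded_Times) auto
  then obtain r where "r > 0" "\<And>z. z \<in> U \<Longrightarrow> norm z \<le> r" by (auto simp: bounded_pos)
  then show ?thesis by (intro that[of r]) auto
qed

lemma wt\<Phi>_integrable: "integrable lborel (\<lambda>z. indicator U z * (wt a z * \<Phi> k z))"
proof -
  obtain r where r: "r > 0" "U \<subseteq> cball 0 r" using U_bounded .
  obtain C where C: "C \<ge> 0" "\<And>z. z \<in> cball 0 r \<Longrightarrow> \<bar>\<Phi> k z\<bar> \<le> C" using cont_bounded_ball[OF \<Phi>_cont] by blast
  have "integrable lborel (\<lambda>z. wt a z * (indicator U z * \<Phi> k z))"
  proof (rule integrable_wt_bounded[OF a(1), where c = 0 and r = "r + 1" and C = C])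
    show "\<bar>indicator U z * \<Phi> k z\<bar> \<le> C" for z using C(1) C(2)[of z] r(2) by (cases "z \<in> U") (auto simp del: mem_cball)
    show "indicator U z * \<Phi> k z = 0" if "z \<notin> ball 0 (r + 1)" for z using that r(2) by (cases "z \<in> U") auto
  qed measurable
  then show ?thesis by (simp add: ac_simps)
qed

lemma diff_integrable:
  assumes "du k < \<infinity>" shows "integrable lborel (\<lambda>z. indicator U z * (wt a z * (u z - \<Phi> k z)))"
proof (rule integrableI_bounded)
  have "(\<integral>\<^sup>+z. ennreal (norm (indicator U z * (wt a z * (u z - \<Phi> k z)))) \<partial>lborel) = du k"
    unfolding du_def by (intro nn_integral_cong) (simp add: indicator_def abs_mult wt_nonneg)
  then show "(\<integral>\<^sup>+z. ennreal (norm (indicator U z * (wt a z * (u z - \<Phi> k z)))) \<partial>lborel) < \<infinity>" using assms by simp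
qed measurable

lemma mu_integrable: "integrable lborel mu"
proof -
  have "\<forall>\<^sub>F k in sequentially. du k < 1" using d_lim(1) by (rule order_tendstoD) simp
  then obtain k where k: "du k < 1" using eventually_happens by fastforce
  then have "du k < \<infinity>" by (auto intro: less_trans)
  from Bochner_Integration.integrable_add[OF diff_integrable[OF this] wt\<Phi>_integrable[of k]]
  show ?thesis by (simp add: mu_def[abs_def] algebra_simps)
qed

definition Au where "Au e x = (LINT z|lborel. mu z * P e ((x, 0) - z))"

lemma Au_measurable [measurable]:
  assumes e: "e > 0" shows "Au e \<in> borel_measurable borel"
proof -
  note P_measurable[OF e, measurable]
  have "(\<lambda>p. P e ((fst p, 0) - snd p)) \<in> borel_measurable (borel \<Otimes>\<^sub>M borel)" by measurable
  then have "(\<lambda>x. LINT z|lborel. mu z * P e ((x, 0) - z)) \<in> borel_measurable borel"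
    by (intro lborel.borel_measurable_lebesgue_integral) measurable
  then show ?thesis unfolding Au_def[abs_def] .
qed

lemma kernel_tendsto:
  assumes [measurable]: "K \<in> borel_measurable borel" and K: "\<And>z. \<bar>K z\<bar> \<le> C" "\<And>z. norm z \<ge> \<rho> \<Longrightarrow> K z = 0"
    and x: "x \<in> core"
  shows "(\<lambda>k. LINT z|lborel. wt a z * (\<Phi> k z * K (z - (x, 0)))) \<longlonglongrightarrow> (LINT z|lborel. mu z * K (z - (x, 0)))"
proof -
  let ?K = "\<lambda>z. K (z - (x, 0))"
  have C: "C \<ge> 0" using K(1) by (rule order_trans[OF abs_ge_zero])
  have eq: "wt a z * (\<Phi> k z * ?K z) = ?K z * (indicator U z * (wt a z * \<Phi> k z))" for k z
  proof (cases "z \<in> U")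
    case False
    have "wt a z * (\<Phi> k z * ?K z) = 0" by (rule outside_U[OF x False]) (simp add: K(2))
    then show ?thesis using False by simp
  qed simp
  show ?thesis
    unfolding eq mult.commute[of "mu _"]
  proof (rule L1_limit(2))
    show "(\<lambda>z. ?K z * mu z) \<in> borel_measurable lborel" by measurable
    show "integrable lborel (\<lambda>z. ?K z * (indicator U z * (wt a z * \<Phi> k z)))" for k
      by (rule bounded_mult_integrable[OF wt\<Phi>_integrable _ K(1)]) measurable
    have "(\<integral>\<^sup>+z. ennreal \<bar>?K z * mu z - ?K z * (indicator U z * (wt a z * \<Phi> k z))\<bar> \<partial>lborel) \<le> ennreal C * du k" for k
    proof -
      have "(\<integral>\<^sup>+z. ennreal \<bar>?K z * mu z - ?K z * (indicator U z * (wt a z * \<Phi> k z))\<bar> \<partial>lborel)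
        \<le> (\<integral>\<^sup>+z. ennreal C * (ennreal (wt a z * \<bar>u z - \<Phi> k z\<bar>) * indicator U z) \<partial>lborel)"
      proof (rule nn_integral_mono)
        fix z :: "'a \<times> real"
        have "\<bar>?K z * mu z - ?K z * (indicator U z * (wt a z * \<Phi> k z))\<bar> = \<bar>?K z\<bar> * (indicator U z * (wt a z * \<bar>u z - \<Phi> k z\<bar>))"
        proof -
          have "?K z * mu z - ?K z * (indicator U z * (wt a z * \<Phi> k z)) = ?K z * (indicator U z * (wt a z * (u z - \<Phi> k z)))"
            by (simp add: mu_def algebra_simps)
          then show ?thesis by (simp add: abs_mult wt_nonneg)
        qed
        also have "\<dots> \<le> C * (indicator U z * (wt a z * \<bar>u z - \<Phi> k z\<bar>))"
          by (intro mult_right_mono K(1)) (simp add: wt_nonneg)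
        finally show "ennreal \<bar>?K z * mu z - ?K z * (indicator U z * (wt a z * \<Phi> k z))\<bar> \<le> ennreal C * (ennreal (wt a z * \<bar>u z - \<Phi> k z\<bar>) * indicator U z)"
          using C by (cases "z \<in> U") (auto simp: ennreal_mult'[OF C, symmetric] intro: ennreal_leI)
      qed
      also have "\<dots> = ennreal C * du k" unfolding du_def by (rule nn_integral_cmult) measurable
      finally show ?thesis .
    qed
    moreover have "(\<lambda>k. ennreal C * du k) \<longlonglongrightarrow> ennreal C * 0" by (intro ennreal_tendsto_cmult d_lim) simp
    then have "(\<lambda>k. ennreal C * du k) \<longlonglongrightarrow> 0" by simp
    ultimately show "(\<lambda>k. \<integral>\<^sup>+z. ennreal \<bar>?K z * mu z - ?K z * (indicator U z * (wt a z * \<Phi> k z))\<bar> \<partial>lborel) \<longlonglongrightarrow> 0"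
      by (rule_tac tendsto_sandwich[OF _ _ tendsto_const, where h = "\<lambda>k. ennreal C * du k"]) auto
  qed
qed

lemma Ab_tendsto:
  assumes e: "e > 0" and x: "x \<in> core"
  shows "(\<lambda>j. Ab e (\<Phi> j) x) \<longlonglongrightarrow> Au e x"
proof -
  have "(\<lambda>k. LINT z|lborel. wt a z * (\<Phi> k z * P e (z - (x, 0)))) \<longlonglongrightarrow> (LINT z|lborel. mu z * P e (z - (x, 0)))"
  proof (rule kernel_tendsto[OF P_measurable[OF e] _ _ x])
    show "\<bar>P e z\<bar> \<le> 4 * q * \<rho>\<^sup>2 * e powr (- q)" for z using P_bounds(1,2)[OF e, of z] by simp
  qed (rule P_bounds(3)[OF e])
  then show ?thesis by (simp add: Ab_def Au_def P_even[of e _ "(x, 0)"])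
qed

text \<open>\<open>Ab_L1\<close> is applied to \<open>\<Phi> j - \<Phi> k\<close>, and Fatou's lemma
  lets \<open>j\<close> tend to infinity. Because \<open>e\<close> enters only through the mass, the
  limits in the approximation and in the regularisation can be interchanged.\<close>

lemma Au_Ab_L1:
  assumes e: "e > 0"
  shows "(\<integral>\<^sup>+x. ennreal \<bar>Au e x - Ab e (\<Phi> k) x\<bar> * indicator core x \<partial>lborel) \<le> ennreal (mass e) * (dw k + dg k)"
proof -
  note Ab_measurable[OF \<Phi>_measurable(1) e, measurable] Au_measurable[OF e, measurable]
  define F where "F j x = ennreal \<bar>Ab e (\<Phi> j) x - Ab e (\<Phi> k) x\<bar> * indicator core x" for j x
  have "(\<integral>\<^sup>+x. ennreal \<bar>Au e x - Ab e (\<Phi> k) x\<bar> * indicator core x \<partial>lborel) = (\<integral>\<^sup>+x. liminf (\<lambda>j. F j x) \<partial>lborel)"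
  proof (rule nn_integral_cong)
    fix x :: 'a
    show "ennreal \<bar>Au e x - Ab e (\<Phi> k) x\<bar> * indicator core x = liminf (\<lambda>j. F j x)"
    proof (cases "x \<in> core")
      case True
      have "(\<lambda>j. F j x) \<longlonglongrightarrow> ennreal \<bar>Au e x - Ab e (\<Phi> k) x\<bar>"
        unfolding F_def using True by (auto intro!: tendsto_intros Ab_tendsto[OF e])
      then show ?thesis using True lim_imp_Liminf[OF sequentially_bot] by force
    next
      case False
      then have "F j x = 0" for j by (simp add: F_def)
      then show ?thesis using False by (simp add: Liminf_const)
    qed
  qed
  also have "\<dots> \<le> liminf (\<lambda>j. \<integral>\<^sup>+x. F j x \<partial>lborel)"
    unfolding F_def by (rule nn_integral_liminf) measurable
  also have "\<dots> \<le> liminf (\<lambda>j. ennreal (mass e) * ((dw j + dw k) + (dg j + dg k)))"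
  proof (intro Liminf_mono always_eventually allI)
    fix j
    have C1: "Ck 1 (\<lambda>z. \<Phi> j z - \<Phi> k z)" by (intro Ck_diff \<Phi>)
    have "(\<integral>\<^sup>+x. F j x \<partial>lborel) = (\<integral>\<^sup>+x. ennreal \<bar>Ab e (\<lambda>z. \<Phi> j z - \<Phi> k z) x\<bar> * indicator core x \<partial>lborel)"
    proof (rule nn_integral_cong)
      fix x :: 'a
      have "Ab e (\<lambda>z. \<Phi> j z - \<Phi> k z) x = (LINT z|lborel. wt a z * (\<Phi> j z * P e (z - (x, 0))) - wt a z * (\<Phi> k z * P e (z - (x, 0))))"
        unfolding Ab_def by (intro Bochner_Integration.integral_cong refl) (simp add: algebra_simps)
      also have "\<dots> = Ab e (\<Phi> j) x - Ab e (\<Phi> k) x"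
        unfolding Ab_def by (intro Bochner_Integration.integral_diff Ab_integrable[OF \<Phi>_cont e])
      finally show "F j x = ennreal \<bar>Ab e (\<lambda>z. \<Phi> j z - \<Phi> k z) x\<bar> * indicator core x" by (simp add: F_def)
    qed
    also have "\<dots> \<le> ennreal (mass e) * ((\<integral>\<^sup>+x. ennreal \<bar>\<Phi> j (x, 0) - \<Phi> k (x, 0)\<bar> * indicator \<Omega> x \<partial>lborel)
         + (\<integral>\<^sup>+z. ennreal (norm (grad (\<lambda>z. \<Phi> j z - \<Phi> k z) z)) * indicator U z \<partial>lborel))"
      by (rule Ab_L1[OF C1 e])
    also have "\<dots> \<le> ennreal (mass e) * ((dw j + dw k) + (dg j + dg k))"
    proof (intro mult_left_mono add_mono)
      have "(\<integral>\<^sup>+x. ennreal \<bar>\<Phi> j (x, 0) - \<Phi> k (x, 0)\<bar> * indicator \<Omega> x \<partial>lborel)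
          \<le> (\<integral>\<^sup>+x. ennreal \<bar>w x - \<Phi> j (x, 0)\<bar> * indicator \<Omega> x + ennreal \<bar>w x - \<Phi> k (x, 0)\<bar> * indicator \<Omega> x \<partial>lborel)"
        by (intro nn_integral_mono) (auto simp: indicator_def ennreal_plus[symmetric] simp del: ennreal_plus intro!: ennreal_leI)
      also have "\<dots> = dw j + dw k" unfolding dw_def by (rule nn_integral_add) measurable
      finally show "(\<integral>\<^sup>+x. ennreal \<bar>\<Phi> j (x, 0) - \<Phi> k (x, 0)\<bar> * indicator \<Omega> x \<partial>lborel) \<le> dw j + dw k" .
      have gd: "norm (grad (\<lambda>z. \<Phi> j z - \<Phi> k z) z) \<le> norm (g z - grad (\<Phi> j) z) + norm (g z - grad (\<Phi> k) z)" for z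
        unfolding grad_diff[OF Ck_differentiable[OF \<Phi>] Ck_differentiable[OF \<Phi>]]
        using norm_triangle_ineq4[of "g z - grad (\<Phi> k) z" "g z - grad (\<Phi> j) z"] by simp
      have "(\<integral>\<^sup>+z. ennreal (norm (grad (\<lambda>z. \<Phi> j z - \<Phi> k z) z)) * indicator U z \<partial>lborel)
          \<le> (\<integral>\<^sup>+z. ennreal (norm (g z - grad (\<Phi> j) z)) * indicator U z + ennreal (norm (g z - grad (\<Phi> k) z)) * indicator U z \<partial>lborel)"
        by (intro nn_integral_mono) (use gd in \<open>auto simp: indicator_def ennreal_plus[symmetric] simp del: ennreal_plus intro!: ennreal_leI\<close>)
      also have "\<dots> = dg j + dg k" unfolding dg_def by (rule nn_integral_add) measurable
      finally show "(\<integral>\<^sup>+z. ennreal (norm (grad (\<lambda>z. \<Phi> j z - \<Phi> k z) z)) * indicator U z \<partial>lborel) \<le> dg j + dg k" .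
    qed simp
    finally show "(\<integral>\<^sup>+x. F j x \<partial>lborel) \<le> ennreal (mass e) * ((dw j + dw k) + (dg j + dg k))" .
  qed
  also have "\<dots> = ennreal (mass e) * ((0 + dw k) + (0 + dg k))"
    by (intro lim_imp_Liminf sequentially_bot ennreal_tendsto_cmult tendsto_add d_lim tendsto_const) simp
  finally show ?thesis by simp
qed

text \<open>Comparison through a smooth \<open>\<Phi> k\<close>: up to the bound on the masses,
  replacing \<open>u\<close> costs \<open>dw k + dg k\<close> and replacing \<open>w\<close> costs
  \<open>dw k\<close>, both uniformly in \<open>m\<close>; for fixed \<open>k\<close> the averages
  of \<open>\<Phi> k\<close> converge by \<open>Ab_uniform\<close>.\<close>

lemma trace_limit:
  "(\<lambda>m. \<integral>\<^sup>+x. ennreal \<bar>Au (E m) x - mass (E m) * w x\<bar> * indicator core x \<partial>lborel) \<longlonglongrightarrow> 0"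
    (is "?X \<longlonglongrightarrow> 0")
proof -
  note Ab_measurable[OF \<Phi>_measurable(1) E(2), measurable] Au_measurable[OF E(2), measurable]
  have sub: "core \<subseteq> \<Omega>" using \<rho> by (intro inner_set_subset) simp
  obtain M where M: "M \<ge> 0" "\<And>m. mass (E m) \<le> M" using mass_bounded by blast
  define G where "G k m = (\<integral>\<^sup>+x. ennreal \<bar>Ab (E m) (\<Phi> k) x - mass (E m) * \<Phi> k (x, 0)\<bar> * indicator core x \<partial>lborel)" for k m
  have G: "G k \<longlonglongrightarrow> 0" for k
  proof (rule ennreal_tendsto_0[where Y = "\<lambda>i. emeasure lborel \<Omega> * ennreal (E i)"])
    have fin: "emeasure lborel \<Omega> < \<infinity>" by (rule emeasure_bounded_finite[OF \<Omega>(2)])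
    then have "(\<lambda>i. emeasure lborel \<Omega> * ennreal (E i)) \<longlonglongrightarrow> emeasure lborel \<Omega> * ennreal 0"
      by (intro ennreal_tendsto_cmult tendsto_ennrealI E(1)) (simp add: infinity_ennreal_def)
    then show "(\<lambda>i. emeasure lborel \<Omega> * ennreal (E i)) \<longlonglongrightarrow> 0" by simp
    fix i
    have "\<forall>\<^sub>F m in sequentially. G k m \<le> emeasure lborel \<Omega> * ennreal (E i)"
      using Ab_uniform[OF \<Phi>_cont[of k] E(2)[of i]]
    proof eventually_elim
      case (elim m)
      have "G k m \<le> (\<integral>\<^sup>+x. ennreal (E i) * indicator \<Omega> x \<partial>lborel)"
        unfolding G_def
      proof (rule nn_integral_mono)
        fix x :: 'a
        show "ennreal \<bar>Ab (E m) (\<Phi> k) x - mass (E m) * \<Phi> k (x, 0)\<bar> * indicator core x \<le> ennreal (E i) * indicator \<Omega> x"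
          using elim sub by (cases "x \<in> core") (auto intro!: ennreal_leI)
      qed
      also have "\<dots> = emeasure lborel \<Omega> * ennreal (E i)" by (subst nn_integral_cmult_indicator) (auto simp: mult.commute)
      finally show ?case .
    qed
    then show "\<exists>Z. Z \<longlonglongrightarrow> emeasure lborel \<Omega> * ennreal (E i) \<and> (\<forall>\<^sub>F m in sequentially. G k m \<le> Z m)"
      by (intro exI[of _ "\<lambda>_. emeasure lborel \<Omega> * ennreal (E i)"]) simp
  qed
  show ?thesis
  proof (rule ennreal_tendsto_0[where Y = "\<lambda>k. ennreal M * (dw k + dg k) + ennreal M * dw k"])
    have "(\<lambda>k. ennreal M * (dw k + dg k) + ennreal M * dw k) \<longlonglongrightarrow> ennreal M * (0 + 0) + ennreal M * 0"
      by (intro tendsto_add ennreal_tendsto_cmult d_lim) auto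
    then show "(\<lambda>k. ennreal M * (dw k + dg k) + ennreal M * dw k) \<longlonglongrightarrow> 0" by simp
    fix k
    have le: "?X m \<le> (ennreal M * (dw k + dg k) + ennreal M * dw k) + G k m" for m
    proof -
      let ?i = "\<lambda>x. indicator core x :: ennreal"
      have "?X m \<le> (\<integral>\<^sup>+x. (ennreal \<bar>Au (E m) x - Ab (E m) (\<Phi> k) x\<bar> * ?i x
          + ennreal M * (ennreal \<bar>w x - \<Phi> k (x, 0)\<bar> * indicator \<Omega> x))
          + ennreal \<bar>Ab (E m) (\<Phi> k) x - mass (E m) * \<Phi> k (x, 0)\<bar> * ?i x \<partial>lborel)"
      proof (rule nn_integral_mono)
        fix x :: 'a
        show "ennreal \<bar>Au (E m) x - mass (E m) * w x\<bar> * ?i x \<le> (ennreal \<bar>Au (E m) x - Ab (E m) (\<Phi> k) x\<bar> * ?i x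
          + ennreal M * (ennreal \<bar>w x - \<Phi> k (x, 0)\<bar> * indicator \<Omega> x))
          + ennreal \<bar>Ab (E m) (\<Phi> k) x - mass (E m) * \<Phi> k (x, 0)\<bar> * ?i x"
        proof (cases "x \<in> core")
          case True
          have "mass (E m) * \<bar>w x - \<Phi> k (x, 0)\<bar> \<le> M * \<bar>w x - \<Phi> k (x, 0)\<bar>"
            by (intro mult_right_mono M) simp
          moreover have "\<bar>mass (E m) * \<Phi> k (x, 0) - mass (E m) * w x\<bar> = mass (E m) * \<bar>w x - \<Phi> k (x, 0)\<bar>"
            using mass_nonneg[OF E(2)] by (simp add: right_diff_distrib[symmetric] abs_mult abs_minus_commute)
          ultimately have "\<bar>Au (E m) x - mass (E m) * w x\<bar> \<le> (\<bar>Au (E m) x - Ab (E m) (\<Phi> k) x\<bar> + M * \<bar>w x - \<Phi> k (x, 0)\<bar>)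
              + \<bar>Ab (E m) (\<Phi> k) x - mass (E m) * \<Phi> k (x, 0)\<bar>" by linarith
          then have "ennreal \<bar>Au (E m) x - mass (E m) * w x\<bar> \<le> ennreal ((\<bar>Au (E m) x - Ab (E m) (\<Phi> k) x\<bar> + M * \<bar>w x - \<Phi> k (x, 0)\<bar>)
              + \<bar>Ab (E m) (\<Phi> k) x - mass (E m) * \<Phi> k (x, 0)\<bar>)" by (rule ennreal_leI)
          then show ?thesis using True sub M(1) by (simp add: ennreal_mult' subset_iff)
        qed simp
      qed
      also have "\<dots> = (\<integral>\<^sup>+x. ennreal \<bar>Au (E m) x - Ab (E m) (\<Phi> k) x\<bar> * ?i x
          + ennreal M * (ennreal \<bar>w x - \<Phi> k (x, 0)\<bar> * indicator \<Omega> x) \<partial>lborel) + G k m"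
        unfolding G_def by (rule nn_integral_add) measurable
      also have "(\<integral>\<^sup>+x. ennreal \<bar>Au (E m) x - Ab (E m) (\<Phi> k) x\<bar> * ?i x
          + ennreal M * (ennreal \<bar>w x - \<Phi> k (x, 0)\<bar> * indicator \<Omega> x) \<partial>lborel)
          = (\<integral>\<^sup>+x. ennreal \<bar>Au (E m) x - Ab (E m) (\<Phi> k) x\<bar> * ?i x \<partial>lborel) + (\<integral>\<^sup>+x. ennreal M * (ennreal \<bar>w x - \<Phi> k (x, 0)\<bar> * indicator \<Omega> x) \<partial>lborel)"
        by (rule nn_integral_add) measurable
      also have "(\<integral>\<^sup>+x. ennreal M * (ennreal \<bar>w x - \<Phi> k (x, 0)\<bar> * indicator \<Omega> x) \<partial>lborel) = ennreal M * dw k"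
        unfolding dw_def by (rule nn_integral_cmult) measurable
      also have "(\<integral>\<^sup>+x. ennreal \<bar>Au (E m) x - Ab (E m) (\<Phi> k) x\<bar> * ?i x \<partial>lborel) \<le> ennreal M * (dw k + dg k)"
        by (rule order_trans[OF Au_Ab_L1[OF E(2)]]) (intro mult_right_mono ennreal_leI M(2), simp)
      finally show ?thesis by (simp add: add_mono)
    qed
    have "(\<lambda>m. (ennreal M * (dw k + dg k) + ennreal M * dw k) + G k m) \<longlonglongrightarrow> (ennreal M * (dw k + dg k) + ennreal M * dw k) + 0"
      by (intro tendsto_add tendsto_const G)
    then show "\<exists>Z. Z \<longlonglongrightarrow> ennreal M * (dw k + dg k) + ennreal M * dw k \<and> (\<forall>\<^sub>F m in sequentially. ?X m \<le> Z m)"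
      using le by (intro exI[of _ "\<lambda>m. (ennreal M * (dw k + dg k) + ennreal M * dw k) + G k m"]) simp
  qed
qed

text \<open>L1 convergence yields convergence almost everywhere along a subsequence, which is enough
  to identify the limit in the representation.\<close>

lemma trace_AE:
  "\<exists>r::nat\<Rightarrow>nat. strict_mono r \<and> (AE x in lborel. x \<in> core \<longrightarrow> (\<lambda>m. Au (E (r m)) x) \<longlonglongrightarrow> mass0 * w x)"
proof -
  note Au_measurable[OF E(2), measurable]
  define f where "f m x = (Au (E m) x - mass (E m) * w x) * indicator core x" for m x
  have "(\<lambda>m. \<integral>\<^sup>+x. ennreal \<bar>f m x\<bar> \<partial>lborel) = (\<lambda>m. \<integral>\<^sup>+x. ennreal \<bar>Au (E m) x - mass (E m) * w x\<bar> * indicator core x \<partial>lborel)"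
    unfolding f_def by (intro ext nn_integral_cong) (simp add: indicator_def)
  then have "\<exists>r::nat\<Rightarrow>nat. strict_mono r \<and> (AE x in lborel. (\<lambda>m. f (r m) x) \<longlonglongrightarrow> 0)"
    using trace_limit by (intro AE_sub_of_L1) (auto simp: f_def)
  then show ?thesis
  proof (elim exE conjE)
    fix r :: "nat \<Rightarrow> nat" assume r: "strict_mono r" "AE x in lborel. (\<lambda>m. f (r m) x) \<longlonglongrightarrow> 0"
    have "AE x in lborel. x \<in> core \<longrightarrow> (\<lambda>m. Au (E (r m)) x) \<longlonglongrightarrow> mass0 * w x"
      using r(2)
    proof eventually_elim
      case (elim x)
      show ?case
      proof
        assume x: "x \<in> core"
        have "(\<lambda>m. mass (E (r m)) * w x) \<longlonglongrightarrow> mass0 * w x"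
          using LIMSEQ_subseq_LIMSEQ[OF mass_tendsto r(1)] by (intro tendsto_mult tendsto_const) (simp add: o_def)
        from tendsto_add[OF elim this] show "(\<lambda>m. Au (E (r m)) x) \<longlonglongrightarrow> mass0 * w x" using x by (simp add: f_def)
      qed
    qed
    then show ?thesis using r(1) by blast
  qed
qed

text \<open>The averages \<open>Au\<close> are formed from \<open>u\<close> alone, whatever the
  approximating sequence, so both traces are their L1 limit divided by \<open>mass0\<close>. This
  links the trace hidden in the notion of solution to the one named in the theorem.\<close>

lemma trace_unique:
  assumes "trace_data \<Omega> a q \<rho> T u g' \<Phi>' w'"
  shows "AE x in lborel. x \<in> core \<longrightarrow> w x = w' x"
proof -
  note Au_measurable[OF E(2), measurable] trace_data.w[OF assms, measurable]
  let ?i = "\<lambda>x. indicator core x :: ennreal"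
  define I where "I = (\<integral>\<^sup>+x. ennreal \<bar>w x - w' x\<bar> * ?i x \<partial>lborel)"
  define X where "X m = (\<integral>\<^sup>+x. ennreal \<bar>Au (E m) x - mass (E m) * w x\<bar> * ?i x \<partial>lborel)" for m
  define X' where "X' m = (\<integral>\<^sup>+x. ennreal \<bar>Au (E m) x - mass (E m) * w' x\<bar> * ?i x \<partial>lborel)" for m
  have lim: "(\<lambda>m. X m + X' m) \<longlonglongrightarrow> 0 + 0"
    unfolding X_def X'_def using trace_limit trace_data.trace_limit[OF assms] by (rule tendsto_add)
  have "\<forall>\<^sub>F m in sequentially. mass0 / 2 < mass (E m)"
    using mass0_pos by (intro order_tendstoD(1)[OF mass_tendsto]) simp
  then have "\<forall>\<^sub>F m in sequentially. ennreal (mass0 / 2) * I \<le> X m + X' m"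
  proof eventually_elim
    case (elim m)
    have "ennreal (mass0 / 2) * I = (\<integral>\<^sup>+x. ennreal (mass0 / 2) * (ennreal \<bar>w x - w' x\<bar> * ?i x) \<partial>lborel)"
      unfolding I_def by (rule nn_integral_cmult[symmetric]) measurable
    also have "\<dots> \<le> (\<integral>\<^sup>+x. ennreal \<bar>Au (E m) x - mass (E m) * w x\<bar> * ?i x + ennreal \<bar>Au (E m) x - mass (E m) * w' x\<bar> * ?i x \<partial>lborel)"
    proof (rule nn_integral_mono)
      fix x :: 'a
      have "mass0 / 2 * \<bar>w x - w' x\<bar> \<le> mass (E m) * \<bar>w x - w' x\<bar>" using elim by (intro mult_right_mono) auto
      also have "\<dots> = \<bar>mass (E m) * w x - mass (E m) * w' x\<bar>"
        using mass_nonneg[OF E(2)] by (simp add: right_diff_distrib[symmetric] abs_mult)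
      finally have "mass0 / 2 * \<bar>w x - w' x\<bar> \<le> \<bar>Au (E m) x - mass (E m) * w x\<bar> + \<bar>Au (E m) x - mass (E m) * w' x\<bar>" by linarith
      then have "ennreal (mass0 / 2 * \<bar>w x - w' x\<bar>) \<le> ennreal (\<bar>Au (E m) x - mass (E m) * w x\<bar> + \<bar>Au (E m) x - mass (E m) * w' x\<bar>)"
        by (rule ennreal_leI)
      also have "\<dots> = ennreal \<bar>Au (E m) x - mass (E m) * w x\<bar> + ennreal \<bar>Au (E m) x - mass (E m) * w' x\<bar>" by simp
      also have "ennreal (mass0 / 2 * \<bar>w x - w' x\<bar>) = ennreal (mass0 / 2) * ennreal \<bar>w x - w' x\<bar>"
        using mass0_pos by (intro ennreal_mult') simp
      finally show "ennreal (mass0 / 2) * (ennreal \<bar>w x - w' x\<bar> * ?i x) \<le> ennreal \<bar>Au (E m) x - mass (E m) * w x\<bar> * ?i x + ennreal \<bar>Au (E m) x - mass (E m) * w' x\<bar> * ?i x"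
        by (cases "x \<in> core") simp_all
    qed
    also have "\<dots> = X m + X' m" unfolding X_def X'_def by (rule nn_integral_add) measurable
    finally show ?case .
  qed
  then have "ennreal (mass0 / 2) * I \<le> 0 + 0" by (intro tendsto_lowerbound[OF lim]) auto
  then have "I = 0" using mass0_pos by simp
  then have "AE x in lborel. ennreal \<bar>w x - w' x\<bar> * ?i x = 0" unfolding I_def by (subst (asm) nn_integral_0_iff_AE) auto
  then show ?thesis by eventually_elim (auto simp: indicator_def split: if_splits)
qed

end

section \<open>The representation formula\<close>

text \<open>All derivatives can be moved onto the kernel, which stays smooth with bounded support.
  Together with \<open>conv_bounded\<close> this bounds every derivative of the remainder on the
  whole space.\<close>

lemma conv_partials:
  assumes m: "integrable lebesgue m" and \<phi>: "\<And>k. Ck k \<phi>" "bdd_supp \<phi>"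
    and j: "bounded_linear j" "\<And>i. i \<in> Basis \<Longrightarrow> j i \<in> Basis" and "set is \<subseteq> Basis"
  shows "\<exists>\<psi>. (\<forall>k. Ck k \<psi>) \<and> bdd_supp \<psi> \<and>
     partials is (\<lambda>x. LINT z|lebesgue. m z * \<phi> (j x - z)) = (\<lambda>x. LINT z|lebesgue. m z * \<psi> (j x - z))"
  using assms(6)
proof (induction "is")
  case Nil
  then show ?case using \<phi> by auto
next
  case (Cons i "is")
  then obtain \<psi> where \<psi>: "\<forall>k. Ck k \<psi>" "bdd_supp \<psi>"
    "partials is (\<lambda>x. LINT z|lebesgue. m z * \<phi> (j x - z)) = (\<lambda>x. LINT z|lebesgue. m z * \<psi> (j x - z))" by auto
  have "Ck (Suc k) \<psi>" for k using \<psi>(1) by blast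
  then have "Ck k (partial (j i) \<psi>)" for k using j(2)[of i] Cons.prems by simp
  moreover have "Ck 1 \<psi>" using \<psi>(1) by blast
  ultimately show ?case
    using \<psi>(2,3) conv_partial[OF m _ \<psi>(2) j(1)] bdd_supp_partial[OF \<psi>(2)]
    by (intro exI[of _ "partial (j i) \<psi>"]) simp
qed

text \<open>\<open>ga_lim\<close> is the weighted form of the gradient convergence, as it enters the
  weak equation; the form without weight in \<open>trace_data\<close> belongs to the estimate along
  vertical slices.\<close>

locale weak_solution = trace_data \<Omega> a q \<rho> T u g \<Phi> w
  for \<Omega> :: "'a::euclidean_space set" and a q \<rho> T u g \<Phi> w +
  fixes lam :: real
  assumes lam: "lam > 0"
    and ga_lim: "(\<lambda>k. \<integral>\<^sup>+z. ennreal (wt a z * norm (g z - grad (\<Phi> k) z)) * indicator U z \<partial>lborel) \<longlonglongrightarrow> 0"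
    and w_integrable: "integrable lborel w"
    and weak: "e > 0 \<Longrightarrow> x \<in> core \<Longrightarrow>
      (LINT z|lborel. indicator U z * (wt a z * (g z \<bullet> grad (\<lambda>z. ker0 q (\<rho>\<^sup>2) e ((norm (z - (x, 0)))\<^sup>2)) z)))
      = lam * (LINT y|lborel. max (w y) 0 * ker0 q (\<rho>\<^sup>2) e ((norm (x - y))\<^sup>2))"
begin

definition Bu where "Bu e x = (LINT z|lborel. mu z * S e ((x, 0) - z))"

lemma mult_mu_integrable:
  assumes "K \<in> borel_measurable borel" "\<And>z. \<bar>K z\<bar> \<le> C"
  shows "integrable lborel (\<lambda>z. mu z * K z)"
  using bounded_mult_integrable[OF mu_integrable assms] by (simp add: mult.commute)

lemma S_abs: "e \<ge> 0 \<Longrightarrow> \<bar>S e z\<bar> \<le> 4 * \<rho>\<^sup>2 * (\<rho>\<^sup>2 / 2) powr (- q)"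
  using S_bounds(1,2)[of e z] by simp

lemma P_abs: "e > 0 \<Longrightarrow> \<bar>P e z\<bar> \<le> 4 * q * \<rho>\<^sup>2 * e powr (- q)"
  using P_bounds(1,2)[of e z] by simp

text \<open>Green's identity is available for the smooth \<open>\<Phi> k\<close>. Both sides pass to
  the limit because the kernels are bounded and supported near \<open>(x, 0)\<close>, and the weak
  equation turns the gradient side into the potential of \<open>max (w y) 0\<close>.\<close>

lemma weak_limit:
  assumes e: "e > 0" and x: "x \<in> core"
  shows "lam * (LINT y|lborel. max (w y) 0 * ker0 q (\<rho>\<^sup>2) e ((norm (x - y))\<^sup>2)) = Au e x - Bu e x"
proof -
  let ?\<psi> = "\<lambda>z :: 'a \<times> real. ker0 q (\<rho>\<^sup>2) e ((norm (z - (x, 0)))\<^sup>2)"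
  obtain C where C: "\<And>z. norm (grad ?\<psi> z) \<le> C" and zero: "\<And>z. norm (z - (x, 0)) \<ge> \<rho> \<Longrightarrow> grad ?\<psi> z = 0"
    and cont: "continuous_on UNIV (grad ?\<psi>)" using grad_kernel[OF e] by blast
  have [measurable]: "grad ?\<psi> \<in> borel_measurable borel" by (rule borel_measurable_continuous_onI[OF cont])
  have C0: "C \<ge> 0" using C by (rule order_trans[OF norm_ge_zero])
  define F where "F k z = wt a z * (grad (\<Phi> k) z \<bullet> grad ?\<psi> z)" for k z
  define f where "f z = indicator U z * (wt a z * (g z \<bullet> grad ?\<psi> z))" for z
  have FU: "F k z = indicator U z * (wt a z * (grad (\<Phi> k) z \<bullet> grad ?\<psi> z))" for k z
  proof (cases "z \<in> U")
    case False
    have "wt a z * (grad (\<Phi> k) z \<bullet> grad ?\<psi> z) = 0" by (rule outside_U[OF x False]) (simp add: zero)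
    then show ?thesis using False by (simp add: F_def)
  qed (simp add: F_def)
  have "(\<lambda>k. LINT z|lborel. F k z) \<longlonglongrightarrow> (LINT z|lborel. f z)"
  proof (rule L1_limit(2))
    show "f \<in> borel_measurable lborel" unfolding f_def[abs_def] by measurable
    show "integrable lborel (F k)" for k
    proof -
      have cg: "continuous_on UNIV (\<lambda>z. grad (\<Phi> k) z \<bullet> grad ?\<psi> z)"
        by (intro continuous_intros cont grad_continuous \<Phi>)
      obtain D where D: "D \<ge> 0" "\<And>z. z \<in> cball (x, 0) \<rho> \<Longrightarrow> \<bar>grad (\<Phi> k) z \<bullet> grad ?\<psi> z\<bar> \<le> D"
        using cont_bounded_ball[OF cg] by blast
      have z0: "grad (\<Phi> k) z \<bullet> grad ?\<psi> z = 0" if "z \<notin> ball (x, 0) \<rho>" for z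
        using that zero[of z] by (simp add: dist_norm norm_minus_commute)
      show ?thesis
        unfolding F_def[abs_def]
      proof (rule integrable_wt_bounded[OF a(1) _ _ z0])
        show "(\<lambda>z. grad (\<Phi> k) z \<bullet> grad ?\<psi> z) \<in> borel_measurable borel" by measurable
        show "\<bar>grad (\<Phi> k) z \<bullet> grad ?\<psi> z\<bar> \<le> D" for z
        proof (cases "z \<in> ball (x, 0) \<rho>")
          case True
          then show ?thesis using D(2)[of z] by (simp del: mem_ball mem_cball add: ball_subset_cball[THEN subsetD])
        next
          case False
          then show ?thesis using z0[OF False] D(1) by simp
        qed
      qed
    qed
    have "(\<integral>\<^sup>+z. ennreal \<bar>f z - F k z\<bar> \<partial>lborel) \<le> ennreal C * (\<integral>\<^sup>+z. ennreal (wt a z * norm (g z - grad (\<Phi> k) z)) * indicator U z \<partial>lborel)" for k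
    proof -
      have "(\<integral>\<^sup>+z. ennreal \<bar>f z - F k z\<bar> \<partial>lborel) \<le> (\<integral>\<^sup>+z. ennreal C * (ennreal (wt a z * norm (g z - grad (\<Phi> k) z)) * indicator U z) \<partial>lborel)"
      proof (rule nn_integral_mono)
        fix z
        have "\<bar>f z - F k z\<bar> = indicator U z * (wt a z * \<bar>(g z - grad (\<Phi> k) z) \<bullet> grad ?\<psi> z\<bar>)"
        proof -
          have "f z - F k z = indicator U z * (wt a z * ((g z - grad (\<Phi> k) z) \<bullet> grad ?\<psi> z))"
            unfolding FU f_def inner_diff_left by (simp add: algebra_simps)
          then show ?thesis by (simp add: abs_mult wt_nonneg)
        qed
        also have "\<dots> \<le> indicator U z * (wt a z * (norm (g z - grad (\<Phi> k) z) * C))"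
        proof (intro mult_left_mono)
          have "\<bar>(g z - grad (\<Phi> k) z) \<bullet> grad ?\<psi> z\<bar> \<le> norm (g z - grad (\<Phi> k) z) * norm (grad ?\<psi> z)" by (rule Cauchy_Schwarz_ineq2)
          also have "\<dots> \<le> norm (g z - grad (\<Phi> k) z) * C" by (intro mult_left_mono C) simp
          finally show "\<bar>(g z - grad (\<Phi> k) z) \<bullet> grad ?\<psi> z\<bar> \<le> norm (g z - grad (\<Phi> k) z) * C" .
        qed (auto simp: wt_nonneg)
        finally have "ennreal \<bar>f z - F k z\<bar> \<le> ennreal (C * (indicator U z * (wt a z * norm (g z - grad (\<Phi> k) z))))"
          by (intro ennreal_leI) (simp only: ac_simps)
        then show "ennreal \<bar>f z - F k z\<bar> \<le> ennreal C * (ennreal (wt a z * norm (g z - grad (\<Phi> k) z)) * indicator U z)"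
          unfolding ennreal_mult'[OF C0] by (cases "z \<in> U") simp_all
      qed
      also have "\<dots> = ennreal C * (\<integral>\<^sup>+z. ennreal (wt a z * norm (g z - grad (\<Phi> k) z)) * indicator U z \<partial>lborel)"
        by (rule nn_integral_cmult) measurable
      finally show ?thesis .
    qed
    moreover have "(\<lambda>k. ennreal C * (\<integral>\<^sup>+z. ennreal (wt a z * norm (g z - grad (\<Phi> k) z)) * indicator U z \<partial>lborel)) \<longlonglongrightarrow> ennreal C * 0"
      by (intro ennreal_tendsto_cmult ga_lim) simp
    then have "(\<lambda>k. ennreal C * (\<integral>\<^sup>+z. ennreal (wt a z * norm (g z - grad (\<Phi> k) z)) * indicator U z \<partial>lborel)) \<longlonglongrightarrow> 0" by simp
    ultimately show "(\<lambda>k. \<integral>\<^sup>+z. ennreal \<bar>f z - F k z\<bar> \<partial>lborel) \<longlonglongrightarrow> 0"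
      by (rule_tac tendsto_sandwich[OF _ _ tendsto_const]) auto
  qed
  moreover have "(\<lambda>k. LINT z|lborel. F k z) \<longlonglongrightarrow> Au e x - Bu e x"
  proof -
    let ?K = "\<lambda>z. P e z - S e z"
    note P_measurable[OF e, measurable] S_measurable[of e, measurable]
    have e0: "e \<ge> 0" using e by simp
    have "(\<lambda>k. LINT z|lborel. wt a z * (\<Phi> k z * ?K (z - (x, 0)))) \<longlonglongrightarrow> (LINT z|lborel. mu z * ?K (z - (x, 0)))"
    proof (rule kernel_tendsto[OF _ _ _ x])
      show "?K \<in> borel_measurable borel" using e0 by measurable
      show "\<bar>?K z\<bar> \<le> 4 * q * \<rho>\<^sup>2 * e powr (- q) + 4 * \<rho>\<^sup>2 * (\<rho>\<^sup>2 / 2) powr (- q)" for z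
        using P_abs[OF e, of z] S_abs[OF e0, of z] by linarith
      show "?K z = 0" if "norm z \<ge> \<rho>" for z using P_bounds(3)[OF e that] S_bounds(3)[OF e0 that] by simp
    qed
    moreover have "(LINT z|lborel. F k z) = (LINT z|lborel. wt a z * (\<Phi> k z * ?K (z - (x, 0))))" for k
      unfolding F_def P_def S_def by (rule green_identity[OF a(1) q e \<Phi>]) simp
    moreover have "(LINT z|lborel. mu z * ?K (z - (x, 0))) = Au e x - Bu e x"
    proof -
      have "(LINT z|lborel. mu z * ?K (z - (x, 0))) = (LINT z|lborel. mu z * P e ((x, 0) - z) - mu z * S e ((x, 0) - z))"
        by (intro Bochner_Integration.integral_cong refl) (simp add: P_even[of e _ "(x, 0)"] S_even[of e _ "(x, 0)"] algebra_simps)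
      also have "\<dots> = Au e x - Bu e x"
        unfolding Au_def Bu_def
      proof (rule Bochner_Integration.integral_diff)
        show "integrable lborel (\<lambda>z. mu z * P e ((x, 0) - z))" by (rule mult_mu_integrable[OF _ P_abs[OF e]]) measurable
        show "integrable lborel (\<lambda>z. mu z * S e ((x, 0) - z))" by (rule mult_mu_integrable[OF _ S_abs[OF e0]]) (use e0 in measurable)
      qed
      finally show ?thesis .
    qed
    ultimately show ?thesis by simp
  qed
  ultimately have "(LINT z|lborel. f z) = Au e x - Bu e x" by (rule LIMSEQ_unique)
  then show ?thesis using weak[OF e x] by (simp add: f_def)
qed

lemma Bu_tendsto: "(\<lambda>m. Bu (E m) x) \<longlonglongrightarrow> Bu 0 x"
  unfolding Bu_def
proof (rule integral_dominated_convergence[where w = "\<lambda>z. \<bar>mu z\<bar> * (4 * \<rho>\<^sup>2 * (\<rho>\<^sup>2 / 2) powr (- q))"])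
  note S_measurable[of 0, measurable] S_measurable[OF E(3), measurable]
  show "(\<lambda>z. mu z * S 0 ((x, 0) - z)) \<in> borel_measurable lborel" by measurable
  show "(\<lambda>z. mu z * S (E m) ((x, 0) - z)) \<in> borel_measurable lborel" for m by measurable
  show "integrable lborel (\<lambda>z. \<bar>mu z\<bar> * (4 * \<rho>\<^sup>2 * (\<rho>\<^sup>2 / 2) powr (- q)))"
    using mu_integrable by simp
  show "AE z in lborel. (\<lambda>m. mu z * S (E m) ((x, 0) - z)) \<longlonglongrightarrow> mu z * S 0 ((x, 0) - z)"
    by (intro AE_I2 tendsto_mult tendsto_const S_tendsto)
  show "AE z in lborel. norm (mu z * S (E m) ((x, 0) - z)) \<le> \<bar>mu z\<bar> * (4 * \<rho>\<^sup>2 * (\<rho>\<^sup>2 / 2) powr (- q))" for m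
    unfolding real_norm_def abs_mult by (intro AE_I2 mult_left_mono S_abs[OF E(3)]) simp
qed

text \<open>Convergence of the potential at \<open>x\<close> for \<open>e = 0\<close> is not known
  in advance. Fatou's lemma derives it from the convergent right side of \<open>weak_limit\<close>;
  since \<open>ker0\<close> grows as \<open>e\<close> decreases, the limit integrand then dominates
  the whole family.\<close>

lemma kernel_limit:
  fixes r :: "nat \<Rightarrow> nat"
  assumes r: "strict_mono r" and x: "x \<in> core" and lim: "(\<lambda>m. Au (E (r m)) x) \<longlonglongrightarrow> l"
  shows "l = lam * (LINT y|lborel. max (w y) 0 * ker0 q (\<rho>\<^sup>2) 0 ((norm (x - y))\<^sup>2)) + Bu 0 x"
proof -
  define k where "k e y = ker0 q (\<rho>\<^sup>2) e ((norm (x - y))\<^sup>2)" for e and y :: 'a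
  define W where "W y = max (w y) 0" for y
  have W0: "W y \<ge> 0" for y by (simp add: W_def)
  have [measurable]: "W \<in> borel_measurable borel" unfolding W_def[abs_def] by measurable
  have Er: "(\<lambda>m. E (r m)) \<longlonglongrightarrow> 0" using LIMSEQ_subseq_LIMSEQ[OF E(1) r] by (simp add: o_def)
  have k_cont: "continuous_on UNIV (k e)" if "e > 0" for e
  proof -
    have "continuous_on UNIV (\<lambda>y. ker0 q (\<rho>\<^sup>2) e ((norm (y - x))\<^sup>2))"
      by (rule Ck_continuous[OF Ck_radial[OF kdiff_ker0 that, of 0]])
    then show ?thesis unfolding k_def[abs_def] by (simp add: norm_minus_commute)
  qed
  have k_meas [measurable]: "k e \<in> borel_measurable borel" if "e > 0" for e
    by (rule borel_measurable_continuous_onI[OF k_cont[OF that]])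
  have t: "(norm (x - y))\<^sup>2 > 0" if "y \<noteq> x" for y using that by simp
  have k_lim: "(\<lambda>m. k (E (r m)) y) \<longlonglongrightarrow> k 0 y" if "y \<noteq> x" for y
    unfolding k_def using t[OF that] q_pos E(2) by (intro ker0_tendsto Er) auto
  have k_nn: "k e y \<ge> 0" if "e > 0" for e y
    unfolding k_def using that by (intro ker0_nonneg) (auto intro: less_le_trans[of _ 0])
  have k_le: "k e y \<le> k 0 y" if "e > 0" "y \<noteq> x" for e y
    unfolding k_def using that t[OF that(2)] q_pos by (intro ker0_le) auto
  have k0_nn: "k 0 y \<ge> 0" if "y \<noteq> x" for y using k_nn[of 1 y] k_le[OF _ that, of 1] by simp
  \<comment> \<open>At \<open>y = x\<close> the kernel with \<open>e = 0\<close> is singular;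
    changing it at this one point makes nonnegativity and measurability hold everywhere.\<close>
  define k' where "k' y = (if y = x then 0 else k 0 y)" for y
  have k'_meas [measurable]: "k' \<in> borel_measurable borel"
  proof (rule borel_measurable_LIMSEQ_real[where u = "\<lambda>m y. if y = x then 0 else k (E (r m)) y"])
    show "(\<lambda>m. if y = x then 0 else k (E (r m)) y) \<longlonglongrightarrow> k' y" for y
      using k_lim[of y] by (simp add: k'_def)
    show "(\<lambda>y. if y = x then 0 else k (E (r m)) y) \<in> borel_measurable borel" for m
      using k_meas[OF E(2), measurable] by measurable
  qed
  note k_meas[OF E(2), measurable]
  have int_k: "integrable lborel (\<lambda>y. W y * k (E m) y)" for m
  proof -
    have "bdd_supp (\<lambda>y. ker0 q (\<rho>\<^sup>2) (E m) ((norm (y - x))\<^sup>2))" by (rule bdd_supp_radial[OF ker0_eq_0])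
    then have bs: "bdd_supp (k (E m))" unfolding k_def[abs_def] by (simp add: norm_minus_commute)
    obtain C where C: "\<And>y. \<bar>k (E m) y\<bar> \<le> C"
      using bdd_supp_ucont(2)[OF k_cont[OF E(2)] bs] by blast
    have "integrable lborel W" unfolding W_def[abs_def] using w_integrable by simp
    from bounded_mult_integrable[OF this _ C] show ?thesis by (simp add: mult.commute)
  qed
  have lim2: "(\<lambda>m. LINT y|lborel. W y * k (E (r m)) y) \<longlonglongrightarrow> (l - Bu 0 x) / lam"
  proof -
    have "(\<lambda>m. (Au (E (r m)) x - Bu (E (r m)) x) / lam) \<longlonglongrightarrow> (l - Bu 0 x) / lam"
      using LIMSEQ_subseq_LIMSEQ[OF Bu_tendsto r, of x] lam
      by (intro tendsto_divide tendsto_diff lim tendsto_const) (auto simp: o_def)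
    moreover have "(LINT y|lborel. W y * k (E (r m)) y) = (Au (E (r m)) x - Bu (E (r m)) x) / lam" for m
      unfolding weak_limit[OF E(2) x, symmetric] W_def k_def using lam by simp
    ultimately show ?thesis by simp
  qed
  have aex: "AE y in lborel. y \<noteq> x" by (rule AE_lborel_singleton)
  have "(\<integral>\<^sup>+y. ennreal (W y * k' y) \<partial>lborel) = (\<integral>\<^sup>+y. liminf (\<lambda>m. ennreal (W y * k (E (r m)) y)) \<partial>lborel)"
  proof (rule nn_integral_cong_AE)
    show "AE y in lborel. ennreal (W y * k' y) = liminf (\<lambda>m. ennreal (W y * k (E (r m)) y))"
      using aex
    proof eventually_elim
      case (elim y)
      have "(\<lambda>m. ennreal (W y * k (E (r m)) y)) \<longlonglongrightarrow> ennreal (W y * k' y)"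
        using k_lim[OF elim] elim by (intro tendsto_ennrealI tendsto_mult tendsto_const) (simp add: k'_def)
      then show ?case by (rule lim_imp_Liminf[OF sequentially_bot, symmetric])
    qed
  qed
  also have "\<dots> \<le> liminf (\<lambda>m. \<integral>\<^sup>+y. ennreal (W y * k (E (r m)) y) \<partial>lborel)"
    by (rule nn_integral_liminf) measurable
  also have "\<dots> = liminf (\<lambda>m. ennreal (LINT y|lborel. W y * k (E (r m)) y))"
    using k_nn[OF E(2)] W0 by (subst nn_integral_eq_integral[OF int_k]) auto
  also have "\<dots> = ennreal ((l - Bu 0 x) / lam)"
    by (intro lim_imp_Liminf sequentially_bot tendsto_ennrealI lim2)
  also have "\<dots> < \<infinity>" by simp
  finally have fin: "(\<integral>\<^sup>+y. ennreal (W y * k' y) \<partial>lborel) < \<infinity>" .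
  have nn': "W y * k' y \<ge> 0" for y using W0 k0_nn by (simp add: k'_def)
  have int0: "integrable lborel (\<lambda>y. W y * k' y)"
  proof (rule integrableI_bounded)
    show "(\<integral>\<^sup>+y. ennreal (norm (W y * k' y)) \<partial>lborel) < \<infinity>" using fin nn' by simp
  qed measurable
  have "(\<lambda>m. LINT y|lborel. W y * k (E (r m)) y) \<longlonglongrightarrow> (LINT y|lborel. W y * k' y)"
  proof (rule integral_dominated_convergence[OF _ _ int0])
    show "AE y in lborel. (\<lambda>m. W y * k (E (r m)) y) \<longlonglongrightarrow> W y * k' y"
      using aex by eventually_elim (auto intro!: tendsto_intros k_lim simp: k'_def)
    show "AE y in lborel. norm (W y * k (E (r m)) y) \<le> W y * k' y" for m
      using aex
    proof eventually_elim
      case (elim y)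
      have "W y * k (E (r m)) y \<le> W y * k' y" using elim k_le[OF E(2) elim] W0 by (auto simp: k'_def intro!: mult_left_mono)
      then show ?case using k_nn[OF E(2)] W0 by simp
    qed
  qed measurable
  then have "(LINT y|lborel. W y * k' y) = (l - Bu 0 x) / lam" using lim2 by (rule LIMSEQ_unique)
  moreover have "(LINT y|lborel. W y * k' y) = (LINT y|lborel. W y * k 0 y)"
  proof (rule integral_cong_AE)
    show "AE y in lborel. W y * k' y = W y * k 0 y" using aex by eventually_elim (simp add: k'_def)
    have "(\<lambda>y. W y * k 0 y) = (\<lambda>y. W y * (if y = x then k 0 x else k' y))" by (auto simp: k'_def)
    then show "(\<lambda>y. W y * k 0 y) \<in> borel_measurable lborel" by simp
  qed measurable
  ultimately have "lam * (LINT y|lborel. W y * k 0 y) = l - Bu 0 x" using lam by simp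
  then show ?thesis by (simp add: W_def k_def)
qed

text \<open>Dividing by \<open>mass0\<close> gives \<open>\<kappa> = lam / mass0\<close>. The
  remainder is the convolution of the integrable \<open>mu / mass0\<close> with the smooth kernel
  \<open>S 0\<close>, evaluated at boundary points through
  \<open>x \<mapsto> (x, 0)\<close>.\<close>

theorem representation:
  "\<exists>\<kappa> H. (\<forall>k. Ck k H) \<and> (\<forall>is. set is \<subseteq> Basis \<longrightarrow> (\<exists>C. \<forall>x. \<bar>partials is H x\<bar> \<le> C)) \<and>
     (AE x in lborel. x \<in> core \<longrightarrow>
        w x = \<kappa> * (LINT y|lborel. max (w y) 0 * ker0 q (\<rho>\<^sup>2) 0 ((norm (x - y))\<^sup>2)) + H x)"
proof -
  define m where "m z = mu z / mass0" for z
  have [measurable]: "m \<in> borel_measurable borel" unfolding m_def[abs_def] by measurable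
  have m: "integrable lebesgue m" unfolding m_def using mu_integrable by (simp add: integrable_completion)
  define H where "H x = (LINT z|lebesgue. m z * S 0 ((x, 0) - z))" for x
  have H: "H x = Bu 0 x / mass0" for x
  proof -
    note S_measurable[of 0, measurable]
    have "H x = (LINT z|lborel. m z * S 0 ((x, 0) - z))" unfolding H_def by (rule integral_completion) measurable
    then show ?thesis by (simp add: m_def Bu_def)
  qed
  have bl: "bounded_linear (\<lambda>x :: 'a. (x, 0 :: real))" by (intro bounded_linear_Pair bounded_linear_ident bounded_linear_zero)
  have bs: "(i, 0 :: real) \<in> Basis" if "i \<in> (Basis :: 'a set)" for i using that by (simp add: Basis_prod_def)
  have "Ck k H" for k
    unfolding H_def[abs_def] by (rule conv_Ck[OF m S_Ck S_supp bl bs]) auto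
  moreover have "\<exists>C. \<forall>x. \<bar>partials is H x\<bar> \<le> C" if bs_is: "set is \<subseteq> Basis" for "is"
  proof -
    have "\<exists>\<psi>. (\<forall>k. Ck k \<psi>) \<and> bdd_supp \<psi> \<and>
       partials is (\<lambda>x. LINT z|lebesgue. m z * S 0 ((x, 0) - z)) = (\<lambda>x. LINT z|lebesgue. m z * \<psi> ((x, 0) - z))"
      by (rule conv_partials[OF m S_Ck S_supp bl bs bs_is]) auto
    then obtain \<psi> where \<psi>: "Ck 0 \<psi>" "bdd_supp \<psi>" "partials is H = (\<lambda>x. LINT z|lebesgue. m z * \<psi> ((x, 0) - z))"
      unfolding H_def[abs_def] by blast
    show ?thesis using conv_bounded[OF m Ck_continuous[OF \<psi>(1)] \<psi>(2), of "\<lambda>x. (x, 0)"] \<psi>(3) by simp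
  qed
  moreover have "AE x in lborel. x \<in> core \<longrightarrow>
      w x = (lam / mass0) * (LINT y|lborel. max (w y) 0 * ker0 q (\<rho>\<^sup>2) 0 ((norm (x - y))\<^sup>2)) + H x"
    using trace_AE
  proof (elim exE conjE)
    fix r :: "nat \<Rightarrow> nat"
    assume r: "strict_mono r" and ae: "AE x in lborel. x \<in> core \<longrightarrow> (\<lambda>m. Au (E (r m)) x) \<longlonglongrightarrow> mass0 * w x"
    from ae show ?thesis
    proof eventually_elim
      case (elim x)
      show ?case
      proof
        assume x: "x \<in> core"
        have "mass0 * w x = lam * (LINT y|lborel. max (w y) 0 * ker0 q (\<rho>\<^sup>2) 0 ((norm (x - y))\<^sup>2)) + Bu 0 x"
          using elim x by (intro kernel_limit[OF r x]) blast
        then show "w x = (lam / mass0) * (LINT y|lborel. max (w y) 0 * ker0 q (\<rho>\<^sup>2) 0 ((norm (x - y))\<^sup>2)) + H x"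
          unfolding H using mass0_pos by (simp add: field_simps)
      qed
    qed
  qed
  ultimately show ?thesis by blast
qed

end

section \<open>Passing to Borel representatives\<close>

lemma borel_measurable_completion_AE:
  fixes f g :: "'b \<Rightarrow> 'c::topological_space"
  assumes g: "g \<in> borel_measurable M" and ae: "AE x in M. f x = g x"
  shows "f \<in> borel_measurable (completion M)"
proof (rule measurableI)
  fix A :: "'c set" assume "A \<in> sets borel"
  then have A: "g -` A \<inter> space M \<in> sets (completion M)" using measurable_sets[OF g] by simp
  have "AE x in completion M. x \<in> g -` A \<inter> space M \<longleftrightarrow> x \<in> f -` A \<inter> space M"
    using AE_completion[OF ae] by eventually_elim auto
  from completion.in_sets_AE[OF this A] show "f -` A \<inter> space (completion M) \<in> sets (completion M)"
    by simp
qed simp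

lemma integral_lebesgue_eq:
  fixes f g :: "'b::euclidean_space \<Rightarrow> real"
  assumes g: "g \<in> borel_measurable borel" and ae: "AE x in lborel. f x = g x"
  shows "(LINT x|lebesgue. f x) = (LINT x|lborel. g x)"
proof -
  have "(LINT x|lebesgue. f x) = (LINT x|lebesgue. g x)"
    using g by (intro integral_cong_AE borel_measurable_completion_AE[OF _ ae] AE_completion[OF ae] measurable_completion) simp_all
  also have "\<dots> = (LINT x|lborel. g x)" using g by (intro integral_completion) simp
  finally show ?thesis .
qed

lemma borel_version:
  fixes f :: "'b::euclidean_space \<Rightarrow> 'c::euclidean_space"
  assumes "f \<in> borel_measurable lebesgue"
  shows "\<exists>f'\<in>borel_measurable borel. AE x in lborel. f x = f' x"
proof -
  have "\<forall>i. \<exists>f'. f' \<in> borel_measurable borel \<and> (AE x in lborel. f x \<bullet> i = f' x)"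
  proof
    fix i
    have "(\<lambda>x. f x \<bullet> i) \<in> borel_measurable lebesgue" using assms by simp
    from completion_ex_borel_measurable_real[OF this]
    show "\<exists>f'. f' \<in> borel_measurable borel \<and> (AE x in lborel. f x \<bullet> i = f' x)" by auto
  qed
  from choice[OF this] obtain F where F: "\<And>i. F i \<in> borel_measurable borel" "\<And>i. AE x in lborel. f x \<bullet> i = F i x" by blast
  note F(1)[measurable]
  have "AE x in lborel. \<forall>i\<in>Basis. f x \<bullet> i = F i x" using F(2) by (intro AE_finite_allI) auto
  then have "AE x in lborel. f x = (\<Sum>i\<in>Basis. F i x *\<^sub>R i)"
  proof eventually_elim
    case (elim x)
    have "f x = (\<Sum>i\<in>Basis. (f x \<bullet> i) *\<^sub>R i)" by (rule euclidean_representation[symmetric])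
    also have "\<dots> = (\<Sum>i\<in>Basis. F i x *\<^sub>R i)" using elim by (intro sum.cong) auto
    finally show ?case .
  qed
  then show ?thesis by (intro bexI[of _ "\<lambda>x. \<Sum>i\<in>Basis. F i x *\<^sub>R i"]) measurable
qed

lemma L2_borel:
  fixes f :: "'b::euclidean_space \<Rightarrow> 'c::euclidean_space"
  assumes "L2_on U f"
  shows "\<exists>f'\<in>borel_measurable borel. AE x in lborel. x \<in> U \<longrightarrow> f x = f' x"
proof -
  have "(\<lambda>x. indicator U x *\<^sub>R f x) \<in> borel_measurable lebesgue"
    using assms by (simp add: L2_on_def set_borel_measurable_def)
  from borel_version[OF this] show ?thesis
  proof (elim bexE)
    fix f' assume f': "f' \<in> borel_measurable borel" "AE x in lborel. indicator U x *\<^sub>R f x = f' x"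
    from f'(2) have "AE x in lborel. x \<in> U \<longrightarrow> f x = f' x" by eventually_elim auto
    then show ?thesis using f'(1) by blast
  qed
qed

text \<open>The weighted space only makes the product with the weight measurable; on the cylinder
  the weight is positive and can be divided out again.\<close>

lemma wL2_borel:
  fixes f :: "'b::euclidean_space \<times> real \<Rightarrow> 'c::euclidean_space"
  assumes "wL2_on a (\<Omega> \<times> {0<..<T}) f"
  shows "\<exists>f'\<in>borel_measurable borel. AE z in lborel. z \<in> \<Omega> \<times> {0<..<T} \<longrightarrow> f z = f' z"
  using L2_borel[OF assms[unfolded wL2_on_def]]
proof (elim bexE)
  fix f' :: "'b \<times> real \<Rightarrow> 'c"
  assume f' [measurable]: "f' \<in> borel_measurable borel"
    and ae: "AE z in lborel. z \<in> \<Omega> \<times> {0<..<T} \<longrightarrow> weighted a f z = f' z"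
  from ae have "AE z in lborel. z \<in> \<Omega> \<times> {0<..<T} \<longrightarrow> f z = (snd z powr (- a / 2)) *\<^sub>R f' z"
  proof eventually_elim
    case (elim z)
    show ?case
    proof
      assume z: "z \<in> \<Omega> \<times> {0<..<T}"
      then have "snd z > 0" by (auto simp: mem_Times_iff)
      then have "snd z powr (- a / 2) * snd z powr (a / 2) = 1" by (simp add: powr_add[symmetric])
      then show "f z = (snd z powr (- a / 2)) *\<^sub>R f' z" using elim z by (simp add: weighted_def flip: elim)
    qed
  qed
  then show ?thesis by (intro bexI[of _ "\<lambda>z. (snd z powr (- a / 2)) *\<^sub>R f' z"]) measurable
qed

section \<open>From weighted L2 convergence to L1 convergence\<close>

lemma L2_sqnorm_cong_AE:
  "AE x in lborel. x \<in> U \<longrightarrow> f x = f' x \<Longrightarrow> L2_sqnorm U f = L2_sqnorm U f'"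
  unfolding L2_sqnorm_def nn_integral_completion
  by (intro nn_integral_cong_AE) (auto elim!: eventually_mono simp: indicator_def)

lemma L2_sqnorm_mono: "V \<subseteq> U \<Longrightarrow> L2_sqnorm V f \<le> L2_sqnorm U f"
  unfolding L2_sqnorm_def by (intro nn_integral_mono) (auto simp: indicator_def)

text \<open>Cauchy-Schwarz bounds the square of an L1 norm; comparing squares avoids roots of
  extended reals.\<close>

lemma tendsto_0_of_square:
  fixes x y :: "nat \<Rightarrow> ennreal"
  assumes le: "\<And>k. (x k)\<^sup>2 \<le> y k * M" and M: "M < \<infinity>" and y: "y \<longlonglongrightarrow> 0"
  shows "x \<longlonglongrightarrow> 0"
proof (rule order_tendstoI)
  fix e :: ennreal assume e: "0 < e"
  have "(\<lambda>k. M * y k) \<longlonglongrightarrow> M * 0" using M y by (intro ennreal_tendsto_cmult) (simp_all add: infinity_ennreal_def)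
  moreover have "M * 0 < e * e" using e by (simp add: ennreal_zero_less_mult_iff)
  ultimately have "\<forall>\<^sub>F k in sequentially. M * y k < e * e" by (rule order_tendstoD)
  then show "\<forall>\<^sub>F k in sequentially. x k < e"
  proof eventually_elim
    case (elim k)
    show ?case
    proof (rule ccontr)
      assume "\<not> x k < e"
      then have "e * e \<le> x k * x k" by (intro mult_mono) auto
      then show False using le[of k] elim by (simp add: power2_eq_square mult.commute)
    qed
  qed
qed simp

lemma L2_L1:
  fixes F :: "'b::euclidean_space \<Rightarrow> 'c::euclidean_space"
  assumes [measurable]: "F \<in> borel_measurable borel" "\<Omega> \<in> sets borel"
  shows "(\<integral>\<^sup>+x. ennreal (norm (F x)) * indicator \<Omega> x \<partial>lborel)\<^sup>2 \<le> L2_sqnorm \<Omega> F * emeasure lborel \<Omega>"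
proof -
  have "(\<integral>\<^sup>+x. ennreal (norm (F x)) * indicator \<Omega> x \<partial>lborel)
     = (\<integral>\<^sup>+x. (ennreal (norm (F x)) * indicator \<Omega> x) * indicator \<Omega> x \<partial>lborel)"
    by (intro nn_integral_cong) (simp add: indicator_def)
  also have "\<dots>\<^sup>2 \<le> (\<integral>\<^sup>+x. (ennreal (norm (F x)) * indicator \<Omega> x)\<^sup>2 \<partial>lborel) * (\<integral>\<^sup>+x. (indicator \<Omega> x)\<^sup>2 \<partial>lborel)"
    by (rule Cauchy_Schwarz_nn_integral) measurable
  also have "(\<integral>\<^sup>+x. (ennreal (norm (F x)) * indicator \<Omega> x)\<^sup>2 \<partial>lborel) = L2_sqnorm \<Omega> F"
    unfolding L2_sqnorm_def nn_integral_completion by (intro nn_integral_cong) (simp add: indicator_def ennreal_power)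
  also have "(\<integral>\<^sup>+x. (indicator \<Omega> x :: ennreal)\<^sup>2 \<partial>lborel) = (\<integral>\<^sup>+x. indicator \<Omega> x \<partial>lborel)"
    by (intro nn_integral_cong) (simp add: indicator_def)
  also have "\<dots> = emeasure lborel \<Omega>" by simp
  finally show ?thesis .
qed

text \<open>Cauchy-Schwarz with \<open>y powr c = y powr (a / 2) * y powr (c - a / 2)\<close>. The
  cases of interest are \<open>c = a\<close> and \<open>c = 0\<close>, where the second factor
  leaves the weights \<open>y powr a\<close> and \<open>y powr (- a)\<close>, integrable near 0 for
  \<open>a > -1\<close> and \<open>a < 1\<close> respectively.\<close>

lemma wL2_L1:
  fixes F :: "'b::euclidean_space \<times> real \<Rightarrow> 'c::euclidean_space"
  assumes [measurable]: "F \<in> borel_measurable borel" and \<Omega>: "open \<Omega>"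
  shows "(\<integral>\<^sup>+z. ennreal (wt c z * norm (F z)) * indicator (\<Omega> \<times> {0<..<T}) z \<partial>lborel)\<^sup>2
     \<le> L2_sqnorm (\<Omega> \<times> {0<..<T}) (weighted a F) * (\<integral>\<^sup>+z. ennreal (wt (2 * c - a) z) * indicator (\<Omega> \<times> {..<T}) z \<partial>lborel)"
proof -
  define U where "U = \<Omega> \<times> {0<..<T}"
  have "open U" unfolding U_def by (intro open_Times \<Omega>) simp
  then have [measurable]: "U \<in> sets borel" by (rule borel_open)
  have U: "snd z > 0" if "z \<in> U" for z using that by (auto simp: U_def)
  have "(\<integral>\<^sup>+z. ennreal (wt c z * norm (F z)) * indicator U z \<partial>lborel)
     = (\<integral>\<^sup>+z. (ennreal (norm (weighted a F z)) * indicator U z) * (ennreal (wt (c - a / 2) z) * indicator U z) \<partial>lborel)"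
  proof (rule nn_integral_cong)
    fix z :: "'b \<times> real"
    show "ennreal (wt c z * norm (F z)) * indicator U z = (ennreal (norm (weighted a F z)) * indicator U z) * (ennreal (wt (c - a / 2) z) * indicator U z)"
    proof (cases "z \<in> U")
      case True
      have "snd z powr c = snd z powr (a / 2) * snd z powr (c - a / 2)" by (simp add: powr_add[symmetric])
      then have "wt c z * norm (F z) = norm (weighted a F z) * wt (c - a / 2) z"
        using U[OF True] by (simp add: wt_def weighted_def)
      then show ?thesis using True by (simp add: ennreal_mult' wt_nonneg)
    qed simp
  qed
  also have "\<dots>\<^sup>2 \<le> (\<integral>\<^sup>+z. (ennreal (norm (weighted a F z)) * indicator U z)\<^sup>2 \<partial>lborel) * (\<integral>\<^sup>+z. (ennreal (wt (c - a / 2) z) * indicator U z)\<^sup>2 \<partial>lborel)"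
    unfolding weighted_def by (rule Cauchy_Schwarz_nn_integral) measurable
  also have "(\<integral>\<^sup>+z. (ennreal (norm (weighted a F z)) * indicator U z)\<^sup>2 \<partial>lborel) = L2_sqnorm U (weighted a F)"
    unfolding L2_sqnorm_def nn_integral_completion by (intro nn_integral_cong) (simp add: indicator_def ennreal_power)
  also have "(\<integral>\<^sup>+z. (ennreal (wt (c - a / 2) z) * indicator U z)\<^sup>2 \<partial>lborel) \<le> (\<integral>\<^sup>+z. ennreal (wt (2 * c - a) z) * indicator (\<Omega> \<times> {..<T}) z \<partial>lborel)"
  proof (rule nn_integral_mono)
    fix z :: "'b \<times> real"
    show "(ennreal (wt (c - a / 2) z) * indicator U z)\<^sup>2 \<le> ennreal (wt (2 * c - a) z) * indicator (\<Omega> \<times> {..<T}) z"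
    proof (cases "z \<in> U")
      case True
      have "(wt (c - a / 2) z)\<^sup>2 = wt (2 * c - a) z"
        using U[OF True] by (simp add: wt_def power2_eq_square powr_add[symmetric])
      then show ?thesis using True by (auto simp: ennreal_power wt_nonneg U_def)
    qed simp
  qed
  finally show ?thesis unfolding U_def by (simp add: mult_left_mono)
qed

text \<open>The matrix of \<open>has_trace\<close>, with height, gradient and approximating sequence
  as parameters so that they can be shared between several statements.\<close>

definition "trace_on a \<Omega> T u w g \<Phi> \<longleftrightarrow> wL2_on a (\<Omega> \<times> {0<..<T}) u \<and>
  weak_gradient (\<Omega> \<times> {0<..<T}) u g \<and> wL2_on a (\<Omega> \<times> {0<..<T}) g \<and> (\<forall>k::nat. smooth_on UNIV (\<Phi> k)) \<and>
  (\<lambda>k. L2_sqnorm (\<Omega> \<times> {0<..<T}) (weighted a (\<lambda>z. u z - \<Phi> k z))) \<longlonglongrightarrow> 0 \<and>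
  (\<lambda>k. L2_sqnorm (\<Omega> \<times> {0<..<T}) (weighted a (\<lambda>z. g z - grad (\<Phi> k) z))) \<longlonglongrightarrow> 0 \<and>
  (\<lambda>k. L2_sqnorm \<Omega> (\<lambda>x. w x - \<Phi> k (x, 0))) \<longlonglongrightarrow> 0"

lemma has_trace_iff: "has_trace a \<Omega> u w \<longleftrightarrow> L2_on \<Omega> w \<and> (\<exists>T>0. \<exists>g \<Phi>. trace_on a \<Omega> T u w g \<Phi>)"
  unfolding has_trace_def trace_on_def Let_def ..

context extension
begin

lemma L1_lim:
  fixes F :: "nat \<Rightarrow> 'a \<times> real \<Rightarrow> 'c::euclidean_space"
  assumes F: "\<And>k. F k \<in> borel_measurable borel" and c: "- 1 < 2 * c - a" and T: "T \<le> T'"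
    and lim: "(\<lambda>k. L2_sqnorm (\<Omega> \<times> {0<..<T'}) (weighted a (f k))) \<longlonglongrightarrow> 0"
    and ae: "\<And>k. AE z in lborel. z \<in> U \<longrightarrow> f k z = F k z"
  shows "(\<lambda>k. \<integral>\<^sup>+z. ennreal (wt c z * norm (F k z)) * indicator U z \<partial>lborel) \<longlonglongrightarrow> 0"
proof (rule tendsto_0_of_square[OF _ _ lim])
  fix k
  have "L2_sqnorm U (weighted a (F k)) = L2_sqnorm U (weighted a (f k))"
    using ae[of k] by (intro L2_sqnorm_cong_AE) (auto elim!: eventually_mono simp: weighted_def)
  also have "\<dots> \<le> L2_sqnorm (\<Omega> \<times> {0<..<T'}) (weighted a (f k))" using T by (intro L2_sqnorm_mono) (auto simp: U_def)
  finally show "(\<integral>\<^sup>+z. ennreal (wt c z * norm (F k z)) * indicator U z \<partial>lborel)\<^sup>2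
     \<le> L2_sqnorm (\<Omega> \<times> {0<..<T'}) (weighted a (f k)) * (\<integral>\<^sup>+z. ennreal (wt (2 * c - a) z) * indicator (\<Omega> \<times> {..<T}) z \<partial>lborel)"
    using wL2_L1[OF F[of k] \<Omega>(1), of c T a] unfolding U_def by (meson mult_right_mono order_trans zero_le)
  show "(\<integral>\<^sup>+z. ennreal (wt (2 * c - a) (z :: 'a \<times> real)) * indicator (\<Omega> \<times> {..<T}) z \<partial>lborel) < \<infinity>"
    using emeasure_bounded_finite[OF \<Omega>(2)] by (intro nn_integral_wt_cylinder c \<Omega>_borel) simp
qed

lemma trace_dataI:
  assumes b: "ub \<in> borel_measurable borel" "gb \<in> borel_measurable borel" "wb \<in> borel_measurable borel"
    and ae: "AE z in lborel. z \<in> U \<longrightarrow> u z = ub z" "AE z in lborel. z \<in> U \<longrightarrow> g z = gb z" "AE x in lborel. x \<in> \<Omega> \<longrightarrow> w x = wb x"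
    and T: "T \<le> T'" and tr: "trace_on a \<Omega> T' u w g \<Phi>"
  shows "trace_data \<Omega> a q \<rho> T ub gb \<Phi> wb"
    and "(\<lambda>k. \<integral>\<^sup>+z. ennreal (wt a z * norm (gb z - grad (\<Phi> k) z)) * indicator U z \<partial>lborel) \<longlonglongrightarrow> 0"
proof -
  note b[measurable] and lim = tr[unfolded trace_on_def, THEN conjunct2, THEN conjunct2, THEN conjunct2, THEN conjunct2]
  have Ck: "Ck j (\<Phi> k)" for j k using tr by (simp add: smooth_on_UNIV_iff trace_on_def)
  have [measurable]: "\<Phi> k \<in> borel_measurable borel" "grad (\<Phi> k) \<in> borel_measurable borel" for k
    by (rule borel_measurable_continuous_onI[OF Ck_continuous[OF Ck[of 0]]],
        rule borel_measurable_continuous_onI[OF grad_continuous[OF Ck]])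
  have g_ae: "AE z in lborel. z \<in> U \<longrightarrow> g z - grad (\<Phi> k) z = gb z - grad (\<Phi> k) z" for k
    using ae(2) by eventually_elim simp
  have g_meas: "(\<lambda>z. gb z - grad (\<Phi> k) z) \<in> borel_measurable borel" for k by measurable
  \<comment> \<open>These are the two conditions \<open>a > -1\<close> and \<open>a < 1\<close>, for
    the weighted and the unweighted L1 norm.\<close>
  have c: "- 1 < 2 * a - a" "- 1 < 2 * 0 - a" using a by auto
  show "(\<lambda>k. \<integral>\<^sup>+z. ennreal (wt a z * norm (gb z - grad (\<Phi> k) z)) * indicator U z \<partial>lborel) \<longlonglongrightarrow> 0"
    by (rule L1_lim[OF g_meas c(1) T lim[THEN conjunct2, THEN conjunct1] g_ae])
  have u_lim: "(\<lambda>k. \<integral>\<^sup>+z. ennreal (wt a z * \<bar>ub z - \<Phi> k z\<bar>) * indicator U z \<partial>lborel) \<longlonglongrightarrow> 0"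
    unfolding real_norm_def[symmetric]
  proof (rule L1_lim[OF _ c(1) T lim[THEN conjunct1]])
    show "AE z in lborel. z \<in> U \<longrightarrow> u z - \<Phi> k z = ub z - \<Phi> k z" for k
      using ae(1) by eventually_elim simp
  qed measurable
  have "(\<lambda>k. \<integral>\<^sup>+z. ennreal (wt 0 z * norm (gb z - grad (\<Phi> k) z)) * indicator U z \<partial>lborel) \<longlonglongrightarrow> 0"
    by (rule L1_lim[OF g_meas c(2) T lim[THEN conjunct2, THEN conjunct1] g_ae])
  moreover have "ennreal (wt 0 z * t) * indicator U z = ennreal t * indicator U z" for z t
    by (auto simp: wt_def indicator_def U_def)
  ultimately have g_lim: "(\<lambda>k. \<integral>\<^sup>+z. ennreal (norm (gb z - grad (\<Phi> k) z)) * indicator U z \<partial>lborel) \<longlonglongrightarrow> 0" by simp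
  have w_lim: "(\<lambda>k. \<integral>\<^sup>+x. ennreal \<bar>wb x - \<Phi> k (x, 0)\<bar> * indicator \<Omega> x \<partial>lborel) \<longlonglongrightarrow> 0"
  proof (rule tendsto_0_of_square[OF _ _ lim[THEN conjunct2, THEN conjunct2]])
    fix k
    have "L2_sqnorm \<Omega> (\<lambda>x. w x - \<Phi> k (x, 0)) = L2_sqnorm \<Omega> (\<lambda>x. wb x - \<Phi> k (x, 0))"
      using ae(3) by (intro L2_sqnorm_cong_AE) (auto elim!: eventually_mono)
    then show "(\<integral>\<^sup>+x. ennreal \<bar>wb x - \<Phi> k (x, 0)\<bar> * indicator \<Omega> x \<partial>lborel)\<^sup>2 \<le> L2_sqnorm \<Omega> (\<lambda>x. w x - \<Phi> k (x, 0)) * emeasure lborel \<Omega>"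
      using L2_L1[of "\<lambda>x. wb x - \<Phi> k (x, 0)" \<Omega>] by simp
    show "emeasure lborel \<Omega> < \<infinity>" using emeasure_bounded_finite[OF \<Omega>(2)] by simp
  qed
  show "trace_data \<Omega> a q \<rho> T ub gb \<Phi> wb"
    by (intro trace_data.intro extension_axioms trace_data_axioms.intro b Ck u_lim g_lim w_lim)
qed

text \<open>The support lies in a closed ball around \<open>(x, 0)\<close> whose projection stays in
  \<open>\<Omega>\<close>. The ball crosses \<open>y = 0\<close>, as the notion of solution permits,
  and this is how the boundary term of the weak equation is seen.\<close>

lemma kernel_test_function:
  assumes e: "e > 0" and x: "x \<in> core"
  shows "(\<lambda>z :: 'a \<times> real. ker0 q (\<rho>\<^sup>2) e ((norm (z - (x, 0)))\<^sup>2)) \<in> test_functions (\<Omega> \<times> UNIV)"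
proof -
  let ?\<psi> = "\<lambda>z :: 'a \<times> real. ker0 q (\<rho>\<^sup>2) e ((norm (z - (x, 0)))\<^sup>2)"
  have "z \<in> cball (x, 0) \<rho>" if "?\<psi> z \<noteq> 0" for z
  proof (rule ccontr)
    assume "z \<notin> cball (x, 0) \<rho>"
    then have "norm (z - (x, 0)) \<ge> \<rho>" by (simp add: dist_norm norm_minus_commute)
    then have "ker0 q (\<rho>\<^sup>2) e ((norm (z - (x, 0)))\<^sup>2) = 0" using \<rho> by (intro ker0_eq_0 power_mono) auto
    then show False using that by simp
  qed
  then have sub: "closure {z. ?\<psi> z \<noteq> 0} \<subseteq> cball (x, 0) \<rho>" by (intro closure_minimal) auto
  then have "bounded (closure {z. ?\<psi> z \<noteq> 0})" by (rule bounded_subset[OF bounded_cball])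
  then have "compact (closure {z. ?\<psi> z \<noteq> 0})" by (simp add: compact_eq_bounded_closed)
  moreover have "cball (x, 0) \<rho> \<subseteq> \<Omega> \<times> (UNIV :: real set)"
  proof
    fix z :: "'a \<times> real" assume "z \<in> cball (x, 0) \<rho>"
    then have "dist x (fst z) \<le> \<rho>" using dist_fst_le[of "(x, 0)" z] by simp
    then have "fst z \<in> inner_set (\<rho> - \<rho>) \<Omega>" by (rule inner_set_near[OF x])
    then show "z \<in> \<Omega> \<times> UNIV" using inner_set_subset[of 0 \<Omega>] by (auto simp: mem_Times_iff)
  qed
  moreover have "smooth_on UNIV ?\<psi>" unfolding smooth_on_UNIV_iff by (intro allI Ck_radial[OF kdiff_ker0 e])
  ultimately show ?thesis using sub by (auto simp: test_functions_def)
qed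

end

lemma L2_integrable:
  assumes [measurable]: "wb \<in> borel_measurable borel" and \<Omega>: "open \<Omega>" "bounded \<Omega>"
    and w: "L2_on \<Omega> w" and ae: "AE x in lborel. x \<in> \<Omega> \<longrightarrow> w x = wb x"
    and zero: "\<And>x. x \<notin> \<Omega> \<Longrightarrow> wb x = (0 :: real)"
  shows "integrable lborel wb"
proof (rule integrableI_bounded)
  have [measurable]: "\<Omega> \<in> sets borel" by (rule borel_open[OF \<Omega>(1)])
  let ?I = "\<integral>\<^sup>+x. ennreal (norm (wb x)) * indicator \<Omega> x \<partial>lborel"
  have "L2_sqnorm \<Omega> wb = L2_sqnorm \<Omega> w"
    using ae by (intro L2_sqnorm_cong_AE) (auto elim!: eventually_mono)
  then have "L2_sqnorm \<Omega> wb < \<infinity>" using w by (simp add: L2_on_def)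
  then have "L2_sqnorm \<Omega> wb * emeasure lborel \<Omega> < \<infinity>"
    using emeasure_bounded_finite[OF \<Omega>(2)] by (simp add: ennreal_mult_less_top)
  then have "?I\<^sup>2 < \<infinity>" using L2_L1[of wb \<Omega>] by (auto intro: le_less_trans)
  then have "?I < \<infinity>" by (auto simp: power_less_top_ennreal)
  moreover have "(\<integral>\<^sup>+x. ennreal (norm (wb x)) \<partial>lborel) = ?I"
  proof (rule nn_integral_cong)
    fix x show "ennreal (norm (wb x)) = ennreal (norm (wb x)) * indicator \<Omega> x"
      using zero[of x] by (cases "x \<in> \<Omega>") auto
  qed
  ultimately show "(\<integral>\<^sup>+x. ennreal (norm (wb x)) \<partial>lborel) < \<infinity>" by simp
qed measurable

context extension
begin

text \<open>The given equation lives on the infinite cylinder and uses Lebesgue measurable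
  functions. The support of the kernel restricts it to \<open>U\<close>, and equality almost
  everywhere then allows the Borel versions.\<close>

lemma weak_transfer:
  assumes [measurable]: "gb \<in> borel_measurable borel" "wb \<in> borel_measurable borel"
    and zero: "\<And>x. x \<notin> \<Omega> \<Longrightarrow> wb x = 0"
    and ae: "AE z in lborel. z \<in> U \<longrightarrow> g z = gb z" "AE x in lborel. x \<in> \<Omega> \<longrightarrow> w x = wb x"
    and weq: "\<And>\<psi>. \<psi> \<in> test_functions (\<Omega> \<times> UNIV) \<Longrightarrow>
        (LINT z:\<Omega> \<times> {0<..}|lebesgue. snd z powr a * (g z \<bullet> grad \<psi> z)) = lam * (LINT x:\<Omega>|lebesgue. max (w x) 0 * \<psi> (x, 0))"
    and e: "e > 0" and x: "x \<in> core"
  shows "(LINT z|lborel. indicator U z * (wt a z * (gb z \<bullet> grad (\<lambda>z. ker0 q (\<rho>\<^sup>2) e ((norm (z - (x, 0)))\<^sup>2)) z)))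
      = lam * (LINT y|lborel. max (wb y) 0 * ker0 q (\<rho>\<^sup>2) e ((norm (x - y))\<^sup>2))"
proof -
  let ?\<psi> = "\<lambda>z :: 'a \<times> real. ker0 q (\<rho>\<^sup>2) e ((norm (z - (x, 0)))\<^sup>2)"
  obtain C where "\<And>z. norm (grad ?\<psi> z) \<le> C" and grad0: "\<And>z. norm (z - (x, 0)) \<ge> \<rho> \<Longrightarrow> grad ?\<psi> z = 0"
    and cont: "continuous_on UNIV (grad ?\<psi>)" using grad_kernel[OF e] by blast
  have [measurable]: "grad ?\<psi> \<in> borel_measurable borel" by (rule borel_measurable_continuous_onI[OF cont])
  have "continuous_on UNIV ?\<psi>" by (rule Ck_continuous[OF Ck_radial[OF kdiff_ker0 e, of 0]])
  then have [measurable]: "?\<psi> \<in> borel_measurable borel" by (rule borel_measurable_continuous_onI)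
  have "(LINT z:\<Omega> \<times> {0<..}|lebesgue. snd z powr a * (g z \<bullet> grad ?\<psi> z))
      = (LINT z|lborel. indicator U z * (wt a z * (gb z \<bullet> grad ?\<psi> z)))"
    unfolding set_lebesgue_integral_def
  proof (rule integral_lebesgue_eq)
    show "(\<lambda>z. indicator U z * (wt a z * (gb z \<bullet> grad ?\<psi> z))) \<in> borel_measurable borel" by measurable
    show "AE z in lborel. indicator (\<Omega> \<times> {0<..}) z *\<^sub>R (snd z powr a * (g z \<bullet> grad ?\<psi> z)) = indicator U z * (wt a z * (gb z \<bullet> grad ?\<psi> z))"
      using ae(1)
    proof eventually_elim
      case (elim z)
      show ?case
      proof (cases "z \<in> U")
        case True
        then show ?thesis using elim by (auto simp: U_def wt_def)
      next
        case False
        have 0: "wt a z * (g z \<bullet> grad ?\<psi> z) = 0" by (rule outside_U[OF x False]) (simp add: grad0)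
        have 1: "indicator (\<Omega> \<times> {0<..}) z *\<^sub>R (snd z powr a * (g z \<bullet> grad ?\<psi> z)) = indicator (\<Omega> \<times> {0<..}) z * (wt a z * (g z \<bullet> grad ?\<psi> z))"
          by (auto simp: wt_def indicator_def)
        show ?thesis unfolding 1 0 using False by simp
      qed
    qed
  qed
  moreover have "(LINT y:\<Omega>|lebesgue. max (w y) 0 * ?\<psi> (y, 0)) = (LINT y|lborel. max (wb y) 0 * ?\<psi> (y, 0))"
    unfolding set_lebesgue_integral_def
  proof (rule integral_lebesgue_eq)
    show "(\<lambda>y. max (wb y) 0 * ?\<psi> (y, 0)) \<in> borel_measurable borel" by measurable
    show "AE y in lborel. indicator \<Omega> y *\<^sub>R (max (w y) 0 * ?\<psi> (y, 0)) = max (wb y) 0 * ?\<psi> (y, 0)"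
      using ae(2)
    proof eventually_elim
      case (elim y)
      show ?case using elim zero[of y] by (cases "y \<in> \<Omega>") simp_all
    qed
  qed
  moreover have "?\<psi> (y, 0) = ker0 q (\<rho>\<^sup>2) e ((norm (x - y))\<^sup>2)" for y
    by (simp add: norm_Pair norm_minus_commute)
  ultimately show ?thesis using weq[OF kernel_test_function[OF e x]] by simp
qed

end

theorem theorem4p2:
  fixes \<Omega> :: "(real ^ 'n) set"
    and u :: "(real ^ 'n) \<times> real \<Rightarrow> real"
    and u0 :: "real ^ 'n \<Rightarrow> real"
    and s a lam :: real
  assumes "smooth_bounded_domain \<Omega>"
    and "0 < s" and "s < 1" and "a = 1 - 2 * s" and "lam > 0"
    and "thin_eigen_solution a lam \<Omega> u"
    and "has_trace a \<Omega> u u0"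
  shows "\<exists>v. (AE x in lebesgue. x \<in> \<Omega> \<longrightarrow> v x = u0 x) \<and>
           (\<forall>K. compactly_contained K \<Omega> \<longrightarrow>
              (s \<le> 1/2 \<longrightarrow> (\<forall>\<alpha>. 0 < \<alpha> \<and> \<alpha> < 2 * s \<longrightarrow> holder_on 1 \<alpha> K v)) \<and>
              (s > 1/2 \<longrightarrow> (\<forall>\<alpha>. 0 < \<alpha> \<and> \<alpha> < 2 * s - 1 \<longrightarrow> holder_on 2 \<alpha> K v)))"
proof -
  have \<Omega>: "open \<Omega>" "bounded \<Omega>" using assms(1) by (auto simp: smooth_bounded_domain_def)
  note s = assms(2,3) and a_def = assms(4) and lam = assms(5) and sol = assms(6) and tr = assms(7)
  obtain g w where wg: "weak_gradient (\<Omega> \<times> {0<..}) u g" and tr1: "has_trace a \<Omega> u w"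
    and weq: "\<And>\<psi>. \<psi> \<in> test_functions (\<Omega> \<times> UNIV) \<Longrightarrow>
        (LINT z:\<Omega> \<times> {0<..}|lebesgue. snd z powr a * (g z \<bullet> grad \<psi> z)) = lam * (LINT x:\<Omega>|lebesgue. max (w x) 0 * \<psi> (x, 0))"
    using sol unfolding thin_eigen_solution_def by blast
  \<comment> \<open>Two traces are in play, \<open>w\<close> from the notion of solution and the
    given \<open>u0\<close>, each with its own height, weak gradient and approximating
    sequence.\<close>
  obtain T1 g1 \<Phi>1 where t1: "T1 > 0" "L2_on \<Omega> w" "trace_on a \<Omega> T1 u w g1 \<Phi>1"
    using tr1 unfolding has_trace_iff by blast
  obtain T2 g2 \<Phi>2 where t2: "T2 > 0" "L2_on \<Omega> u0" "trace_on a \<Omega> T2 u u0 g2 \<Phi>2"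
    using tr unfolding has_trace_iff by blast
  have L: "wL2_on a (\<Omega> \<times> {0<..<T1}) u" "weak_gradient (\<Omega> \<times> {0<..<T1}) u g1"
    "wL2_on a (\<Omega> \<times> {0<..<T1}) g1" "wL2_on a (\<Omega> \<times> {0<..<T2}) g2"
    using t1(3) t2(3) by (auto simp: trace_on_def)
  \<comment> \<open>A common height: both sets of trace data restrict to the shorter
    cylinder.\<close>
  define T where "T = min T1 T2"
  have T: "T > 0" "T \<le> T1" "T \<le> T2" using t1(1) t2(1) by (auto simp: T_def)
  define q where "q = real DIM(real ^ 'n) / 2 - s + 1"
  have ext: "extension \<Omega> a q \<rho> T" if "0 < \<rho>" "\<rho> < min 1 T" for \<rho>
    using that \<Omega> s by unfold_locales (auto simp: a_def q_def)
  have U: "extension.U \<Omega> T = \<Omega> \<times> {0<..<T}"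
  proof -
    interpret extension \<Omega> a q "min 1 T / 2" T using T(1) by (intro ext) auto
    show ?thesis by (rule U_def)
  qed
  obtain ub where ub: "ub \<in> borel_measurable borel" "AE z in lborel. z \<in> \<Omega> \<times> {0<..<T1} \<longrightarrow> u z = ub z"
    using wL2_borel[OF L(1)] by auto
  obtain gb1 where gb1: "gb1 \<in> borel_measurable borel" "AE z in lborel. z \<in> \<Omega> \<times> {0<..<T1} \<longrightarrow> g1 z = gb1 z"
    using wL2_borel[OF L(3)] by auto
  obtain gb2 where gb2: "gb2 \<in> borel_measurable borel" "AE z in lborel. z \<in> \<Omega> \<times> {0<..<T2} \<longrightarrow> g2 z = gb2 z"
    using wL2_borel[OF L(4)] by auto
  obtain w' where w': "w' \<in> borel_measurable borel" "AE x in lborel. x \<in> \<Omega> \<longrightarrow> w x = w' x"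
    using L2_borel[OF t1(2)] by auto
  obtain u0b where u0b: "u0b \<in> borel_measurable borel" "AE x in lborel. x \<in> \<Omega> \<longrightarrow> u0 x = u0b x"
    using L2_borel[OF t2(2)] by auto
  have [measurable]: "\<Omega> \<in> sets borel" by (rule borel_open[OF \<Omega>(1)])
  \<comment> \<open>Extension by 0 makes the potential over the whole space equal to the one over
    \<open>\<Omega>\<close>.\<close>
  define wb where "wb x = indicator \<Omega> x * w' x" for x
  have wb [measurable]: "wb \<in> borel_measurable borel" unfolding wb_def[abs_def] using w'(1) by measurable
  have wb_ae: "AE x in lborel. x \<in> \<Omega> \<longrightarrow> w x = wb x" using w'(2) by eventually_elim (simp add: wb_def)
  have wb0: "wb x = 0" if "x \<notin> \<Omega>" for x using that by (simp add: wb_def)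
  have u_ae: "AE z in lborel. z \<in> extension.U \<Omega> T \<longrightarrow> u z = ub z"
    unfolding U using ub(2) by eventually_elim (use T in auto)
  have g1_ae: "AE z in lborel. z \<in> extension.U \<Omega> T \<longrightarrow> g1 z = gb1 z"
    unfolding U using gb1(2) by eventually_elim (use T in auto)
  have g2_ae: "AE z in lborel. z \<in> extension.U \<Omega> T \<longrightarrow> g2 z = gb2 z"
    unfolding U using gb2(2) by eventually_elim (use T in auto)
  \<comment> \<open>The gradient of the weak equation is identified with the one that the smooth
    functions approximate, so that the limit in Green's identity concerns the equation
    itself.\<close>
  have g_ae: "AE z in lborel. z \<in> extension.U \<Omega> T \<longrightarrow> g z = gb1 z"
  proof -
    have o: "open (\<Omega> \<times> {0<..<T})" using \<Omega>(1) by (intro open_Times) auto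
    have "AE z in lebesgue. z \<in> \<Omega> \<times> {0<..<T} \<longrightarrow> g z = g1 z"
    proof (rule weak_gradient_unique[OF o])
      show "weak_gradient (\<Omega> \<times> {0<..<T}) u g" by (rule weak_gradient_subset[OF wg]) auto
      show "weak_gradient (\<Omega> \<times> {0<..<T}) u g1" by (rule weak_gradient_subset[OF L(2)]) (use T in auto)
    qed
    then have "AE z in lborel. z \<in> \<Omega> \<times> {0<..<T} \<longrightarrow> g z = g1 z" by (simp only: AE_completion_iff)
    then show ?thesis using g1_ae unfolding U by eventually_elim simp
  qed
  have td1: "trace_data \<Omega> a q \<rho> T ub gb1 \<Phi>1 wb"
    and ga: "(\<lambda>k. \<integral>\<^sup>+z. ennreal (wt a z * norm (gb1 z - grad (\<Phi>1 k) z)) * indicator (extension.U \<Omega> T) z \<partial>lborel) \<longlonglongrightarrow> 0"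
    if \<rho>: "0 < \<rho>" "\<rho> < min 1 T" for \<rho>
    using extension.trace_dataI[OF ext[OF \<rho>] ub(1) gb1(1) wb u_ae g1_ae wb_ae T(2) t1(3)] by auto
  have td2: "trace_data \<Omega> a q \<rho> T ub gb2 \<Phi>2 u0b" if \<rho>: "0 < \<rho>" "\<rho> < min 1 T" for \<rho>
    by (rule extension.trace_dataI(1)[OF ext[OF \<rho>] ub(1) gb2(1) u0b(1) u_ae g2_ae u0b(2) T(3) t2(3)])
  have wb_int: "integrable lborel wb" by (rule L2_integrable[OF wb \<Omega> t1(2) wb_ae wb0])
  have rep: "\<exists>\<kappa> H. (\<forall>k. Ck k H) \<and> (\<forall>is. set is \<subseteq> Basis \<longrightarrow> (\<exists>C. \<forall>x. \<bar>partials is H x\<bar> \<le> C)) \<and>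
     (AE x in lborel. x \<in> inner_set \<rho> \<Omega> \<longrightarrow>
        wb x = \<kappa> * (LINT y|lborel. max (wb y) 0 * ker0 q (\<rho>\<^sup>2) 0 ((norm (x - y))\<^sup>2)) + H x)"
    if \<rho>: "0 < \<rho>" "\<rho> < min 1 T" for \<rho>
  proof -
    have "weak_solution \<Omega> a q \<rho> T ub gb1 \<Phi>1 wb lam"
      by (intro weak_solution.intro weak_solution_axioms.intro td1[OF \<rho>] lam ga[OF \<rho>] wb_int
          extension.weak_transfer[OF ext[OF \<rho>] gb1(1) wb wb0 g_ae wb_ae weq])
    then show ?thesis by (rule weak_solution.representation)
  qed
  have fin: "(\<integral>\<^sup>+x. ennreal \<bar>wb x\<bar> * indicator \<Omega> x \<partial>lborel) < \<infinity>"
  proof -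
    have "(\<integral>\<^sup>+x. ennreal \<bar>wb x\<bar> * indicator \<Omega> x \<partial>lborel) \<le> (\<integral>\<^sup>+x. ennreal (norm (wb x)) \<partial>lborel)"
      by (intro nn_integral_mono) (simp add: indicator_def)
    also have "\<dots> < \<infinity>" using wb_int by (simp add: integrable_iff_bounded)
    finally show ?thesis .
  qed
  interpret potential_representation \<Omega> wb s "min 1 T" "real DIM(real ^ 'n)"
    using \<Omega> wb fin s T(1) rep by unfold_locales (auto simp: q_def)
  \<comment> \<open>The trace data exist for radii strictly below \<open>min 1 T\<close>; the
    \<open>+ 2\<close> guarantees this already for \<open>k = 0\<close>. As the radii tend to 0, the
    inner sets exhaust \<open>\<Omega>\<close>.\<close>
  have "AE x in lborel. \<forall>k::nat. x \<in> inner_set (min 1 T / (real k + 2)) \<Omega> \<longrightarrow> wb x = u0b x"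
    unfolding AE_all_countable
  proof
    fix k :: nat
    have "min 1 T * 1 < min 1 T * (real k + 2)" using T(1) by (intro mult_strict_left_mono) auto
    then have \<rho>: "0 < min 1 T / (real k + 2)" "min 1 T / (real k + 2) < min 1 T"
      using T(1) by (simp, subst pos_divide_less_eq, simp_all)
    show "AE x in lborel. x \<in> inner_set (min 1 T / (real k + 2)) \<Omega> \<longrightarrow> wb x = u0b x"
      by (rule trace_data.trace_unique[OF td1[OF \<rho>] td2[OF \<rho>]])
  qed
  then have unique: "AE x in lborel. x \<in> \<Omega> \<longrightarrow> wb x = u0 x"
    using u0b(2)
  proof eventually_elim
    case (elim x)
    show ?case
    proof
      assume x: "x \<in> \<Omega>"
      obtain \<delta> where \<delta>: "\<delta> > 0" "x \<in> inner_set \<delta> \<Omega>" using compact_subset_inner_set[of "{x}" \<Omega>] x \<Omega> by auto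
      obtain k :: nat where "1 / \<delta> < real k" using reals_Archimedean2 by blast
      then have "1 / (real k + 2) < \<delta>" using \<delta>(1) by (simp add: field_simps)
      moreover have "min 1 T / (real k + 2) \<le> 1 / (real k + 2)" by (intro divide_right_mono) auto
      ultimately have "x \<in> inner_set (min 1 T / (real k + 2)) \<Omega>"
        using \<delta>(2) inner_set_mono[of "min 1 T / (real k + 2)" \<delta> \<Omega>] by auto
      then have "wb x = u0b x" using elim(1) by blast
      then show "wb x = u0 x" using elim(2) x by simp
    qed
  qed
  from regularity obtain v where v: "AE x in lborel. x \<in> \<Omega> \<longrightarrow> v x = wb x"
    and hold: "\<And>\<delta> \<alpha>. \<delta> > 0 \<Longrightarrow> \<alpha> > 0 \<Longrightarrow> s \<le> 1 / 2 \<Longrightarrow> \<alpha> < 2 * s \<Longrightarrow> holder_on 1 \<alpha> (inner_set \<delta> \<Omega>) v"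
      "\<And>\<delta> \<alpha>. \<delta> > 0 \<Longrightarrow> \<alpha> > 0 \<Longrightarrow> s > 1 / 2 \<Longrightarrow> \<alpha> < 2 * s - 1 \<Longrightarrow> holder_on 2 \<alpha> (inner_set \<delta> \<Omega>) v"
    by blast
  show ?thesis
  proof (intro exI conjI allI impI)
    have "AE x in lborel. x \<in> \<Omega> \<longrightarrow> v x = u0 x" using v unique by eventually_elim simp
    then show "AE x in lebesgue. x \<in> \<Omega> \<longrightarrow> v x = u0 x" by (rule AE_completion)
    fix K \<alpha>
    assume "compactly_contained K \<Omega>"
    then obtain \<delta> where \<delta>: "\<delta> > 0" "K \<subseteq> inner_set \<delta> \<Omega>"
      using compact_subset_inner_set[of "closure K" \<Omega>] \<Omega> closure_subset[of K] unfolding compactly_contained_def by blast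
    show "holder_on 1 \<alpha> K v" if "s \<le> 1 / 2" "0 < \<alpha> \<and> \<alpha> < 2 * s"
      using hold(1)[OF \<delta>(1), of \<alpha>] that \<delta>(2) by (auto intro: holder_on_subset)
    show "holder_on 2 \<alpha> K v" if "s > 1 / 2" "0 < \<alpha> \<and> \<alpha> < 2 * s - 1"
      using hold(2)[OF \<delta>(1), of \<alpha>] that \<delta>(2) by (auto intro: holder_on_subset)
  qed
qed

end
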